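(* Let $k$ be a field of characteristic zero, let $q$ be a nondegenerate quadratic form over $k$ of rank $n\geq 2$, and let $G=\mathrm{O}(q)$ be the orthogonal group of $q$. Let $V$ be a finite-dimensional $k$-vector space with an almost free linear $G$-action. Then the field $k(V)^G$ is stably pure over $k$.
   Context: Let $\bar k$ be an algebraic closure of $k$. For a linear algebraic $k$-group $G$ acting on a geometrically integral $k$-variety $X$, $k(X)^G$ denotes the subfield of $\bar k(X)^{G(\bar k)}$ fixed by $\mathrm{Gal}(\bar k/k)$. The action is almost free if there is a non-empty open set $U\subset X$ such that for every $x\in U(\bar k)$ the stabilizer $G_x\subset G(\bar k)$ is trivial. A field $K/k$ is stably pure over $k$ if $K(x_1,\dots,x_r)$ is purely transcendental over $k$ for some independent variables $x_1,\dots,x_r$. *)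

theory Defs
  imports
    "HOL-Library.Poly_Mapping"
    "HOL-Computational_Algebra.Fraction_Field"
    "HOL-Algebra.Generated_Fields"
    "HOL-Algebra.Algebraic_Closure_Type"
    "Jordan_Normal_Form.Determinant"
begin

section \<open>Polynomials in several variables and their fractions\<close>

type_synonym ('x, 'c) mpoly = "('x \<Rightarrow>\<^sub>0 nat) \<Rightarrow>\<^sub>0 'c"

definition mconst :: "'c::zero \<Rightarrow> ('x, 'c) mpoly" where
  "mconst c = Poly_Mapping.single 0 c"

definition mvar :: "'x \<Rightarrow> ('x, 'c::zero_neq_one) mpoly" where
  "mvar x = Poly_Mapping.single (Poly_Mapping.single x 1) 1"

definition mvars :: "('x, 'c::zero) mpoly \<Rightarrow> 'x set" where
  "mvars p = (\<Union>t\<in>Poly_Mapping.keys p. Poly_Mapping.keys t)"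

text \<open>Evaluate at \<open>f\<close>, with coefficients transported along \<open>\<phi>\<close>.\<close>

definition meval :: "('c::zero \<Rightarrow> 'd::comm_semiring_1) \<Rightarrow> ('x \<Rightarrow> 'd) \<Rightarrow> ('x, 'c) mpoly \<Rightarrow> 'd" where
  "meval \<phi> f p =
     (\<Sum>t\<in>Poly_Mapping.keys p. \<phi> (Poly_Mapping.lookup p t) *
        (\<Prod>x\<in>Poly_Mapping.keys t. f x ^ Poly_Mapping.lookup t x))"

text \<open>The extension of an injective ring homomorphism \<open>h\<close> to fraction fields. It is applied below
  only to automorphisms of polynomial rings; the lemma shows that the description is then unique.\<close>

definition fract_map :: "('b::idom \<Rightarrow> 'c::idom) \<Rightarrow> 'b fract \<Rightarrow> 'c fract" where
  "fract_map h r = (THE s. \<exists>a b. b \<noteq> 0 \<and> r = Fract a b \<and> s = Fract (h a) (h b))"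

lemma fract_map_Fract:
  assumes mult: "\<And>x y. h (x * y) = h x * h y"
    and nz: "\<And>x. h x = 0 \<longleftrightarrow> x = 0"
    and b: "b \<noteq> 0"
  shows "fract_map h (Fract a b) = Fract (h a) (h b)"
  unfolding fract_map_def
proof (rule the_equality)
  show "\<exists>a' b'. b' \<noteq> 0 \<and> Fract a b = Fract a' b' \<and> Fract (h a) (h b) = Fract (h a') (h b')"
    using b by blast
next
  fix s assume "\<exists>a' b'. b' \<noteq> 0 \<and> Fract a b = Fract a' b' \<and> s = Fract (h a') (h b')"
  then obtain a' b' where *: "b' \<noteq> 0" "Fract a b = Fract a' b'" "s = Fract (h a') (h b')"
    by blast
  then have "a * b' = a' * b"
    using b by (simp add: eq_fract)
  then have "h a * h b' = h a' * h b"
    by (metis mult)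
  then show "s = Fract (h a) (h b)"
    using * b nz by (simp add: eq_fract)
qed


section \<open>Purely transcendental and stably pure extensions\<close>

text \<open>Field extensions are given as subsets \<open>k\<close>, \<open>K\<close> of an ambient field type.\<close>

abbreviation gen_field :: "'f::field set \<Rightarrow> 'f set" where
  "gen_field S \<equiv> generate_field ring_of_type_algebra S"

definition alg_independent :: "'f::field set \<Rightarrow> 'f set \<Rightarrow> bool" where
  "alg_independent k S \<longleftrightarrow>
     (\<forall>p :: ('f, 'f) mpoly.
        mvars p \<subseteq> S \<and> Poly_Mapping.range p \<subseteq> k \<and> meval id id p = 0 \<longrightarrow> p = 0)"

definition purely_transcendental :: "'f::field set \<Rightarrow> 'f set \<Rightarrow> bool" where
  "purely_transcendental k K \<longleftrightarrow> (\<exists>S. alg_independent k S \<and> K = gen_field (k \<union> S))"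

text \<open>\<open>K(x\<^sub>1, \<dots>, x\<^sub>r)\<close> is formed inside the field of fractions over the ambient field in
  countably many new variables.\<close>

definition stably_pure :: "'f::field set \<Rightarrow> 'f set \<Rightarrow> bool" where
  "stably_pure k K \<longleftrightarrow>
     (let \<iota> = (\<lambda>c. Fract (mconst c) 1 :: (nat, 'f) mpoly fract);
          x = (\<lambda>i. Fract (mvar i) 1)
      in \<exists>r. purely_transcendental (\<iota> ` k) (gen_field (\<iota> ` K \<union> x ` {..<r})))"


section \<open>Quadratic forms and their orthogonal groups\<close>

text \<open>The form \<open>q(v) = \<Sum>\<^sub>i\<^sub>,\<^sub>j C\<^sub>i\<^sub>j v\<^sub>i v\<^sub>j\<close>; \<open>C\<close> need not be symmetric.\<close>

definition quad_form :: "'a::comm_ring_1 mat \<Rightarrow> 'a vec \<Rightarrow> 'a" where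
  "quad_form C v = v \<bullet> (C *\<^sub>v v)"

definition polar_form :: "'a::comm_ring_1 mat \<Rightarrow> 'a vec \<Rightarrow> 'a vec \<Rightarrow> 'a" where
  "polar_form C v w = quad_form C (v + w) - quad_form C v - quad_form C w"

definition nondegenerate_form :: "nat \<Rightarrow> 'a::comm_ring_1 mat \<Rightarrow> bool" where
  "nondegenerate_form n C \<longleftrightarrow>
     (\<forall>v\<in>carrier_vec n. (\<forall>w\<in>carrier_vec n. polar_form C v w = 0) \<longrightarrow> v = 0\<^sub>v n)"

text \<open>A linear algebraic \<open>k\<close>-group (\<open>k\<close> of characteristic zero) is represented by its group of
  points over the algebraic closure of \<open>k\<close>; the \<open>k\<close>-structure enters through the coefficients of
  regular functions and through the action of the Galois group.\<close>

definition orthogonal_group :: "nat \<Rightarrow> 'a::field mat \<Rightarrow> 'a alg_closure mat set" where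
  "orthogonal_group n C =
     {A \<in> carrier_mat n n. invertible_mat A \<and>
        (\<forall>v\<in>carrier_vec n. quad_form (map_mat to_ac C) (A *\<^sub>v v) = quad_form (map_mat to_ac C) v)}"


section \<open>Linear actions defined over the base field\<close>

text \<open>A regular function over \<open>k\<close> on a closed subgroup of \<open>GL\<^sub>n\<close> is the restriction of an element
  of \<open>k[x\<^sub>a\<^sub>b, det\<^sup>-\<^sup>1]\<close>.\<close>

definition regular_fun ::
    "nat \<Rightarrow> 'a::field alg_closure mat set \<Rightarrow> ('a alg_closure mat \<Rightarrow> 'a alg_closure) \<Rightarrow> bool" where
  "regular_fun n G f \<longleftrightarrow>
     (\<exists>(p :: (nat \<times> nat, 'a) mpoly) N. mvars p \<subseteq> {..<n} \<times> {..<n} \<and>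
        (\<forall>A\<in>G. det A ^ N * f A = meval to_ac (\<lambda>ab. A $$ ab) p))"

text \<open>\<open>\<rho>\<close> is the action of the \<open>k\<close>-group \<open>G\<close>, closed in \<open>GL\<^sub>n\<close>, on \<open>V = k\<^sup>m\<close>.\<close>

definition linear_action ::
    "nat \<Rightarrow> 'a::field alg_closure mat set \<Rightarrow> nat \<Rightarrow> ('a alg_closure mat \<Rightarrow> 'a alg_closure mat) \<Rightarrow> bool"
  where
  "linear_action n G m \<rho> \<longleftrightarrow>
     (\<forall>A\<in>G. \<rho> A \<in> carrier_mat m m) \<and>
     \<rho> (1\<^sub>m n) = 1\<^sub>m m \<and>
     (\<forall>A\<in>G. \<forall>B\<in>G. \<rho> (A * B) = \<rho> A * \<rho> B) \<and>
     (\<forall>i<m. \<forall>j<m. regular_fun n G (\<lambda>A. \<rho> A $$ (i, j)))"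

text \<open>Geometric points of the open subsets of the \<open>k\<close>-variety \<open>V = k\<^sup>m\<close>.\<close>

definition open_over_base :: "nat \<Rightarrow> 'a::field alg_closure vec set \<Rightarrow> bool" where
  "open_over_base m U \<longleftrightarrow>
     (\<exists>P :: (nat, 'a) mpoly set. (\<forall>p\<in>P. mvars p \<subseteq> {..<m}) \<and>
        U = {x \<in> carrier_vec m. \<exists>p\<in>P. meval to_ac (\<lambda>i. x $ i) p \<noteq> 0})"

definition almost_free ::
    "nat \<Rightarrow> 'a::field alg_closure mat set \<Rightarrow> nat \<Rightarrow> ('a alg_closure mat \<Rightarrow> 'a alg_closure mat) \<Rightarrow> bool"
  where
  "almost_free n G m \<rho> \<longleftrightarrow>
     (\<exists>U. open_over_base m U \<and> U \<noteq> {} \<and> (\<forall>x\<in>U. {A \<in> G. \<rho> A *\<^sub>v x = x} = {1\<^sub>m n}))"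


section \<open>The field of invariant rational functions\<close>

text \<open>The field of rational functions on affine \<open>m\<close>-space.\<close>

definition function_field :: "nat \<Rightarrow> (nat, 'b::idom) mpoly fract set" where
  "function_field m = {Fract a b | a b. b \<noteq> 0 \<and> mvars a \<subseteq> {..<m} \<and> mvars b \<subseteq> {..<m}}"

text \<open>The polynomial \<open>p(M x)\<close>. The unused variables \<open>x\<^sub>i\<close> with \<open>i \<ge> m\<close> are fixed, so that an
  invertible \<open>M\<close> gives an automorphism.\<close>

definition lin_subst :: "nat \<Rightarrow> 'b::comm_ring_1 mat \<Rightarrow> (nat, 'b) mpoly \<Rightarrow> (nat, 'b) mpoly" where
  "lin_subst m M =
     meval mconst (\<lambda>i. if i < m then \<Sum>j<m. mconst (M $$ (i, j)) * mvar j else mvar i)"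

definition absolute_galois_group :: "('a::field alg_closure \<Rightarrow> 'a alg_closure) set" where
  "absolute_galois_group =
     {\<sigma>. bij \<sigma> \<and> (\<forall>x y. \<sigma> (x + y) = \<sigma> x + \<sigma> y) \<and> (\<forall>x y. \<sigma> (x * y) = \<sigma> x * \<sigma> y) \<and>
         (\<forall>c. \<sigma> (to_ac c) = to_ac c)}"

definition invariant_field ::
    "'a::field alg_closure mat set \<Rightarrow> nat \<Rightarrow> ('a alg_closure mat \<Rightarrow> 'a alg_closure mat)
      \<Rightarrow> (nat, 'a alg_closure) mpoly fract set" where
  "invariant_field G m \<rho> =
     {f \<in> function_field m.
        (\<forall>A\<in>G. fract_map (lin_subst m (\<rho> A)) f = f) \<and>
        (\<forall>\<sigma>\<in>absolute_galois_group. fract_map (Poly_Mapping.map \<sigma>) f = f)}"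

definition base_field :: "(nat, 'a::field alg_closure) mpoly fract set" where
  "base_field = range (\<lambda>c :: 'a. Fract (mconst (to_ac c)) 1)"

end

theory Submission
  imports Defs
begin

text \<open>Over an algebraic closure of the base field \<open>k\<close> the group \<open>G\<close> consists of the matrices \<open>A\<close> with
  \<open>A\<^sup>T B A = B\<close>, where \<open>B\<close> is the matrix of the polar form. Let it also act by left multiplication on the
  space \<open>W\<close> of square matrices \<open>X\<close> of size \<open>n\<close>. The field of invariants of \<open>V \<times> W\<close> is described in two ways.

  Over \<open>V\<close>, the product is a trivial vector bundle on which \<open>G\<close> acts. As the action on \<open>V\<close> is almost free,
  the bundle descends to the quotient and is generically trivial there, so \<open>k(V \<times> W)\<^sup>G\<close> is generated by
  \<open>n * n\<close> independent elements over \<open>k(V)\<^sup>G\<close>. Over \<open>W\<close>, for the same reason, \<open>k(V \<times> W)\<^sup>G\<close> is purely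
  transcendental over \<open>k(W)\<^sup>G\<close>. Finally \<open>k(W)\<^sup>G\<close> is generated by the entries of the Gram matrix \<open>X\<^sup>T B X\<close>, and
  those on and above the diagonal are algebraically independent. Hence \<open>k(V)\<^sup>G\<close> becomes purely
  transcendental over \<open>k\<close> after the adjunction of \<open>n * n\<close> variables (\<open>invariant_field_stably_pure\<close>).

  The descent takes place on function fields. The geometric points of \<open>G\<close> and the Galois group together
  form an abstract group acting on rational functions, and the bundle is a cocycle with values in invertible
  matrices. A form of Hilbert 90, \<open>cocycle_splits\<close>, trivialises the cocycle, provided that its entries are
  orbit sums \<open>\<Sum>\<^sub>b \<gamma>(a\<^sub>b) b\<close>; with \<open>fixed_field_adjoin\<close> this gives the generators over the fixed field. On \<open>W\<close> the
  entries are orbit sums because the generic matrix is invertible. On \<open>V\<close> this is where the action has to be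
  almost free: by the Nullstellensatz the entries are radicial over the orbit sums, since they are
  determined by the image of a generic point (\<open>separation_by_orbit_map\<close>). In characteristic zero a
  radicial function is a quotient of orbit sums, and the denominator disappears because an ideal of
  orbit sums stable under translations is trivial (\<open>radicial_family_in_orbit_span\<close>).

  For \<open>k(W)\<^sup>G\<close>, take a symmetric matrix \<open>S\<close> of independent variables. Over an algebraic closure of the field of
  rational functions in the entries of \<open>S\<close> there are matrices \<open>Y\<close> with \<open>Y\<^sup>T B Y = S\<close>, and any two differ by an
  isometry. By the density of the geometric points (\<open>invariance_extends\<close>) an invariant function has
  the same value at all of them, so the value is fixed by the Galois group and is a rational function of \<open>S\<close>.
  The identity obtained in this way at the matrices \<open>Y\<close> holds at the generic matrix \<open>X\<close>
  (\<open>vanishing_on_gram_fibre\<close>), which gives \<open>invariants_of_matrix\<close>.\<close>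

section \<open>Polynomials in several variables\<close>

definition monom_eval :: "('x \<Rightarrow> 'd::comm_semiring_1) \<Rightarrow> ('x \<Rightarrow>\<^sub>0 nat) \<Rightarrow> 'd" where
  "monom_eval f t = (\<Prod>x\<in>Poly_Mapping.keys t. f x ^ Poly_Mapping.lookup t x)"

lemma meval_monom_eval:
  "meval \<phi> f p = (\<Sum>t\<in>Poly_Mapping.keys p. \<phi> (Poly_Mapping.lookup p t) * monom_eval f t)"
  by (simp add: meval_def monom_eval_def)

lemma monom_eval_superset:
  assumes "finite K" "Poly_Mapping.keys t \<subseteq> K"
  shows "monom_eval f t = (\<Prod>x\<in>K. f x ^ Poly_Mapping.lookup t x)"
  unfolding monom_eval_def using assms
  by (intro prod.mono_neutral_left) (auto simp: in_keys_iff)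

lemma monom_eval_zero [simp]: "monom_eval f 0 = 1"
  by (simp add: monom_eval_def)

lemma monom_eval_add: "monom_eval f (s + t) = monom_eval f s * monom_eval f t"
proof -
  let ?K = "Poly_Mapping.keys s \<union> Poly_Mapping.keys t"
  have "Poly_Mapping.keys (s + t) \<subseteq> ?K" by (rule Poly_Mapping.keys_add)
  then show ?thesis
    by (simp add: monom_eval_superset[of ?K] lookup_add power_add prod.distrib)
qed

lemma meval_superset:
  assumes "finite K" "Poly_Mapping.keys p \<subseteq> K" "\<phi> 0 = 0"
  shows "meval \<phi> f p = (\<Sum>t\<in>K. \<phi> (Poly_Mapping.lookup p t) * monom_eval f t)"
  unfolding meval_monom_eval using assms
  by (intro sum.mono_neutral_left) (auto simp: in_keys_iff)

lemma meval_single: "\<phi> 0 = 0 \<Longrightarrow> meval \<phi> f (Poly_Mapping.single t c) = \<phi> c * monom_eval f t"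
  by (subst meval_superset[of "{t}"]) auto

lemma mpoly_sum_singles:
  fixes p :: "'k \<Rightarrow>\<^sub>0 'c::comm_monoid_add"
  shows "(\<Sum>t\<in>Poly_Mapping.keys p. Poly_Mapping.single t (Poly_Mapping.lookup p t)) = p"
  by (rule poly_mapping_eqI)
    (auto simp: lookup_sum lookup_single when_def in_keys_iff)

lemma mpoly_induct_single [case_names single add]:
  fixes p :: "'k::zero \<Rightarrow>\<^sub>0 'c::comm_monoid_add"
  assumes "\<And>t c. P (Poly_Mapping.single t c)" "\<And>p q. P p \<Longrightarrow> P q \<Longrightarrow> P (p + q)"
  shows "P p"
proof -
  have "P (\<Sum>t\<in>K. Poly_Mapping.single t (Poly_Mapping.lookup p t))" if "finite K" for K
    using that
  proof induction
    case empty
    then show ?case using assms(1)[of 0 0] by simp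
  qed (auto intro: assms)
  from this[of "Poly_Mapping.keys p"] show ?thesis by (simp add: mpoly_sum_singles)
qed

lemma meval_add:
  assumes "comm_ring_hom \<phi>"
  shows "meval \<phi> f (p + q) = meval \<phi> f p + meval \<phi> f q"
proof -
  interpret comm_ring_hom \<phi> by fact
  let ?K = "Poly_Mapping.keys p \<union> Poly_Mapping.keys q"
  have "Poly_Mapping.keys (p + q) \<subseteq> ?K" by (rule Poly_Mapping.keys_add)
  then show ?thesis
    by (simp add: meval_superset[of ?K] lookup_add hom_add algebra_simps sum.distrib)
qed

lemma comm_ring_hom_meval:
  assumes "comm_ring_hom \<phi>"
  shows "comm_ring_hom (meval \<phi> f)"
proof -
  interpret comm_ring_hom \<phi> by fact
  have mult: "meval \<phi> f (p * q) = meval \<phi> f p * meval \<phi> f q" for p q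
  proof (induction p rule: mpoly_induct_single)
    case (single s c)
    show ?case
      by (induction q rule: mpoly_induct_single)
        (simp_all add: mult_single meval_single monom_eval_add hom_mult algebra_simps
          meval_add[OF assms])
  qed (simp add: meval_add[OF assms] algebra_simps)
  have "meval \<phi> f 1 = 1"
    using meval_single[of \<phi> f 0 1] by simp
  moreover have "meval \<phi> f 0 = 0" by (simp add: meval_def)
  ultimately show ?thesis
    by unfold_locales (auto simp: mult meval_add[OF assms])
qed

lemma meval_mconst [simp]: "\<phi> 0 = 0 \<Longrightarrow> meval \<phi> f (mconst c) = \<phi> c"
  by (simp add: mconst_def meval_single)

lemma meval_mvar [simp]: "\<phi> 0 = 0 \<Longrightarrow> \<phi> 1 = 1 \<Longrightarrow> meval \<phi> f (mvar x) = f x"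
  by (simp add: mvar_def meval_single monom_eval_def)

lemma comm_ring_hom_mconst: "comm_ring_hom mconst"
  by unfold_locales (auto simp: mconst_def single_add mult_single)

lemma comm_ring_hom_id: "comm_ring_hom id"
  by unfold_locales auto

lemma comm_ring_hom_comp: "comm_ring_hom f \<Longrightarrow> comm_ring_hom g \<Longrightarrow> comm_ring_hom (g \<circ> f)"
  by (simp add: comm_ring_hom_def ring_hom_def semiring_hom_def comm_monoid_add_hom_def
      monoid_add_hom_def monoid_mult_hom_def one_hom_def semigroup_mult_hom_def times_hom_def
      zero_hom_def semigroup_add_hom_def plus_hom_def)

lemma comm_ring_homI:
  assumes "h 1 = 1" "\<And>x y. h (x + y) = h x + h y" "\<And>x y. h (x * y) = h x * h y"
  shows "comm_ring_hom h"
proof -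
  have "h (0 + 0) = h 0 + h 0" by (rule assms)
  then show ?thesis
    by unfold_locales (auto simp: assms)
qed

lemma hom_meval:
  assumes "comm_ring_hom h"
  shows "h (meval \<phi> f p) = meval (\<lambda>c. h (\<phi> c)) (\<lambda>x. h (f x)) p"
proof -
  interpret comm_ring_hom h by fact
  show ?thesis by (simp add: meval_def hom_sum hom_mult hom_prod hom_power)
qed

lemma mvar_power: "mvar x ^ k = Poly_Mapping.single (Poly_Mapping.single x k) 1"
  by (induction k) (simp_all add: mvar_def mult_single flip: single_add)

lemma monom_eval_mvar: "monom_eval mvar t = Poly_Mapping.single t 1"
proof -
  have "(\<Prod>x\<in>K. Poly_Mapping.single (g x) (1::'b)) = Poly_Mapping.single (\<Sum>x\<in>K. g x) 1"
    if "finite K" for K and g :: "'a \<Rightarrow> ('a \<Rightarrow>\<^sub>0 nat)"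
    using that by induction (simp_all add: mult_single)
  then show ?thesis
    by (simp add: monom_eval_def mvar_power mpoly_sum_singles)
qed

lemma meval_mconst_mvar [simp]: "meval mconst mvar p = p"
  by (simp add: meval_monom_eval monom_eval_mvar mconst_def mult_single mpoly_sum_singles)

lemma meval_cong:
  assumes "\<And>t. t \<in> Poly_Mapping.keys p \<Longrightarrow> \<phi> (Poly_Mapping.lookup p t) = \<psi> (Poly_Mapping.lookup p t)"
    and "\<And>x. x \<in> mvars p \<Longrightarrow> f x = g x"
  shows "meval \<phi> f p = meval \<psi> g p"
proof -
  have "f x ^ n = g x ^ n" if "t \<in> Poly_Mapping.keys p" "x \<in> Poly_Mapping.keys t" for t x n
    using that assms(2)[of x] unfolding mvars_def by force
  then show ?thesis
    unfolding meval_def using assms(1) by (intro sum.cong arg_cong2[where f = "(*)"] prod.cong) auto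
qed

text \<open>Every subset of a ring that is closed under sums and products and contains the transported
  coefficients and the values of the variables contains the value of the polynomial. Applied to the
  set of all polynomials with a given property, this is an induction principle.\<close>

lemma meval_closed:
  fixes Z :: "'d::comm_semiring_1 set" and p :: "('x, 'c::zero) mpoly"
  assumes "0 \<in> Z" "1 \<in> Z"
    and add: "\<And>a b. a \<in> Z \<Longrightarrow> b \<in> Z \<Longrightarrow> a + b \<in> Z"
    and mult: "\<And>a b. a \<in> Z \<Longrightarrow> b \<in> Z \<Longrightarrow> a * b \<in> Z"
    and "\<And>t. t \<in> Poly_Mapping.keys p \<Longrightarrow> \<phi> (Poly_Mapping.lookup p t) \<in> Z"
    and "\<And>x. x \<in> mvars p \<Longrightarrow> f x \<in> Z"
  shows "meval \<phi> f p \<in> Z"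
proof -
  have pow: "a ^ n \<in> Z" if "a \<in> Z" for a n
    using that by (induction n) (auto intro: assms)
  have prod: "(\<Prod>x\<in>K. g x) \<in> Z" if "finite K" "\<And>x. x \<in> K \<Longrightarrow> g x \<in> Z" for K and g :: "'x \<Rightarrow> 'd"
    using that by (induction K rule: finite_induct) (auto intro: assms)
  have sum: "(\<Sum>x\<in>K. g x) \<in> Z" if "finite K" "\<And>x. x \<in> K \<Longrightarrow> g x \<in> Z"
    for K and g :: "('x \<Rightarrow>\<^sub>0 nat) \<Rightarrow> 'd"
    using that by (induction K rule: finite_induct) (auto intro: assms)
  show ?thesis
    unfolding meval_def
    by (intro sum mult prod pow assms) (auto simp: mvars_def)
qed

lemma mpoly_hom_eqI:
  assumes "comm_ring_hom g" "comm_ring_hom h"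
    and "\<And>c. g (mconst c) = h (mconst c)" "\<And>x. g (mvar x) = h (mvar x)"
  shows "g p = h p"
  using hom_meval[OF assms(1), of mconst mvar p] hom_meval[OF assms(2), of mconst mvar p] assms(3,4)
  by simp

lemma finite_mvars [simp]: "finite (mvars p)"
  by (simp add: mvars_def)

lemma mvars_mconst [simp]: "mvars (mconst c) = {}"
  by (auto simp: mvars_def mconst_def)

lemma mvars_mvar [simp]: "mvars (mvar x :: ('x, 'c::zero_neq_one) mpoly) = {x}"
  by (auto simp: mvars_def mvar_def)

lemma mvars_zero [simp]: "mvars 0 = {}"
  by (auto simp: mvars_def)

lemma mvars_one [simp]: "mvars (1 :: ('x, 'c::zero_neq_one) mpoly) = {}"
  by (auto simp: mvars_def)

lemma mvars_add: "mvars (p + q) \<subseteq> mvars p \<union> mvars q"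
  using Poly_Mapping.keys_add[of p q] by (fastforce simp: mvars_def)

lemma mvars_mult: "mvars (p * q) \<subseteq> mvars p \<union> mvars q"
proof -
  have "x \<in> mvars p \<union> mvars q" if "t \<in> Poly_Mapping.keys (p * q)" "x \<in> Poly_Mapping.keys t" for x t
  proof -
    from that(1) obtain a b where "t = a + b" "a \<in> Poly_Mapping.keys p" "b \<in> Poly_Mapping.keys q"
      using keys_mult[of p q] by blast
    with that(2) show ?thesis
      using Poly_Mapping.keys_add[of a b] by (auto simp: mvars_def)
  qed
  then show ?thesis unfolding mvars_def[of "p * q"] by blast
qed

lemma mvars_uminus [simp]: "mvars (- p :: ('x, 'c::ab_group_add) mpoly) = mvars p"
  by (auto simp: mvars_def in_keys_iff)

lemma mvars_sum: "finite K \<Longrightarrow> mvars (\<Sum>x\<in>K. g x) \<subseteq> (\<Union>x\<in>K. mvars (g x))"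
proof (induction K rule: finite_induct)
  case (insert x F)
  then show ?case using mvars_add[of "g x" "sum g F"] by auto
qed auto

definition mpolys :: "'c::zero set \<Rightarrow> 'x set \<Rightarrow> ('x, 'c) mpoly set" where
  "mpolys L V = {p. mvars p \<subseteq> V \<and> (\<forall>t. Poly_Mapping.lookup p t \<in> L)}"

definition subring_set :: "'c::comm_ring_1 set \<Rightarrow> bool" where
  "subring_set L \<longleftrightarrow> 0 \<in> L \<and> 1 \<in> L \<and> (\<forall>a\<in>L. (- a) \<in> L) \<and> (\<forall>a\<in>L. \<forall>b\<in>L. a + b \<in> L \<and> a * b \<in> L)"

lemma subring_setD:
  assumes "subring_set L"
  shows "0 \<in> L" "1 \<in> L" "a \<in> L \<Longrightarrow> - a \<in> L" "a \<in> L \<Longrightarrow> b \<in> L \<Longrightarrow> a + b \<in> L"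
    "a \<in> L \<Longrightarrow> b \<in> L \<Longrightarrow> a * b \<in> L" "a \<in> L \<Longrightarrow> b \<in> L \<Longrightarrow> a - b \<in> L"
  using assms unfolding subring_set_def by (auto simp: diff_conv_add_uminus simp del: add_uminus_conv_diff)

lemma subring_set_sum: "subring_set L \<Longrightarrow> (\<And>x. x \<in> K \<Longrightarrow> g x \<in> L) \<Longrightarrow> (\<Sum>x\<in>K. g x) \<in> L"
  by (induction K rule: infinite_finite_induct) (auto simp: subring_setD)

lemma subring_set_prod: "subring_set L \<Longrightarrow> (\<And>x. x \<in> K \<Longrightarrow> g x \<in> L) \<Longrightarrow> (\<Prod>x\<in>K. g x) \<in> L"
  by (induction K rule: infinite_finite_induct) (auto simp: subring_setD)

lemma subring_set_power: "subring_set L \<Longrightarrow> a \<in> L \<Longrightarrow> a ^ n \<in> L"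
  by (induction n) (auto simp: subring_setD)

lemma subring_set_UNIV [simp]: "subring_set UNIV"
  by (auto simp: subring_set_def)

lemma subring_set_vimage:
  assumes "comm_ring_hom h" "subring_set L"
  shows "subring_set {p. h p \<in> L}"
proof -
  interpret comm_ring_hom h by fact
  show ?thesis
    using subring_setD[OF assms(2)]
    by (auto simp: subring_set_def hom_add hom_mult hom_uminus)
qed

lemma subring_set_image:
  assumes "comm_ring_hom h" "subring_set L"
  shows "subring_set (h ` L)"
proof -
  interpret comm_ring_hom h by fact
  show ?thesis
    unfolding subring_set_def
  proof (intro conjI ballI)
    show "0 \<in> h ` L" "1 \<in> h ` L"
      using subring_setD(1,2)[OF assms(2)] hom_zero hom_one by (metis image_eqI)+
  next
    fix a assume "a \<in> h ` L"
    then show "- a \<in> h ` L" using subring_setD(3)[OF assms(2)] by (auto simp flip: hom_uminus)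
  next
    fix a b assume "a \<in> h ` L" "b \<in> h ` L"
    then show "a + b \<in> h ` L" "a * b \<in> h ` L"
      using subring_setD(4,5)[OF assms(2)] by (auto simp flip: hom_add hom_mult)
  qed
qed

lemma meval_in_subring:
  assumes "subring_set Z"
    and "\<And>t. t \<in> Poly_Mapping.keys p \<Longrightarrow> \<phi> (Poly_Mapping.lookup p t) \<in> Z"
    and "\<And>x. x \<in> mvars p \<Longrightarrow> f x \<in> Z"
  shows "meval \<phi> f p \<in> Z"
  using assms by (intro meval_closed) (auto simp: subring_setD)

lemma mpoly_mult_expand:
  "p * q = (\<Sum>s\<in>Poly_Mapping.keys p. \<Sum>t\<in>Poly_Mapping.keys q.
     Poly_Mapping.single (s + t) (Poly_Mapping.lookup p s * Poly_Mapping.lookup q t))"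
proof -
  have "p * q = (\<Sum>s\<in>Poly_Mapping.keys p. Poly_Mapping.single s (Poly_Mapping.lookup p s))
      * (\<Sum>t\<in>Poly_Mapping.keys q. Poly_Mapping.single t (Poly_Mapping.lookup q t))"
    by (simp add: mpoly_sum_singles)
  then show ?thesis by (simp add: sum_product mult_single)
qed

lemma subring_set_mpolys:
  fixes L :: "'c::comm_ring_1 set"
  assumes "subring_set L"
  shows "subring_set (mpolys L V :: ('b, 'c) mpoly set)"
proof -
  note L = subring_setD[OF assms]
  have one: "(1 :: ('b, 'c) mpoly) \<in> mpolys L V"
    using L(1,2) by (auto simp: mpolys_def lookup_one when_def)
  have add: "p + q \<in> mpolys L V" if "p \<in> mpolys L V" "q \<in> mpolys L V" for p q :: "('b, 'c) mpoly"
    using that L(4) mvars_add[of p q] by (auto simp: mpolys_def lookup_add)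
  have mult: "p * q \<in> mpolys L V" if "p \<in> mpolys L V" "q \<in> mpolys L V" for p q :: "('b, 'c) mpoly"
  proof -
    have "Poly_Mapping.lookup (p * q) t \<in> L" for t
      unfolding mpoly_mult_expand lookup_sum using that L(1,5)
      by (intro subring_set_sum[OF assms]) (auto simp: lookup_single when_def mpolys_def)
    then show ?thesis using that mvars_mult[of p q] by (auto simp: mpolys_def)
  qed
  show ?thesis
    unfolding subring_set_def using one add mult L(1,3) by (auto simp: mpolys_def)
qed

lemma mconst_in_mpolys [simp]: "0 \<in> L \<Longrightarrow> c \<in> L \<Longrightarrow> mconst c \<in> mpolys L V"
  by (auto simp: mpolys_def mconst_def lookup_single when_def mvars_def)

lemma mvar_in_mpolys [simp]: "0 \<in> L \<Longrightarrow> 1 \<in> L \<Longrightarrow> x \<in> V \<Longrightarrow> mvar x \<in> mpolys L V"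
  by (auto simp: mpolys_def mvar_def lookup_single when_def mvars_def)

lemma lookup_map: "\<sigma> 0 = 0 \<Longrightarrow> Poly_Mapping.lookup (Poly_Mapping.map \<sigma> p) t = \<sigma> (Poly_Mapping.lookup p t)"
  by (auto simp: Poly_Mapping.map.rep_eq when_def)

lemma map_eq_meval:
  assumes "comm_ring_hom \<sigma>"
  shows "Poly_Mapping.map \<sigma> p = meval (\<lambda>c. mconst (\<sigma> c)) mvar p"
proof -
  interpret comm_ring_hom \<sigma> by fact
  have "(\<Sum>t\<in>K. Poly_Mapping.single t (\<sigma> (Poly_Mapping.lookup p t))) =
      Poly_Mapping.map \<sigma> (\<Sum>t\<in>K. Poly_Mapping.single t (Poly_Mapping.lookup p t))" if "finite K" for K
    using that
    by (intro poly_mapping_eqI) (simp add: lookup_map lookup_sum lookup_single when_def if_distrib[of \<sigma>]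
        hom_sum)
  from this[of "Poly_Mapping.keys p"] show ?thesis
    by (simp add: mpoly_sum_singles meval_monom_eval monom_eval_mvar mconst_def mult_single)
qed

lemma meval_map:
  assumes "comm_ring_hom \<sigma>" "\<phi> 0 = 0"
  shows "meval \<phi> f (Poly_Mapping.map \<sigma> p) = meval (\<lambda>c. \<phi> (\<sigma> c)) f p"
proof -
  interpret comm_ring_hom \<sigma> by fact
  have "Poly_Mapping.keys (Poly_Mapping.map \<sigma> p) \<subseteq> Poly_Mapping.keys p"
    by (auto simp: in_keys_iff lookup_map)
  then show ?thesis
    by (subst meval_superset[of "Poly_Mapping.keys p"])
      (use assms(2) in \<open>simp_all add: meval_monom_eval lookup_map\<close>)
qed

lemma mvars_map: "mvars (Poly_Mapping.map \<sigma> p) \<subseteq> mvars p"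
  by (auto simp: mvars_def in_keys_iff Poly_Mapping.map.rep_eq when_def split: if_splits)

lemma comm_ring_hom_poly: "comm_ring_hom (\<lambda>P. poly P a)"
  by unfold_locales auto

lemma comm_ring_hom_pCons: "comm_ring_hom h \<Longrightarrow> comm_ring_hom (\<lambda>c. [:h c:])"
proof -
  assume "comm_ring_hom h"
  then interpret comm_ring_hom h .
  show ?thesis by unfold_locales (auto simp: hom_add hom_mult one_pCons)
qed

lemma comm_ring_hom_map_poly: "comm_ring_hom h \<Longrightarrow> comm_ring_hom (map_poly h)"
proof -
  assume "comm_ring_hom h"
  then interpret comm_ring_hom h .
  show ?thesis
    by (rule comm_ring_homI)
      (auto simp: hom_add hom_mult hom_sum intro!: poly_eqI simp: coeff_map_poly coeff_mult)
qed

text \<open>A polynomial is a univariate polynomial in any one of its variables; evaluating that one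
  variable last reduces the statement to the finiteness of the set of roots.\<close>

lemma mpoly_nonvanishing_point:
  fixes p :: "('x, 'c::field_char_0) mpoly"
  assumes "p \<noteq> 0"
  obtains z where "meval id z p \<noteq> 0"
proof -
  have "\<exists>z. meval id z p \<noteq> 0" if "finite V" "mvars p \<subseteq> V" "p \<noteq> 0" for V and p :: "('x, 'c) mpoly"
    using that
  proof (induction V arbitrary: p rule: finite_induct)
    case empty
    then have "Poly_Mapping.keys p \<subseteq> {0}" by (auto simp: mvars_def)
    then have "Poly_Mapping.single 0 (Poly_Mapping.lookup p 0) = p"
      by (intro poly_mapping_eqI) (auto simp: lookup_single when_def in_keys_iff)
    then have eq: "p = mconst (Poly_Mapping.lookup p 0)" by (simp add: mconst_def)
    have "meval id z p = Poly_Mapping.lookup p 0" for z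
      by (subst eq) simp
    moreover have "Poly_Mapping.lookup p 0 \<noteq> 0"
      using eq empty.prems(2) by (metis mconst_def single_zero)
    ultimately show ?case by metis
  next
    case (insert x V)
    define F where "F = meval (\<lambda>c::'c. [:mconst c:]) (\<lambda>y. if y = x then [:0, 1:] else [:mvar y:])"
    have F: "comm_ring_hom F"
      unfolding F_def by (intro comm_ring_hom_meval comm_ring_hom_pCons comm_ring_hom_mconst)
    have Fc: "F (mconst c) = [:mconst c:]" for c
      unfolding F_def by (subst meval_mconst) (auto simp: mconst_def)
    have Fv: "F (mvar y) = (if y = x then [:0, 1:] else [:mvar y:])" for y
      unfolding F_def by (subst meval_mvar) (auto simp: mconst_def one_pCons)
    have "poly (F p) (mvar x) = p"
      by (rule mpoly_hom_eqI[OF comm_ring_hom_comp[OF F comm_ring_hom_poly, unfolded o_def]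
            comm_ring_hom_id, of "mvar x", simplified]) (auto simp: Fc Fv)
    then have "F p \<noteq> 0" using insert.prems by auto
    then obtain i where i: "Polynomial.coeff (F p) i \<noteq> 0" by (auto simp: poly_eq_iff)
    have "F p \<in> {P. \<forall>i. mvars (Polynomial.coeff P i) \<subseteq> V}"
      unfolding F_def
    proof (rule meval_closed; (intro CollectI allI)?)
      fix P Q :: "('x, 'c) mpoly poly" and i
      assume P: "P \<in> {P. \<forall>i. mvars (Polynomial.coeff P i) \<subseteq> V}"
        and Q: "Q \<in> {P. \<forall>i. mvars (Polynomial.coeff P i) \<subseteq> V}"
      show "mvars (Polynomial.coeff (P + Q) i) \<subseteq> V"
        using P Q mvars_add[of "Polynomial.coeff P i" "Polynomial.coeff Q i"] by fastforce
      have "mvars (Polynomial.coeff P j * Polynomial.coeff Q (i - j)) \<subseteq> V" for j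
        using P Q mvars_mult[of "Polynomial.coeff P j" "Polynomial.coeff Q (i - j)"] by fastforce
      then show "mvars (Polynomial.coeff (P * Q) i) \<subseteq> V"
        using mvars_sum[of "{..i}" "\<lambda>j. Polynomial.coeff P j * Polynomial.coeff Q (i - j)"]
        unfolding coeff_mult by blast
    next
      fix y i assume "y \<in> mvars p"
      with insert.prems show "mvars (Polynomial.coeff (if y = x then [:0, 1:] else [:mvar y:]) i) \<subseteq> V"
        by (auto simp: coeff_pCons split: nat.split)
    qed (auto simp: coeff_pCons one_pCons split: nat.split)
    then have "mvars (Polynomial.coeff (F p) i) \<subseteq> V" by auto
    with insert.IH i obtain z where z: "meval id z (Polynomial.coeff (F p) i) \<noteq> 0" by blast
    note hz = comm_ring_hom_meval[OF comm_ring_hom_id, of z]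
    interpret hz: comm_ring_hom "meval id z :: ('x, 'c) mpoly \<Rightarrow> 'c" by (rule hz)
    define P where "P = map_poly (meval id z) (F p)"
    have "P \<noteq> 0" using z by (auto simp: P_def poly_eq_iff coeff_map_poly)
    then have "finite {a. poly P a = 0}" by (rule poly_roots_finite)
    then have "{a. poly P a = 0} \<noteq> UNIV" using infinite_UNIV_char_0 by metis
    then obtain a where a: "poly P a \<noteq> 0" by auto
    have "poly P a = meval id (z(x := a)) p"
      unfolding P_def
      by (rule mpoly_hom_eqI[of "\<lambda>p. poly (map_poly (meval id z) (F p)) a" "meval id (z(x := a))"])
        (use comm_ring_hom_comp[OF F comm_ring_hom_comp[OF comm_ring_hom_map_poly[OF hz] comm_ring_hom_poly]]
          in \<open>auto simp: o_def Fc Fv map_poly_pCons intro!: comm_ring_hom_meval comm_ring_hom_id\<close>)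
    with a show ?case by metis
  qed
  from this[of "mvars p" p] assms that show ?thesis by auto
qed

subsection \<open>Fractions\<close>

lemma comm_ring_hom_Fract: "comm_ring_hom (\<lambda>a. Fract a 1)"
  by (rule comm_ring_homI) (auto simp: One_fract_def)

lemma field_hom_comm_ring_hom: "comm_ring_hom h \<Longrightarrow> field_hom h" for h :: "'c::field \<Rightarrow> 'd::field"
  by (simp add: field_hom_def idom_hom_def)

lemma hom_eq_0_iff:
  fixes h :: "'c::field \<Rightarrow> 'd::field"
  assumes "comm_ring_hom h"
  shows "h x = 0 \<longleftrightarrow> x = 0"
proof -
  interpret field_hom h by (rule field_hom_comm_ring_hom) fact
  show ?thesis by simp
qed

lemma hom_divide:
  fixes h :: "'c::field \<Rightarrow> 'd::field"
  assumes "comm_ring_hom h"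
  shows "h (x / y) = h x / h y" "h (inverse x) = inverse (h x)"
proof -
  interpret field_hom h by (rule field_hom_comm_ring_hom) fact
  have *: "h (inverse x) = inverse (h x)" for x
    by (cases "x = 0") (auto simp flip: hom_mult intro!: inverse_unique[symmetric])
  show "h (x / y) = h x / h y" "h (inverse x) = inverse (h x)"
    by (simp_all add: divide_inverse hom_mult *)
qed

text \<open>The extension of an injective ring homomorphism into a field to the field of fractions.\<close>

definition fract_ext :: "('b::idom \<Rightarrow> 'e::field) \<Rightarrow> 'b fract \<Rightarrow> 'e" where
  "fract_ext h r = (SOME y. \<exists>a b. b \<noteq> 0 \<and> r = Fract a b \<and> y = h a / h b)"

lemma fract_ext_Fract:
  assumes "comm_ring_hom h" and nz: "\<And>x. h x = 0 \<Longrightarrow> x = 0" and b: "b \<noteq> 0"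
  shows "fract_ext h (Fract a b) = h a / h b"
  unfolding fract_ext_def
proof (rule some_equality)
  interpret comm_ring_hom h by fact
  fix y assume "\<exists>a' b'. b' \<noteq> 0 \<and> Fract a b = Fract a' b' \<and> y = h a' / h b'"
  then obtain a' b' where *: "b' \<noteq> 0" "Fract a b = Fract a' b'" "y = h a' / h b'" by blast
  then have "h (a * b') = h (a' * b)" using b by (simp add: eq_fract)
  moreover have "h b \<noteq> 0" "h b' \<noteq> 0" using nz b * by auto
  ultimately show "y = h a / h b" unfolding *(3) by (simp add: hom_mult divide_simps)
qed (use b in blast)

lemma comm_ring_hom_fract_ext:
  assumes "comm_ring_hom h" and nz: "\<And>x. h x = 0 \<Longrightarrow> x = 0"
  shows "comm_ring_hom (fract_ext h)"
proof -
  interpret comm_ring_hom h by fact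
  note ext = fract_ext_Fract[OF assms]
  have nz': "h x \<noteq> 0" if "x \<noteq> 0" for x using nz that by blast
  show ?thesis
  proof (rule comm_ring_homI)
    show "fract_ext h 1 = 1" using ext[of 1 1] by (simp add: One_fract_def)
  next
    fix r s :: "'a fract"
    obtain a b c d where "r = Fract a b" "b \<noteq> 0" "s = Fract c d" "d \<noteq> 0"
      by (metis Fract_cases)
    then show "fract_ext h (r + s) = fract_ext h r + fract_ext h s"
      and "fract_ext h (r * s) = fract_ext h r * fract_ext h s"
      using nz'[of b] nz'[of d] by (auto simp: ext hom_add hom_mult field_simps)
  qed
qed

lemma fract_hom_eqI:
  fixes g h :: "'b::idom fract \<Rightarrow> 'e::field"
  assumes "comm_ring_hom g" "comm_ring_hom h" "\<And>a. g (Fract a 1) = h (Fract a 1)"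
  shows "g r = h r"
proof (cases r)
  case (Fract a b)
  then have "r = Fract a 1 / Fract b 1" by simp
  then show ?thesis by (metis hom_divide(1) assms)
qed

subsection \<open>Generated subfields\<close>

definition subfield_set :: "'f::field set \<Rightarrow> bool" where
  "subfield_set K \<longleftrightarrow> subring_set K \<and> (\<forall>a\<in>K. inverse a \<in> K)"

lemma subfield_setD:
  assumes "subfield_set L"
  shows "subring_set L" "0 \<in> L" "1 \<in> L" "a \<in> L \<Longrightarrow> - a \<in> L" "a \<in> L \<Longrightarrow> b \<in> L \<Longrightarrow> a + b \<in> L"
    "a \<in> L \<Longrightarrow> b \<in> L \<Longrightarrow> a * b \<in> L" "a \<in> L \<Longrightarrow> b \<in> L \<Longrightarrow> a - b \<in> L"
    "a \<in> L \<Longrightarrow> inverse a \<in> L" "a \<in> L \<Longrightarrow> b \<in> L \<Longrightarrow> a / b \<in> L"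
  using assms subring_setD[of L] unfolding subfield_set_def by (auto simp: divide_inverse)

lemma subfield_set_UNIV [simp]: "subfield_set UNIV"
  by (simp add: subfield_set_def)

lemma gen_field_incl: "S \<subseteq> gen_field S"
  by (rule subsetI) (rule generate_field.incl)

lemma ring_of_type_algebra_simps:
  "\<one>\<^bsub>(ring_of_type_algebra :: 'f::field ring)\<^esub> = 1"
  "\<zero>\<^bsub>(ring_of_type_algebra :: 'f ring)\<^esub> = 0"
  "a \<oplus>\<^bsub>(ring_of_type_algebra :: 'f ring)\<^esub> b = a + b"
  "a \<otimes>\<^bsub>(ring_of_type_algebra :: 'f ring)\<^esub> b = a * b"
  by (simp_all add: ring_of_type_algebra_def)

lemma ring_of_type_algebra_uminus: "\<ominus>\<^bsub>(ring_of_type_algebra :: 'f::field ring)\<^esub> a = - a"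
  by (rule abelian_group.minus_equality[OF ring.is_abelian_group[OF ring_from_type_algebra]])
    (simp_all add: ring_of_type_algebra_def)

lemma ring_of_type_algebra_inverse:
  assumes "a \<noteq> 0"
  shows "inv\<^bsub>(ring_of_type_algebra :: 'f::field ring)\<^esub> a = inverse a"
  by (rule monoid.inv_char[OF ring.is_monoid[OF ring_from_type_algebra]])
    (simp_all add: ring_of_type_algebra_def assms)

lemma subfield_set_gen_field [simp]: "subfield_set (gen_field S)"
proof -
  note i = generate_field.intros[where R = "ring_of_type_algebra" and H = S,
      unfolded ring_of_type_algebra_simps ring_of_type_algebra_uminus]
  have zero: "0 \<in> gen_field S" using i(5)[OF i(1) i(3)[OF i(1)]] by simp
  have "inverse a \<in> gen_field S" if "a \<in> gen_field S" for a
    using i(4)[OF that] that zero by (cases "a = 0") (auto simp: ring_of_type_algebra_inverse)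
  with zero i show ?thesis by (auto simp: subfield_set_def subring_set_def)
qed

lemma gen_field_minimal:
  assumes "subfield_set K" "S \<subseteq> K"
  shows "gen_field S \<subseteq> K"
proof
  fix a assume "a \<in> gen_field S"
  then show "a \<in> K"
    using subfield_setD[OF assms(1)] assms(2)
    by (induction rule: generate_field.induct)
      (auto simp: ring_of_type_algebra_simps ring_of_type_algebra_uminus ring_of_type_algebra_inverse)
qed

lemma gen_field_mono: "S \<subseteq> T \<Longrightarrow> gen_field S \<subseteq> gen_field T"
  by (meson gen_field_minimal subfield_set_gen_field gen_field_incl order_trans)

lemma gen_field_Un_gen_field: "gen_field (gen_field S \<union> T) = gen_field (S \<union> T)"
proof (rule antisym)
  have "gen_field S \<union> T \<subseteq> gen_field (S \<union> T)"
    using gen_field_mono[of S "S \<union> T"] gen_field_incl[of "S \<union> T"] by auto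
  then show "gen_field (gen_field S \<union> T) \<subseteq> gen_field (S \<union> T)"
    by (intro gen_field_minimal) auto
  show "gen_field (S \<union> T) \<subseteq> gen_field (gen_field S \<union> T)"
    using gen_field_incl[of S] by (intro gen_field_mono) auto
qed

lemma subfield_set_vimage:
  fixes h :: "'c::field \<Rightarrow> 'd::field"
  assumes "comm_ring_hom h" "subfield_set L"
  shows "subfield_set {p. h p \<in> L}"
  using subring_set_vimage[OF assms(1), of L] assms(2)
  unfolding subfield_set_def by (simp add: hom_divide(2)[OF assms(1)])

lemma subfield_set_image:
  fixes h :: "'c::field \<Rightarrow> 'd::field"
  assumes "comm_ring_hom h" "subfield_set L"
  shows "subfield_set (h ` L)"
proof -
  have "inverse (h a) \<in> h ` L" if "a \<in> L" for a
    using subfield_setD(8)[OF assms(2) that] hom_divide(2)[OF assms(1), of a] by (metis image_eqI)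
  then show ?thesis
    using subring_set_image[OF assms(1), of L] assms(2) by (auto simp: subfield_set_def)
qed

lemma image_gen_field:
  fixes h :: "'c::field \<Rightarrow> 'd::field"
  assumes h: "comm_ring_hom h"
  shows "h ` gen_field S = gen_field (h ` S)"
proof (rule antisym)
  have "gen_field S \<subseteq> {p. h p \<in> gen_field (h ` S)}"
  proof (rule gen_field_minimal)
    show "subfield_set {p. h p \<in> gen_field (h ` S)}"
      by (rule subfield_set_vimage[OF h subfield_set_gen_field])
    show "S \<subseteq> {p. h p \<in> gen_field (h ` S)}"
      using gen_field_incl[of "h ` S"] by blast
  qed
  then show "h ` gen_field S \<subseteq> gen_field (h ` S)" by blast
  show "gen_field (h ` S) \<subseteq> h ` gen_field S"
  proof (rule gen_field_minimal)
    show "subfield_set (h ` gen_field S)"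
      by (rule subfield_set_image[OF h subfield_set_gen_field])
    show "h ` S \<subseteq> h ` gen_field S"
      using gen_field_incl[of S] by (rule image_mono)
  qed
qed

section \<open>Extension of homomorphisms and the Nullstellensatz\<close>

definition ideal_set :: "'r::comm_ring_1 set \<Rightarrow> bool" where
  "ideal_set J \<longleftrightarrow> 0 \<in> J \<and> (\<forall>a\<in>J. \<forall>b\<in>J. a + b \<in> J) \<and> (\<forall>a\<in>J. \<forall>c. c * a \<in> J)"

definition prime_ideal_set :: "'r::comm_ring_1 set \<Rightarrow> bool" where
  "prime_ideal_set P \<longleftrightarrow> ideal_set P \<and> 1 \<notin> P \<and> (\<forall>a b. a * b \<in> P \<longrightarrow> a \<in> P \<or> b \<in> P)"

lemma ideal_setD:
  assumes "ideal_set J"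
  shows "0 \<in> J" "a \<in> J \<Longrightarrow> b \<in> J \<Longrightarrow> a + b \<in> J" "a \<in> J \<Longrightarrow> c * a \<in> J" "a \<in> J \<Longrightarrow> a * c \<in> J"
    "a \<in> J \<Longrightarrow> - a \<in> J" "a \<in> J \<Longrightarrow> b \<in> J \<Longrightarrow> a - b \<in> J"
proof -
  show 1: "0 \<in> J" "a \<in> J \<Longrightarrow> b \<in> J \<Longrightarrow> a + b \<in> J" "a \<in> J \<Longrightarrow> c * a \<in> J" for a b c
    using assms by (auto simp: ideal_set_def)
  show "a \<in> J \<Longrightarrow> a * c \<in> J" using 1(3)[of a c] by (simp add: mult.commute)
  show 2: "a \<in> J \<Longrightarrow> - a \<in> J" for a using 1(3)[of a "-1"] by simp
  show "a \<in> J \<Longrightarrow> b \<in> J \<Longrightarrow> a - b \<in> J" using 1(2)[of a "-b"] 2[of b] by simp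
qed

lemma ideal_set_sum: "ideal_set J \<Longrightarrow> (\<And>x. x \<in> K \<Longrightarrow> g x \<in> J) \<Longrightarrow> (\<Sum>x\<in>K. g x) \<in> J"
  by (induction K rule: infinite_finite_induct) (auto simp: ideal_setD)

lemma prime_ideal_set_power: "prime_ideal_set P \<Longrightarrow> a \<notin> P \<Longrightarrow> a ^ n \<notin> P"
  by (induction n) (auto simp: prime_ideal_set_def)

text \<open>By Zorn there is an ideal that is maximal among those containing \<open>I\<close> and no power of \<open>g\<close>; if it
  contained a product but neither factor, both factors would produce powers of \<open>g\<close> in it.\<close>

lemma prime_ideal_avoiding_powers:
  fixes g :: "'r::comm_ring_1"
  assumes "ideal_set I" "\<And>n. g ^ n \<notin> I"
  obtains P where "prime_ideal_set P" "I \<subseteq> P" "g \<notin> P"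
proof -
  define \<A> where "\<A> = {J. ideal_set J \<and> I \<subseteq> J \<and> (\<forall>n. g ^ n \<notin> J)}"
  have "\<exists>M\<in>\<A>. \<forall>J\<in>\<A>. M \<subseteq> J \<longrightarrow> J = M"
  proof (rule subset_Zorn_nonempty)
    show "\<A> \<noteq> {}" using assms by (auto simp: \<A>_def)
  next
    fix \<C> assume "\<C> \<noteq> {}" and ch: "subset.chain \<A> \<C>"
    have sub: "\<C> \<subseteq> \<A>" and lin: "\<And>x y. x \<in> \<C> \<Longrightarrow> y \<in> \<C> \<Longrightarrow> x \<subseteq> y \<or> y \<subseteq> x"
      using ch by (auto simp: subset_chain_def)
    have "a + b \<in> \<Union>\<C>" if ab: "a \<in> \<Union>\<C>" "b \<in> \<Union>\<C>" for a b
    proof -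
      from ab obtain x y where xy: "x \<in> \<C>" "a \<in> x" "y \<in> \<C>" "b \<in> y" by blast
      then obtain w where "w \<in> \<C>" "a \<in> w" "b \<in> w" using lin[of x y] by blast
      then show ?thesis using sub ideal_setD(2)[of w a b] by (auto simp: \<A>_def)
    qed
    moreover have "c * a \<in> \<Union>\<C>" if "a \<in> \<Union>\<C>" for a c
      using that sub ideal_setD(3) unfolding \<A>_def by blast
    moreover have "0 \<in> \<Union>\<C>" using \<open>\<C> \<noteq> {}\<close> sub ideal_setD(1) unfolding \<A>_def by blast
    ultimately show "\<Union>\<C> \<in> \<A>"
      using sub \<open>\<C> \<noteq> {}\<close> unfolding \<A>_def ideal_set_def by blast
  qed
  then obtain P where P: "P \<in> \<A>" and max: "\<And>J. J \<in> \<A> \<Longrightarrow> P \<subseteq> J \<Longrightarrow> J = P" by blast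
  have idP: "ideal_set P" "I \<subseteq> P" "\<And>n. g ^ n \<notin> P" using P by (auto simp: \<A>_def)
  note idP' = ideal_setD[OF idP(1)]
  have enlarge: "\<exists>n p c. p \<in> P \<and> g ^ n = p + c * a" if "a \<notin> P" for a
  proof (rule ccontr)
    assume no: "\<not> ?thesis"
    let ?J = "{p + c * a | p c. p \<in> P}"
    have "ideal_set ?J"
      unfolding ideal_set_def
    proof (intro conjI ballI allI)
      show "0 \<in> ?J" using idP'(1) by (intro CollectI exI[of _ 0]) auto
      fix x assume "x \<in> ?J"
      then obtain p c where x: "x = p + c * a" "p \<in> P" by blast
      show "d * x \<in> ?J" for d
        unfolding x using idP'(3)[OF x(2), of d]
        by (intro CollectI exI[of _ "d * p"] exI[of _ "d * c"]) (simp add: distrib_left mult.assoc)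
      fix y assume "y \<in> ?J"
      then obtain q d where y: "y = q + d * a" "q \<in> P" by blast
      show "x + y \<in> ?J"
        using x y idP'(2) by (intro CollectI exI[of _ "p + q"] exI[of _ "c + d"]) (auto simp: algebra_simps)
    qed
    moreover have PJ: "P \<subseteq> ?J" by (force intro: exI[of _ 0])
    ultimately have "?J = P" using no idP(2) by (intro max) (auto simp: \<A>_def)
    moreover have "a \<in> ?J" using idP'(1) by (intro CollectI exI[of _ 0] exI[of _ 1]) auto
    ultimately show False using that by simp
  qed
  have "a \<in> P \<or> b \<in> P" if ab: "a * b \<in> P" for a b
  proof (rule ccontr)
    assume "\<not> ?thesis"
    then obtain n p c l q d where "p \<in> P" "g ^ n = p + c * a" "q \<in> P" "g ^ l = q + d * b"
      using enlarge[of a] enlarge[of b] by blast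
    then have "g ^ (n + l) = p * (q + d * b) + q * (c * a) + (c * d) * (a * b)"
      by (simp add: power_add algebra_simps)
    moreover have "p * (q + d * b) + q * (c * a) + (c * d) * (a * b) \<in> P"
      using idP'(4)[OF \<open>p \<in> P\<close>] idP'(4)[OF \<open>q \<in> P\<close>] idP'(3)[OF ab] by (intro idP'(2))
    ultimately show False using idP(3) by metis
  qed
  moreover have "g \<notin> P" "1 \<notin> P" using idP(3)[of 1] idP(3)[of 0] by auto
  ultimately show ?thesis using idP that[of P] by (auto simp: prime_ideal_set_def)
qed

text \<open>\<open>hom_mod P D \<phi>\<close>: on the subring \<open>D\<close>, \<open>\<phi>\<close> is a ring homomorphism that factors
  through the quotient by \<open>P\<close>; outside \<open>D\<close> its values are arbitrary.\<close>

definition hom_mod :: "'r::comm_ring_1 set \<Rightarrow> 'r set \<Rightarrow> ('r \<Rightarrow> 'c::field) \<Rightarrow> bool" where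
  "hom_mod P D \<phi> \<longleftrightarrow> \<phi> 1 = 1 \<and> (\<forall>a\<in>D. \<forall>b\<in>D. \<phi> (a + b) = \<phi> a + \<phi> b \<and> \<phi> (a * b) = \<phi> a * \<phi> b) \<and>
     (\<forall>a\<in>D. a \<in> P \<longrightarrow> \<phi> a = 0)"

definition polys_over :: "'r::comm_ring_1 set \<Rightarrow> 'r poly set" where
  "polys_over D = {p. \<forall>i. Polynomial.coeff p i \<in> D}"

definition adjoin :: "'r::comm_ring_1 set \<Rightarrow> 'r \<Rightarrow> 'r set" where
  "adjoin D z = (\<lambda>p. poly p z) ` polys_over D"

lemma subring_set_polys_over: "subring_set D \<Longrightarrow> subring_set (polys_over D)"
  unfolding subring_set_def[of "polys_over D"]
  by (auto simp: polys_over_def coeff_mult coeff_1 subring_setD intro!: subring_set_sum)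

lemma polys_over_intros:
  assumes "subring_set D"
  shows "c \<in> D \<Longrightarrow> Polynomial.monom c n \<in> polys_over D" "c \<in> D \<Longrightarrow> [:c:] \<in> polys_over D"
    "c \<in> D \<Longrightarrow> p \<in> polys_over D \<Longrightarrow> Polynomial.smult c p \<in> polys_over D"
  using subring_setD[OF assms] by (auto simp: polys_over_def coeff_pCons split: nat.split)

lemma subring_set_adjoin: "subring_set D \<Longrightarrow> subring_set (adjoin D z)"
  unfolding adjoin_def by (intro subring_set_image comm_ring_hom_poly subring_set_polys_over)

lemma adjoin_superset: "subring_set D \<Longrightarrow> D \<subseteq> adjoin D z"
proof
  fix d assume "subring_set D" "d \<in> D"
  then show "d \<in> adjoin D z"
    unfolding adjoin_def by (intro image_eqI[of _ _ "[:d:]"]) (auto simp: polys_over_intros)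
qed

lemma adjoin_self: "subring_set D \<Longrightarrow> z \<in> adjoin D z"
  unfolding adjoin_def
  by (intro image_eqI[of _ _ "[:0, 1:]"]) (auto simp: polys_over_def coeff_pCons subring_setD split: nat.split)

text \<open>Division with remainder over a ring: the price is a power of the leading coefficient.\<close>

lemma pseudo_division:
  assumes D: "subring_set D" and g: "g \<in> polys_over D" "\<forall>i>s. Polynomial.coeff g i = 0"
  shows "p \<in> polys_over D \<Longrightarrow> \<forall>i\<ge>n. Polynomial.coeff p i = 0 \<Longrightarrow>
    \<exists>k q r. q \<in> polys_over D \<and> r \<in> polys_over D \<and>
      Polynomial.smult (Polynomial.coeff g s ^ k) p = q * g + r \<and>
      (\<forall>i\<ge>s. Polynomial.coeff r i = 0) \<and> (\<forall>i\<ge>n - s. Polynomial.coeff q i = 0)"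
proof (induction n arbitrary: p)
  case 0
  then have "p = 0" by (auto simp: poly_eq_iff)
  then show ?case using subring_setD(1)[OF subring_set_polys_over[OF D]]
    by (intro exI[of _ 0]) auto
next
  case (Suc n)
  note DD = subring_setD[OF subring_set_polys_over[OF D]]
  show ?case
  proof (cases "n < s")
    case True
    then show ?thesis using Suc.prems DD(1) by (intro exI[of _ 0] exI[of _ p]) auto
  next
    case False
    let ?m = "Polynomial.coeff g s" and ?c = "Polynomial.coeff p n"
    let ?q = "Polynomial.monom ?c (n - s)"
    let ?p = "Polynomial.smult ?m p - ?q * g"
    have c: "?m \<in> D" "?c \<in> D" using g(1) Suc.prems(1) by (auto simp: polys_over_def)
    have p: "?p \<in> polys_over D"
      using Suc.prems(1) g(1) c by (intro DD polys_over_intros[OF D]) auto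
    have "Polynomial.coeff ?p i = 0" if "i \<ge> n" for i
    proof (cases "i = n")
      case True
      then show ?thesis using False by (simp add: coeff_monom_mult)
    next
      case False
      then have "i > n" using that by simp
      then show ?thesis using Suc.prems(2) g(2) \<open>\<not> n < s\<close> by (simp add: coeff_monom_mult)
    qed
    with Suc.IH[OF p] obtain k q r where qr: "q \<in> polys_over D" "r \<in> polys_over D"
      "Polynomial.smult (?m ^ k) ?p = q * g + r" "\<forall>i\<ge>s. Polynomial.coeff r i = 0"
      "\<forall>i\<ge>n - s. Polynomial.coeff q i = 0" by blast
    let ?q' = "q + Polynomial.smult (?m ^ k) ?q"
    have "Polynomial.smult (?m ^ Suc k) p = ?q' * g + r"
      using qr(3) by (simp add: smult_diff_right algebra_simps smult_smult)
    moreover have "?q' \<in> polys_over D"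
      using qr(1) c by (intro DD polys_over_intros[OF D] subring_set_power[OF D]) auto
    moreover have "\<forall>i\<ge>Suc n - s. Polynomial.coeff ?q' i = 0"
      using qr(5) False by (auto simp: coeff_monom)
    ultimately show ?thesis using qr(2,4) by blast
  qed
qed

locale hom_extension =
  fixes P D :: "'r::comm_ring_1 set" and z :: 'r
  assumes P: "prime_ideal_set P" and D: "subring_set D"
begin

lemmas idP = ideal_setD[OF P[unfolded prime_ideal_set_def, THEN conjunct1]]
lemmas DD = subring_setD[OF D]
lemmas PD = subring_setD[OF subring_set_polys_over[OF D]]

lemma hom_mod_simps:
  assumes "hom_mod P D \<phi>"
  shows "\<phi> 0 = 0" "\<phi> 1 = 1" "a \<in> D \<Longrightarrow> b \<in> D \<Longrightarrow> \<phi> (a + b) = \<phi> a + \<phi> b"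
    "a \<in> D \<Longrightarrow> b \<in> D \<Longrightarrow> \<phi> (a * b) = \<phi> a * \<phi> b" "a \<in> D \<Longrightarrow> a \<in> P \<Longrightarrow> \<phi> a = 0"
    "a \<in> D \<Longrightarrow> \<phi> (a ^ k) = \<phi> a ^ k"
    "(\<And>x. x \<in> K \<Longrightarrow> g x \<in> D) \<Longrightarrow> \<phi> (\<Sum>x\<in>K. g x) = (\<Sum>x\<in>K. \<phi> (g x))"
    "a \<in> D \<Longrightarrow> \<phi> (- a) = - \<phi> a"
proof -
  show 1: "\<phi> 0 = 0" "\<phi> 1 = 1"
    "a \<in> D \<Longrightarrow> b \<in> D \<Longrightarrow> \<phi> (a + b) = \<phi> a + \<phi> b" 
    "a \<in> D \<Longrightarrow> b \<in> D \<Longrightarrow> \<phi> (a * b) = \<phi> a * \<phi> b" "a \<in> D \<Longrightarrow> a \<in> P \<Longrightarrow> \<phi> a = 0" for a b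
    using assms DD(1) idP(1) by (auto simp: hom_mod_def)
  show "a \<in> D \<Longrightarrow> \<phi> (a ^ k) = \<phi> a ^ k"
    by (induction k) (auto simp: 1 subring_set_power[OF D])
  show "(\<And>x. x \<in> K \<Longrightarrow> g x \<in> D) \<Longrightarrow> \<phi> (\<Sum>x\<in>K. g x) = (\<Sum>x\<in>K. \<phi> (g x))"
    by (induction K rule: infinite_finite_induct) (auto simp: 1 subring_set_sum[OF D])
  show "a \<in> D \<Longrightarrow> \<phi> (- a) = - \<phi> a"
    using 1(3)[of a "-a"] 1(1) DD(3)[of a] by (simp add: add_eq_0_iff)
qed

lemma map_poly_hom_mod:
  assumes "hom_mod P D \<phi>" "p \<in> polys_over D" "q \<in> polys_over D"
  shows "map_poly \<phi> (p + q) = map_poly \<phi> p + map_poly \<phi> q"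
    "map_poly \<phi> (p * q) = map_poly \<phi> p * map_poly \<phi> q"
    "a \<in> D \<Longrightarrow> map_poly \<phi> (Polynomial.smult a p) = Polynomial.smult (\<phi> a) (map_poly \<phi> p)"
  using assms(2,3)
  by (auto intro!: poly_eqI sum.cong simp: coeff_map_poly hom_mod_simps[OF assms(1)] polys_over_def
      coeff_mult DD)

lemma poly_in_P: "(\<And>i. Polynomial.coeff p i \<in> P) \<Longrightarrow> poly p z \<in> P"
  unfolding poly_altdef by (intro ideal_set_sum idP) (use P in \<open>auto simp: prime_ideal_set_def\<close>)

text \<open>Sending \<open>z\<close> to \<open>\<zeta>\<close> extends \<open>\<phi>\<close> to \<open>D[z]\<close> as soon as \<open>\<zeta>\<close> satisfies all transported
  relations.\<close>

lemma extend:
  assumes hom: "hom_mod P D \<phi>"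
    and K: "\<forall>p\<in>polys_over D. poly p z \<in> P \<longrightarrow> poly (map_poly \<phi> p) \<zeta> = 0"
  shows "\<exists>\<phi>'. hom_mod P (adjoin D z) \<phi>' \<and>
    (\<forall>p\<in>polys_over D. \<phi>' (poly p z) = poly (map_poly \<phi> p) \<zeta>) \<and> (\<forall>d\<in>D. \<phi>' d = \<phi> d)"
proof -
  note m = map_poly_hom_mod[OF hom]
  define \<phi>' where "\<phi>' a = poly (map_poly \<phi> (SOME p. p \<in> polys_over D \<and> poly p z = a)) \<zeta>" for a
  have eq: "\<phi>' (poly p z) = poly (map_poly \<phi> p) \<zeta>" if p: "p \<in> polys_over D" for p
  proof -
    define q where "q = (SOME q. q \<in> polys_over D \<and> poly q z = poly p z)"
    have q: "q \<in> polys_over D" "poly q z = poly p z"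
      using someI[of "\<lambda>q. q \<in> polys_over D \<and> poly q z = poly p z" p] p unfolding q_def by auto
    have "poly (map_poly \<phi> (p - q)) \<zeta> = 0"
      using p q PD(6) by (intro K[rule_format]) (auto simp: idP)
    moreover have "map_poly \<phi> p = map_poly \<phi> (p - q) + map_poly \<phi> q"
      using m(1)[of "p - q" q] p q(1) PD(6) by simp
    ultimately show ?thesis unfolding \<phi>'_def q_def[symmetric] by simp
  qed
  have c: "\<phi>' d = \<phi> d" if "d \<in> D" for d
    using eq[OF polys_over_intros(2)[OF D that]] hom_mod_simps(1)[OF hom]
    by (simp add: map_poly_pCons)
  have "hom_mod P (adjoin D z) \<phi>'"
    unfolding hom_mod_def
  proof (intro conjI ballI impI)
    show "\<phi>' 1 = 1" using c[OF DD(2)] hom_mod_simps(2)[OF hom] by simp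
    fix a assume "a \<in> adjoin D z"
    then obtain p where p: "a = poly p z" "p \<in> polys_over D" by (auto simp: adjoin_def)
    show "\<phi>' a = 0" if "a \<in> P" using that p K eq by simp
    fix b assume "b \<in> adjoin D z"
    then obtain q where q: "b = poly q z" "q \<in> polys_over D" by (auto simp: adjoin_def)
    show "\<phi>' (a + b) = \<phi>' a + \<phi>' b"
      using eq[OF PD(4)[OF p(2) q(2)]] by (simp add: p q eq m)
    show "\<phi>' (a * b) = \<phi>' a * \<phi>' b"
      using eq[OF PD(5)[OF p(2) q(2)]] by (simp add: p q eq m)
  qed
  then show ?thesis using eq c by blast
qed

text \<open>A relation of least degree with a leading coefficient that survives under \<open>\<phi>\<close> controls all
  relations, by pseudo-division.\<close>

lemma relations_vanish:
  assumes hom: "hom_mod P D \<phi>"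
    and \<mu>: "\<mu> \<in> polys_over D" "\<forall>i>r. Polynomial.coeff \<mu> i = 0" "poly \<mu> z \<in> P"
    and least: "\<forall>p\<in>polys_over D. (\<forall>i\<ge>r. Polynomial.coeff p i = 0) \<and> poly p z \<in> P \<longrightarrow>
      (\<forall>i. Polynomial.coeff p i \<in> P)"
    and nz: "\<phi> (Polynomial.coeff \<mu> r) \<noteq> 0" and root: "poly (map_poly \<phi> \<mu>) \<zeta> = 0"
    and p: "p \<in> polys_over D" "poly p z \<in> P"
  shows "poly (map_poly \<phi> p) \<zeta> = 0"
proof -
  have "\<forall>i\<ge>Suc (Polynomial.degree p). Polynomial.coeff p i = 0" by (auto simp: coeff_eq_0)
  from pseudo_division[OF D \<mu>(1,2) p(1) this] obtain k q s where qs: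
    "q \<in> polys_over D" "s \<in> polys_over D"
    "Polynomial.smult (Polynomial.coeff \<mu> r ^ k) p = q * \<mu> + s" "\<forall>i\<ge>r. Polynomial.coeff s i = 0"
    by blast
  have m: "Polynomial.coeff \<mu> r \<in> D" using \<mu>(1) by (auto simp: polys_over_def)
  have "poly s z = Polynomial.coeff \<mu> r ^ k * poly p z - poly q z * poly \<mu> z"
    using arg_cong[OF qs(3), of "\<lambda>P. poly P z"] by simp
  then have "poly s z \<in> P" using p(2) \<mu>(3) by (auto intro: idP)
  then have "\<forall>i. Polynomial.coeff s i \<in> P" using least qs by blast
  then have "map_poly \<phi> s = 0"
    using qs(2) by (intro poly_eqI) (auto simp: coeff_map_poly hom_mod_simps[OF hom] polys_over_def)
  moreover have "map_poly \<phi> (Polynomial.smult (Polynomial.coeff \<mu> r ^ k) p) =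
      map_poly \<phi> q * map_poly \<phi> \<mu> + map_poly \<phi> s"
    unfolding qs(3) using qs(1,2) \<mu>(1) PD(5) by (simp add: map_poly_hom_mod[OF hom])
  ultimately have "Polynomial.smult (\<phi> (Polynomial.coeff \<mu> r) ^ k) (map_poly \<phi> p) =
      map_poly \<phi> q * map_poly \<phi> \<mu>"
    using p(1) m
    by (simp add: map_poly_hom_mod[OF hom] subring_set_power[OF D] hom_mod_simps[OF hom])
  then have "\<phi> (Polynomial.coeff \<mu> r) ^ k * poly (map_poly \<phi> p) \<zeta> = 0"
    using root by (metis mult_zero_right poly_mult poly_smult)
  then show ?thesis using nz by simp
qed

lemma least_relation:
  assumes "p \<in> polys_over D" "poly p z \<in> P" "\<exists>i. Polynomial.coeff p i \<notin> P"
  obtains \<mu> r where "\<mu> \<in> polys_over D" "\<forall>i>r. Polynomial.coeff \<mu> i = 0" "poly \<mu> z \<in> P"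
    "Polynomial.coeff \<mu> r \<notin> P" "r > 0"
    "\<forall>p\<in>polys_over D. (\<forall>i\<ge>r. Polynomial.coeff p i = 0) \<and> poly p z \<in> P \<longrightarrow>
      (\<forall>i. Polynomial.coeff p i \<in> P)"
proof -
  define R where "R r \<longleftrightarrow> (\<exists>\<mu>\<in>polys_over D. poly \<mu> z \<in> P \<and> (\<forall>i>r. Polynomial.coeff \<mu> i = 0) \<and>
    (\<exists>i. Polynomial.coeff \<mu> i \<notin> P))" for r
  define r where "r = (LEAST r. R r)"
  have "R (Polynomial.degree p)" using assms by (auto simp: R_def coeff_eq_0)
  then have "R r" unfolding r_def by (rule LeastI)
  then obtain \<mu> where \<mu>: "\<mu> \<in> polys_over D" "poly \<mu> z \<in> P" "\<forall>i>r. Polynomial.coeff \<mu> i = 0"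
    "\<exists>i. Polynomial.coeff \<mu> i \<notin> P" by (auto simp: R_def)
  have least: "\<forall>i. Polynomial.coeff p i \<in> P"
    if p: "p \<in> polys_over D" "\<forall>i\<ge>r. Polynomial.coeff p i = 0" "poly p z \<in> P" for p
  proof (cases r)
    case 0
    then show ?thesis using p idP(1) by simp
  next
    case (Suc r')
    then have "\<not> R r'" unfolding r_def by (metis lessI not_less_Least)
    then show ?thesis using p Suc unfolding R_def by (metis Suc_leI)
  qed
  have lead: "Polynomial.coeff \<mu> r \<notin> P"
  proof
    assume P: "Polynomial.coeff \<mu> r \<in> P"
    let ?p = "\<mu> - Polynomial.monom (Polynomial.coeff \<mu> r) r"
    have "Polynomial.coeff \<mu> r \<in> D" using \<mu>(1) by (auto simp: polys_over_def)
    then have "?p \<in> polys_over D" using \<mu>(1) by (intro PD polys_over_intros[OF D])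
    moreover have "\<forall>i\<ge>r. Polynomial.coeff ?p i = 0"
      using \<mu>(3) by (auto simp: coeff_monom)
    moreover have "poly ?p z \<in> P"
      using \<mu>(2) P by (auto simp: poly_monom intro: idP)
    ultimately have all: "\<forall>i. Polynomial.coeff ?p i \<in> P" by (intro least)
    have "Polynomial.coeff \<mu> i \<in> P" for i
      using all[rule_format, of i] P by (cases "i = r") (auto simp: coeff_monom)
    then show False using \<mu>(4) by blast
  qed
  have "r > 0"
  proof (rule ccontr)
    assume "\<not> r > 0"
    then have "\<mu> = [:Polynomial.coeff \<mu> 0:]"
      using \<mu>(3) by (intro poly_eqI) (auto simp: coeff_pCons split: nat.split)
    then have "poly \<mu> z = Polynomial.coeff \<mu> 0" by (metis poly_const_conv)
    then show False using \<mu>(2) lead \<open>\<not> r > 0\<close> by simp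
  qed
  moreover have "\<forall>p\<in>polys_over D. (\<forall>i\<ge>r. Polynomial.coeff p i = 0) \<and> poly p z \<in> P \<longrightarrow>
      (\<forall>i. Polynomial.coeff p i \<in> P)" using least by blast
  ultimately show ?thesis using that[of \<mu> r] \<mu> lead by blast
qed

text \<open>If \<open>z\<close> is algebraic over \<open>D\<close> modulo \<open>P\<close>, then every nonzero \<open>b\<close> in \<open>D[z]\<close> divides a nonzero
  element of \<open>D\<close>: a polynomial of least degree in the ideal generated by \<open>b\<close>, written as a
  polynomial in \<open>z\<close>, and the minimal relation is constant.\<close>

lemma multiple_in_base:
  assumes \<mu>: "\<mu> \<in> polys_over D" "\<forall>i>r. Polynomial.coeff \<mu> i = 0" "poly \<mu> z \<in> P"
    and lead: "Polynomial.coeff \<mu> r \<notin> P"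
    and least: "\<forall>p\<in>polys_over D. (\<forall>i\<ge>r. Polynomial.coeff p i = 0) \<and> poly p z \<in> P \<longrightarrow>
      (\<forall>i. Polynomial.coeff p i \<in> P)"
    and b: "b \<in> polys_over D" "poly b z \<notin> P"
  obtains u a where "u \<in> polys_over D" "a \<in> D" "a \<notin> P" "a - poly u z * poly b z \<in> P"
proof -
  define PP where "PP = {w \<in> polys_over D. \<forall>i. Polynomial.coeff w i \<in> P}"
  define G where "G = {u * b + v * \<mu> + w | u v w. u \<in> polys_over D \<and> v \<in> polys_over D \<and> w \<in> PP}"
  have PP: "0 \<in> PP" "\<And>v w. v \<in> PP \<Longrightarrow> w \<in> PP \<Longrightarrow> v + w \<in> PP"
    "\<And>c w. c \<in> polys_over D \<Longrightarrow> w \<in> PP \<Longrightarrow> c * w \<in> PP" "\<And>w. w \<in> PP \<Longrightarrow> - w \<in> PP"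
    using PD idP P unfolding PP_def
    by (auto simp: coeff_mult prime_ideal_set_def intro!: ideal_set_sum)
  have GI: "g \<in> polys_over D" if "g \<in> G" for g
    using that \<mu>(1) b(1) PD(4,5) by (auto simp: G_def PP_def)
  have Gcomb: "c * g + d * h \<in> G" if gh: "g \<in> G" "h \<in> G" and cd: "c \<in> polys_over D" "d \<in> polys_over D"
    for c d g h
  proof -
    from gh obtain u v w u' v' w' where *:
      "g = u * b + v * \<mu> + w" "u \<in> polys_over D" "v \<in> polys_over D" "w \<in> PP"
      "h = u' * b + v' * \<mu> + w'" "u' \<in> polys_over D" "v' \<in> polys_over D" "w' \<in> PP"
      unfolding G_def by blast
    have "c * g + d * h = (c * u + d * u') * b + (c * v + d * v') * \<mu> + (c * w + d * w')"
      unfolding * by (simp add: algebra_simps)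
    moreover have "c * u + d * u' \<in> polys_over D" "c * v + d * v' \<in> polys_over D"
      "c * w + d * w' \<in> PP"
      using * cd PD(4,5) PP(2,3) by auto
    ultimately show ?thesis unfolding G_def by blast
  qed
  have GI': "u * b + v * \<mu> + w \<in> G" if "u \<in> polys_over D" "v \<in> polys_over D" "w \<in> PP" for u v w
    using that by (auto simp: G_def)
  have bG: "b \<in> G" using GI'[of 1 0 0] PD(1,2) PP(1) by simp
  have \<mu>G: "\<mu> \<in> G" using GI'[of 0 1 0] PD(1,2) PP(1) by simp
  have PPG: "w \<in> PP \<Longrightarrow> w \<in> G" for w using GI'[of 0 0 w] PD(1) by simp
  \<comment> \<open>the least degree of an element of the ideal that has a coefficient outside \<open>P\<close>\<close>
  define S where "S s \<longleftrightarrow> (\<exists>g\<in>G. (\<forall>i>s. Polynomial.coeff g i = 0) \<and> (\<exists>i. Polynomial.coeff g i \<notin> P))" for s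
  define s where "s = (LEAST s. S s)"
  have "S r" using \<mu>(2) lead \<mu>G by (auto simp: S_def)
  then have "S s" unfolding s_def by (rule LeastI)
  then obtain g where g: "g \<in> G" "\<forall>i>s. Polynomial.coeff g i = 0" "\<exists>i. Polynomial.coeff g i \<notin> P"
    by (auto simp: S_def)
  note gD = GI[OF g(1)]
  have small: "h \<in> PP" if h: "h \<in> G" "\<forall>i\<ge>s. Polynomial.coeff h i = 0" for h
  proof (cases s)
    case 0
    then have "h = 0" using h(2) by (auto simp: poly_eq_iff)
    then show ?thesis using PP(1) by simp
  next
    case (Suc s')
    then have "\<not> S s'" unfolding s_def by (metis lessI not_less_Least)
    then show ?thesis using h Suc GI[OF h(1)] unfolding S_def PP_def by (auto simp: Suc_le_eq)
  qed
  let ?c = "Polynomial.coeff g s"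
  have cD: "?c \<in> D" using gD by (auto simp: polys_over_def)
  have c: "?c \<notin> P"
  proof
    assume cP: "?c \<in> P"
    then have mon: "Polynomial.monom ?c s \<in> PP"
      using cD polys_over_intros(1)[OF D] idP(1) by (auto simp: PP_def coeff_monom)
    have "1 * g + (-1) * Polynomial.monom ?c s \<in> G"
      using g(1) PPG[OF mon] PD(2,3) by (intro Gcomb) auto
    then have "g - Polynomial.monom ?c s \<in> PP"
      using g(2) by (intro small) (auto simp: coeff_monom)
    then have "g - Polynomial.monom ?c s + Polynomial.monom ?c s \<in> PP" using mon by (intro PP(2))
    then show False using g(3) by (simp add: PP_def)
  qed
  have div: "\<exists>k q w. q \<in> polys_over D \<and> w \<in> PP \<and> Polynomial.smult (?c ^ k) h = q * g + w \<and>
      (\<forall>i\<ge>n - s. Polynomial.coeff q i = 0)"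
    if h: "h \<in> G" "\<forall>i\<ge>n. Polynomial.coeff h i = 0" for h n
  proof -
    from pseudo_division[OF D gD g(2) GI[OF h(1)] h(2)] obtain k q w where *:
      "q \<in> polys_over D" "w \<in> polys_over D" "Polynomial.smult (?c ^ k) h = q * g + w"
      "\<forall>i\<ge>s. Polynomial.coeff w i = 0" "\<forall>i\<ge>n - s. Polynomial.coeff q i = 0" by blast
    have "w = [:?c ^ k:] * h + (- q) * g" using *(3) by simp
    also have "\<dots> \<in> G"
      using h(1) g(1) *(1) cD
      by (intro Gcomb PD(3) polys_over_intros[OF D] subring_set_power[OF D])
    finally have "w \<in> PP" using *(4) by (intro small)
    then show ?thesis using * by blast
  qed
  have PPz: "poly w z \<in> P" if "w \<in> PP" for w using that by (intro poly_in_P) (auto simp: PP_def)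
  have "s = 0"
  proof (rule ccontr)
    assume "s \<noteq> 0"
    have "\<forall>i\<ge>Suc r. Polynomial.coeff \<mu> i = 0" using \<mu>(2) by auto
    from div[OF \<mu>G this] obtain k q w where q: "q \<in> polys_over D" "w \<in> PP"
      "Polynomial.smult (?c ^ k) \<mu> = q * g + w" "\<forall>i\<ge>Suc r - s. Polynomial.coeff q i = 0" by blast
    have "\<forall>i\<ge>Suc (Polynomial.degree b). Polynomial.coeff b i = 0" by (auto simp: coeff_eq_0)
    from div[OF bG this] obtain l q' w' where q': "q' \<in> polys_over D" "w' \<in> PP"
      "Polynomial.smult (?c ^ l) b = q' * g + w'" by blast
    have "poly q z * poly g z = ?c ^ k * poly \<mu> z - poly w z"
      using arg_cong[OF q(3), of "\<lambda>P. poly P z"] by simp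
    then have "poly q z * poly g z \<in> P" using \<mu>(3) PPz[OF q(2)] by (auto intro: idP)
    moreover have "poly g z \<notin> P"
    proof
      assume gP: "poly g z \<in> P"
      have "?c ^ l * poly b z = poly q' z * poly g z + poly w' z"
        using arg_cong[OF q'(3), of "\<lambda>P. poly P z"] by simp
      then have "?c ^ l * poly b z \<in> P" using gP PPz[OF q'(2)] by (auto intro: idP)
      then show False using b(2) prime_ideal_set_power[OF P c] P by (auto simp: prime_ideal_set_def)
    qed
    ultimately have "poly q z \<in> P" using P by (auto simp: prime_ideal_set_def)
    moreover have "\<forall>i\<ge>r. Polynomial.coeff q i = 0" using q(4) \<open>s \<noteq> 0\<close> by auto
    ultimately have "q \<in> PP" using least q(1) by (auto simp: PP_def)
    then have "q * g + w \<in> PP" using gD q(2) PP(2,3)[of g q] by (auto simp: mult.commute intro: PP)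
    then have "Polynomial.coeff (Polynomial.smult (?c ^ k) \<mu>) r \<in> P" using q(3) by (auto simp: PP_def)
    then show False using lead prime_ideal_set_power[OF P c] P by (auto simp: prime_ideal_set_def)
  qed
  then have "g = [:?c:]"
    using g(2) by (intro poly_eqI) (auto simp: coeff_pCons split: nat.split)
  then have gz: "poly g z = ?c" by (metis poly_const_conv)
  from g(1) obtain u v w where uvw: "g = u * b + v * \<mu> + w" "u \<in> polys_over D" "w \<in> PP"
    by (auto simp: G_def)
  have "?c - poly u z * poly b z = poly v z * poly \<mu> z + poly w z"
    using gz uvw(1) by (metis add_diff_cancel_left' add.assoc poly_add poly_mult)
  then have "?c - poly u z * poly b z \<in> P" using \<mu>(3) PPz[OF uvw(3)] by (auto intro: idP)
  then show ?thesis using that uvw(2) cD c by blast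
qed

text \<open>The condition on \<open>\<phi>\<close> is nonvanishing at one element of \<open>D\<close>. If \<open>z\<close> is transcendental modulo \<open>P\<close>, it
  may be sent to any value at which \<open>b\<close> survives, and a coefficient of \<open>b\<close> does; if \<open>z\<close> is algebraic, it
  is sent to a root of the relation of least degree, and \<open>b\<close> survives because it divides an element
  of \<open>D\<close> that does.\<close>

lemma extension_step:
  assumes "b \<in> adjoin D z" "b \<notin> P"
  obtains a where "a \<in> D" "a \<notin> P"
    "\<And>\<phi> :: 'r \<Rightarrow> 'c::{alg_closed_field, field_char_0}. hom_mod P D \<phi> \<Longrightarrow> \<phi> a \<noteq> 0 \<Longrightarrow>
      \<exists>\<phi>'. hom_mod P (adjoin D z) \<phi>' \<and> (\<forall>d\<in>D. \<phi>' d = \<phi> d) \<and> \<phi>' b \<noteq> 0"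
proof -
  from assms(1) obtain B where B: "B \<in> polys_over D" "b = poly B z" by (auto simp: adjoin_def)
  show ?thesis
  proof (cases "\<forall>p\<in>polys_over D. poly p z \<in> P \<longrightarrow> (\<forall>i. Polynomial.coeff p i \<in> P)")
    case True
    from assms(2) B obtain i where i: "Polynomial.coeff B i \<notin> P" using poly_in_P by blast
    have "\<exists>\<phi>'. hom_mod P (adjoin D z) \<phi>' \<and> (\<forall>d\<in>D. \<phi>' d = \<phi> d) \<and> \<phi>' b \<noteq> 0"
      if \<phi>: "hom_mod P D \<phi>" "\<phi> (Polynomial.coeff B i) \<noteq> 0" for \<phi> :: "'r \<Rightarrow> 'c"
    proof -
      have "map_poly \<phi> B \<noteq> 0" using \<phi>(2)
        by (auto simp: poly_eq_iff coeff_map_poly hom_mod_simps[OF \<phi>(1)])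
      then have "finite {a. poly (map_poly \<phi> B) a = 0}" by (rule poly_roots_finite)
      then have "{a. poly (map_poly \<phi> B) a = 0} \<noteq> UNIV" using infinite_UNIV_char_0 by metis
      then obtain \<zeta> where \<zeta>: "poly (map_poly \<phi> B) \<zeta> \<noteq> 0" by auto
      have "\<forall>p\<in>polys_over D. poly p z \<in> P \<longrightarrow> poly (map_poly \<phi> p) \<zeta> = 0"
      proof (intro ballI impI)
        fix p assume "p \<in> polys_over D" "poly p z \<in> P"
        then have "map_poly \<phi> p = 0" using True
          by (intro poly_eqI) (auto simp: coeff_map_poly hom_mod_simps[OF \<phi>(1)] polys_over_def)
        then show "poly (map_poly \<phi> p) \<zeta> = 0" by simp
      qed
      from extend[OF \<phi>(1) this] obtain \<phi>' where "hom_mod P (adjoin D z) \<phi>'"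
        "\<forall>p\<in>polys_over D. \<phi>' (poly p z) = poly (map_poly \<phi> p) \<zeta>" "\<forall>d\<in>D. \<phi>' d = \<phi> d"
        by blast
      then show ?thesis using \<zeta> B by auto
    qed
    then show ?thesis using that[of "Polynomial.coeff B i"] i B(1) by (auto simp: polys_over_def)
  next
    case False
    then obtain p where p: "p \<in> polys_over D" "poly p z \<in> P" "\<exists>i. Polynomial.coeff p i \<notin> P"
      by blast
    obtain \<mu> r where \<mu>: "\<mu> \<in> polys_over D" "\<forall>i>r. Polynomial.coeff \<mu> i = 0" "poly \<mu> z \<in> P"
      "Polynomial.coeff \<mu> r \<notin> P" "r > 0"
      and least: "\<forall>p\<in>polys_over D.
        (\<forall>i\<ge>r. Polynomial.coeff p i = 0) \<and> poly p z \<in> P \<longrightarrow> (\<forall>i. Polynomial.coeff p i \<in> P)"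
      by (rule least_relation[OF p])
    obtain u c where u: "u \<in> polys_over D" "c \<in> D" "c \<notin> P" "c - poly u z * poly B z \<in> P"
      using multiple_in_base[OF \<mu>(1-4) least B(1)] assms(2) B(2) by blast
    let ?m = "Polynomial.coeff \<mu> r"
    have m: "?m \<in> D" using \<mu>(1) by (auto simp: polys_over_def)
    have "\<exists>\<phi>'. hom_mod P (adjoin D z) \<phi>' \<and> (\<forall>d\<in>D. \<phi>' d = \<phi> d) \<and> \<phi>' b \<noteq> 0"
      if \<phi>: "hom_mod P D \<phi>" "\<phi> (?m * c) \<noteq> 0" for \<phi> :: "'r \<Rightarrow> 'c"
    proof -
      have nz: "\<phi> ?m \<noteq> 0" "\<phi> c \<noteq> 0" using \<phi> m u(2) by (auto simp: hom_mod_simps[OF \<phi>(1)])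
      have "Polynomial.coeff (map_poly \<phi> \<mu>) r \<noteq> 0"
        using nz(1) by (simp add: coeff_map_poly hom_mod_simps[OF \<phi>(1)])
      then have "Polynomial.degree (map_poly \<phi> \<mu>) > 0" using \<mu>(5) le_degree by fastforce
      then obtain \<zeta> where \<zeta>: "poly (map_poly \<phi> \<mu>) \<zeta> = 0" using alg_closed_imp_poly_has_root by blast
      have "\<forall>p\<in>polys_over D. poly p z \<in> P \<longrightarrow> poly (map_poly \<phi> p) \<zeta> = 0"
        using relations_vanish[OF \<phi>(1) \<mu>(1-3) least nz(1) \<zeta>] by blast
      from extend[OF \<phi>(1) this] obtain \<phi>' where
        \<phi>': "hom_mod P (adjoin D z) \<phi>'" "\<forall>d\<in>D. \<phi>' d = \<phi> d" by blast
      interpret E: hom_extension P "adjoin D z" z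
        by unfold_locales (auto simp: P D subring_set_adjoin)
      let ?x = "poly u z"
      have x: "?x \<in> adjoin D z" using u(1) by (auto simp: adjoin_def)
      have cz: "c \<in> adjoin D z" using u(2) adjoin_superset[OF D] by auto
      have xb: "?x * b \<in> adjoin D z" using x assms(1) by (intro E.DD)
      have "\<phi>' (c - ?x * b) = 0"
        using u(4) E.DD(6)[OF cz xb] B(2) by (intro E.hom_mod_simps[OF \<phi>'(1)]) auto
      moreover have "\<phi>' c = \<phi>' (c - ?x * b) + \<phi>' ?x * \<phi>' b"
        using E.hom_mod_simps(3)[OF \<phi>'(1) E.DD(6)[OF cz xb] xb] E.hom_mod_simps(4)[OF \<phi>'(1) x assms(1)]
        by simp
      ultimately have "\<phi>' b \<noteq> 0" using nz(2) \<phi>'(2) u(2) by auto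
      then show ?thesis using \<phi>' by blast
    qed
    moreover have "?m * c \<in> D" "?m * c \<notin> P"
      using m u \<mu>(4) P DD(5) by (auto simp: prime_ideal_set_def)
    ultimately show ?thesis using that by blast
  qed
qed

end

fun adjoins :: "'r::comm_ring_1 set \<Rightarrow> 'r list \<Rightarrow> 'r set" where
  "adjoins D [] = D"
| "adjoins D (z # zs) = adjoins (adjoin D z) zs"

lemma subring_set_adjoins: "subring_set D \<Longrightarrow> subring_set (adjoins D zs)"
  by (induction zs arbitrary: D) (auto simp: subring_set_adjoin)

lemma adjoins_superset: "subring_set D \<Longrightarrow> D \<union> set zs \<subseteq> adjoins D zs"
proof (induction zs arbitrary: D)
  case (Cons z zs)
  from Cons.IH[OF subring_set_adjoin[OF Cons.prems, of z]] show ?case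
    using adjoin_superset[OF Cons.prems] adjoin_self[OF Cons.prems, of z] by auto
qed auto

lemma extension_steps:
  assumes P: "prime_ideal_set P" and "subring_set D" "b \<in> adjoins D zs" "b \<notin> P"
  shows "\<exists>a\<in>D. a \<notin> P \<and> (\<forall>\<phi> :: 'r::comm_ring_1 \<Rightarrow> 'c::{alg_closed_field, field_char_0}.
    hom_mod P D \<phi> \<and> \<phi> a \<noteq> 0 \<longrightarrow>
      (\<exists>\<phi>'. hom_mod P (adjoins D zs) \<phi>' \<and> (\<forall>d\<in>D. \<phi>' d = \<phi> d) \<and> \<phi>' b \<noteq> 0))"
  using assms(2-)
proof (induction zs arbitrary: D)
  case Nil
  then show ?case by auto
next
  case (Cons z zs)
  interpret hom_extension P D z using P Cons.prems by unfold_locales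
  from Cons.IH[OF subring_set_adjoin[OF D, of z]] Cons.prems obtain a where
    a: "a \<in> adjoin D z" "a \<notin> P" and a': "\<forall>\<phi> :: 'r \<Rightarrow> 'c. hom_mod P (adjoin D z) \<phi> \<and> \<phi> a \<noteq> 0 \<longrightarrow>
      (\<exists>\<phi>'. hom_mod P (adjoins (adjoin D z) zs) \<phi>' \<and> (\<forall>d\<in>adjoin D z. \<phi>' d = \<phi> d) \<and> \<phi>' b \<noteq> 0)"
    by auto
  obtain c where c: "c \<in> D" "c \<notin> P" and c': "\<And>\<phi> :: 'r \<Rightarrow> 'c. hom_mod P D \<phi> \<Longrightarrow> \<phi> c \<noteq> 0 \<Longrightarrow>
      \<exists>\<phi>'. hom_mod P (adjoin D z) \<phi>' \<and> (\<forall>d\<in>D. \<phi>' d = \<phi> d) \<and> \<phi>' a \<noteq> 0"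
    by (rule extension_step[OF a, where ?'c = 'c]) blast
  show ?case
  proof (intro bexI[of _ c] conjI allI impI; (elim conjE)?)
    fix \<phi> :: "'r \<Rightarrow> 'c" assume "hom_mod P D \<phi>" "\<phi> c \<noteq> 0"
    from c'[OF this] obtain \<phi>1 where 1: "hom_mod P (adjoin D z) \<phi>1" "\<forall>d\<in>D. \<phi>1 d = \<phi> d" "\<phi>1 a \<noteq> 0"
      by blast
    with a' obtain \<phi>2 where "hom_mod P (adjoins (adjoin D z) zs) \<phi>2"
      "\<forall>d\<in>adjoin D z. \<phi>2 d = \<phi>1 d" "\<phi>2 b \<noteq> 0" by blast
    then show "\<exists>\<phi>'. hom_mod P (adjoins D (z # zs)) \<phi>' \<and> (\<forall>d\<in>D. \<phi>' d = \<phi> d) \<and> \<phi>' b \<noteq> 0"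
      using 1(2) adjoin_superset[OF D, of z] by (intro exI[of _ \<phi>2]) auto
  qed (use c in auto)
qed

lemma hom_mod_meval:
  assumes "hom_mod P D \<phi>" "subring_set D" "\<And>c. mconst c \<in> D" "\<And>c. \<phi> (mconst c) = c"
    and "\<And>x. x \<in> mvars p \<Longrightarrow> mvar x \<in> D" "0 \<in> P"
  shows "p \<in> D" "\<phi> p = meval id (\<lambda>x. \<phi> (mvar x)) p"
proof -
  define z where "z = (\<lambda>x. \<phi> (mvar x))"
  let ?Z = "{q. q \<in> D \<and> \<phi> q = meval id z q}"
  note h = comm_ring_hom_meval[OF comm_ring_hom_id, of z]
  interpret h: comm_ring_hom "meval id z" by (rule h)
  note D = subring_setD[OF assms(2)]
  have "meval mconst mvar p \<in> ?Z"
  proof (rule meval_closed)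
    have "\<phi> 0 = 0" using assms(1,6) D(1) unfolding hom_mod_def by blast
    then show "0 \<in> ?Z" using D(1) by simp
    have "\<phi> 1 = 1" using assms(1) unfolding hom_mod_def by blast
    then show "1 \<in> ?Z" using D(2) by simp
    fix a b assume "a \<in> ?Z" "b \<in> ?Z"
    moreover from this have "\<phi> (a + b) = \<phi> a + \<phi> b" "\<phi> (a * b) = \<phi> a * \<phi> b"
      using assms(1) unfolding hom_mod_def by blast+
    ultimately show "a + b \<in> ?Z" "a * b \<in> ?Z" using D(4,5) by (auto simp: h.hom_add h.hom_mult)
  qed (use assms(3-5) in \<open>auto simp: z_def\<close>)
  then show "p \<in> D" "\<phi> p = meval id (\<lambda>x. \<phi> (mvar x)) p" by (auto simp: z_def)
qed

text \<open>Hilbert's Nullstellensatz. If no power of \<open>g\<close> lies in the ideal, there is a prime ideal above it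
  that avoids \<open>g\<close>, and the inclusion of the constants extends variable by variable to a
  homomorphism into the base field that kills the prime ideal but not \<open>g\<close>: this is a common zero.\<close>

theorem nullstellensatz:
  fixes F :: "'i \<Rightarrow> ('x, 'c::{alg_closed_field, field_char_0}) mpoly"
  assumes fin: "finite K" and zeros: "\<And>z. (\<forall>i\<in>K. meval id z (F i) = 0) \<Longrightarrow> meval id z g = 0"
  shows "\<exists>N c. g ^ N = (\<Sum>i\<in>K. c i * F i)"
proof -
  define I where "I = {\<Sum>i\<in>K. c i * F i | c. True}"
  have "ideal_set I"
    unfolding ideal_set_def
  proof (intro conjI ballI allI)
    show "0 \<in> I" unfolding I_def by (intro CollectI exI[of _ "\<lambda>_. 0"]) auto
    fix a assume "a \<in> I"
    then obtain c where c: "a = (\<Sum>i\<in>K. c i * F i)" by (auto simp: I_def)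
    show "d * a \<in> I" for d
      unfolding I_def c
      by (intro CollectI exI[of _ "\<lambda>i. d * c i"]) (auto simp: sum_distrib_left mult.assoc)
    fix b assume "b \<in> I"
    then obtain d where d: "b = (\<Sum>i\<in>K. d i * F i)" by (auto simp: I_def)
    show "a + b \<in> I"
      unfolding I_def c d
      by (intro CollectI exI[of _ "\<lambda>i. c i + d i"]) (auto simp: sum.distrib distrib_right)
  qed
  have FI: "F i \<in> I" if "i \<in> K" for i
    unfolding I_def using fin that
    by (intro CollectI exI[of _ "\<lambda>k. if k = i then 1 else 0"]) (simp add: mult_delta_left)
  show ?thesis
  proof (cases "\<exists>N. g ^ N \<in> I")
    case True
    then show ?thesis by (auto simp: I_def)
  next
    case False
    then obtain P where P: "prime_ideal_set P" "I \<subseteq> P" "g \<notin> P"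
      using prime_ideal_avoiding_powers[OF \<open>ideal_set I\<close>] by blast
    have P0: "0 \<in> P" using P(1) by (auto simp: prime_ideal_set_def ideal_set_def)
    define D where "D = range (mconst :: 'c \<Rightarrow> ('x, 'c) mpoly)"
    have D: "subring_set D"
      unfolding D_def by (rule subring_set_image[OF comm_ring_hom_mconst subring_set_UNIV])
    obtain xs where xs: "set xs = (\<Union>f\<in>insert g (F ` K). mvars f)"
      using finite_list[of "\<Union>f\<in>insert g (F ` K). mvars f"] fin by auto
    define E where "E = adjoins D (map mvar xs)"
    have E: "subring_set E" "D \<subseteq> E" "\<And>x. x \<in> set xs \<Longrightarrow> mvar x \<in> E"
      using subring_set_adjoins[OF D] adjoins_superset[OF D, of "map mvar xs"] by (auto simp: E_def)
    have mem: "f \<in> E" if "f \<in> insert g (F ` K)" for f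
    proof -
      have "meval mconst mvar f \<in> E"
        using that E by (intro meval_in_subring) (auto simp: D_def xs)
      then show ?thesis by simp
    qed
    \<comment> \<open>taking the constant term, the inverse of the inclusion of the constants\<close>
    define \<phi>0 where "\<phi>0 p = Poly_Mapping.lookup p 0" for p :: "('x, 'c) mpoly"
    have \<phi>0: "\<phi>0 (mconst c) = c" for c by (simp add: \<phi>0_def mconst_def)
    interpret m: comm_ring_hom "mconst :: 'c \<Rightarrow> ('x, 'c) mpoly" by (rule comm_ring_hom_mconst)
    have constP: "c = 0" if "(mconst c :: ('x, 'c) mpoly) \<in> P" for c
    proof (rule ccontr)
      assume "c \<noteq> 0"
      have "mconst (inverse c) * mconst c \<in> P"
        using that P(1) by (auto simp: prime_ideal_set_def ideal_set_def)
      then show False using P(1) \<open>c \<noteq> 0\<close> by (simp add: prime_ideal_set_def flip: m.hom_mult)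
    qed
    have hom0: "hom_mod P D \<phi>0"
      using \<phi>0[of 1] constP
      by (auto simp: hom_mod_def D_def \<phi>0 simp flip: m.hom_add m.hom_mult)
    from extension_steps[OF P(1) D mem[of g, unfolded E_def] P(3), where 'c = 'c] obtain a where
      a: "a \<in> D" "a \<notin> P" "\<forall>\<phi> :: ('x, 'c) mpoly \<Rightarrow> 'c. hom_mod P D \<phi> \<and> \<phi> a \<noteq> 0 \<longrightarrow>
        (\<exists>\<phi>'. hom_mod P E \<phi>' \<and> (\<forall>d\<in>D. \<phi>' d = \<phi> d) \<and> \<phi>' g \<noteq> 0)"
      unfolding E_def by auto
    from a(1) obtain c where "a = mconst c" unfolding D_def by blast
    moreover from this have "c \<noteq> 0" using a(2) P0 by auto
    ultimately have "a = mconst c" "c \<noteq> 0" by auto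
    then have "\<phi>0 a \<noteq> 0" by (simp add: \<phi>0)
    with a(3) hom0 obtain \<phi> where \<phi>: "hom_mod P E \<phi>" "\<forall>d\<in>D. \<phi> d = \<phi>0 d" "\<phi> g \<noteq> 0" by blast
    have val: "\<phi> f = meval id (\<lambda>x. \<phi> (mvar x)) f" if "f \<in> insert g (F ` K)" for f
      using that E \<phi>(2) \<phi>0 P0 xs
      by (intro hom_mod_meval(2)[OF \<phi>(1) E(1)]) (auto simp: D_def)
    have "meval id (\<lambda>x. \<phi> (mvar x)) (F i) = 0" if "i \<in> K" for i
    proof -
      have "\<phi> (F i) = 0" using \<phi>(1) mem[of "F i"] FI[OF that] P(2) that by (auto simp: hom_mod_def)
      then show ?thesis using val[of "F i"] that by simp
    qed
    then have "\<phi> g = 0" using zeros val by simp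
    then show ?thesis using \<phi>(3) by simp
  qed
qed

section \<open>The fixed field of the absolute Galois group\<close>

lemma prime_ideal_zero: "prime_ideal_set {0 :: 'r::idom}"
  by (auto simp: prime_ideal_set_def ideal_set_def)

lemma subring_set_range_to_ac: "subring_set (range (to_ac :: 'a::field \<Rightarrow> 'a alg_closure))"
  by (intro subring_set_image comm_ring_homI) auto

lemma comm_ring_hom_to_ac: "comm_ring_hom to_ac"
  by (rule comm_ring_homI) auto

lemma algebraic_relation:
  fixes z :: "'a::field alg_closure"
  obtains p where "p \<in> polys_over (range to_ac)" "poly p z \<in> {0}" "\<exists>i. Polynomial.coeff p i \<notin> {0}"
proof -
  obtain p :: "'a poly" where p: "p \<noteq> 0" "poly (map_poly to_ac p) z = 0"
    using alg_closure_algebraic by blast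
  then obtain i where "Polynomial.coeff p i \<noteq> 0" by (auto simp: poly_eq_iff)
  with p that[of "map_poly to_ac p"] show ?thesis by (auto simp: polys_over_def coeff_map_poly)
qed

text \<open>A homomorphism over the base field is injective on any subring of the algebraic closure, because
  an element of the kernel would be a root of its minimal equation, whose constant term is not zero.\<close>

lemma hom_mod_nonzero:
  fixes \<phi> :: "'a::field alg_closure \<Rightarrow> 'a alg_closure"
  assumes sub: "subring_set D" "range to_ac \<subseteq> D" and hom: "hom_mod {0} D \<phi>" "\<And>c. \<phi> (to_ac c) = to_ac c"
    and d: "d \<in> D" "d \<noteq> 0"
  shows "\<phi> d \<noteq> 0"
proof
  assume 0: "\<phi> d = 0"
  interpret hom_extension "{0}" D d
    using sub prime_ideal_zero by unfold_locales
  define N where "N n \<longleftrightarrow> (\<exists>p :: 'a poly. p \<noteq> 0 \<and> poly (map_poly to_ac p) d = 0 \<and> Polynomial.degree p = n)" for n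
  have "\<exists>n. N n" using alg_closure_algebraic[of d] unfolding N_def by blast
  then have "N (LEAST n. N n)" by (rule LeastI_ex)
  then obtain p :: "'a poly" where p: "p \<noteq> 0" "poly (map_poly to_ac p) d = 0"
    "Polynomial.degree p = (LEAST n. N n)" by (auto simp: N_def)
  have "Polynomial.coeff p 0 \<noteq> 0"
  proof
    assume c0: "Polynomial.coeff p 0 = 0"
    obtain q where q: "p = pCons 0 q" using c0 by (cases p) auto
    then have "N (Polynomial.degree q)" "Polynomial.degree q < Polynomial.degree p"
      using p d(2) by (auto simp: N_def map_poly_pCons)
    then show False using p(3) not_less_Least by metis
  qed
  moreover have "\<phi> (poly (map_poly to_ac p) d) = poly (map_poly to_ac p) (\<phi> d)"
  proof -
    have mem: "Polynomial.coeff (map_poly to_ac p) i \<in> D" for i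
      using sub(2) by (auto simp: coeff_map_poly)
    have "\<phi> (Polynomial.coeff (map_poly to_ac p) i * d ^ i) = Polynomial.coeff (map_poly to_ac p) i * \<phi> d ^ i" for i
      using mem[of i] d(1) subring_set_power[OF sub(1) d(1), of i]
      by (simp add: hom_mod_simps[OF hom(1)] hom(2) coeff_map_poly)
    then show ?thesis
      unfolding poly_altdef using mem d(1) subring_set_power[OF sub(1) d(1)]
      by (subst hom_mod_simps(7)[OF hom(1)]) (auto intro: DD(5))
  qed
  ultimately show False using p(2) 0 by (simp add: hom_mod_simps[OF hom(1)] poly_0_coeff_0 coeff_map_poly)
qed

text \<open>A maximal extension exists by Zorn, applied to graphs since the domains vary. It is defined
  everywhere, because one more algebraic element can always be sent to a root of its transported
  relation of least degree.\<close>

lemma hom_extends_to_closure: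
  fixes \<phi> :: "'a::field alg_closure \<Rightarrow> 'a alg_closure"
  assumes D: "subring_set D" "range to_ac \<subseteq> D" and hom: "hom_mod {0} D \<phi>" "\<And>c. \<phi> (to_ac c) = to_ac c"
  shows "\<exists>\<sigma>. comm_ring_hom \<sigma> \<and> (\<forall>d\<in>D. \<sigma> d = \<phi> d)"
proof -
  define graph where "graph r \<longleftrightarrow> (\<forall>c. (to_ac c, to_ac c) \<in> r) \<and> (\<forall>b. (0, b) \<in> r \<longrightarrow> b = 0) \<and>
    (\<forall>a a' b b'. (a, a') \<in> r \<and> (b, b') \<in> r \<longrightarrow> (a + b, a' + b') \<in> r \<and> (a * b, a' * b') \<in> r)"
    for r :: "('a alg_closure \<times> 'a alg_closure) set"
  have graphI: "graph ((\<lambda>d. (d, \<psi> d)) ` E)"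
    if "subring_set E" "range to_ac \<subseteq> E" "hom_mod {0} E \<psi>" "\<And>c. \<psi> (to_ac c) = to_ac c" for E \<psi>
    using that subring_setD[OF that(1)]
    unfolding graph_def hom_mod_def by (auto simp: image_iff)
  let ?r0 = "(\<lambda>d. (d, \<phi> d)) ` D"
  define \<A> where "\<A> = {r. graph r \<and> ?r0 \<subseteq> r}"
  have "\<exists>r\<in>\<A>. \<forall>s\<in>\<A>. r \<subseteq> s \<longrightarrow> s = r"
  proof (rule subset_Zorn_nonempty)
    show "\<A> \<noteq> {}" using graphI[OF D hom] by (auto simp: \<A>_def)
  next
    fix \<C> assume "\<C> \<noteq> {}" and ch: "subset.chain \<A> \<C>"
    have sub: "\<C> \<subseteq> \<A>" and lin: "\<And>x y. x \<in> \<C> \<Longrightarrow> y \<in> \<C> \<Longrightarrow> x \<subseteq> y \<or> y \<subseteq> x"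
      using ch by (auto simp: subset_chain_def)
    have gC: "graph w" "?r0 \<subseteq> w" if "w \<in> \<C>" for w using that sub by (auto simp: \<A>_def)
    have "(a + b, a' + b') \<in> \<Union>\<C> \<and> (a * b, a' * b') \<in> \<Union>\<C>"
      if ab: "(a, a') \<in> \<Union>\<C>" "(b, b') \<in> \<Union>\<C>" for a a' b b'
    proof -
      from ab obtain x y where xy: "x \<in> \<C>" "(a, a') \<in> x" "y \<in> \<C>" "(b, b') \<in> y" by blast
      then obtain w where w: "w \<in> \<C>" "(a, a') \<in> w" "(b, b') \<in> w" using lin[of x y] by blast
      then have "(a + b, a' + b') \<in> w \<and> (a * b, a' * b') \<in> w"
        using gC(1)[OF w(1)] unfolding graph_def by blast
      then show ?thesis using w(1) by blast
    qed
    then have 3: "\<forall>a a' b b'. (a, a') \<in> \<Union>\<C> \<and> (b, b') \<in> \<Union>\<C> \<longrightarrow>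
        (a + b, a' + b') \<in> \<Union>\<C> \<and> (a * b, a' * b') \<in> \<Union>\<C>"
      by simp
    obtain w where w: "w \<in> \<C>" using \<open>\<C> \<noteq> {}\<close> by blast
    have 1: "\<forall>c. (to_ac c, to_ac c) \<in> \<Union>\<C>"
      using gC(1)[OF w] w unfolding graph_def by (intro allI UnionI) auto
    have 2: "\<forall>b. (0, b) \<in> \<Union>\<C> \<longrightarrow> b = 0"
    proof (intro allI impI)
      fix b assume "(0, b) \<in> \<Union>\<C>"
      then obtain x where "x \<in> \<C>" "(0, b) \<in> x" by (elim UnionE)
      then show "b = 0" using gC(1)[of x] unfolding graph_def by simp
    qed
    have "?r0 \<subseteq> \<Union>\<C>" using gC(2)[OF w] w by (intro subset_trans[OF _ Union_upper])
    with 1 2 3 show "\<Union>\<C> \<in> \<A>" unfolding \<A>_def graph_def mem_Collect_eq by (intro conjI)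
  qed
  then obtain r where rA: "r \<in> \<A>" and maxA: "\<forall>s\<in>\<A>. r \<subseteq> s \<longrightarrow> s = r" by blast
  have r: "graph r" "?r0 \<subseteq> r" using rA unfolding \<A>_def by auto
  have max: "s = r" if "graph s" "r \<subseteq> s" for s
    using maxA that subset_trans[OF r(2) that(2)] unfolding \<A>_def by simp
  define E where "E = Domain r"
  have neg: "(- a, - a') \<in> r" if "(a, a') \<in> r" for a a'
  proof -
    have "(to_ac (- 1), to_ac (- 1)) \<in> r" using r(1) unfolding graph_def by blast
    then have "(to_ac (- 1) * a, to_ac (- 1) * a') \<in> r" using r(1) that unfolding graph_def by blast
    then show ?thesis by simp
  qed
  have sv: "b = c" if "(a, b) \<in> r" "(a, c) \<in> r" for a b c
  proof -
    have "(a + - a, b + - c) \<in> r" using r(1) that(1) neg[OF that(2)] unfolding graph_def by blast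
    then have "(0, b - c) \<in> r" by simp
    then show ?thesis using r(1) unfolding graph_def by (metis eq_iff_diff_eq_0)
  qed
  define \<psi> where "\<psi> a = (THE b. (a, b) \<in> r)" for a
  have \<psi>: "\<psi> a = b" if "(a, b) \<in> r" for a b
    unfolding \<psi>_def using that sv by blast
  have \<psi>r: "(a, \<psi> a) \<in> r" if "a \<in> E" for a using that \<psi> unfolding E_def by blast
  have rE: "r = (\<lambda>d. (d, \<psi> d)) ` E" using \<psi> \<psi>r by (force simp: E_def)
  have kE: "range to_ac \<subseteq> E" using r(1) unfolding graph_def E_def by blast
  have \<psi>k: "\<psi> (to_ac c) = to_ac c" for c using r(1) unfolding graph_def by (intro \<psi>) blast
  have closed: "a + b \<in> E" "a * b \<in> E" "\<psi> (a + b) = \<psi> a + \<psi> b" "\<psi> (a * b) = \<psi> a * \<psi> b"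
    if "a \<in> E" "b \<in> E" for a b
  proof -
    have *: "(a + b, \<psi> a + \<psi> b) \<in> r" "(a * b, \<psi> a * \<psi> b) \<in> r"
      using \<psi>r[OF that(1)] \<psi>r[OF that(2)] r(1) unfolding graph_def by blast+
    then show "a + b \<in> E" "a * b \<in> E" by (auto simp: E_def)
    show "\<psi> (a + b) = \<psi> a + \<psi> b" "\<psi> (a * b) = \<psi> a * \<psi> b" using * by (auto intro: \<psi>)
  qed
  have E: "subring_set E"
    unfolding subring_set_def
  proof (intro conjI ballI)
    show "0 \<in> E" "1 \<in> E" using kE to_ac_0 to_ac_1 by (metis rangeI subsetD)+
    show "- a \<in> E" if "a \<in> E" for a using neg[OF \<psi>r[OF that]] by (auto simp: E_def)
  qed (use closed in auto)
  have hom\<psi>: "hom_mod {0} E \<psi>"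
    using closed \<psi>k[of 0] \<psi>k[of 1] by (auto simp: hom_mod_def)
  have "z \<in> E" for z
  proof -
    interpret hom_extension "{0}" E z using E prime_ideal_zero by unfold_locales
    obtain p where "p \<in> polys_over (range to_ac)" "poly p z \<in> {0}" "\<exists>i. Polynomial.coeff p i \<notin> {0}"
      by (rule algebraic_relation)
    then have "p \<in> polys_over E" "poly p z \<in> {0}" "\<exists>i. Polynomial.coeff p i \<notin> {0}"
      using kE by (auto simp: polys_over_def)
    then obtain \<mu> r' where \<mu>: "\<mu> \<in> polys_over E" "\<forall>i>r'. Polynomial.coeff \<mu> i = 0" "poly \<mu> z \<in> {0}"
      and lead: "Polynomial.coeff \<mu> r' \<notin> {0}" "r' > 0"
      and least: "\<forall>p\<in>polys_over E. (\<forall>i\<ge>r'. Polynomial.coeff p i = 0) \<and> poly p z \<in> {0} \<longrightarrow>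
        (\<forall>i. Polynomial.coeff p i \<in> {0})"
      by (rule least_relation)
    have nz: "\<psi> (Polynomial.coeff \<mu> r') \<noteq> 0"
      using lead(1) \<mu>(1) by (intro hom_mod_nonzero[OF E kE hom\<psi> \<psi>k]) (auto simp: polys_over_def)
    then have "Polynomial.coeff (map_poly \<psi> \<mu>) r' \<noteq> 0"
      using \<psi>k[of 0] by (simp add: coeff_map_poly)
    then have "Polynomial.degree (map_poly \<psi> \<mu>) > 0" using lead(2) le_degree by fastforce
    then obtain \<zeta> where \<zeta>: "poly (map_poly \<psi> \<mu>) \<zeta> = 0" using alg_closed_imp_poly_has_root by blast
    have "\<forall>p\<in>polys_over E. poly p z \<in> {0} \<longrightarrow> poly (map_poly \<psi> p) \<zeta> = 0"
      using relations_vanish[OF hom\<psi> \<mu> least nz \<zeta>] by blast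
    from extend[OF hom\<psi> this] obtain \<psi>' where
      \<psi>': "hom_mod {0} (adjoin E z) \<psi>'" "\<forall>d\<in>E. \<psi>' d = \<psi> d" by blast
    have E': "E \<subseteq> adjoin E z" by (rule adjoin_superset[OF E])
    have "graph ((\<lambda>d. (d, \<psi>' d)) ` adjoin E z)"
    proof (rule graphI[OF subring_set_adjoin[OF E] _ \<psi>'(1)])
      show "range to_ac \<subseteq> adjoin E z" using E' kE by blast
      show "\<psi>' (to_ac c) = to_ac c" for c using \<psi>'(2) subsetD[OF kE rangeI[of to_ac c]] \<psi>k[of c] by simp
    qed
    moreover have "r \<subseteq> (\<lambda>d. (d, \<psi>' d)) ` adjoin E z"
      unfolding rE using E' \<psi>'(2) by (auto simp: image_iff)
    ultimately have "(\<lambda>d. (d, \<psi>' d)) ` adjoin E z = r" by (rule max)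
    then show ?thesis using adjoin_self[OF E, of z] unfolding E_def by blast
  qed
  then have "comm_ring_hom \<psi>"
    using closed \<psi>k[of 1] by (intro comm_ring_homI) auto
  moreover have "\<psi> d = \<phi> d" if "d \<in> D" for d using r(2) that by (intro \<psi>) auto
  ultimately show ?thesis by blast
qed

text \<open>Such a homomorphism permutes the finitely many roots of each polynomial over the base field.\<close>

lemma hom_over_base_bij:
  fixes \<sigma> :: "'a::field alg_closure \<Rightarrow> 'a alg_closure"
  assumes "comm_ring_hom \<sigma>" "\<And>c. \<sigma> (to_ac c) = to_ac c"
  shows "\<sigma> \<in> absolute_galois_group"
proof -
  interpret comm_ring_hom \<sigma> by fact
  have inj: "inj \<sigma>"
  proof (rule injI)
    fix x y assume "\<sigma> x = \<sigma> y"
    then have "\<sigma> (x - y) = 0" by (simp add: hom_minus)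
    then show "x = y" by (simp add: hom_eq_0_iff[OF assms(1)])
  qed
  have "y \<in> range \<sigma>" for y
  proof -
    obtain p :: "'a poly" where p: "p \<noteq> 0" "poly (map_poly to_ac p) y = 0"
      using alg_closure_algebraic by blast
    let ?S = "{x. poly (map_poly to_ac p) x = 0}"
    have "\<sigma> (poly (map_poly to_ac p) x) = poly (map_poly to_ac p) (\<sigma> x)" for x
      by (simp add: poly_altdef hom_sum hom_mult hom_power coeff_map_poly assms(2))
    then have "\<sigma> ` ?S \<subseteq> ?S" by (auto, metis hom_zero)
    moreover have "map_poly to_ac p \<noteq> 0" using p(1) by (auto simp: poly_eq_iff coeff_map_poly)
    then have "finite ?S" by (rule poly_roots_finite)
    ultimately have "\<sigma> ` ?S = ?S" using inj by (intro endo_inj_surj) (auto intro: inj_on_subset)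
    then show ?thesis using p(2) by blast
  qed
  then have "bij \<sigma>" using inj unfolding bij_def by blast
  then show ?thesis
    using assms(2) by (auto simp: absolute_galois_group_def hom_add hom_mult)
qed

text \<open>An element outside the base field has a conjugate different from itself, because its minimal
  polynomial is separable; the homomorphism moving it extends to the algebraic closure.\<close>

theorem galois_fixed_field:
  fixes c :: "'a::field_char_0 alg_closure"
  assumes fixed: "\<And>\<sigma>. \<sigma> \<in> absolute_galois_group \<Longrightarrow> \<sigma> c = c"
  shows "c \<in> range to_ac"
proof (rule ccontr)
  assume c: "c \<notin> range to_ac"
  define k where "k = range (to_ac :: 'a \<Rightarrow> 'a alg_closure)"
  have k: "subring_set k" unfolding k_def by (rule subring_set_range_to_ac)
  interpret hom_extension "{0}" k c using k prime_ideal_zero by unfold_locales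
  obtain p where "p \<in> polys_over k" "poly p c \<in> {0}" "\<exists>i. Polynomial.coeff p i \<notin> {0}"
    unfolding k_def by (rule algebraic_relation)
  then obtain \<mu> r where \<mu>: "\<mu> \<in> polys_over k" "\<forall>i>r. Polynomial.coeff \<mu> i = 0" "poly \<mu> c \<in> {0}"
    and lead: "Polynomial.coeff \<mu> r \<notin> {0}" "r > 0"
    and least: "\<forall>p\<in>polys_over k. (\<forall>i\<ge>r. Polynomial.coeff p i = 0) \<and> poly p c \<in> {0} \<longrightarrow>
      (\<forall>i. Polynomial.coeff p i \<in> {0})"
    by (rule least_relation)
  have deg: "Polynomial.degree \<mu> = r"
    using \<mu>(2) lead(1) by (metis degree_le le_antisym le_degree singletonI)
  have ofnat: "of_nat n \<in> k" for n
    unfolding k_def by (metis rangeI to_ac_of_nat)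
  have "pderiv \<mu> \<in> polys_over k"
    using \<mu>(1) ofnat DD(2,4,5) by (auto simp: polys_over_def coeff_pderiv)
  moreover have "\<forall>i\<ge>r. Polynomial.coeff (pderiv \<mu>) i = 0" using \<mu>(2) by (auto simp: coeff_pderiv)
  moreover have "Polynomial.coeff (pderiv \<mu>) (r - 1) \<noteq> 0"
    using lead by (simp add: coeff_pderiv flip: of_nat_Suc)
  ultimately have sep: "poly (pderiv \<mu>) c \<noteq> 0" using least by blast
  obtain q where q: "\<mu> = [:- c, 1:] * q" using \<mu>(3) by (auto simp: poly_eq_0_iff_dvd dvd_def)
  have "q \<noteq> 0" using q lead(1) by auto
  have degq: "r = Suc (Polynomial.degree q)"
    using deg \<open>q \<noteq> 0\<close> unfolding q by (subst (asm) degree_mult_eq) auto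
  have "poly (pderiv ([:- c, 1:] * q)) c = poly q c"
    by (subst pderiv_mult) (simp add: pderiv_pCons)
  then have qc: "poly q c \<noteq> 0" using sep unfolding q by simp
  have "Polynomial.degree q > 0"
  proof (rule ccontr)
    assume "\<not> ?thesis"
    then have "r = 1" using degq by simp
    have c01: "Polynomial.coeff \<mu> 0 \<in> k" "Polynomial.coeff \<mu> 1 \<in> k" using \<mu>(1) by (auto simp: polys_over_def)
    have "poly \<mu> c = Polynomial.coeff \<mu> 0 + Polynomial.coeff \<mu> 1 * c"
      using deg \<open>r = 1\<close> by (simp add: poly_altdef)
    then have "c = - Polynomial.coeff \<mu> 0 / Polynomial.coeff \<mu> 1"
      using \<mu>(3) lead(1) \<open>r = 1\<close> by (simp add: field_simps add_eq_0_iff)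
    also have "\<dots> \<in> k" using c01 unfolding k_def by (auto simp flip: to_ac_minus to_ac_divide)
    finally show False using c by (simp add: k_def)
  qed
  then obtain \<zeta> where \<zeta>: "poly q \<zeta> = 0" using alg_closed_imp_poly_has_root by blast
  have "\<zeta> \<noteq> c" using \<zeta> qc by auto
  have hom: "hom_mod {0} k id" by (auto simp: hom_mod_def)
  have [simp]: "map_poly id p = p" for p :: "'a alg_closure poly"
    by (simp add: poly_eq_iff coeff_map_poly)
  have "\<forall>p\<in>polys_over k. poly p c \<in> {0} \<longrightarrow> poly (map_poly id p) \<zeta> = 0"
    using relations_vanish[OF hom \<mu> least, of \<zeta>] lead(1) \<zeta> q by auto
  from extend[OF hom this] obtain \<phi> where \<phi>: "hom_mod {0} (adjoin k c) \<phi>"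
    "\<forall>p\<in>polys_over k. \<phi> (poly p c) = poly (map_poly id p) \<zeta>" "\<forall>d\<in>k. \<phi> d = id d" by blast
  have "[:0, 1:] \<in> polys_over k" using DD by (auto simp: polys_over_def coeff_pCons split: nat.split)
  from \<phi>(2)[rule_format, OF this] have "\<phi> c = \<zeta>" by simp
  have \<phi>k: "\<phi> (to_ac x) = to_ac x" for x using \<phi>(3) by (simp add: k_def)
  have kc: "range to_ac \<subseteq> adjoin k c" using adjoin_superset[OF k] by (auto simp: k_def)
  from hom_extends_to_closure[OF subring_set_adjoin[OF k] kc \<phi>(1) \<phi>k] obtain \<sigma> where
    \<sigma>: "comm_ring_hom \<sigma>" "\<forall>d\<in>adjoin k c. \<sigma> d = \<phi> d" by blast
  have "\<sigma> (to_ac x) = to_ac x" for x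
    using \<sigma>(2) subsetD[OF kc rangeI[of to_ac x]] \<phi>k[of x] by simp
  then have "\<sigma> \<in> absolute_galois_group"
    by (rule hom_over_base_bij[OF \<sigma>(1)])
  moreover have "\<sigma> c = \<zeta>" using \<sigma>(2) adjoin_self[OF k] \<open>\<phi> c = \<zeta>\<close> by simp
  ultimately show False using fixed \<open>\<zeta> \<noteq> c\<close> by metis
qed

section \<open>Descent along a group of field automorphisms\<close>

instance fract :: ("{idom, ring_char_0}") field_char_0
proof
  show "inj (of_nat :: nat \<Rightarrow> 'a fract)"
    by (rule injI) (simp add: of_nat_fract eq_fract)
qed

definition alg_indep_family :: "'f::field set \<Rightarrow> 'j set \<Rightarrow> ('j \<Rightarrow> 'f) \<Rightarrow> bool" where
  "alg_indep_family L J t \<longleftrightarrow> (\<forall>p\<in>mpolys L J. meval id t p = 0 \<longrightarrow> p = 0)"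

text \<open>The quotients of values of polynomials already form a field.\<close>

lemma gen_field_ratio:
  assumes L: "subfield_set L" and x: "x \<in> gen_field (L \<union> t ` J)"
  obtains p q where "p \<in> mpolys L J" "q \<in> mpolys L J" "meval id t q \<noteq> 0"
    "x = meval id t p / meval id t q"
proof -
  interpret t: comm_ring_hom "meval id t" by (rule comm_ring_hom_meval[OF comm_ring_hom_id])
  define K where "K = {meval id t p / meval id t q | p q. p \<in> mpolys L J \<and> q \<in> mpolys L J \<and> meval id t q \<noteq> 0}"
  note M = subring_setD[OF subring_set_mpolys[OF subfield_setD(1)[OF L], of J]]
  note L0 = subfield_setD(2,3)[OF L]
  have intro: "a / b \<in> K" if "a = meval id t p" "b = meval id t q" "p \<in> mpolys L J" "q \<in> mpolys L J" "b \<noteq> 0"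
    for a b p q using that by (auto simp: K_def)
  have K0: "0 \<in> K" "1 \<in> K"
    using intro[of 0 0 1 1] intro[of 1 1 1 1] M(1,2) by auto
  have "subfield_set K"
    unfolding subfield_set_def subring_set_def
  proof (intro conjI ballI)
    fix a assume "a \<in> K"
    then obtain p q where a: "a = meval id t p / meval id t q" "p \<in> mpolys L J" "q \<in> mpolys L J" "meval id t q \<noteq> 0"
      by (auto simp: K_def)
    show "- a \<in> K" using intro[of "- meval id t p" "- p" "meval id t q" q] a M(3) by (auto simp: t.hom_uminus)
    show "inverse a \<in> K"
      using intro[of "meval id t q" q "meval id t p" p] a K0 by (cases "meval id t p = 0") auto
    fix b assume "b \<in> K"
    then obtain r s where b: "b = meval id t r / meval id t s" "r \<in> mpolys L J" "s \<in> mpolys L J" "meval id t s \<noteq> 0"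
      by (auto simp: K_def)
    have "a + b = meval id t (p * s + r * q) / meval id t (q * s)"
      using a(4) b(4) unfolding a(1) b(1) by (simp add: t.hom_add t.hom_mult field_simps)
    also have "\<dots> \<in> K"
      using a b M(4,5) by (intro intro[OF refl refl]) (auto simp: t.hom_mult)
    finally show "a + b \<in> K" .
    have "a * b = meval id t (p * r) / meval id t (q * s)"
      unfolding a(1) b(1) by (simp add: t.hom_mult)
    also have "\<dots> \<in> K"
      using a b M(5) by (intro intro[OF refl refl]) (auto simp: t.hom_mult)
    finally show "a * b \<in> K" .
  qed (use K0 in auto)
  moreover have "a \<in> K" if "a \<in> L" for a
    using intro[of a "mconst a" 1 1] that L0 M(2) by simp
  moreover have "t j \<in> K" if "j \<in> J" for j
    using intro[of "t j" "mvar j" 1 1] that L0 M(2) by simp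
  ultimately have "gen_field (L \<union> t ` J) \<subseteq> K" by (intro gen_field_minimal) auto
  with x have "x \<in> K" by blast
  then show ?thesis using that by (auto simp: K_def)
qed

text \<open>Descent is carried out for an abstract group of automorphisms of an ambient field and a stable
  subfield \<open>L\<close>; different subfields of one ambient field can then be treated side by side.\<close>

locale semilinear_action =
  fixes \<Gamma> :: "'g set" and act :: "'g \<Rightarrow> 'f::field_char_0 \<Rightarrow> 'f"
    and mul :: "'g \<Rightarrow> 'g \<Rightarrow> 'g" and one :: 'g and L :: "'f set"
  assumes hom: "\<gamma> \<in> \<Gamma> \<Longrightarrow> comm_ring_hom (act \<gamma>)"
    and stable: "\<gamma> \<in> \<Gamma> \<Longrightarrow> a \<in> L \<Longrightarrow> act \<gamma> a \<in> L"
    and L: "subfield_set L"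
    and one: "one \<in> \<Gamma>" "act one a = a"
    and mul: "\<gamma> \<in> \<Gamma> \<Longrightarrow> \<delta> \<in> \<Gamma> \<Longrightarrow> mul \<gamma> \<delta> \<in> \<Gamma>"
      "\<gamma> \<in> \<Gamma> \<Longrightarrow> \<delta> \<in> \<Gamma> \<Longrightarrow> act (mul \<gamma> \<delta>) a = act \<gamma> (act \<delta> a)"
begin

definition fixed :: "'f set" where
  "fixed = {a \<in> L. \<forall>\<gamma>\<in>\<Gamma>. act \<gamma> a = a}"

lemmas LD = subfield_setD[OF L]

lemma act_simps:
  assumes "\<gamma> \<in> \<Gamma>"
  shows "act \<gamma> 0 = 0" "act \<gamma> 1 = 1" "act \<gamma> (a + b) = act \<gamma> a + act \<gamma> b"
    "act \<gamma> (a * b) = act \<gamma> a * act \<gamma> b" "act \<gamma> (a - b) = act \<gamma> a - act \<gamma> b"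
    "act \<gamma> (- a) = - act \<gamma> a" "act \<gamma> (\<Sum>x\<in>K. g x) = (\<Sum>x\<in>K. act \<gamma> (g x))"
    "act \<gamma> (a / b) = act \<gamma> a / act \<gamma> b" "act \<gamma> (inverse a) = inverse (act \<gamma> a)"
    "act \<gamma> a = 0 \<longleftrightarrow> a = 0" "act \<gamma> (of_nat n) = of_nat n"
proof -
  interpret comm_ring_hom "act \<gamma>" by (rule hom[OF assms])
  show "act \<gamma> 0 = 0" "act \<gamma> 1 = 1" "act \<gamma> (a + b) = act \<gamma> a + act \<gamma> b"
    "act \<gamma> (a * b) = act \<gamma> a * act \<gamma> b" "act \<gamma> (a - b) = act \<gamma> a - act \<gamma> b"
    "act \<gamma> (- a) = - act \<gamma> a" "act \<gamma> (\<Sum>x\<in>K. g x) = (\<Sum>x\<in>K. act \<gamma> (g x))" "act \<gamma> (of_nat n) = of_nat n"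
    by (simp_all add: hom_add hom_mult hom_minus hom_uminus hom_sum hom_of_nat)
  show "act \<gamma> (a / b) = act \<gamma> a / act \<gamma> b" "act \<gamma> (inverse a) = inverse (act \<gamma> a)" "act \<gamma> a = 0 \<longleftrightarrow> a = 0"
    by (simp_all add: hom_divide[OF hom[OF assms]] hom_eq_0_iff[OF hom[OF assms]])
qed

lemma subfield_set_fixed: "subfield_set fixed"
  unfolding subfield_set_def subring_set_def fixed_def using LD by (auto simp: act_simps)

text \<open>A fixed rational function in invariant variables has fixed coefficients: among its denominators
  with a coefficient equal to \<open>1\<close>, one with fewest terms must be invariant, since the difference with
  its translate would be a denominator with fewer terms.\<close>

theorem fixed_field_adjoin:
  assumes t: "\<And>j \<gamma>. j \<in> J \<Longrightarrow> \<gamma> \<in> \<Gamma> \<Longrightarrow> act \<gamma> (t j) = t j"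
    and indep: "alg_indep_family L J t"
    and x: "x \<in> gen_field (L \<union> t ` J)" "\<And>\<gamma>. \<gamma> \<in> \<Gamma> \<Longrightarrow> act \<gamma> x = x"
  shows "x \<in> gen_field (fixed \<union> t ` J)"
proof -
  interpret t: comm_ring_hom "meval id t" by (rule comm_ring_hom_meval[OF comm_ring_hom_id])
  have subring: "subring_set (mpolys L J)" for J :: "'b set"
    by (rule subring_set_mpolys[OF subfield_setD(1)[OF L]])
  note M = subring_setD[OF subring[of J]]
  define S where "S = {p \<in> mpolys L J. p \<noteq> 0 \<and> (\<exists>p'\<in>mpolys L J. x * meval id t p = meval id t p')}"
  obtain p0 q0 where pq0: "p0 \<in> mpolys L J" "q0 \<in> mpolys L J" "meval id t q0 \<noteq> 0"
    "x = meval id t p0 / meval id t q0" by (rule gen_field_ratio[OF L x(1)])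
  have "q0 \<in> S" using pq0 by (auto simp: S_def)
  then obtain p where p: "p \<in> S" and min: "\<And>q. q \<in> S \<Longrightarrow> card (Poly_Mapping.keys p) \<le> card (Poly_Mapping.keys q)"
    using ex_has_least_nat[of "\<lambda>p. p \<in> S" q0 "\<lambda>p. card (Poly_Mapping.keys p)"] by blast
  then obtain p' where p': "p \<in> mpolys L J" "p \<noteq> 0" "p' \<in> mpolys L J" "x * meval id t p = meval id t p'"
    by (auto simp: S_def)
  obtain e where e: "e \<in> Poly_Mapping.keys p" using p'(2) by (metis equals0I keys_eq_empty)
  define c where "c = inverse (Poly_Mapping.lookup p e)"
  have c: "c \<in> L" "c \<noteq> 0" using p'(1) e LD(8) by (auto simp: mpolys_def c_def in_keys_iff)
  \<comment> \<open>normalised to have the coefficient \<open>1\<close> at \<open>e\<close>, as all translates then have\<close>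
  define r where "r = mconst c * p"
  define r' where "r' = mconst c * p'"
  have lookup_r: "Poly_Mapping.lookup r s = c * Poly_Mapping.lookup p s" for s
    unfolding r_def mconst_def mult_map_scale_conv_mult[symmetric] by (simp add: lookup_map)
  have keys_r: "Poly_Mapping.keys r = Poly_Mapping.keys p" using c(2) by (auto simp: in_keys_iff lookup_r)
  have r: "r \<in> mpolys L J" "r' \<in> mpolys L J"
    unfolding r_def r'_def using p' c LD(2) by (auto intro!: M(5))
  have xr: "x * meval id t r = meval id t r'"
    unfolding r_def r'_def t.hom_mult using p'(4) by (simp add: algebra_simps)
  have re: "Poly_Mapping.lookup r e = 1" using e by (simp add: lookup_r c_def in_keys_iff)
  have ev: "act \<gamma> (meval id t q) = meval id t (Poly_Mapping.map (act \<gamma>) q)"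
    if "\<gamma> \<in> \<Gamma>" "q \<in> mpolys L J" for \<gamma> q
    using that t unfolding hom_meval[OF hom[OF that(1)]]
    by (subst meval_map[OF hom[OF that(1)]]) (auto intro!: meval_cong simp: mpolys_def)
  have mapL: "Poly_Mapping.map (act \<gamma>) q \<in> mpolys L J" if "\<gamma> \<in> \<Gamma>" "q \<in> mpolys L J" for \<gamma> q
    using that mvars_map[of "act \<gamma>" q] stable by (auto simp: mpolys_def lookup_map act_simps)
  have inv: "Poly_Mapping.map (act \<gamma>) r = r" "Poly_Mapping.map (act \<gamma>) r' = r'" if g: "\<gamma> \<in> \<Gamma>" for \<gamma>
  proof -
    let ?q = "Poly_Mapping.map (act \<gamma>) r - r" and ?q' = "Poly_Mapping.map (act \<gamma>) r' - r'"
    have mem: "?q \<in> mpolys L J" "?q' \<in> mpolys L J" using mapL[OF g] r M(6) by auto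
    have "x * meval id t (Poly_Mapping.map (act \<gamma>) r) = meval id t (Poly_Mapping.map (act \<gamma>) r')"
      using arg_cong[OF xr, of "act \<gamma>"] x(2)[OF g] ev[OF g] r by (simp add: act_simps[OF g])
    then have eq: "x * meval id t ?q = meval id t ?q'"
      using xr by (simp add: t.hom_minus right_diff_distrib)
    have "?q = 0"
    proof (rule ccontr)
      assume "?q \<noteq> 0"
      then have "?q \<in> S" using mem eq by (auto simp: S_def)
      then have le: "card (Poly_Mapping.keys p) \<le> card (Poly_Mapping.keys ?q)" by (rule min)
      have "Poly_Mapping.keys ?q \<subseteq> Poly_Mapping.keys p - {e}"
        by (auto simp: in_keys_iff lookup_minus lookup_map act_simps[OF g] re)
          (auto simp: lookup_r act_simps[OF g])
      then have "card (Poly_Mapping.keys ?q) \<le> card (Poly_Mapping.keys p - {e})" by (intro card_mono) auto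
      also have "\<dots> < card (Poly_Mapping.keys p)" using e by (intro card_Diff1_less) auto
      finally show False using le by simp
    qed
    moreover from this eq have "?q' = 0" using indep mem(2) by (auto simp: alg_indep_family_def)
    ultimately show "Poly_Mapping.map (act \<gamma>) r = r" "Poly_Mapping.map (act \<gamma>) r' = r'" by auto
  qed
  have coeff: "Poly_Mapping.lookup q s \<in> fixed" if "q = r \<or> q = r'" for q s
  proof -
    have "act \<gamma> (Poly_Mapping.lookup q s) = Poly_Mapping.lookup q s" if "\<gamma> \<in> \<Gamma>" for \<gamma>
      using inv[OF that] \<open>q = r \<or> q = r'\<close> act_simps(1)[OF that] by (metis lookup_map)
    then show ?thesis using r that by (auto simp: fixed_def mpolys_def)
  qed
  have mem: "meval id t q \<in> gen_field (fixed \<union> t ` J)" if "q = r \<or> q = r'" for q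
  proof (rule meval_in_subring)
    show "subring_set (gen_field (fixed \<union> t ` J))" by (rule subfield_setD(1)[OF subfield_set_gen_field])
    show "id (Poly_Mapping.lookup q s) \<in> gen_field (fixed \<union> t ` J)" for s
      using coeff[OF that] gen_field_incl[of "fixed \<union> t ` J"] by auto
    show "t j \<in> gen_field (fixed \<union> t ` J)" if "j \<in> mvars q" for j
    proof -
      have "j \<in> J" using that \<open>q = r \<or> q = r'\<close> r by (auto simp: mpolys_def)
      then show ?thesis using gen_field_incl[of "fixed \<union> t ` J"] by blast
    qed
  qed
  have "r \<noteq> 0" using re by auto
  then have "meval id t r \<noteq> 0" using indep r by (auto simp: alg_indep_family_def)
  then have "x = meval id t r' / meval id t r" using xr by (simp add: field_simps)
  then show ?thesis
    using subfield_setD(9)[OF subfield_set_gen_field mem[of r'] mem[of r]] by simp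
qed

text \<open>The functions on the group that are finite sums of orbit maps of elements of \<open>L\<close> with
  coefficients in \<open>L\<close>. The terms are indexed by their coefficients.\<close>

definition orbit_span :: "('g \<Rightarrow> 'f) set" where
  "orbit_span = {f. \<exists>B \<alpha>. finite B \<and> B \<subseteq> L \<and> \<alpha> ` B \<subseteq> L \<and> (\<forall>\<gamma>\<in>\<Gamma>. f \<gamma> = (\<Sum>b\<in>B. act \<gamma> (\<alpha> b) * b))}"

lemma orbit_spanI:
  assumes "finite I" "\<And>i. i \<in> I \<Longrightarrow> \<alpha> i \<in> L" "\<And>i. i \<in> I \<Longrightarrow> \<beta> i \<in> L"
    and "\<And>\<gamma>. \<gamma> \<in> \<Gamma> \<Longrightarrow> f \<gamma> = (\<Sum>i\<in>I. act \<gamma> (\<alpha> i) * \<beta> i)"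
  shows "f \<in> orbit_span"
proof -
  have "f \<gamma> = (\<Sum>b\<in>\<beta> ` I. act \<gamma> (\<Sum>i\<in>{i \<in> I. \<beta> i = b}. \<alpha> i) * b)" if g: "\<gamma> \<in> \<Gamma>" for \<gamma>
  proof -
    have "f \<gamma> = (\<Sum>b\<in>\<beta> ` I. \<Sum>i\<in>{i \<in> I. \<beta> i = b}. act \<gamma> (\<alpha> i) * \<beta> i)"
      unfolding assms(4)[OF g] by (rule sum.image_gen[OF assms(1)])
    then show ?thesis by (simp add: act_simps[OF g] sum_distrib_right)
  qed
  then show ?thesis
    unfolding orbit_span_def mem_Collect_eq using assms(1-3)
    by (intro exI[of _ "\<beta> ` I"] exI[of _ "\<lambda>b. \<Sum>i\<in>{i \<in> I. \<beta> i = b}. \<alpha> i"])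
      (auto intro!: subring_set_sum[OF LD(1)])
qed

lemma orbit_spanE:
  assumes "f \<in> orbit_span"
  obtains B \<alpha> where "finite B" "B \<subseteq> L" "\<alpha> ` B \<subseteq> L" "\<forall>\<gamma>\<in>\<Gamma>. f \<gamma> = (\<Sum>b\<in>B. act \<gamma> (\<alpha> b) * b)"
  using assms unfolding orbit_span_def by blast

lemma orbit_span_cong: "f \<in> orbit_span \<Longrightarrow> (\<And>\<gamma>. \<gamma> \<in> \<Gamma> \<Longrightarrow> g \<gamma> = f \<gamma>) \<Longrightarrow> g \<in> orbit_span"
  unfolding orbit_span_def by simp

lemma orbit_span_orbit: "a \<in> L \<Longrightarrow> (\<lambda>\<gamma>. act \<gamma> a) \<in> orbit_span"
  by (rule orbit_spanI[of "{()}" "\<lambda>_. a" "\<lambda>_. 1"]) (auto simp: LD)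

lemma orbit_span_const: "a \<in> L \<Longrightarrow> (\<lambda>\<gamma>. a) \<in> orbit_span"
  by (rule orbit_spanI[of "{()}" "\<lambda>_. 1" "\<lambda>_. a"]) (auto simp: LD act_simps)

lemma orbit_span_add:
  assumes "f \<in> orbit_span" "g \<in> orbit_span"
  shows "(\<lambda>\<gamma>. f \<gamma> + g \<gamma>) \<in> orbit_span"
proof -
  from orbit_spanE[OF assms(1)] obtain B \<alpha> where *: "finite B" "B \<subseteq> L" "\<alpha> ` B \<subseteq> L"
    "\<And>\<gamma>. \<gamma> \<in> \<Gamma> \<Longrightarrow> f \<gamma> = (\<Sum>b\<in>B. act \<gamma> (\<alpha> b) * b)" by metis
  from orbit_spanE[OF assms(2)] obtain C \<beta> where **: "finite C" "C \<subseteq> L" "\<beta> ` C \<subseteq> L"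
    "\<And>\<gamma>. \<gamma> \<in> \<Gamma> \<Longrightarrow> g \<gamma> = (\<Sum>b\<in>C. act \<gamma> (\<beta> b) * b)" by metis
  show ?thesis
    by (rule orbit_spanI[of "B <+> C" "case_sum \<alpha> \<beta>" "case_sum id id"])
      (use * ** in \<open>auto simp: sum.Plus\<close>)
qed

lemma orbit_span_mult:
  assumes "f \<in> orbit_span" "g \<in> orbit_span"
  shows "(\<lambda>\<gamma>. f \<gamma> * g \<gamma>) \<in> orbit_span"
proof -
  from orbit_spanE[OF assms(1)] obtain B \<alpha> where *: "finite B" "B \<subseteq> L" "\<alpha> ` B \<subseteq> L"
    "\<And>\<gamma>. \<gamma> \<in> \<Gamma> \<Longrightarrow> f \<gamma> = (\<Sum>b\<in>B. act \<gamma> (\<alpha> b) * b)" by metis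
  from orbit_spanE[OF assms(2)] obtain C \<beta> where **: "finite C" "C \<subseteq> L" "\<beta> ` C \<subseteq> L"
    "\<And>\<gamma>. \<gamma> \<in> \<Gamma> \<Longrightarrow> g \<gamma> = (\<Sum>b\<in>C. act \<gamma> (\<beta> b) * b)" by metis
  show ?thesis
  proof (rule orbit_spanI[of "B \<times> C" "\<lambda>(b, c). \<alpha> b * \<beta> c" "\<lambda>(b, c). b * c"])
    fix \<gamma> assume g: "\<gamma> \<in> \<Gamma>"
    show "f \<gamma> * g \<gamma> = (\<Sum>i\<in>B \<times> C. act \<gamma> (case i of (b, c) \<Rightarrow> \<alpha> b * \<beta> c) * (case i of (b, c) \<Rightarrow> b * c))"
      unfolding *(4)[OF g] **(4)[OF g] sum_product
      by (simp add: sum.cartesian_product act_simps[OF g] algebra_simps split_def)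
  qed (use * ** in \<open>auto intro!: LD(6)\<close>)
qed

lemma orbit_span_uminus: "f \<in> orbit_span \<Longrightarrow> (\<lambda>\<gamma>. - f \<gamma>) \<in> orbit_span"
  using orbit_span_mult[OF orbit_span_const[of "-1"], of f] LD(3,4) by simp

lemma orbit_span_diff: "f \<in> orbit_span \<Longrightarrow> g \<in> orbit_span \<Longrightarrow> (\<lambda>\<gamma>. f \<gamma> - g \<gamma>) \<in> orbit_span"
  using orbit_span_add[OF _ orbit_span_uminus, of f g] by simp

lemma orbit_span_sum: "(\<And>i. i \<in> I \<Longrightarrow> f i \<in> orbit_span) \<Longrightarrow> (\<lambda>\<gamma>. \<Sum>i\<in>I. f i \<gamma>) \<in> orbit_span"
  by (induction I rule: infinite_finite_induct) (auto intro: orbit_span_add orbit_span_const simp: LD)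

lemma orbit_span_prod: "(\<And>i. i \<in> I \<Longrightarrow> f i \<in> orbit_span) \<Longrightarrow> (\<lambda>\<gamma>. \<Prod>i\<in>I. f i \<gamma>) \<in> orbit_span"
  by (induction I rule: infinite_finite_induct) (auto intro: orbit_span_mult orbit_span_const simp: LD)

lemma orbit_span_power: "f \<in> orbit_span \<Longrightarrow> (\<lambda>\<gamma>. f \<gamma> ^ n) \<in> orbit_span"
  by (induction n) (auto intro: orbit_span_mult orbit_span_const simp: LD)

lemma orbit_span_in_L: "f \<in> orbit_span \<Longrightarrow> \<gamma> \<in> \<Gamma> \<Longrightarrow> f \<gamma> \<in> L"
  by (erule orbit_spanE) (auto intro!: subring_set_sum[OF LD(1)] LD(6) stable simp: image_subset_iff subset_iff)

lemma orbit_span_translate: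
  assumes "f \<in> orbit_span" "\<delta> \<in> \<Gamma>"
  shows "(\<lambda>\<gamma>. f (mul \<gamma> \<delta>)) \<in> orbit_span"
proof -
  from orbit_spanE[OF assms(1)] obtain B \<alpha> where *: "finite B" "B \<subseteq> L" "\<alpha> ` B \<subseteq> L"
    "\<And>\<gamma>. \<gamma> \<in> \<Gamma> \<Longrightarrow> f \<gamma> = (\<Sum>b\<in>B. act \<gamma> (\<alpha> b) * b)" by metis
  show ?thesis
    by (rule orbit_spanI[of B "\<lambda>b. act \<delta> (\<alpha> b)" id]) (use * assms(2) in \<open>auto simp: mul stable\<close>)
qed

lemma orbit_span_meval:
  assumes "\<And>t. t \<in> Poly_Mapping.keys p \<Longrightarrow> \<phi> (Poly_Mapping.lookup p t) \<in> L"
    and "\<And>x. x \<in> mvars p \<Longrightarrow> f x \<in> orbit_span"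
  shows "(\<lambda>\<gamma>. meval \<phi> (\<lambda>x. f x \<gamma>) p) \<in> orbit_span"
  unfolding meval_def using assms
  by (intro orbit_span_sum orbit_span_mult orbit_span_prod orbit_span_power orbit_span_const)
    (auto simp: mvars_def)

text \<open>Descent of ideals, for the ideal of the common denominators of a family: it is stable under
  translations because the span of the family is. An element with fewest terms, normalised to have a
  coefficient \<open>1\<close>, does not change under translations, so it is a nonzero constant.\<close>

theorem common_denominator_trivial:
  assumes d: "d \<in> orbit_span" "\<exists>\<gamma>\<in>\<Gamma>. d \<gamma> \<noteq> 0" "\<And>i. i \<in> I \<Longrightarrow> (\<lambda>\<gamma>. d \<gamma> * a i \<gamma>) \<in> orbit_span"
    and trans: "\<And>\<delta>. \<delta> \<in> \<Gamma> \<Longrightarrow> \<exists>u. (\<forall>i\<in>I. \<forall>k\<in>I. u i k \<in> L) \<and>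
      (\<forall>\<gamma>\<in>\<Gamma>. \<forall>i\<in>I. a i \<gamma> = (\<Sum>k\<in>I. act \<gamma> (u i k) * a k (mul \<gamma> \<delta>)))"
    and i: "i \<in> I"
  shows "a i \<in> orbit_span"
proof -
  define W where "W n \<longleftrightarrow> (\<exists>d B \<alpha>. finite B \<and> card B = n \<and> B \<subseteq> L \<and> \<alpha> ` B \<subseteq> L \<and>
    (\<forall>\<gamma>\<in>\<Gamma>. d \<gamma> = (\<Sum>b\<in>B. act \<gamma> (\<alpha> b) * b)) \<and> (\<exists>\<gamma>\<in>\<Gamma>. d \<gamma> \<noteq> 0) \<and>
    (\<forall>i\<in>I. (\<lambda>\<gamma>. d \<gamma> * a i \<gamma>) \<in> orbit_span))" for n
  define n where "n = (LEAST n. W n)"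
  from orbit_spanE[OF d(1)] obtain B \<alpha> where "finite B" "B \<subseteq> L" "\<alpha> ` B \<subseteq> L"
    "\<forall>\<gamma>\<in>\<Gamma>. d \<gamma> = (\<Sum>b\<in>B. act \<gamma> (\<alpha> b) * b)" .
  with d(2,3) have "W (card B)"
    unfolding W_def by (intro exI[of _ d] exI[of _ B] exI[of _ \<alpha>]) simp
  then have "W n" unfolding n_def by (rule LeastI)
  then obtain d B \<alpha> where B: "finite B" "card B = n" "B \<subseteq> L" and \<alpha>B: "\<alpha> ` B \<subseteq> L"
    and dB': "\<forall>\<gamma>\<in>\<Gamma>. d \<gamma> = (\<Sum>b\<in>B. act \<gamma> (\<alpha> b) * b)" and dnz: "\<exists>\<gamma>\<in>\<Gamma>. d \<gamma> \<noteq> 0"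
    and da': "\<forall>i\<in>I. (\<lambda>\<gamma>. d \<gamma> * a i \<gamma>) \<in> orbit_span"
    unfolding W_def by (elim exE conjE)
  note dB = dB'[rule_format] and da = da'[rule_format]
  have "\<exists>b0\<in>B. \<alpha> b0 \<noteq> 0"
  proof (rule ccontr)
    assume "\<not> ?thesis"
    then have "d \<gamma> = 0" if "\<gamma> \<in> \<Gamma>" for \<gamma> unfolding dB[OF that] by (simp add: act_simps[OF that])
    then show False using dnz by blast
  qed
  then obtain b0 where b0: "b0 \<in> B" "\<alpha> b0 \<noteq> 0" by blast
  define \<alpha>' where "\<alpha>' b = \<alpha> b / \<alpha> b0" for b
  have \<alpha>'L: "\<alpha>' b \<in> L" if "b \<in> B" for b using \<alpha>B b0 that LD(9) by (auto simp: \<alpha>'_def image_subset_iff)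
  define e where "e \<gamma> = act \<gamma> (inverse (\<alpha> b0)) * d \<gamma>" for \<gamma>
  have eB: "e \<gamma> = (\<Sum>b\<in>B. act \<gamma> (\<alpha>' b) * b)" if "\<gamma> \<in> \<Gamma>" for \<gamma>
    unfolding e_def dB[OF that] sum_distrib_left \<alpha>'_def
    by (simp add: act_simps[OF that] divide_inverse mult_ac)
  have inv_b0: "inverse (\<alpha> b0) \<in> L" using \<alpha>B b0 LD(8) by auto
  have ea: "(\<lambda>\<gamma>. e \<gamma> * a i \<gamma>) \<in> orbit_span" if "i \<in> I" for i
    using orbit_span_mult[OF orbit_span_orbit[OF inv_b0] da[OF that]] by (simp add: e_def mult.assoc)
  have const: "e (mul \<gamma> \<delta>) = e \<gamma>" if \<gamma>: "\<gamma> \<in> \<Gamma>" and \<delta>: "\<delta> \<in> \<Gamma>" for \<gamma> \<delta>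
  proof (rule ccontr)
    assume ne: "e (mul \<gamma> \<delta>) \<noteq> e \<gamma>"
    \<comment> \<open>the coefficient of \<open>b0\<close> is \<open>1\<close> in both terms, so it cancels\<close>
    define h where "h \<gamma> = e (mul \<gamma> \<delta>) - e \<gamma>" for \<gamma>
    have hB: "h \<gamma> = (\<Sum>b\<in>B - {b0}. act \<gamma> (act \<delta> (\<alpha>' b) - \<alpha>' b) * b)" if "\<gamma> \<in> \<Gamma>" for \<gamma>
    proof -
      have "h \<gamma> = (\<Sum>b\<in>B. act \<gamma> (act \<delta> (\<alpha>' b) - \<alpha>' b) * b)"
        unfolding h_def eB[OF mul(1)[OF that \<delta>]] eB[OF that] mul(2)[OF that \<delta>]
        by (simp add: act_simps[OF that] left_diff_distrib sum_subtractf)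
      also have "\<dots> = (\<Sum>b\<in>B - {b0}. act \<gamma> (act \<delta> (\<alpha>' b) - \<alpha>' b) * b)"
        using b0 B(1)
        by (subst sum.remove[of _ b0]) (auto simp: \<alpha>'_def act_simps[OF \<delta>] act_simps[OF that])
      finally show ?thesis .
    qed
    have ha: "(\<lambda>\<gamma>. h \<gamma> * a i \<gamma>) \<in> orbit_span" if i: "i \<in> I" for i
    proof -
      from trans[OF \<delta>] obtain u where u: "\<And>i k. i \<in> I \<Longrightarrow> k \<in> I \<Longrightarrow> u i k \<in> L"
        "\<And>\<gamma> i. \<gamma> \<in> \<Gamma> \<Longrightarrow> i \<in> I \<Longrightarrow> a i \<gamma> = (\<Sum>k\<in>I. act \<gamma> (u i k) * a k (mul \<gamma> \<delta>))" by blast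
      have "(\<lambda>\<gamma>. \<Sum>k\<in>I. act \<gamma> (u i k) * (e (mul \<gamma> \<delta>) * a k (mul \<gamma> \<delta>))) \<in> orbit_span"
        using u(1)[OF i] ea orbit_span_translate[OF ea \<delta>]
        by (intro orbit_span_sum orbit_span_mult[OF orbit_span_orbit]) auto
      then have "(\<lambda>\<gamma>. e (mul \<gamma> \<delta>) * a i \<gamma>) \<in> orbit_span"
        by (rule orbit_span_cong) (simp add: u(2)[OF _ i] sum_distrib_left mult_ac)
      from orbit_span_diff[OF this ea[OF i]] show ?thesis by (simp add: h_def left_diff_distrib)
    qed
    have "W (card (B - {b0}))"
      unfolding W_def
    proof (intro exI conjI ballI)
      show "finite (B - {b0})" "B - {b0} \<subseteq> L" using B by auto
      show "card (B - {b0}) = card (B - {b0})" ..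
      show "(\<lambda>b. act \<delta> (\<alpha>' b) - \<alpha>' b) ` (B - {b0}) \<subseteq> L"
        using \<alpha>'L stable[OF \<delta>] LD(7) by auto
      show "\<gamma> \<in> \<Gamma> \<Longrightarrow> h \<gamma> = (\<Sum>b\<in>B - {b0}. act \<gamma> (act \<delta> (\<alpha>' b) - \<alpha>' b) * b)" for \<gamma> by (rule hB)
      show "\<exists>\<gamma>\<in>\<Gamma>. h \<gamma> \<noteq> 0" using ne \<gamma> by (auto simp: h_def)
      show "i \<in> I \<Longrightarrow> (\<lambda>\<gamma>. h \<gamma> * a i \<gamma>) \<in> orbit_span" for i by (rule ha)
    qed
    then have "n \<le> card (B - {b0})" unfolding n_def by (rule Least_le)
    then show False using B(1,2) b0(1) card_Diff1_less[of B b0] by simp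
  qed
  have econst: "e \<gamma> = e one" if "\<gamma> \<in> \<Gamma>" for \<gamma>
    using const[OF one(1) that] eB[OF mul(1)[OF one(1) that]] eB[OF that]
    by (simp add: mul(2)[OF one(1) that] one(2))
  have "e one \<noteq> 0"
    using dnz econst b0 unfolding e_def by (auto simp: act_simps)
  have "e one \<in> L" unfolding eB[OF one(1)] using B(3) \<alpha>'L
    by (intro subring_set_sum[OF LD(1)] LD(6)) (auto simp: one)
  then have "(\<lambda>\<gamma>. inverse (e one) * (e \<gamma> * a i \<gamma>)) \<in> orbit_span"
    by (intro orbit_span_mult[OF orbit_span_const] LD(8) ea i)
  then show ?thesis
    by (rule orbit_span_cong) (use econst \<open>e one \<noteq> 0\<close> in simp)
qed

lemma orbit_span_common:
  assumes "finite J" "\<And>j. j \<in> J \<Longrightarrow> f j \<in> orbit_span"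
  shows "\<exists>B \<alpha>. finite B \<and> B \<subseteq> L \<and> (\<forall>j\<in>J. \<forall>b\<in>B. \<alpha> j b \<in> L) \<and>
    (\<forall>j\<in>J. \<forall>\<gamma>\<in>\<Gamma>. f j \<gamma> = (\<Sum>b\<in>B. act \<gamma> (\<alpha> j b) * b))"
proof -
  have "\<forall>j\<in>J. \<exists>B \<alpha>. finite B \<and> B \<subseteq> L \<and> \<alpha> ` B \<subseteq> L \<and> (\<forall>\<gamma>\<in>\<Gamma>. f j \<gamma> = (\<Sum>b\<in>B. act \<gamma> (\<alpha> b) * b))"
    using assms(2) unfolding orbit_span_def by simp
  from bchoice[OF this] obtain B where
    "\<forall>j\<in>J. \<exists>\<alpha>. finite (B j) \<and> B j \<subseteq> L \<and> \<alpha> ` B j \<subseteq> L \<and> (\<forall>\<gamma>\<in>\<Gamma>. f j \<gamma> = (\<Sum>b\<in>B j. act \<gamma> (\<alpha> b) * b))" ..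
  from bchoice[OF this] obtain \<alpha> where
    B': "\<forall>j\<in>J. finite (B j) \<and> B j \<subseteq> L \<and> \<alpha> j ` B j \<subseteq> L \<and> (\<forall>\<gamma>\<in>\<Gamma>. f j \<gamma> = (\<Sum>b\<in>B j. act \<gamma> (\<alpha> j b) * b))" ..
  have B: "finite (B j)" "B j \<subseteq> L" "\<alpha> j ` B j \<subseteq> L" "\<gamma> \<in> \<Gamma> \<Longrightarrow> f j \<gamma> = (\<Sum>b\<in>B j. act \<gamma> (\<alpha> j b) * b)"
    if "j \<in> J" for j \<gamma>
    using bspec[OF B' that] by simp_all
  define \<alpha>' where "\<alpha>' j b = (if b \<in> B j then \<alpha> j b else 0)" for j b
  have "f j \<gamma> = (\<Sum>b\<in>(\<Union>j\<in>J. B j). act \<gamma> (\<alpha>' j b) * b)" if j: "j \<in> J" and g: "\<gamma> \<in> \<Gamma>" for j \<gamma>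
    unfolding B(4)[OF j g] using j B(1) assms(1)
    by (intro sum.mono_neutral_cong_left) (auto simp: \<alpha>'_def act_simps[OF g])
  moreover have "\<alpha>' j b \<in> L" if "j \<in> J" for j b using B(3)[OF that] LD(2) by (auto simp: \<alpha>'_def)
  moreover have "finite (\<Union>j\<in>J. B j)" "(\<Union>j\<in>J. B j) \<subseteq> L" using B assms(1) by auto
  ultimately show ?thesis by (intro exI[of _ "\<Union>j\<in>J. B j"] exI[of _ \<alpha>']) simp
qed

lemma of_nat_in_L: "of_nat k \<in> L"
  by (induction k) (auto simp: LD)

end

lemma index_mat_mult_lessThan:
  assumes "A \<in> carrier_mat n m" "B \<in> carrier_mat m p" "i < n" "j < p"
  shows "(A * B) $$ (i, j) = (\<Sum>k<m. A $$ (i, k) * B $$ (k, j))"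
  using assms by (auto simp: scalar_prod_def lessThan_atLeast0 intro!: sum.cong)

text \<open>The determinant of a linear combination of matrices is a polynomial in the coefficients, so if it
  does not vanish for some coefficients it does not vanish for some natural numbers.\<close>

lemma det_combination_of_nat:
  fixes \<alpha> :: "nat \<times> nat \<Rightarrow> 'b \<Rightarrow> 'f::field_char_0"
  assumes "finite S" "S \<subseteq> B" "finite B" "det (mat n n (\<lambda>ij. \<Sum>b\<in>B. t b * \<alpha> ij b)) \<noteq> 0"
  shows "\<exists>z :: 'b \<Rightarrow> nat. det (mat n n (\<lambda>ij. \<Sum>b\<in>B. (if b \<in> S then of_nat (z b) else t b) * \<alpha> ij b)) \<noteq> 0"
  using assms(1,2)
proof (induction S rule: finite_induct)
  case empty
  then show ?case using assms(4) by simp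
next
  case (insert b0 S)
  then obtain z where z: "det (mat n n (\<lambda>ij. \<Sum>b\<in>B. (if b \<in> S then of_nat (z b) else t b) * \<alpha> ij b)) \<noteq> 0"
    by auto
  define u where "u ij = (\<Sum>b\<in>B - {b0}. (if b \<in> S then of_nat (z b) else t b) * \<alpha> ij b)" for ij
  define P where "P = det (mat n n (\<lambda>ij. [:u ij, \<alpha> ij b0:]))"
  have P: "poly P x = det (mat n n (\<lambda>ij. u ij + x * \<alpha> ij b0))" for x
    unfolding P_def comm_ring_hom.hom_det[OF comm_ring_hom_poly, symmetric]
    by (intro arg_cong[where f = det]) (auto intro!: eq_matI)
  have split: "(\<Sum>b\<in>B. s b * \<alpha> ij b) = s b0 * \<alpha> ij b0 + (\<Sum>b\<in>B - {b0}. s b * \<alpha> ij b)" for s ij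
    using insert.prems assms(3) by (intro sum.remove) auto
  have "poly P (t b0) \<noteq> 0"
    using z insert.hyps unfolding P split u_def by (simp add: add.commute)
  then have "P \<noteq> 0" by auto
  then have "finite {x. poly P x = 0}" by (rule poly_roots_finite)
  moreover have "infinite (range (of_nat :: nat \<Rightarrow> 'f))"
    by (rule range_inj_infinite, rule injI) simp
  ultimately have "\<not> range (of_nat :: nat \<Rightarrow> 'f) \<subseteq> {x. poly P x = 0}" using finite_subset by blast
  then obtain k where k: "poly P (of_nat k) \<noteq> 0" by blast
  have *: "(\<Sum>b\<in>B - {b0}. (if b \<in> insert b0 S then of_nat ((z(b0 := k)) b) else t b) * \<alpha> ij b) = u ij" for ij
    unfolding u_def by (intro sum.cong) auto
  show ?case
    using k unfolding P
    by (intro exI[of _ "z(b0 := k)"]) (simp add: split * add.commute del: insert_iff fun_upd_apply, simp)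
qed

context semilinear_action
begin

text \<open>Hilbert 90. If the entries of a cocycle of matrices are orbit sums, write the whole matrix with
  as few terms as possible. Then the coefficients are determined by the function, so the cocycle
  relation shows that all coefficient matrices are equivariant. They span the full space because the
  cocycle is the identity at the identity, so some integral combination of them is invertible.\<close>

theorem cocycle_splits:
  assumes c: "\<And>\<gamma>. \<gamma> \<in> \<Gamma> \<Longrightarrow> c \<gamma> \<in> carrier_mat n n" and c1: "c one = 1\<^sub>m n"
    and cocycle: "\<And>\<gamma> \<delta>. \<gamma> \<in> \<Gamma> \<Longrightarrow> \<delta> \<in> \<Gamma> \<Longrightarrow> c (mul \<gamma> \<delta>) = map_mat (act \<gamma>) (c \<delta>) * c \<gamma>"
    and entries: "\<And>i j. i < n \<Longrightarrow> j < n \<Longrightarrow> (\<lambda>\<gamma>. c \<gamma> $$ (i, j)) \<in> orbit_span"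
  shows "\<exists>F\<in>carrier_mat n n. (\<forall>i<n. \<forall>j<n. F $$ (i, j) \<in> L) \<and> det F \<noteq> 0 \<and>
    (\<forall>\<gamma>\<in>\<Gamma>. map_mat (act \<gamma>) F = c \<gamma> * F)"
proof -
  define J where "J = {..<n} \<times> {..<n}"
  define W where "W k \<longleftrightarrow> (\<exists>B \<alpha>. finite B \<and> card B = k \<and> B \<subseteq> L \<and> (\<forall>j\<in>J. \<forall>b\<in>B. \<alpha> j b \<in> L) \<and>
    (\<forall>j\<in>J. \<forall>\<gamma>\<in>\<Gamma>. c \<gamma> $$ j = (\<Sum>b\<in>B. act \<gamma> (\<alpha> j b) * b)))" for k
  have "finite J" by (simp add: J_def)
  moreover have "(\<lambda>\<gamma>. c \<gamma> $$ j) \<in> orbit_span" if "j \<in> J" for j using that entries by (auto simp: J_def)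
  ultimately have "\<exists>B \<alpha>. finite B \<and> B \<subseteq> L \<and> (\<forall>j\<in>J. \<forall>b\<in>B. \<alpha> j b \<in> L) \<and>
    (\<forall>j\<in>J. \<forall>\<gamma>\<in>\<Gamma>. c \<gamma> $$ j = (\<Sum>b\<in>B. act \<gamma> (\<alpha> j b) * b))" by (rule orbit_span_common)
  then obtain B0 \<alpha>0 where "finite B0" "B0 \<subseteq> L" "\<forall>j\<in>J. \<forall>b\<in>B0. \<alpha>0 j b \<in> L"
    "\<forall>j\<in>J. \<forall>\<gamma>\<in>\<Gamma>. c \<gamma> $$ j = (\<Sum>b\<in>B0. act \<gamma> (\<alpha>0 j b) * b)" by (elim exE conjE)
  then have "W (card B0)" unfolding W_def by (intro exI[of _ B0] exI[of _ \<alpha>0]) simp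
  then have "\<exists>k. W k" ..
  then have "W (LEAST k. W k)" by (rule LeastI_ex)
  then obtain B \<alpha> where B: "finite B" "card B = (LEAST k. W k)" "B \<subseteq> L"
    and \<alpha>: "\<forall>j\<in>J. \<forall>b\<in>B. \<alpha> j b \<in> L"
    and cB: "\<forall>j\<in>J. \<forall>\<gamma>\<in>\<Gamma>. c \<gamma> $$ j = (\<Sum>b\<in>B. act \<gamma> (\<alpha> j b) * b)"
    unfolding W_def by (elim exE conjE)
  \<comment> \<open>a relation among the elements of \<open>B\<close> would allow one of them to be eliminated\<close>
  have unique: "x b0 = 0"
    if xL: "\<And>b. b \<in> B \<Longrightarrow> x b \<in> L" and x0: "\<And>\<gamma>. \<gamma> \<in> \<Gamma> \<Longrightarrow> (\<Sum>b\<in>B. act \<gamma> (x b) * b) = 0" and b0: "b0 \<in> B"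
    for x b0
  proof (rule ccontr)
    assume nz: "x b0 \<noteq> 0"
    define \<alpha>' where "\<alpha>' j b = \<alpha> j b - \<alpha> j b0 * (x b / x b0)" for j b
    have "c \<gamma> $$ j = (\<Sum>b\<in>B - {b0}. act \<gamma> (\<alpha>' j b) * b)" if j: "j \<in> J" and g: "\<gamma> \<in> \<Gamma>" for j \<gamma>
    proof -
      have "(\<Sum>b\<in>B. act \<gamma> (\<alpha> j b0 * (x b / x b0)) * b) = act \<gamma> (\<alpha> j b0 / x b0) * (\<Sum>b\<in>B. act \<gamma> (x b) * b)"
        unfolding sum_distrib_left by (simp add: act_simps[OF g] mult_ac)
      then have "(\<Sum>b\<in>B. act \<gamma> (\<alpha> j b0 * (x b / x b0)) * b) = 0" using x0[OF g] by simp
      then have "c \<gamma> $$ j = (\<Sum>b\<in>B. act \<gamma> (\<alpha>' j b) * b)"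
        using cB j g by (simp add: \<alpha>'_def act_simps[OF g] left_diff_distrib sum_subtractf)
      also have "\<dots> = (\<Sum>b\<in>B - {b0}. act \<gamma> (\<alpha>' j b) * b)"
        using b0 B(1) nz by (subst sum.remove[of _ b0]) (auto simp: \<alpha>'_def act_simps[OF g])
      finally show ?thesis .
    qed
    moreover have "\<alpha>' j b \<in> L" if "j \<in> J" "b \<in> B" for j b
      using \<alpha> that b0 xL LD by (auto simp: \<alpha>'_def)
    ultimately have "W (card (B - {b0}))"
      unfolding W_def using B(1,3) by (intro exI[of _ "B - {b0}"] exI[of _ \<alpha>']) auto
    then have "card B \<le> card (B - {b0})" unfolding B(2) by (rule Least_le)
    then show False using B(1) b0 card_Diff1_less[of B b0] by simp
  qed
  \<comment> \<open>comparison of the coefficients in the two expressions for the cocycle at \<open>\<gamma>\<delta>\<close>\<close>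
  have equiv: "act \<delta> (\<alpha> (i, j) b) = (\<Sum>k<n. c \<delta> $$ (i, k) * \<alpha> (k, j) b)"
    if \<delta>: "\<delta> \<in> \<Gamma>" and ij: "i < n" "j < n" and b: "b \<in> B" for \<delta> i j b
  proof -
    define x where "x b = act \<delta> (\<alpha> (i, j) b) - (\<Sum>k<n. c \<delta> $$ (i, k) * \<alpha> (k, j) b)" for b
    have "x b \<in> L" if "b \<in> B" for b
      unfolding x_def using \<alpha> that ij stable[OF \<delta>] orbit_span_in_L[OF entries \<delta>]
      by (intro LD(7) subring_set_sum[OF LD(1)] LD(6)) (auto simp: J_def)
    moreover have "(\<Sum>b\<in>B. act \<gamma> (x b) * b) = 0" if g: "\<gamma> \<in> \<Gamma>" for \<gamma>
    proof -
      have "(\<Sum>b\<in>B. act \<gamma> (act \<delta> (\<alpha> (i, j) b)) * b) = c (mul \<gamma> \<delta>) $$ (i, j)"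
        using cB mul[OF g \<delta>] ij by (simp add: J_def)
      also have "\<dots> = (\<Sum>k<n. act \<gamma> (c \<delta> $$ (i, k)) * c \<gamma> $$ (k, j))"
        unfolding cocycle[OF g \<delta>] using c[OF g] c[OF \<delta>] ij
        by (subst index_mat_mult_lessThan[of _ n n _ n]) (auto intro!: sum.cong)
      also have "\<dots> = (\<Sum>k<n. act \<gamma> (c \<delta> $$ (i, k)) * (\<Sum>b\<in>B. act \<gamma> (\<alpha> (k, j) b) * b))"
        using cB g ij by (intro sum.cong) (auto simp: J_def)
      also have "\<dots> = (\<Sum>b\<in>B. act \<gamma> (\<Sum>k<n. c \<delta> $$ (i, k) * \<alpha> (k, j) b) * b)"
        unfolding sum_distrib_left act_simps[OF g] sum_distrib_right
        by (subst sum.swap) (simp add: mult_ac)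
      finally show ?thesis
        unfolding x_def by (simp add: act_simps(5)[OF g] left_diff_distrib sum_subtractf)
    qed
    ultimately have "x b = 0" using b by (rule unique)
    then show ?thesis by (simp add: x_def)
  qed
  have "mat n n (\<lambda>ij. \<Sum>b\<in>B. b * \<alpha> ij b) = 1\<^sub>m n"
  proof (rule eq_matI)
    fix i j assume "i < dim_row (1\<^sub>m n :: 'f mat)" "j < dim_col (1\<^sub>m n :: 'f mat)"
    then have ij: "i < n" "j < n" by auto
    then have "c one $$ (i, j) = (\<Sum>b\<in>B. b * \<alpha> (i, j) b)"
      using cB one by (auto simp: J_def mult.commute)
    then show "mat n n (\<lambda>ij. \<Sum>b\<in>B. b * \<alpha> ij b) $$ (i, j) = 1\<^sub>m n $$ (i, j)" using ij c1 by simp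
  qed auto
  then have "det (mat n n (\<lambda>ij. \<Sum>b\<in>B. b * \<alpha> ij b)) \<noteq> 0" by simp
  from det_combination_of_nat[OF B(1) subset_refl B(1) this] obtain z :: "'f \<Rightarrow> nat" where
    z: "det (mat n n (\<lambda>ij. \<Sum>b\<in>B. (if b \<in> B then of_nat (z b) else b) * \<alpha> ij b)) \<noteq> 0" by blast
  define F where "F = mat n n (\<lambda>ij. \<Sum>b\<in>B. of_nat (z b) * \<alpha> ij b)"
  have F: "F \<in> carrier_mat n n" "det F \<noteq> 0"
    using z by (auto simp: F_def cong: sum.cong)
  have Fij: "F $$ (i, j) = (\<Sum>b\<in>B. of_nat (z b) * \<alpha> (i, j) b)" if "i < n" "j < n" for i j
    using that by (simp add: F_def)
  have "F $$ (i, j) \<in> L" if "i < n" "j < n" for i j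
    unfolding Fij[OF that] using \<alpha> that of_nat_in_L
    by (intro subring_set_sum[OF LD(1)] LD(6)) (auto simp: J_def)
  moreover have "map_mat (act \<gamma>) F = c \<gamma> * F" if g: "\<gamma> \<in> \<Gamma>" for \<gamma>
  proof (rule eq_matI)
    fix i j assume "i < dim_row (c \<gamma> * F)" "j < dim_col (c \<gamma> * F)"
    then have ij: "i < n" "j < n" using c[OF g] F(1) by auto
    have "map_mat (act \<gamma>) F $$ (i, j) = (\<Sum>b\<in>B. of_nat (z b) * (\<Sum>k<n. c \<gamma> $$ (i, k) * \<alpha> (k, j) b))"
      using ij F(1) equiv[OF g ij] by (simp add: Fij act_simps[OF g])
    also have "\<dots> = (\<Sum>k<n. c \<gamma> $$ (i, k) * F $$ (k, j))"
      using ij unfolding sum_distrib_left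
      by (subst sum.swap) (simp add: Fij sum_distrib_left mult_ac)
    also have "\<dots> = (c \<gamma> * F) $$ (i, j)"
      using ij c[OF g] F(1) by (subst index_mat_mult_lessThan[of _ n n _ n]) auto
    finally show "map_mat (act \<gamma>) F $$ (i, j) = (c \<gamma> * F) $$ (i, j)" .
  qed (use c[OF g] F(1) in auto)
  ultimately show ?thesis using F by blast
qed

end

section \<open>Radicial functions are orbit sums\<close>

text \<open>The linear forms \<open>V \<gamma>\<close> span a finite-dimensional space, so finitely many of them span it.\<close>

lemma finitely_many_conditions:
  fixes V :: "'g \<Rightarrow> 'y \<Rightarrow> 'f::field"
  assumes "finite Y"
  shows "\<exists>\<Gamma>0. finite \<Gamma>0 \<and> \<Gamma>0 \<subseteq> \<Gamma> \<and> (\<forall>z. (\<forall>\<gamma>\<in>\<Gamma>0. (\<Sum>y\<in>Y. V \<gamma> y * z y) = 0) \<longrightarrow>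
    (\<forall>\<gamma>\<in>\<Gamma>. (\<Sum>y\<in>Y. V \<gamma> y * z y) = 0))"
  using assms
proof (induction Y arbitrary: V rule: finite_induct)
  case empty
  then show ?case by (intro exI[of _ "{}"]) auto
next
  case (insert i Y)
  show ?case
  proof (cases "\<exists>\<gamma>0\<in>\<Gamma>. V \<gamma>0 i \<noteq> 0")
    case False
    from insert.IH[of V] obtain \<Gamma>0 where G: "finite \<Gamma>0" "\<Gamma>0 \<subseteq> \<Gamma>"
      "\<forall>z. (\<forall>\<gamma>\<in>\<Gamma>0. (\<Sum>y\<in>Y. V \<gamma> y * z y) = 0) \<longrightarrow> (\<forall>\<gamma>\<in>\<Gamma>. (\<Sum>y\<in>Y. V \<gamma> y * z y) = 0)" by blast
    have "(\<Sum>y\<in>insert i Y. V \<gamma> y * z y) = (\<Sum>y\<in>Y. V \<gamma> y * z y)" if "\<gamma> \<in> \<Gamma>" for \<gamma> z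
      using False that insert.hyps by simp
    then show ?thesis using G by (intro exI[of _ \<Gamma>0]) (metis subsetD)
  next
    case True
    then obtain \<gamma>0 where g0: "\<gamma>0 \<in> \<Gamma>" "V \<gamma>0 i \<noteq> 0" by blast
    define V' where "V' \<gamma> y = V \<gamma> y - V \<gamma> i * V \<gamma>0 y / V \<gamma>0 i" for \<gamma> y
    from insert.IH[of V'] obtain \<Gamma>0 where G: "finite \<Gamma>0" "\<Gamma>0 \<subseteq> \<Gamma>"
      and G': "\<And>z. (\<forall>\<gamma>\<in>\<Gamma>0. (\<Sum>y\<in>Y. V' \<gamma> y * z y) = 0) \<Longrightarrow> (\<forall>\<gamma>\<in>\<Gamma>. (\<Sum>y\<in>Y. V' \<gamma> y * z y) = 0)" by blast
    have eq: "(\<Sum>y\<in>insert i Y. V \<gamma> y * z y) = (\<Sum>y\<in>Y. V' \<gamma> y * z y)"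
      if z: "(\<Sum>y\<in>insert i Y. V \<gamma>0 y * z y) = 0" for \<gamma> z
    proof -
      have zi: "z i = - (\<Sum>y\<in>Y. V \<gamma>0 y * z y) / V \<gamma>0 i"
        using z insert.hyps g0(2) by (simp add: field_simps add_eq_0_iff)
      have "(\<Sum>y\<in>Y. V' \<gamma> y * z y) = (\<Sum>y\<in>Y. V \<gamma> y * z y) - V \<gamma> i / V \<gamma>0 i * (\<Sum>y\<in>Y. V \<gamma>0 y * z y)"
        unfolding V'_def sum_distrib_left sum_subtractf[symmetric]
        by (intro sum.cong) (simp_all add: left_diff_distrib right_diff_distrib mult_ac)
      then show ?thesis using insert.hyps by (simp add: zi)
    qed
    show ?thesis
    proof (intro exI[of _ "insert \<gamma>0 \<Gamma>0"] conjI allI impI)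
      show "finite (insert \<gamma>0 \<Gamma>0)" "insert \<gamma>0 \<Gamma>0 \<subseteq> \<Gamma>" using G g0 by auto
      fix z assume z: "\<forall>\<gamma>\<in>insert \<gamma>0 \<Gamma>0. (\<Sum>y\<in>insert i Y. V \<gamma> y * z y) = 0"
      then have e: "(\<Sum>y\<in>insert i Y. V \<gamma> y * z y) = (\<Sum>y\<in>Y. V' \<gamma> y * z y)" for \<gamma> by (intro eq) simp
      have "\<forall>\<gamma>\<in>\<Gamma>0. (\<Sum>y\<in>Y. V' \<gamma> y * z y) = 0" using z unfolding e by simp
      then show "\<forall>\<gamma>\<in>\<Gamma>. (\<Sum>y\<in>insert i Y. V \<gamma> y * z y) = 0" unfolding e by (rule G')
    qed
  qed
qed

lemma monic_dvd_linear_power: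
  fixes \<mu> :: "'f::field poly"
  shows "Polynomial.lead_coeff \<mu> = 1 \<Longrightarrow> \<mu> dvd [:- a, 1:] ^ N \<Longrightarrow> \<exists>k. \<mu> = [:- a, 1:] ^ k"
proof (induction N arbitrary: \<mu>)
  case 0
  then obtain c where "\<mu> = [:c:]" by (auto simp: is_unit_poly_iff)
  with 0 have "\<mu> = 1" by (simp add: one_pCons)
  then show ?case by (intro exI[of _ 0]) simp
next
  case (Suc N)
  then obtain \<nu> where \<nu>: "[:- a, 1:] * [:- a, 1:] ^ N = \<mu> * \<nu>" by (auto elim: dvdE)
  have "poly (\<mu> * \<nu>) a = 0" unfolding \<nu>[symmetric] by simp
  then consider "poly \<mu> a = 0" | "poly \<nu> a = 0" by auto
  then show ?case
  proof cases
    case 1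
    then obtain \<mu>' where \<mu>': "\<mu> = [:- a, 1:] * \<mu>'" by (auto simp: poly_eq_0_iff_dvd dvd_def)
    then have "[:- a, 1:] * [:- a, 1:] ^ N = [:- a, 1:] * (\<mu>' * \<nu>)" using \<nu> by (simp only: mult.assoc)
    then have "[:- a, 1:] ^ N = \<mu>' * \<nu>" by (subst (asm) mult_cancel_left) auto
    then have "\<mu>' dvd [:- a, 1:] ^ N" by simp
    moreover have "Polynomial.lead_coeff \<mu>' = 1" using Suc.prems(1) unfolding \<mu>' lead_coeff_mult by simp
    ultimately obtain k where "\<mu>' = [:- a, 1:] ^ k" using Suc.IH by blast
    then show ?thesis using \<mu>' by (intro exI[of _ "Suc k"]) simp
  next
    case 2
    then obtain \<nu>' where \<nu>': "\<nu> = [:- a, 1:] * \<nu>'" by (auto simp: poly_eq_0_iff_dvd dvd_def)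
    then have "[:- a, 1:] * [:- a, 1:] ^ N = [:- a, 1:] * (\<mu> * \<nu>')"
      using \<nu> by (simp only: mult.left_commute)
    then have "[:- a, 1:] ^ N = \<mu> * \<nu>'" by (subst (asm) mult_cancel_left) auto
    then show ?thesis using Suc.IH[OF Suc.prems(1)] by simp
  qed
qed

lemma coeff_linear_power_pred:
  "Polynomial.coeff ([:- a, 1:] ^ Suc k) k = - of_nat (Suc k) * (a :: 'f::field)"
proof (induction k)
  case (Suc k)
  have "Polynomial.coeff ([:- a, 1:] ^ Suc k) (Suc k) = 1"
    using lead_coeff_power[of "[:- a, 1:]" "Suc k"] unfolding degree_linear_power by simp
  moreover have "[:- a, 1:] ^ Suc (Suc k) = [:- a, 1:] * [:- a, 1:] ^ Suc k" by simp
  then have "Polynomial.coeff ([:- a, 1:] ^ Suc (Suc k)) (Suc k) =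
      Polynomial.coeff ([:- a, 1:] ^ Suc k) k - a * Polynomial.coeff ([:- a, 1:] ^ Suc k) (Suc k)"
    by (simp only: mult_pCons_left) (simp add: coeff_pCons del: power_Suc)
  ultimately show ?case using Suc.IH by (simp add: algebra_simps del: power_Suc)
qed simp

context semilinear_action
begin

text \<open>The complement of a minimal prime ideal of the ring of orbit sums.\<close>

definition max_mult :: "('g \<Rightarrow> 'f) set \<Rightarrow> bool" where
  "max_mult M \<longleftrightarrow> M \<subseteq> orbit_span \<and> (\<lambda>_. 1) \<in> M \<and> (\<forall>p\<in>M. \<forall>q\<in>M. (\<lambda>\<gamma>. p \<gamma> * q \<gamma>) \<in> M) \<and>
    (\<forall>p\<in>M. \<exists>\<gamma>\<in>\<Gamma>. p \<gamma> \<noteq> 0) \<and>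
    (\<forall>q\<in>orbit_span. q \<in> M \<or> (\<exists>p\<in>M. \<forall>\<gamma>\<in>\<Gamma>. p \<gamma> * q \<gamma> = 0))"

lemma max_mult_exists: "\<exists>M. max_mult M"
proof -
  define \<A> where "\<A> = {M. M \<subseteq> orbit_span \<and> (\<lambda>_. 1) \<in> M \<and> (\<forall>p\<in>M. \<forall>q\<in>M. (\<lambda>\<gamma>. p \<gamma> * q \<gamma>) \<in> M) \<and>
    (\<forall>p\<in>M. \<exists>\<gamma>\<in>\<Gamma>. p \<gamma> \<noteq> 0)}"
  have "\<exists>M\<in>\<A>. \<forall>N\<in>\<A>. M \<subseteq> N \<longrightarrow> N = M"
  proof (rule subset_Zorn_nonempty)
    have "{\<lambda>_. 1} \<in> \<A>"
      using one(1) orbit_span_const LD(3) by (auto simp: \<A>_def)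
    then show "\<A> \<noteq> {}" by blast
  next
    fix \<C> assume "\<C> \<noteq> {}" and ch: "subset.chain \<A> \<C>"
    have sub: "\<C> \<subseteq> \<A>" and lin: "\<And>x y. x \<in> \<C> \<Longrightarrow> y \<in> \<C> \<Longrightarrow> x \<subseteq> y \<or> y \<subseteq> x"
      using ch by (auto simp: subset_chain_def)
    have mem: "N \<subseteq> orbit_span" "(\<lambda>_. 1) \<in> N" "p \<in> N \<Longrightarrow> q \<in> N \<Longrightarrow> (\<lambda>\<gamma>. p \<gamma> * q \<gamma>) \<in> N"
      "p \<in> N \<Longrightarrow> \<exists>\<gamma>\<in>\<Gamma>. p \<gamma> \<noteq> 0" if "N \<in> \<C>" for N p q
      using subsetD[OF sub that] unfolding \<A>_def by auto
    show "\<Union>\<C> \<in> \<A>"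
      unfolding \<A>_def mem_Collect_eq
    proof (intro conjI ballI)
      show "\<Union>\<C> \<subseteq> orbit_span" using mem(1) by blast
      show "(\<lambda>_. 1) \<in> \<Union>\<C>" using mem(2) \<open>\<C> \<noteq> {}\<close> by blast
      show "\<exists>\<gamma>\<in>\<Gamma>. p \<gamma> \<noteq> 0" if "p \<in> \<Union>\<C>" for p using that mem(4) by blast
      fix p q assume "p \<in> \<Union>\<C>" "q \<in> \<Union>\<C>"
      then obtain x y where xy: "x \<in> \<C>" "p \<in> x" "y \<in> \<C>" "q \<in> y" by blast
      then obtain w where "w \<in> \<C>" "p \<in> w" "q \<in> w" using lin[of x y] by blast
      then show "(\<lambda>\<gamma>. p \<gamma> * q \<gamma>) \<in> \<Union>\<C>" using mem(3)[of w p q] by blast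
    qed
  qed
  then obtain M where M: "M \<in> \<A>" and max: "\<forall>N\<in>\<A>. M \<subseteq> N \<longrightarrow> N = M" by blast
  have MD: "M \<subseteq> orbit_span" "(\<lambda>_. 1) \<in> M" "p \<in> M \<Longrightarrow> q \<in> M \<Longrightarrow> (\<lambda>\<gamma>. p \<gamma> * q \<gamma>) \<in> M"
    "p \<in> M \<Longrightarrow> \<exists>\<gamma>\<in>\<Gamma>. p \<gamma> \<noteq> 0" for p q using M unfolding \<A>_def by auto
  have "q \<in> M \<or> (\<exists>p\<in>M. \<forall>\<gamma>\<in>\<Gamma>. p \<gamma> * q \<gamma> = 0)" if q: "q \<in> orbit_span" for q
  proof (rule ccontr)
    assume no: "\<not> ?thesis"
    define N where "N = {\<lambda>\<gamma>. p \<gamma> * q \<gamma> ^ k | p k. p \<in> M}"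
    have NI: "(\<lambda>\<gamma>. p \<gamma> * q \<gamma> ^ k) \<in> N" if "p \<in> M" for p k using that by (auto simp: N_def)
    have "N \<in> \<A>"
      unfolding \<A>_def mem_Collect_eq
    proof (intro conjI ballI)
      show "N \<subseteq> orbit_span"
        using MD(1) q by (auto simp: N_def intro!: orbit_span_mult orbit_span_power)
      show "(\<lambda>_. 1) \<in> N" using NI[OF MD(2), of 0] by simp
      fix x assume "x \<in> N"
      then obtain p k where x: "x = (\<lambda>\<gamma>. p \<gamma> * q \<gamma> ^ k)" "p \<in> M" by (auto simp: N_def)
      from no x(2) MD(4) obtain \<gamma> where "\<gamma> \<in> \<Gamma>" "p \<gamma> * q \<gamma> \<noteq> 0" by blast
      then show "\<exists>\<gamma>\<in>\<Gamma>. x \<gamma> \<noteq> 0" unfolding x(1) by (intro bexI[of _ \<gamma>]) auto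
      fix y assume "y \<in> N"
      then obtain p' l where y: "y = (\<lambda>\<gamma>. p' \<gamma> * q \<gamma> ^ l)" "p' \<in> M" by (auto simp: N_def)
      have "(\<lambda>\<gamma>. x \<gamma> * y \<gamma>) = (\<lambda>\<gamma>. (p \<gamma> * p' \<gamma>) * q \<gamma> ^ (k + l))"
        by (simp add: x y fun_eq_iff power_add mult_ac)
      also have "\<dots> \<in> N" using NI[OF MD(3)[OF x(2) y(2)]] .
      finally show "(\<lambda>\<gamma>. x \<gamma> * y \<gamma>) \<in> N" .
    qed
    moreover have "M \<subseteq> N" using NI[of _ 0] by auto
    ultimately have "N = M" using max by blast
    moreover have "q \<in> N" using NI[OF MD(2), of 1] by simp
    ultimately show False using no by blast
  qed
  then have "max_mult M"
    unfolding max_mult_def using MD by (intro conjI ballI) auto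
  then show ?thesis ..
qed

end

locale germs = semilinear_action \<Gamma> act mul one L
  for \<Gamma> :: "'g set" and act :: "'g \<Rightarrow> 'f::field_char_0 \<Rightarrow> 'f" and mul one L +
  fixes M :: "('g \<Rightarrow> 'f) set"
  assumes M: "max_mult M"
begin

text \<open>The filter of the supports of the elements of \<open>M\<close>: its germs of quotients of orbit sums form the
  localisation at a minimal prime ideal, which is a field because the ring is reduced.\<close>

definition supp_filter :: "'g filter" where
  "supp_filter = (INF m\<in>M. principal {\<gamma> \<in> \<Gamma>. m \<gamma> \<noteq> 0})"

abbreviation ev :: "('g \<Rightarrow> bool) \<Rightarrow> bool" where
  "ev P \<equiv> eventually P supp_filter"

lemma MD: "M \<subseteq> orbit_span" "(\<lambda>_. 1) \<in> M" "p \<in> M \<Longrightarrow> q \<in> M \<Longrightarrow> (\<lambda>\<gamma>. p \<gamma> * q \<gamma>) \<in> M"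
    "p \<in> M \<Longrightarrow> \<exists>\<gamma>\<in>\<Gamma>. p \<gamma> \<noteq> 0" "q \<in> orbit_span \<Longrightarrow> q \<in> M \<or> (\<exists>p\<in>M. \<forall>\<gamma>\<in>\<Gamma>. p \<gamma> * q \<gamma> = 0)"
  using M unfolding max_mult_def by auto

lemma ev_iff: "ev P \<longleftrightarrow> (\<exists>m\<in>M. \<forall>\<gamma>\<in>\<Gamma>. m \<gamma> \<noteq> 0 \<longrightarrow> P \<gamma>)"
proof -
  have "ev P \<longleftrightarrow> (\<exists>m\<in>M. eventually P (principal {\<gamma> \<in> \<Gamma>. m \<gamma> \<noteq> 0}))"
    unfolding supp_filter_def
  proof (rule eventually_INF_base)
    show "M \<noteq> {}" using MD(2) by blast
    fix p q assume "p \<in> M" "q \<in> M"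
    then show "\<exists>r\<in>M. principal {\<gamma> \<in> \<Gamma>. r \<gamma> \<noteq> 0} \<le> inf (principal {\<gamma> \<in> \<Gamma>. p \<gamma> \<noteq> 0}) (principal {\<gamma> \<in> \<Gamma>. q \<gamma> \<noteq> 0})"
      using MD(3)[of p q] by (intro bexI[of _ "\<lambda>\<gamma>. p \<gamma> * q \<gamma>"]) auto
  qed
  then show ?thesis by (auto simp: eventually_principal)
qed

lemma ev_group: "ev (\<lambda>\<gamma>. \<gamma> \<in> \<Gamma>)"
  unfolding ev_iff using MD(2) by blast

lemma ev_imp_ex: "ev P \<Longrightarrow> \<exists>\<gamma>\<in>\<Gamma>. P \<gamma>"
  unfolding ev_iff using MD(4) by blast

lemma ev_False: "\<not> ev (\<lambda>_. False)"
  using ev_imp_ex by blast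

lemma orbit_span_dichotomy: "q \<in> orbit_span \<Longrightarrow> q \<in> M \<and> ev (\<lambda>\<gamma>. q \<gamma> \<noteq> 0) \<or> ev (\<lambda>\<gamma>. q \<gamma> = 0)"
  using MD(5)[of q] unfolding ev_iff by (metis mult_eq_0_iff)

definition quotients :: "('g \<Rightarrow> 'f) set" where
  "quotients = {f. \<exists>p\<in>orbit_span. \<exists>q\<in>orbit_span. ev (\<lambda>\<gamma>. q \<gamma> \<noteq> 0) \<and> ev (\<lambda>\<gamma>. f \<gamma> = p \<gamma> / q \<gamma>)}"

lemma quotientsI:
  assumes "p \<in> orbit_span" "q \<in> orbit_span" "ev (\<lambda>\<gamma>. q \<gamma> \<noteq> 0)" "ev (\<lambda>\<gamma>. f \<gamma> = p \<gamma> / q \<gamma>)"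
  shows "f \<in> quotients"
  using assms unfolding quotients_def by blast

lemma quotientsE:
  assumes "f \<in> quotients"
  obtains p q where "p \<in> orbit_span" "q \<in> orbit_span" "ev (\<lambda>\<gamma>. q \<gamma> \<noteq> 0)" "ev (\<lambda>\<gamma>. f \<gamma> = p \<gamma> / q \<gamma>)"
  using assms unfolding quotients_def by blast

lemma quotients_orbit_span: "f \<in> orbit_span \<Longrightarrow> f \<in> quotients"
  by (rule quotientsI[of f "\<lambda>_. 1"]) (auto intro: orbit_span_const LD)

lemma quotients_const: "a \<in> L \<Longrightarrow> (\<lambda>_. a) \<in> quotients"
  by (intro quotients_orbit_span orbit_span_const)

lemma ev_mult_nonzero:
  assumes "ev (\<lambda>\<gamma>. p \<gamma> \<noteq> 0)" "ev (\<lambda>\<gamma>. q \<gamma> \<noteq> 0)"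
  shows "ev (\<lambda>\<gamma>. p \<gamma> * q \<gamma> \<noteq> (0::'f))"
  using assms by eventually_elim auto

lemma quotients_add:
  assumes "f \<in> quotients" "g \<in> quotients"
  shows "(\<lambda>\<gamma>. f \<gamma> + g \<gamma>) \<in> quotients"
proof -
  from assms(1) obtain p q where f: "p \<in> orbit_span" "q \<in> orbit_span" "ev (\<lambda>\<gamma>. q \<gamma> \<noteq> 0)" "ev (\<lambda>\<gamma>. f \<gamma> = p \<gamma> / q \<gamma>)"
    by (rule quotientsE)
  from assms(2) obtain r s where g: "r \<in> orbit_span" "s \<in> orbit_span" "ev (\<lambda>\<gamma>. s \<gamma> \<noteq> 0)" "ev (\<lambda>\<gamma>. g \<gamma> = r \<gamma> / s \<gamma>)"
    by (rule quotientsE)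
  show ?thesis
  proof (rule quotientsI[of "\<lambda>\<gamma>. p \<gamma> * s \<gamma> + r \<gamma> * q \<gamma>" "\<lambda>\<gamma>. q \<gamma> * s \<gamma>"])
    show "ev (\<lambda>\<gamma>. f \<gamma> + g \<gamma> = (p \<gamma> * s \<gamma> + r \<gamma> * q \<gamma>) / (q \<gamma> * s \<gamma>))"
      using f(3,4) g(3,4) by eventually_elim (simp add: add_frac_eq)
  qed (use f g in \<open>auto intro: orbit_span_add orbit_span_mult ev_mult_nonzero simp del: mult_eq_0_iff\<close>)
qed

lemma quotients_mult:
  assumes "f \<in> quotients" "g \<in> quotients"
  shows "(\<lambda>\<gamma>. f \<gamma> * g \<gamma>) \<in> quotients"
proof -
  from assms(1) obtain p q where f: "p \<in> orbit_span" "q \<in> orbit_span" "ev (\<lambda>\<gamma>. q \<gamma> \<noteq> 0)" "ev (\<lambda>\<gamma>. f \<gamma> = p \<gamma> / q \<gamma>)"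
    by (rule quotientsE)
  from assms(2) obtain r s where g: "r \<in> orbit_span" "s \<in> orbit_span" "ev (\<lambda>\<gamma>. s \<gamma> \<noteq> 0)" "ev (\<lambda>\<gamma>. g \<gamma> = r \<gamma> / s \<gamma>)"
    by (rule quotientsE)
  show ?thesis
  proof (rule quotientsI[of "\<lambda>\<gamma>. p \<gamma> * r \<gamma>" "\<lambda>\<gamma>. q \<gamma> * s \<gamma>"])
    show "ev (\<lambda>\<gamma>. f \<gamma> * g \<gamma> = (p \<gamma> * r \<gamma>) / (q \<gamma> * s \<gamma>))"
      using f(4) g(4) by eventually_elim simp
  qed (use f g in \<open>auto intro: orbit_span_mult ev_mult_nonzero simp del: mult_eq_0_iff\<close>)
qed

lemma quotients_uminus: "f \<in> quotients \<Longrightarrow> (\<lambda>\<gamma>. - f \<gamma>) \<in> quotients"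
  using quotients_mult[OF quotients_const[of "-1"], of f] LD by simp

lemma quotients_sum: "(\<And>i. i \<in> I \<Longrightarrow> f i \<in> quotients) \<Longrightarrow> (\<lambda>\<gamma>. \<Sum>i\<in>I. f i \<gamma>) \<in> quotients"
  by (induction I rule: infinite_finite_induct) (auto intro: quotients_add quotients_const simp: LD)

lemma quotients_dichotomy: "f \<in> quotients \<Longrightarrow> ev (\<lambda>\<gamma>. f \<gamma> \<noteq> 0) \<or> ev (\<lambda>\<gamma>. f \<gamma> = 0)"
proof (erule quotientsE)
  fix p q assume p: "p \<in> orbit_span" and *: "ev (\<lambda>\<gamma>. q \<gamma> \<noteq> 0)" "ev (\<lambda>\<gamma>. f \<gamma> = p \<gamma> / q \<gamma>)"
  from orbit_span_dichotomy[OF p] consider "ev (\<lambda>\<gamma>. p \<gamma> \<noteq> 0)" | "ev (\<lambda>\<gamma>. p \<gamma> = 0)" by blast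
  then show ?thesis
  proof cases
    case 1
    with * have "ev (\<lambda>\<gamma>. f \<gamma> \<noteq> 0)" by eventually_elim simp
    then show ?thesis ..
  next
    case 2
    with * have "ev (\<lambda>\<gamma>. f \<gamma> = 0)" by eventually_elim simp
    then show ?thesis ..
  qed
qed

lemma quotients_divide:
  assumes "f \<in> quotients" "g \<in> quotients" "ev (\<lambda>\<gamma>. g \<gamma> \<noteq> 0)"
  shows "(\<lambda>\<gamma>. f \<gamma> / g \<gamma>) \<in> quotients"
proof -
  from assms(2) obtain r s where g: "r \<in> orbit_span" "s \<in> orbit_span" "ev (\<lambda>\<gamma>. s \<gamma> \<noteq> 0)" "ev (\<lambda>\<gamma>. g \<gamma> = r \<gamma> / s \<gamma>)"
    by (rule quotientsE)
  have "ev (\<lambda>\<gamma>. r \<gamma> \<noteq> 0)" using assms(3) g(4) by eventually_elim auto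
  moreover have "ev (\<lambda>\<gamma>. inverse (g \<gamma>) = s \<gamma> / r \<gamma>)" using g(4) by eventually_elim simp
  ultimately have "(\<lambda>\<gamma>. inverse (g \<gamma>)) \<in> quotients" using g by (intro quotientsI[of s r])
  from quotients_mult[OF assms(1) this] show ?thesis by (simp add: divide_inverse)
qed

text \<open>Linear independence over the field of germs of quotients of orbit sums; equality of germs is
  equality on the support of some element of \<open>M\<close>.\<close>

definition indep :: "'i set \<Rightarrow> ('i \<Rightarrow> 'g \<Rightarrow> 'f) \<Rightarrow> bool" where
  "indep J e \<longleftrightarrow> (\<forall>\<phi>. (\<forall>j\<in>J. \<phi> j \<in> quotients) \<and> ev (\<lambda>\<gamma>. (\<Sum>j\<in>J. \<phi> j \<gamma> * e j \<gamma>) = 0) \<longrightarrow>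
    (\<forall>j\<in>J. ev (\<lambda>\<gamma>. \<phi> j \<gamma> = 0)))"

lemma dependent_in_span:
  assumes "finite J" "indep J e" "i \<notin> J" "\<not> indep (insert i J) e"
  shows "\<exists>\<phi>. (\<forall>j\<in>J. \<phi> j \<in> quotients) \<and> ev (\<lambda>\<gamma>. e i \<gamma> = (\<Sum>j\<in>J. \<phi> j \<gamma> * e j \<gamma>))"
proof -
  from assms(4) obtain \<phi> where \<phi>: "\<forall>j\<in>insert i J. \<phi> j \<in> quotients"
    "ev (\<lambda>\<gamma>. (\<Sum>j\<in>insert i J. \<phi> j \<gamma> * e j \<gamma>) = 0)" "\<not> (\<forall>j\<in>insert i J. ev (\<lambda>\<gamma>. \<phi> j \<gamma> = 0))"
    unfolding indep_def by blast
  have sum: "(\<Sum>j\<in>insert i J. \<phi> j \<gamma> * e j \<gamma>) = \<phi> i \<gamma> * e i \<gamma> + (\<Sum>j\<in>J. \<phi> j \<gamma> * e j \<gamma>)" for \<gamma>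
    using assms(1,3) by simp
  have "\<not> ev (\<lambda>\<gamma>. \<phi> i \<gamma> = 0)"
  proof
    assume 0: "ev (\<lambda>\<gamma>. \<phi> i \<gamma> = 0)"
    with \<phi>(2) have "ev (\<lambda>\<gamma>. (\<Sum>j\<in>J. \<phi> j \<gamma> * e j \<gamma>) = 0)"
      unfolding sum by eventually_elim simp
    then have "\<forall>j\<in>J. ev (\<lambda>\<gamma>. \<phi> j \<gamma> = 0)" using assms(2) \<phi>(1) unfolding indep_def by blast
    with 0 \<phi>(3) show False by simp
  qed
  then have nz: "ev (\<lambda>\<gamma>. \<phi> i \<gamma> \<noteq> 0)" using quotients_dichotomy[of "\<phi> i"] \<phi>(1) by blast
  have "ev (\<lambda>\<gamma>. e i \<gamma> = (\<Sum>j\<in>J. (- \<phi> j \<gamma> / \<phi> i \<gamma>) * e j \<gamma>))"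
    using \<phi>(2) nz unfolding sum
  proof eventually_elim
    case (elim \<gamma>)
    then have "e i \<gamma> = - (\<Sum>j\<in>J. \<phi> j \<gamma> * e j \<gamma>) / \<phi> i \<gamma>" by (simp add: field_simps add_eq_0_iff)
    then show ?case by (simp add: sum_divide_distrib sum_negf)
  qed
  moreover have "(\<lambda>\<gamma>. - \<phi> j \<gamma> / \<phi> i \<gamma>) \<in> quotients" if "j \<in> J" for j
    using \<phi>(1) nz that by (intro quotients_divide quotients_uminus) auto
  ultimately show ?thesis by (intro exI[of _ "\<lambda>j \<gamma>. - \<phi> j \<gamma> / \<phi> i \<gamma>"]) simp
qed

lemma basis_extension:
  assumes "finite I" "J0 \<subseteq> I" "indep J0 e"
  shows "\<exists>J. J0 \<subseteq> J \<and> J \<subseteq> I \<and> indep J e \<and>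
    (\<forall>i\<in>I. \<exists>\<phi>. (\<forall>j\<in>J. \<phi> j \<in> quotients) \<and> ev (\<lambda>\<gamma>. e i \<gamma> = (\<Sum>j\<in>J. \<phi> j \<gamma> * e j \<gamma>)))"
proof -
  let ?\<J> = "{J. J0 \<subseteq> J \<and> J \<subseteq> I \<and> indep J e}"
  have fin: "finite ?\<J>" using assms(1) by (auto intro: finite_subset[of _ "Pow I"])
  have "?\<J> \<noteq> {}" using assms by blast
  from finite_has_maximal[OF fin this] obtain J where
    J: "J \<in> ?\<J>" and max: "\<forall>K\<in>?\<J>. J \<subseteq> K \<longrightarrow> J = K" by (elim bexE)
  have fJ: "finite J" using J assms(1) finite_subset by blast
  have "\<exists>\<phi>. (\<forall>j\<in>J. \<phi> j \<in> quotients) \<and> ev (\<lambda>\<gamma>. e i \<gamma> = (\<Sum>j\<in>J. \<phi> j \<gamma> * e j \<gamma>))" if i: "i \<in> I" for i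
  proof (cases "i \<in> J")
    case True
    then show ?thesis using fJ quotients_const[OF LD(2)] quotients_const[OF LD(3)]
      by (intro exI[of _ "\<lambda>j \<gamma>. if j = i then 1 else 0"]) (auto simp: mult_delta_left)
  next
    case False
    moreover have "\<not> indep (insert i J) e" using max J i False by blast
    ultimately show ?thesis using J fJ by (intro dependent_in_span) auto
  qed
  then show ?thesis using J by blast
qed

text \<open>An identity \<open>\<Sum>\<^sub>y x\<^sub>y(\<gamma>') z\<^sub>y(\<gamma>) = 0\<close> that holds for each \<open>\<gamma>'\<close> and eventually in \<open>\<gamma>\<close> holds
  eventually for all \<open>\<gamma>'\<close> at once, hence on the diagonal.\<close>

lemma ev_diagonal:
  assumes "finite Y" "\<And>\<gamma>'. \<gamma>' \<in> \<Gamma> \<Longrightarrow> ev (\<lambda>\<gamma>. (\<Sum>y\<in>Y. V \<gamma>' y * Z \<gamma> y) = 0)"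
  shows "ev (\<lambda>\<gamma>. (\<Sum>y\<in>Y. V \<gamma> y * Z \<gamma> y) = (0::'f))"
proof -
  from finitely_many_conditions[OF assms(1), of \<Gamma> V] obtain \<Gamma>0 where G: "finite \<Gamma>0" "\<Gamma>0 \<subseteq> \<Gamma>"
    "\<And>z. (\<forall>\<gamma>\<in>\<Gamma>0. (\<Sum>y\<in>Y. V \<gamma> y * z y) = 0) \<Longrightarrow> (\<forall>\<gamma>\<in>\<Gamma>. (\<Sum>y\<in>Y. V \<gamma> y * z y) = 0)" by blast
  have "ev (\<lambda>\<gamma>. \<forall>\<gamma>'\<in>\<Gamma>0. (\<Sum>y\<in>Y. V \<gamma>' y * Z \<gamma> y) = 0)"
    using G(1,2) assms(2) by (intro eventually_ball_finite) auto
  with ev_group show ?thesis by eventually_elim (use G(3) in blast)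
qed

text \<open>If \<open>(a(\<gamma>) - a(\<gamma>'))\<^sup>N\<close> lies in the ideal generated by differences of orbit sums, then the
  minimal polynomial of \<open>a\<close> over the field of germs divides \<open>(T - a)\<^sup>N\<close>. So it is a power of
  \<open>T - a\<close>, and in characteristic zero its second coefficient shows that \<open>a\<close> is a quotient of orbit
  sums.\<close>

theorem radicial_quotient:
  assumes S: "finite S" and f: "\<And>s \<gamma>. s \<in> S \<Longrightarrow> \<gamma> \<in> \<Gamma> \<Longrightarrow> f s \<gamma> \<in> L"
    and w: "\<And>s. s \<in> S \<Longrightarrow> w s \<in> orbit_span"
    and a: "\<And>\<gamma>. \<gamma> \<in> \<Gamma> \<Longrightarrow> a \<gamma> \<in> L"
    and nil: "\<And>\<gamma>' \<gamma>. \<gamma>' \<in> \<Gamma> \<Longrightarrow> \<gamma> \<in> \<Gamma> \<Longrightarrow>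
      (a \<gamma> - a \<gamma>') ^ N = (\<Sum>s\<in>S. f s \<gamma>' * g s \<gamma> * (w s \<gamma> - w s \<gamma>'))"
  shows "\<exists>d\<in>M. (\<lambda>\<gamma>. d \<gamma> * a \<gamma>) \<in> orbit_span"
proof -
  define pw where "pw j \<gamma> = a \<gamma> ^ j" for j :: nat and \<gamma>
  define c where "c j \<gamma> = of_nat (N choose j) * (- a \<gamma>) ^ (N - j)" for j \<gamma>
  have binom: "(x - a \<gamma>) ^ N = (\<Sum>j\<le>N. c j \<gamma> * x ^ j)" for x \<gamma>
    using binomial_ring[of x "- a \<gamma>" N] by (simp add: c_def mult_ac)
  have cL: "c j \<gamma> \<in> L" if "\<gamma> \<in> \<Gamma>" for j \<gamma>
    unfolding c_def using a[OF that] by (intro LD(6) subring_set_power[OF LD(1)] LD(4) of_nat_in_L)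
  \<comment> \<open>the largest number of independent powers below \<open>a\<^sup>N\<close>\<close>
  define R where "R = {r. r \<le> Suc N \<and> indep {..<r} pw}"
  define r where "r = Max R"
  have "finite R" by (rule finite_subset[of _ "{..Suc N}"]) (auto simp: R_def)
  have "1 \<in> R" by (auto simp: R_def indep_def pw_def)
  then have "r \<in> R" "1 \<le> r" unfolding r_def using \<open>finite R\<close> by (auto intro: Max_in Max_ge)
  then have r: "r \<le> Suc N" "indep {..<r} pw" "r > 0" by (auto simp: R_def)
  \<comment> \<open>a family of remainders expressing the powers of \<open>a\<close> in the first \<open>r\<close> powers gives the
    coefficients of \<open>(T - a)\<^sup>N\<close> modulo the relation\<close>
  have key: "ev (\<lambda>\<gamma>. (\<Sum>j\<le>N. c j \<gamma> * \<psi> j t \<gamma>) = 0)"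
    if \<psi>: "\<And>j t. \<psi> j t \<in> quotients" and exp: "\<And>j. j \<le> N \<Longrightarrow> ev (\<lambda>\<gamma>. a \<gamma> ^ j = (\<Sum>t<r. \<psi> j t \<gamma> * a \<gamma> ^ t))"
      and t: "t < r" for \<psi> t
  proof -
    define e where "e = case_sum pw g"
    define I where "I = Inl ` {..<r} \<union> Inr ` S"
    have sumInl: "(\<Sum>j\<in>Inl ` {..<r}. \<phi> j) = (\<Sum>j<r. \<phi> (Inl j))" for \<phi> :: "nat + 'a \<Rightarrow> 'f"
      by (subst sum.reindex) (auto simp: inj_on_def)
    have "indep (Inl ` {..<r}) e"
      unfolding indep_def
    proof (intro allI impI)
      fix \<phi> assume "(\<forall>j\<in>Inl ` {..<r}. \<phi> j \<in> quotients) \<and> ev (\<lambda>\<gamma>. (\<Sum>j\<in>Inl ` {..<r}. \<phi> j \<gamma> * e j \<gamma>) = 0)"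
      then have "(\<forall>j\<in>{..<r}. \<phi> (Inl j) \<in> quotients) \<and> ev (\<lambda>\<gamma>. (\<Sum>j<r. \<phi> (Inl j) \<gamma> * pw j \<gamma>) = 0)"
        by (simp add: sumInl e_def)
      then have "\<forall>j\<in>{..<r}. ev (\<lambda>\<gamma>. \<phi> (Inl j) \<gamma> = 0)"
        using r(2)[unfolded indep_def, rule_format, of "\<lambda>j. \<phi> (Inl j)"] by blast
      then show "\<forall>j\<in>Inl ` {..<r}. ev (\<lambda>\<gamma>. \<phi> j \<gamma> = 0)" by auto
    qed
    moreover have "finite I" "Inl ` {..<r} \<subseteq> I" using S by (auto simp: I_def)
    ultimately have "\<exists>J. Inl ` {..<r} \<subseteq> J \<and> J \<subseteq> I \<and> indep J e \<and>
      (\<forall>i\<in>I. \<exists>\<phi>. (\<forall>j\<in>J. \<phi> j \<in> quotients) \<and> ev (\<lambda>\<gamma>. e i \<gamma> = (\<Sum>j\<in>J. \<phi> j \<gamma> * e j \<gamma>)))"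
      by (intro basis_extension)
    then obtain J where J: "Inl ` {..<r} \<subseteq> J" "J \<subseteq> I" "indep J e" and span:
      "\<forall>i\<in>I. \<exists>\<phi>. (\<forall>j\<in>J. \<phi> j \<in> quotients) \<and> ev (\<lambda>\<gamma>. e i \<gamma> = (\<Sum>j\<in>J. \<phi> j \<gamma> * e j \<gamma>))"
      by (elim exE conjE)
    have "\<forall>s\<in>S. \<exists>\<phi>. (\<forall>j\<in>J. \<phi> j \<in> quotients) \<and> ev (\<lambda>\<gamma>. g s \<gamma> = (\<Sum>j\<in>J. \<phi> j \<gamma> * e j \<gamma>))"
    proof
      fix s assume "s \<in> S"
      then have "Inr s \<in> I" by (simp add: I_def)
      from bspec[OF span this] show "\<exists>\<phi>. (\<forall>j\<in>J. \<phi> j \<in> quotients) \<and>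
        ev (\<lambda>\<gamma>. g s \<gamma> = (\<Sum>j\<in>J. \<phi> j \<gamma> * e j \<gamma>))" by (simp add: e_def)
    qed
    from bchoice[OF this] obtain \<chi> where
      "\<forall>s\<in>S. (\<forall>j\<in>J. \<chi> s j \<in> quotients) \<and> ev (\<lambda>\<gamma>. g s \<gamma> = (\<Sum>j\<in>J. \<chi> s j \<gamma> * e j \<gamma>))" ..
    then have \<chi>: "s \<in> S \<Longrightarrow> j \<in> J \<Longrightarrow> \<chi> s j \<in> quotients"
      and exp': "s \<in> S \<Longrightarrow> ev (\<lambda>\<gamma>. g s \<gamma> = (\<Sum>j\<in>J. \<chi> s j \<gamma> * e j \<gamma>))" for s j by auto
    have fJ: "finite J" using J(2) \<open>finite I\<close> finite_subset by blast
    define \<psi>' where "\<psi>' j i = (case i of Inl t \<Rightarrow> if t < r then \<psi> j t else (\<lambda>_. 0) | Inr s \<Rightarrow> (\<lambda>_. 0))"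
      for j and i :: "nat + 'a"
    have \<psi>': "\<psi>' j i \<in> quotients" for j i
      using \<psi> quotients_const[OF LD(2)] by (auto simp: \<psi>'_def split: sum.split)
    have exp\<psi>: "ev (\<lambda>\<gamma>. a \<gamma> ^ j = (\<Sum>i\<in>J. \<psi>' j i \<gamma> * e i \<gamma>))" if "j \<le> N" for j
    proof -
      have "(\<Sum>i\<in>J. \<psi>' j i \<gamma> * e i \<gamma>) = (\<Sum>i\<in>Inl ` {..<r}. \<psi>' j i \<gamma> * e i \<gamma>)" for \<gamma>
        using J(1) fJ by (intro sum.mono_neutral_right) (auto simp: \<psi>'_def split: sum.splits)
      then have "(\<Sum>i\<in>J. \<psi>' j i \<gamma> * e i \<gamma>) = (\<Sum>t<r. \<psi> j t \<gamma> * a \<gamma> ^ t)" for \<gamma>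
        by (simp add: sumInl \<psi>'_def e_def pw_def)
      then show ?thesis using exp[OF that] by simp
    qed
    \<comment> \<open>the coefficient of the basis element \<open>i\<close> in the identity, with \<open>\<gamma>'\<close> as a parameter\<close>
    define \<Phi> where "\<Phi> \<gamma>' i \<gamma> = (\<Sum>j\<le>N. c j \<gamma>' * \<psi>' j i \<gamma>) - (\<Sum>s\<in>S. f s \<gamma>' * (w s \<gamma> - w s \<gamma>') * \<chi> s i \<gamma>)"
      for \<gamma>' i \<gamma>
    have zero: "ev (\<lambda>\<gamma>. \<Phi> \<gamma>' i \<gamma> = 0)" if g': "\<gamma>' \<in> \<Gamma>" and i: "i \<in> J" for \<gamma>' i
    proof -
      have "\<Phi> \<gamma>' j \<in> quotients" if "j \<in> J" for j
      proof -
        have "(\<lambda>\<gamma>. (\<Sum>l\<le>N. c l \<gamma>' * \<psi>' l j \<gamma>)) \<in> quotients"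
          using cL[OF g'] \<psi>' by (intro quotients_sum quotients_mult[OF quotients_const])
        moreover have "(\<lambda>\<gamma>. - (\<Sum>s\<in>S. f s \<gamma>' * (w s \<gamma> + - w s \<gamma>') * \<chi> s j \<gamma>)) \<in> quotients"
          using f[OF _ g'] quotients_orbit_span[OF w] LD(4)[OF orbit_span_in_L[OF w g']] \<chi> that
          by (intro quotients_uminus quotients_sum quotients_mult quotients_add quotients_const) auto
        ultimately show ?thesis
          using quotients_add[of "\<lambda>\<gamma>. \<Sum>l\<le>N. c l \<gamma>' * \<psi>' l j \<gamma>"
            "\<lambda>\<gamma>. - (\<Sum>s\<in>S. f s \<gamma>' * (w s \<gamma> + - w s \<gamma>') * \<chi> s j \<gamma>)"]
          by (simp add: \<Phi>_def[abs_def])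
      qed
      moreover have "ev (\<lambda>\<gamma>. (\<Sum>i\<in>J. \<Phi> \<gamma>' i \<gamma> * e i \<gamma>) = 0)"
      proof -
        have "ev (\<lambda>\<gamma>. \<forall>j\<in>{..N}. a \<gamma> ^ j = (\<Sum>i\<in>J. \<psi>' j i \<gamma> * e i \<gamma>))"
          using exp\<psi> by (intro eventually_ball_finite) auto
        moreover have "ev (\<lambda>\<gamma>. \<forall>s\<in>S. g s \<gamma> = (\<Sum>j\<in>J. \<chi> s j \<gamma> * e j \<gamma>))"
          using exp' S by (intro eventually_ball_finite) auto
        ultimately show ?thesis
          using ev_group
        proof eventually_elim
          case (elim \<gamma>)
          have "(\<Sum>i\<in>J. (\<Sum>j\<le>N. c j \<gamma>' * \<psi>' j i \<gamma>) * e i \<gamma>) = (\<Sum>j\<le>N. c j \<gamma>' * (\<Sum>i\<in>J. \<psi>' j i \<gamma> * e i \<gamma>))"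
            unfolding sum_distrib_right sum_distrib_left by (subst sum.swap) (simp add: mult.assoc)
          also have "\<dots> = (\<Sum>j\<le>N. c j \<gamma>' * a \<gamma> ^ j)"
            using elim(1) by (intro sum.cong) auto
          also have "\<dots> = (a \<gamma> - a \<gamma>') ^ N" by (simp add: binom)
          finally have 1: "(\<Sum>i\<in>J. (\<Sum>j\<le>N. c j \<gamma>' * \<psi>' j i \<gamma>) * e i \<gamma>) = (a \<gamma> - a \<gamma>') ^ N" .
          have "(\<Sum>i\<in>J. (\<Sum>s\<in>S. f s \<gamma>' * (w s \<gamma> - w s \<gamma>') * \<chi> s i \<gamma>) * e i \<gamma>) =
              (\<Sum>s\<in>S. f s \<gamma>' * (w s \<gamma> - w s \<gamma>') * (\<Sum>i\<in>J. \<chi> s i \<gamma> * e i \<gamma>))"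
            unfolding sum_distrib_right sum_distrib_left by (subst sum.swap) (simp add: mult.assoc)
          also have "\<dots> = (\<Sum>s\<in>S. f s \<gamma>' * g s \<gamma> * (w s \<gamma> - w s \<gamma>'))"
            using elim(2) by (intro sum.cong) (auto simp: mult_ac)
          also have "\<dots> = (a \<gamma> - a \<gamma>') ^ N" using nil[OF g' elim(3)] by simp
          finally show ?case
            using 1 by (simp add: \<Phi>_def left_diff_distrib sum_subtractf)
        qed
      qed
      ultimately show ?thesis using J(3) i unfolding indep_def by blast
    qed
    have tJ: "Inl t \<in> J" using t J(1) by auto
    \<comment> \<open>on the diagonal the right-hand side of the identity cancels\<close>
    define Y where "Y = {..N} <+> (S <+> S)"
    define V where "V \<gamma> y = (case y of Inl j \<Rightarrow> c j \<gamma> | Inr z \<Rightarrow> (case z of Inl s \<Rightarrow> f s \<gamma> | Inr s \<Rightarrow> f s \<gamma> * w s \<gamma>))"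
      for \<gamma> and y :: "nat + 'a + 'a"
    define Z where "Z \<gamma> y = (case y of Inl j \<Rightarrow> \<psi> j t \<gamma> | Inr z \<Rightarrow>
        (case z of Inl s \<Rightarrow> - w s \<gamma> * \<chi> s (Inl t) \<gamma> | Inr s \<Rightarrow> \<chi> s (Inl t) \<gamma>))"
      for \<gamma> and y :: "nat + 'a + 'a"
    have YS: "finite Y" using S by (simp add: Y_def)
    have sumY: "(\<Sum>y\<in>Y. V \<gamma>' y * Z \<gamma> y) = \<Phi> \<gamma>' (Inl t) \<gamma>" for \<gamma>' \<gamma>
    proof -
      have "(\<Sum>y\<in>Y. V \<gamma>' y * Z \<gamma> y) = (\<Sum>j\<le>N. c j \<gamma>' * \<psi> j t \<gamma>) +
          ((\<Sum>s\<in>S. f s \<gamma>' * (- w s \<gamma> * \<chi> s (Inl t) \<gamma>)) + (\<Sum>s\<in>S. f s \<gamma>' * w s \<gamma>' * \<chi> s (Inl t) \<gamma>))"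
        using S by (simp add: Y_def V_def Z_def sum.Plus)
      moreover have "(\<Sum>s\<in>S. f s \<gamma>' * (w s \<gamma> - w s \<gamma>') * \<chi> s (Inl t) \<gamma>) =
          - ((\<Sum>s\<in>S. f s \<gamma>' * (- w s \<gamma> * \<chi> s (Inl t) \<gamma>)) + (\<Sum>s\<in>S. f s \<gamma>' * w s \<gamma>' * \<chi> s (Inl t) \<gamma>))"
        unfolding sum.distrib[symmetric] sum_negf[symmetric] by (intro sum.cong) (simp_all add: algebra_simps)
      moreover have "(\<Sum>j\<le>N. c j \<gamma>' * \<psi>' j (Inl t) \<gamma>) = (\<Sum>j\<le>N. c j \<gamma>' * \<psi> j t \<gamma>)"
        using t by (simp add: \<psi>'_def)
      ultimately show ?thesis unfolding \<Phi>_def by (simp only: diff_minus_eq_add)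
    qed
    have "ev (\<lambda>\<gamma>. (\<Sum>y\<in>Y. V \<gamma> y * Z \<gamma> y) = 0)"
    proof (rule ev_diagonal[OF YS])
      show "ev (\<lambda>\<gamma>. (\<Sum>y\<in>Y. V \<gamma>' y * Z \<gamma> y) = 0)" if "\<gamma>' \<in> \<Gamma>" for \<gamma>'
        unfolding sumY by (rule zero[OF that tJ])
    qed
    moreover have "\<Phi> \<gamma> (Inl t) \<gamma> = (\<Sum>j\<le>N. c j \<gamma> * \<psi> j t \<gamma>)" for \<gamma>
      using t by (simp add: \<Phi>_def \<psi>'_def)
    ultimately show ?thesis unfolding sumY by simp
  qed
  have "r \<le> N"
  proof (rule ccontr)
    assume "\<not> r \<le> N"
    then have rN: "r = Suc N" using r(1) by simp
    define \<psi> where "\<psi> j t = (\<lambda>_::'g. if j = t then 1 else 0 :: 'f)" for j t :: nat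
    have "ev (\<lambda>\<gamma>. (\<Sum>j\<le>N. c j \<gamma> * \<psi> j N \<gamma>) = 0)"
    proof (rule key)
      show "\<psi> j t \<in> quotients" for j t
        using quotients_const[OF LD(2)] quotients_const[OF LD(3)] by (auto simp: \<psi>_def)
      show "ev (\<lambda>\<gamma>. a \<gamma> ^ j = (\<Sum>t<r. \<psi> j t \<gamma> * a \<gamma> ^ t))" if "j \<le> N" for j
        using that rN by (simp add: \<psi>_def mult_delta_left)
    qed (use rN in simp)
    then have "ev (\<lambda>_. False)" by (simp add: \<psi>_def c_def mult_delta_right)
    then show False using ev_False by blast
  qed
  have "\<not> indep (insert r {..<r}) pw"
  proof
    assume "indep (insert r {..<r}) pw"
    then have "Suc r \<in> R" using \<open>r \<le> N\<close> by (simp add: R_def lessThan_Suc)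
    then have "Suc r \<le> r" unfolding r_def using \<open>finite R\<close> by (intro Max_ge)
    then show False by simp
  qed
  from dependent_in_span[OF _ r(2) _ this] have "\<exists>\<phi>. (\<forall>t\<in>{..<r}. \<phi> t \<in> quotients) \<and>
    ev (\<lambda>\<gamma>. pw r \<gamma> = (\<Sum>t<r. \<phi> t \<gamma> * pw t \<gamma>))" by simp
  then obtain \<phi> where \<phi>: "\<forall>t\<in>{..<r}. \<phi> t \<in> quotients"
    "ev (\<lambda>\<gamma>. a \<gamma> ^ r = (\<Sum>t<r. \<phi> t \<gamma> * a \<gamma> ^ t))"
    unfolding pw_def by (elim exE conjE)
  define \<mu> where "\<mu> \<gamma> = Polynomial.monom 1 r - (\<Sum>t<r. Polynomial.monom (\<phi> t \<gamma>) t)" for \<gamma>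
  have \<mu>coeff: "Polynomial.coeff (\<mu> \<gamma>) i = (if i = r then 1 else if i < r then - \<phi> i \<gamma> else 0)" for \<gamma> i
    by (simp add: \<mu>_def coeff_sum coeff_monom)
  have monic: "Polynomial.lead_coeff (\<mu> \<gamma>) = 1" and deg\<mu>: "Polynomial.degree (\<mu> \<gamma>) = r" for \<gamma>
  proof -
    show "Polynomial.degree (\<mu> \<gamma>) = r"
      by (intro antisym degree_le le_degree) (auto simp: \<mu>coeff)
    then show "Polynomial.lead_coeff (\<mu> \<gamma>) = 1" by (simp add: \<mu>coeff)
  qed
  \<comment> \<open>the coefficients of the remainder of \<open>T\<^sup>j\<close> modulo the relation\<close>
  define \<psi> where "\<psi> = rec_nat (\<lambda>t \<gamma>. if t = 0 then 1 else 0 :: 'f)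
    (\<lambda>j p t \<gamma>. (if t = 0 then 0 else p (t - 1) \<gamma>) + (if t < r then p (r - 1) \<gamma> * \<phi> t \<gamma> else 0))"
  have \<psi>0: "\<psi> 0 = (\<lambda>t \<gamma>. if t = 0 then 1 else 0)" and \<psi>Suc: "\<psi> (Suc j) =
    (\<lambda>t \<gamma>. (if t = 0 then 0 else \<psi> j (t - 1) \<gamma>) + (if t < r then \<psi> j (r - 1) \<gamma> * \<phi> t \<gamma> else 0))" for j
    unfolding \<psi>_def by simp_all
  have \<psi>q: "\<psi> j t \<in> quotients" for j t
  proof (induction j arbitrary: t)
    case 0
    then show ?case using quotients_const[OF LD(2)] quotients_const[OF LD(3)] by (simp add: \<psi>0)
  next
    case (Suc j)
    have "(\<lambda>\<gamma>. if t = 0 then 0 else \<psi> j (t - 1) \<gamma>) \<in> quotients"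
      using Suc quotients_const[OF LD(2)] by (cases "t = 0") auto
    moreover have "(\<lambda>\<gamma>. if t < r then \<psi> j (r - 1) \<gamma> * \<phi> t \<gamma> else 0) \<in> quotients"
      using Suc quotients_const[OF LD(2)] \<phi>(1) by (cases "t < r") (auto intro: quotients_mult)
    ultimately show ?case unfolding \<psi>Suc by (rule quotients_add)
  qed
  have rem: "\<mu> \<gamma> dvd Polynomial.monom 1 j - (\<Sum>t<r. Polynomial.monom (\<psi> j t \<gamma>) t)" for j \<gamma>
  proof (induction j)
    case 0
    have "(\<Sum>t<r. Polynomial.monom (\<psi> 0 t \<gamma>) t) = Polynomial.monom 1 0"
      using r(3) by (intro poly_eqI) (auto simp: \<psi>0 coeff_sum coeff_monom)
    then show ?case by simp
  next
    case (Suc j)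
    let ?p = "Polynomial.monom 1 j - (\<Sum>t<r. Polynomial.monom (\<psi> j t \<gamma>) t)"
    have "Polynomial.monom 1 (Suc j) - (\<Sum>t<r. Polynomial.monom (\<psi> (Suc j) t \<gamma>) t) =
        Polynomial.monom 1 1 * ?p + Polynomial.smult (\<psi> j (r - 1) \<gamma>) (\<mu> \<gamma>)"
    proof (rule poly_eqI)
      fix i
      have sum: "Polynomial.coeff (\<Sum>t<r. Polynomial.monom (h t) t) l = (if l < r then h l else 0)"
        for h :: "nat \<Rightarrow> 'f" and l by (simp add: coeff_sum coeff_monom)
      have lhs: "Polynomial.coeff (Polynomial.monom 1 (Suc j) - (\<Sum>t<r. Polynomial.monom (\<psi> (Suc j) t \<gamma>) t)) i =
          (if i = Suc j then 1 else 0) - (if i < r then \<psi> (Suc j) i \<gamma> else 0)"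
        unfolding coeff_diff sum by (simp add: coeff_monom)
      have rhs: "Polynomial.coeff (Polynomial.monom 1 1 * ?p + Polynomial.smult (\<psi> j (r - 1) \<gamma>) (\<mu> \<gamma>)) i =
          (if 1 \<le> i then (if i - 1 = j then 1 else 0) - (if i - 1 < r then \<psi> j (i - 1) \<gamma> else 0) else 0) +
          \<psi> j (r - 1) \<gamma> * (if i = r then 1 else if i < r then - \<phi> i \<gamma> else 0)"
        unfolding coeff_add coeff_monom_mult coeff_diff sum coeff_smult \<mu>coeff by (simp add: coeff_monom)
      have \<psi>i: "\<psi> (Suc j) i \<gamma> = (if i = 0 then 0 else \<psi> j (i - 1) \<gamma>) +
          (if i < r then \<psi> j (r - 1) \<gamma> * \<phi> i \<gamma> else 0)" by (simp only: \<psi>Suc)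
      show "Polynomial.coeff (Polynomial.monom 1 (Suc j) - (\<Sum>t<r. Polynomial.monom (\<psi> (Suc j) t \<gamma>) t)) i =
        Polynomial.coeff (Polynomial.monom 1 1 * ?p + Polynomial.smult (\<psi> j (r - 1) \<gamma>) (\<mu> \<gamma>)) i"
        unfolding lhs rhs \<psi>i using r(3) by (cases "i = 0"; cases "i = r"; cases "i < r") auto
    qed
    then show ?case using Suc.IH by (simp add: dvd_smult)
  qed
  have expj: "ev (\<lambda>\<gamma>. a \<gamma> ^ j = (\<Sum>t<r. \<psi> j t \<gamma> * a \<gamma> ^ t))" for j
    using \<phi>(2)
  proof eventually_elim
    case (elim \<gamma>)
    then have root: "poly (\<mu> \<gamma>) (a \<gamma>) = 0" by (simp add: \<mu>_def poly_monom poly_sum)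
    from rem[of \<gamma> j] obtain q where "Polynomial.monom 1 j - (\<Sum>t<r. Polynomial.monom (\<psi> j t \<gamma>) t) = \<mu> \<gamma> * q"
      by (auto elim: dvdE)
    then have "poly (Polynomial.monom 1 j - (\<Sum>t<r. Polynomial.monom (\<psi> j t \<gamma>) t)) (a \<gamma>) = 0"
      using root by simp
    then show ?case by (simp add: poly_monom poly_sum)
  qed
  have "ev (\<lambda>\<gamma>. \<forall>t\<in>{..<r}. (\<Sum>j\<le>N. c j \<gamma> * \<psi> j t \<gamma>) = 0)"
    using key[OF \<psi>q expj] by (intro eventually_ball_finite) auto
  then have a_eq: "ev (\<lambda>\<gamma>. a \<gamma> = inverse (of_nat r) * \<phi> (r - 1) \<gamma>)"
  proof eventually_elim
    case (elim \<gamma>)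
    have "[:- a \<gamma>, 1:] ^ N = (\<Sum>j\<le>N. Polynomial.smult (c j \<gamma>) (Polynomial.monom 1 j))"
    proof -
      have "[:- a \<gamma>, 1:] ^ N = (Polynomial.monom 1 1 + Polynomial.monom (- a \<gamma>) 0) ^ N"
        by (simp add: monom_Suc monom_0)
      also have "\<dots> = (\<Sum>j\<le>N. of_nat (N choose j) * Polynomial.monom 1 1 ^ j *
          Polynomial.monom (- a \<gamma>) 0 ^ (N - j))"
        by (rule binomial_ring)
      also have "\<dots> = (\<Sum>j\<le>N. Polynomial.smult (c j \<gamma>) (Polynomial.monom 1 j))"
        by (intro sum.cong)
          (simp_all add: c_def monom_power of_nat_monom mult_monom smult_monom)
      finally show ?thesis .
    qed
    moreover have "(\<Sum>j\<le>N. Polynomial.smult (c j \<gamma>) (\<Sum>t<r. Polynomial.monom (\<psi> j t \<gamma>) t)) = 0"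
    proof (rule poly_eqI)
      fix i
      show "Polynomial.coeff (\<Sum>j\<le>N. Polynomial.smult (c j \<gamma>) (\<Sum>t<r. Polynomial.monom (\<psi> j t \<gamma>) t)) i =
          Polynomial.coeff 0 i"
        using elim by (cases "i < r")
          (simp_all add: coeff_sum coeff_monom sum_distrib_left mult_delta_right)
    qed
    ultimately have "[:- a \<gamma>, 1:] ^ N =
        (\<Sum>j\<le>N. Polynomial.smult (c j \<gamma>) (Polynomial.monom 1 j - (\<Sum>t<r. Polynomial.monom (\<psi> j t \<gamma>) t)))"
      by (simp add: smult_diff_right sum_subtractf)
    also have "\<mu> \<gamma> dvd \<dots>" using rem by (intro dvd_sum dvd_smult)
    finally have "\<mu> \<gamma> dvd [:- a \<gamma>, 1:] ^ N" .
    then obtain k where k: "\<mu> \<gamma> = [:- a \<gamma>, 1:] ^ k" using monic_dvd_linear_power monic by blast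
    then have "k = r" using deg\<mu>[of \<gamma>] by (simp add: degree_linear_power)
    then have "Polynomial.coeff (\<mu> \<gamma>) (r - 1) = - of_nat r * a \<gamma>"
      using k coeff_linear_power_pred[of "a \<gamma>" "r - 1"] r(3) by simp
    moreover have "Polynomial.coeff (\<mu> \<gamma>) (r - 1) = - \<phi> (r - 1) \<gamma>"
      using r(3) unfolding \<mu>coeff by (subst if_not_P) auto
    ultimately have "\<phi> (r - 1) \<gamma> = of_nat r * a \<gamma>" by simp
    then show ?case using r(3) by simp
  qed
  have "(\<lambda>\<gamma>. inverse (of_nat r) * \<phi> (r - 1) \<gamma>) \<in> quotients"
    using \<phi>(1) r(3) by (intro quotients_mult[OF quotients_const] LD(8) of_nat_in_L) auto
  then obtain p q where pq: "p \<in> orbit_span" "q \<in> orbit_span" "ev (\<lambda>\<gamma>. q \<gamma> \<noteq> 0)"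
    "ev (\<lambda>\<gamma>. inverse (of_nat r) * \<phi> (r - 1) \<gamma> = p \<gamma> / q \<gamma>)" by (rule quotientsE)
  from a_eq pq(3,4) have "ev (\<lambda>\<gamma>. q \<gamma> * a \<gamma> = p \<gamma>)" by eventually_elim simp
  then obtain m where m: "m \<in> M" "\<And>\<gamma>. \<gamma> \<in> \<Gamma> \<Longrightarrow> m \<gamma> \<noteq> 0 \<Longrightarrow> q \<gamma> * a \<gamma> = p \<gamma>"
    unfolding ev_iff by blast
  have "q \<in> M"
  proof (rule ccontr)
    assume "q \<notin> M"
    then have "ev (\<lambda>\<gamma>. q \<gamma> = 0)" using orbit_span_dichotomy[OF pq(2)] by blast
    with pq(3) have "ev (\<lambda>_. False)" by eventually_elim simp
    then show False using ev_False by blast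
  qed
  moreover have "(\<lambda>\<gamma>. m \<gamma> * q \<gamma> * a \<gamma>) \<in> orbit_span"
  proof (rule orbit_span_cong[of "\<lambda>\<gamma>. m \<gamma> * p \<gamma>"])
    show "(\<lambda>\<gamma>. m \<gamma> * p \<gamma>) \<in> orbit_span" using m(1) MD(1) pq(1) by (auto intro: orbit_span_mult)
    show "m \<gamma> * q \<gamma> * a \<gamma> = m \<gamma> * p \<gamma>" if "\<gamma> \<in> \<Gamma>" for \<gamma>
      using m(2)[OF that] by (cases "m \<gamma> = 0") auto
  qed
  ultimately show ?thesis
    using MD(3)[OF m(1), of q] by (intro bexI[of _ "\<lambda>\<gamma>. m \<gamma> * q \<gamma>"]) simp_all
qed

end

text \<open>A translation-stable finite family of functions that are radicial over the orbit sums consists of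
  orbit sums: the denominators found by localising at a minimal prime ideal multiply to a common
  denominator that is not zero.\<close>

theorem (in semilinear_action) radicial_family_in_orbit_span:
  assumes I: "finite I" and aL: "\<And>i \<gamma>. i \<in> I \<Longrightarrow> \<gamma> \<in> \<Gamma> \<Longrightarrow> a i \<gamma> \<in> L"
    and nil: "\<And>i. i \<in> I \<Longrightarrow> \<exists>N (S :: nat set) f g w. finite S \<and> (\<forall>s\<in>S. \<forall>\<gamma>\<in>\<Gamma>. f s \<gamma> \<in> L) \<and>
      (\<forall>s\<in>S. w s \<in> orbit_span) \<and> (\<forall>\<gamma>'\<in>\<Gamma>. \<forall>\<gamma>\<in>\<Gamma>.
        (a i \<gamma> - a i \<gamma>') ^ N = (\<Sum>s\<in>S. f s \<gamma>' * g s \<gamma> * (w s \<gamma> - w s \<gamma>')))"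
    and trans: "\<And>\<delta>. \<delta> \<in> \<Gamma> \<Longrightarrow> \<exists>u. (\<forall>i\<in>I. \<forall>k\<in>I. u i k \<in> L) \<and>
      (\<forall>\<gamma>\<in>\<Gamma>. \<forall>i\<in>I. a i \<gamma> = (\<Sum>k\<in>I. act \<gamma> (u i k) * a k (mul \<gamma> \<delta>)))"
    and i: "i \<in> I"
  shows "a i \<in> orbit_span"
proof -
  obtain M where "max_mult M" using max_mult_exists by blast
  interpret germs \<Gamma> act mul one L M by unfold_locales fact
  have "\<forall>i\<in>I. \<exists>d. d \<in> M \<and> (\<lambda>\<gamma>. d \<gamma> * a i \<gamma>) \<in> orbit_span"
  proof
    fix i assume i: "i \<in> I"
    from nil[OF i] obtain N and S :: "nat set" and f g w where *: "finite S" "\<forall>s\<in>S. \<forall>\<gamma>\<in>\<Gamma>. f s \<gamma> \<in> L"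
      "\<forall>s\<in>S. w s \<in> orbit_span" "\<forall>\<gamma>'\<in>\<Gamma>. \<forall>\<gamma>\<in>\<Gamma>.
        (a i \<gamma> - a i \<gamma>') ^ N = (\<Sum>s\<in>S. f s \<gamma>' * g s \<gamma> * (w s \<gamma> - w s \<gamma>'))" by (elim exE conjE)
    have "\<exists>d\<in>M. (\<lambda>\<gamma>. d \<gamma> * a i \<gamma>) \<in> orbit_span"
      by (rule radicial_quotient[of S f w "a i" N g]) (use * aL[OF i] in simp_all)
    then show "\<exists>d. d \<in> M \<and> (\<lambda>\<gamma>. d \<gamma> * a i \<gamma>) \<in> orbit_span" by (elim bexE) (intro exI conjI)
  qed
  from bchoice[OF this] obtain d where d: "\<forall>i\<in>I. d i \<in> M \<and> (\<lambda>\<gamma>. d i \<gamma> * a i \<gamma>) \<in> orbit_span" ..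
  have prodM: "(\<lambda>\<gamma>. \<Prod>i\<in>K. d i \<gamma>) \<in> M" if "finite K" "K \<subseteq> I" for K
    using that
  proof (induction K rule: finite_induct)
    case (insert k K)
    then show ?case using MD(3)[of "d k" "\<lambda>\<gamma>. \<Prod>i\<in>K. d i \<gamma>"] d by simp
  qed (use MD(2) in simp)
  show ?thesis
  proof (rule common_denominator_trivial[of "\<lambda>\<gamma>. \<Prod>i\<in>I. d i \<gamma>", OF _ _ _ trans i])
    show "(\<lambda>\<gamma>. \<Prod>i\<in>I. d i \<gamma>) \<in> orbit_span" "\<exists>\<gamma>\<in>\<Gamma>. (\<Prod>i\<in>I. d i \<gamma>) \<noteq> 0"
      using prodM[OF I subset_refl] MD(1) MD(4)[of "\<lambda>\<gamma>. \<Prod>i\<in>I. d i \<gamma>"] by auto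
    fix k assume k: "k \<in> I"
    have "(\<lambda>\<gamma>. \<Prod>i\<in>I - {k}. d i \<gamma>) \<in> orbit_span"
      using d MD(1) by (intro orbit_span_prod) auto
    moreover have "(\<lambda>\<gamma>. d k \<gamma> * a k \<gamma>) \<in> orbit_span" using d k by simp
    ultimately have "(\<lambda>\<gamma>. (\<Prod>i\<in>I - {k}. d i \<gamma>) * (d k \<gamma> * a k \<gamma>)) \<in> orbit_span"
      by (rule orbit_span_mult)
    then show "(\<lambda>\<gamma>. (\<Prod>i\<in>I. d i \<gamma>) * a k \<gamma>) \<in> orbit_span"
      using I k by (simp add: prod.remove[of I k] mult_ac)
  qed
qed

section \<open>Rational functions\<close>

definition rconst :: "'c::field \<Rightarrow> (nat, 'c) mpoly fract" where
  "rconst c = Fract (mconst c) 1"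

definition rvar :: "nat \<Rightarrow> (nat, 'c::field) mpoly fract" where
  "rvar i = Fract (mvar i) 1"

definition ratfuns :: "nat set \<Rightarrow> (nat, 'c::field) mpoly fract set" where
  "ratfuns I = {Fract a b | a b. b \<noteq> 0 \<and> mvars a \<subseteq> I \<and> mvars b \<subseteq> I}"

lemma comm_ring_hom_rconst: "comm_ring_hom rconst"
  unfolding rconst_def using comm_ring_hom_comp[OF comm_ring_hom_mconst comm_ring_hom_Fract]
  by (simp add: o_def)

lemma rconst_simps [simp]: "rconst 0 = 0" "rconst 1 = 1" "rconst (a + b) = rconst a + rconst b"
  "rconst (a * b) = rconst a * rconst b" "rconst (- a) = - rconst a" "rconst (a - b) = rconst a - rconst b"
  "rconst (a / b) = rconst a / rconst b" "rconst (inverse a) = inverse (rconst a)"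
  "rconst a = 0 \<longleftrightarrow> a = 0" "rconst (a ^ k) = rconst a ^ k"
proof -
  interpret comm_ring_hom rconst by (rule comm_ring_hom_rconst)
  show "rconst 0 = 0" "rconst 1 = 1" "rconst (a + b) = rconst a + rconst b"
    "rconst (a * b) = rconst a * rconst b" "rconst (- a) = - rconst a" "rconst (a - b) = rconst a - rconst b"
    "rconst (a ^ k) = rconst a ^ k"
    by (simp_all add: hom_add hom_mult hom_minus hom_uminus hom_power)
  show "rconst (a / b) = rconst a / rconst b" "rconst (inverse a) = inverse (rconst a)"
    "rconst a = 0 \<longleftrightarrow> a = 0"
    by (simp_all add: hom_divide[OF comm_ring_hom_rconst] hom_eq_0_iff[OF comm_ring_hom_rconst])
qed

lemma rconst_sum: "rconst (\<Sum>x\<in>K. g x) = (\<Sum>x\<in>K. rconst (g x))"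
  by (induction K rule: infinite_finite_induct) auto

lemma rconst_inject: "rconst a = rconst b \<longleftrightarrow> a = b"
  using rconst_simps(9)[of "a - b"] unfolding rconst_simps by auto

lemma meval_rconst_rvar: "meval rconst rvar p = Fract p 1"
  by (rule mpoly_hom_eqI[OF comm_ring_hom_meval[OF comm_ring_hom_rconst] comm_ring_hom_Fract])
    (simp_all add: rconst_def[symmetric] rvar_def[symmetric])

lemma Fract_eq_meval: "Fract a b = meval rconst rvar a / meval rconst rvar b"
  by (simp add: meval_rconst_rvar)

lemma meval_rconst_rvar_eq_0_iff: "meval rconst rvar p = 0 \<longleftrightarrow> p = 0"
  by (simp add: meval_rconst_rvar Zero_fract_def eq_fract)

lemma ratfuns_gen_field:
  "(ratfuns I :: (nat, 'c::field) mpoly fract set) = gen_field (range rconst \<union> rvar ` I)"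
proof (rule antisym)
  let ?R = "ratfuns I :: (nat, 'c) mpoly fract set"
  let ?G = "gen_field (range rconst \<union> rvar ` I) :: (nat, 'c) mpoly fract set"
  note G = subfield_setD[OF subfield_set_gen_field[of "range rconst \<union> rvar ` I :: (nat, 'c) mpoly fract set"]]
  have incl: "range rconst \<union> rvar ` I \<subseteq> ?G" by (rule gen_field_incl)
  have mem: "meval rconst rvar p \<in> ?G" if "mvars p \<subseteq> I" for p :: "(nat, 'c) mpoly"
    using that incl by (intro meval_in_subring G(1)) auto
  show "?R \<subseteq> ?G"
  proof
    fix x :: "(nat, 'c) mpoly fract" assume "x \<in> ?R"
    then obtain a b where x: "x = Fract a b" "mvars a \<subseteq> I" "mvars b \<subseteq> I" unfolding ratfuns_def by blast
    show "x \<in> ?G"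
      unfolding x(1) Fract_eq_meval by (rule G(9)[OF mem[OF x(2)] mem[OF x(3)]])
  qed
  show "?G \<subseteq> ?R"
  proof (rule gen_field_minimal)
    have mult: "a * b \<in> ?R" and add: "a + b \<in> ?R"
      if ab: "a \<in> ?R" "b \<in> ?R" for a b :: "(nat, 'c) mpoly fract"
    proof -
      obtain p q r s where *: "a = Fract p q" "q \<noteq> 0" "mvars p \<subseteq> I" "mvars q \<subseteq> I"
        "b = Fract r s" "s \<noteq> 0" "mvars r \<subseteq> I" "mvars s \<subseteq> I" using ab unfolding ratfuns_def by blast
      have m: "mvars (x * y) \<subseteq> I" if "mvars x \<subseteq> I" "mvars y \<subseteq> I" for x y :: "(nat, 'c) mpoly"
        using that mvars_mult[of x y] by blast
      have "mvars (p * s + r * q) \<subseteq> I"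
        using mvars_add[of "p * s" "r * q"] m[OF *(3) *(8)] m[OF *(7) *(4)] by blast
      then show "a * b \<in> ?R" "a + b \<in> ?R"
        unfolding ratfuns_def mem_Collect_eq using * m
        by - (rule exI[of _ "p * r"] exI[of _ "p * s + r * q"], rule exI[of _ "q * s"], simp add: mult.commute)+
    qed
    have "(0 :: (nat, 'c) mpoly fract) \<in> ?R" "(1 :: (nat, 'c) mpoly fract) \<in> ?R"
      unfolding ratfuns_def mem_Collect_eq
      by (rule exI[of _ 0], rule exI[of _ 1], simp add: Zero_fract_def)
        (rule exI[of _ 1], rule exI[of _ 1], simp add: One_fract_def)
    moreover have "- a \<in> ?R" if "a \<in> ?R" for a :: "(nat, 'c) mpoly fract"
    proof -
      obtain p q where "a = Fract p q" "q \<noteq> 0" "mvars p \<subseteq> I" "mvars q \<subseteq> I"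
        using \<open>a \<in> ?R\<close> unfolding ratfuns_def by blast
      then show ?thesis unfolding ratfuns_def mem_Collect_eq
        by (intro exI[of _ "- p"] exI[of _ q]) simp
    qed
    moreover have "inverse a \<in> ?R" if "a \<in> ?R" for a :: "(nat, 'c) mpoly fract"
    proof (cases "a = 0")
      case False
      obtain p q where "a = Fract p q" "q \<noteq> 0" "mvars p \<subseteq> I" "mvars q \<subseteq> I"
        using \<open>a \<in> ?R\<close> unfolding ratfuns_def by blast
      moreover from this False have "p \<noteq> 0" by (auto simp: fract_collapse)
      ultimately show ?thesis unfolding ratfuns_def mem_Collect_eq
        by (intro exI[of _ q] exI[of _ p]) simp
    qed (use \<open>0 \<in> ?R\<close> in simp)
    ultimately show "subfield_set ?R"
      using mult add unfolding subfield_set_def subring_set_def by (intro conjI ballI)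
    have "rconst c \<in> ?R" for c :: 'c
      unfolding ratfuns_def rconst_def mem_Collect_eq by (rule exI[of _ "mconst c"], rule exI[of _ 1]) simp
    moreover have "(rvar i :: (nat, 'c) mpoly fract) \<in> ?R" if "i \<in> I" for i
      unfolding ratfuns_def rvar_def mem_Collect_eq using that
      by (intro exI[of _ "mvar i"] exI[of _ 1]) simp
    ultimately show "range rconst \<union> rvar ` I \<subseteq> ?R" by blast
  qed
qed

lemma function_field_eq_ratfuns: "function_field m = ratfuns {..<m}"
  by (simp add: function_field_def ratfuns_def)

lemma subfield_set_ratfuns: "subfield_set (ratfuns I)"
  unfolding ratfuns_gen_field by (rule subfield_set_gen_field)

lemma rconst_in_ratfuns [simp]: "rconst c \<in> ratfuns I"
  and rvar_in_ratfuns: "i \<in> I \<Longrightarrow> rvar i \<in> ratfuns I"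
  unfolding ratfuns_gen_field using gen_field_incl[of "range rconst \<union> rvar ` I"] by auto

lemma ratfuns_hom_eqI:
  fixes g h :: "(nat, 'c::field) mpoly fract \<Rightarrow> 'e::field"
  assumes "comm_ring_hom g" "comm_ring_hom h" "\<And>c. g (rconst c) = h (rconst c)"
    and "\<And>i. i \<in> I \<Longrightarrow> g (rvar i) = h (rvar i)" and x: "x \<in> ratfuns I"
  shows "g x = h x"
proof -
  interpret g: comm_ring_hom g by fact
  interpret h: comm_ring_hom h by fact
  have "subfield_set {x. g x = h x}"
    unfolding subfield_set_def subring_set_def
    by (auto simp: g.hom_add h.hom_add g.hom_mult h.hom_mult g.hom_uminus h.hom_uminus
        hom_divide[OF assms(1)] hom_divide[OF assms(2)])
  then have "gen_field (range rconst \<union> rvar ` I) \<subseteq> {x. g x = h x}"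
    using assms(3,4) by (intro gen_field_minimal) auto
  with x show ?thesis by (auto simp: ratfuns_gen_field)
qed

lemma ratfuns_image_subset:
  fixes g :: "(nat, 'c::field) mpoly fract \<Rightarrow> 'e::field"
  assumes "comm_ring_hom g" "subfield_set K" "\<And>c. g (rconst c) \<in> K" "\<And>i. i \<in> I \<Longrightarrow> g (rvar i) \<in> K"
    and x: "x \<in> ratfuns I"
  shows "g x \<in> K"
proof -
  have "gen_field (range rconst \<union> rvar ` I) \<subseteq> {x. g x \<in> K}"
  proof (rule gen_field_minimal)
    show "subfield_set {x. g x \<in> K}" by (rule subfield_set_vimage[OF assms(1,2)])
    show "range rconst \<union> rvar ` I \<subseteq> {x. g x \<in> K}" using assms(3,4) by auto
  qed
  with x show ?thesis by (auto simp: ratfuns_gen_field)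
qed

section \<open>Matrices over a subfield\<close>

lemma det_in_subring:
  assumes "subring_set L" "A \<in> carrier_mat n n" "\<And>i j. i < n \<Longrightarrow> j < n \<Longrightarrow> A $$ (i, j) \<in> L"
  shows "det A \<in> L"
proof -
  have "signof \<pi> \<in> L" for \<pi> :: "nat \<Rightarrow> nat"
    using subring_setD[OF assms(1)] by (auto simp: sign_def)
  then show ?thesis
    unfolding det_def'[OF assms(2)] using assms(2,3)
    by (intro subring_set_sum[OF assms(1)] subring_setD(5)[OF assms(1)] subring_set_prod[OF assms(1)])
      (auto simp: permutes_in_image dest: permutes_in_image)
qed

text \<open>By Cramer's rule the entries of the inverse are rational in the entries of the matrix.\<close>

lemma inverse_matrix_over_subfield:
  fixes A :: "'f::field mat"
  assumes "subfield_set L" "A \<in> carrier_mat n n" "\<And>i j. i < n \<Longrightarrow> j < n \<Longrightarrow> A $$ (i, j) \<in> L" "det A \<noteq> 0"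
  shows "\<exists>A'\<in>carrier_mat n n. A * A' = 1\<^sub>m n \<and> A' * A = 1\<^sub>m n \<and> (\<forall>i<n. \<forall>j<n. A' $$ (i, j) \<in> L)"
proof -
  note L = subfield_setD[OF assms(1)]
  define A' where "A' = inverse (det A) \<cdot>\<^sub>m adj_mat A"
  have adj: "adj_mat A \<in> carrier_mat n n" using adj_mat(1)[OF assms(2)] .
  have A': "A' \<in> carrier_mat n n" unfolding A'_def using adj by simp
  have "A * A' = inverse (det A) \<cdot>\<^sub>m (A * adj_mat A)"
    unfolding A'_def using assms(2) adj by (simp add: mult_smult_distrib)
  also have "\<dots> = 1\<^sub>m n" unfolding adj_mat(2)[OF assms(2)] using assms(4) by (intro eq_matI) auto
  finally have 1: "A * A' = 1\<^sub>m n" .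
  have "A' * A = inverse (det A) \<cdot>\<^sub>m (adj_mat A * A)"
    unfolding A'_def using assms(2) adj by (simp add: mult_smult_assoc_mat)
  also have "\<dots> = 1\<^sub>m n" unfolding adj_mat(3)[OF assms(2)] using assms(4) by (intro eq_matI) auto
  finally have 2: "A' * A = 1\<^sub>m n" .
  have "A' $$ (i, j) \<in> L" if "i < n" "j < n" for i j
  proof -
    have "det (mat_delete A j i) \<in> L"
      using assms(2,3) that
      by (intro det_in_subring[OF L(1), of _ "n - 1"])
        (auto simp: mat_delete_def)
    moreover have "(-1) ^ (j + i) \<in> L" using L by (intro subring_set_power[OF L(1)]) auto
    moreover have "det A \<in> L" by (rule det_in_subring[OF L(1) assms(2,3)])
    ultimately show ?thesis
      using that assms(2) adj L(6,8) by (simp add: A'_def adj_mat_def cofactor_def)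
  qed
  then show ?thesis using A' 1 2 by blast
qed

section \<open>Vector bundles over the quotient are generically trivial\<close>

text \<open>\<open>frame_coord F' p q off\<close>: the coordinates, in the frame with inverse \<open>F'\<close>, of \<open>q\<close> vectors of length
  \<open>p\<close>, the coordinate \<open>j\<close> of the vector \<open>b\<close> being the variable with index \<open>off + j * q + b\<close>.\<close>

definition frame_coord :: "(nat, 'c::field) mpoly fract mat \<Rightarrow> nat \<Rightarrow> nat \<Rightarrow> nat \<Rightarrow> nat \<Rightarrow> (nat, 'c) mpoly fract" where
  "frame_coord F' p q off i = (\<Sum>k<p. F' $$ (i div q, k) * rvar (off + k * q + i mod q))"

text \<open>The matrix \<open>F\<close> is a frame of the trivial bundle of rank \<open>p\<close> over the space with coordinates \<open>I\<close>; the fibre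
  is taken \<open>q\<close> times.\<close>

locale frame =
  fixes F F' :: "(nat, 'c::field_char_0) mpoly fract mat" and p q off :: nat and I :: "nat set"
  assumes F: "F \<in> carrier_mat p p" "F' \<in> carrier_mat p p" "F * F' = 1\<^sub>m p" "F' * F = 1\<^sub>m p"
    and FL: "\<And>i j. i < p \<Longrightarrow> j < p \<Longrightarrow> F $$ (i, j) \<in> ratfuns I" "\<And>i j. i < p \<Longrightarrow> j < p \<Longrightarrow> F' $$ (i, j) \<in> ratfuns I"
    and disj: "I \<inter> {off..<off + p * q} = {}"
begin

abbreviation t :: "nat \<Rightarrow> (nat, 'c) mpoly fract" where
  "t \<equiv> frame_coord F' p q off"

lemma index_bound: "j < p \<Longrightarrow> b < q \<Longrightarrow> j * q + b < p * q"
  by (metis mult_le_mono1 Suc_leI add_less_cancel_left less_le_trans mult_Suc add.commute)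

lemma index_div_mod [simp]: "b < q \<Longrightarrow> (j * q + b) div q = j" "b < q \<Longrightarrow> (j * q + b) mod q = b"
  by auto

lemma index_cases:
  assumes "i < p * q"
  obtains j b where "i = j * q + b" "j < p" "b < q"
proof -
  have "q > 0" using assms by (cases q) auto
  then show ?thesis using that[of "i div q" "i mod q"] assms by (simp add: less_mult_imp_div_less)
qed

lemma inv_sums:
  assumes "i < p" "j < p"
  shows "(\<Sum>k<p. F $$ (i, k) * F' $$ (k, j)) = (if i = j then 1 else 0)"
    "(\<Sum>k<p. F' $$ (i, k) * F $$ (k, j)) = (if i = j then 1 else 0)"
proof -
  have "(F * F') $$ (i, j) = (\<Sum>k<p. F $$ (i, k) * F' $$ (k, j))"
    "(F' * F) $$ (i, j) = (\<Sum>k<p. F' $$ (i, k) * F $$ (k, j))"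
    using F assms by (intro index_mat_mult_lessThan; simp)+
  then show "(\<Sum>k<p. F $$ (i, k) * F' $$ (k, j)) = (if i = j then 1 else 0)"
    "(\<Sum>k<p. F' $$ (i, k) * F $$ (k, j)) = (if i = j then 1 else 0)"
    using F(3,4) assms by auto
qed

lemma inverse_sum:
  fixes u v :: "nat \<Rightarrow> nat \<Rightarrow> 'e::field" and w :: "nat \<Rightarrow> 'e"
  assumes "\<And>i j. i < p \<Longrightarrow> j < p \<Longrightarrow> (\<Sum>k<p. u i k * v k j) = (if i = j then 1 else 0)" "j < p"
  shows "(\<Sum>k<p. u j k * (\<Sum>l<p. v k l * w l)) = w j"
proof -
  have "(\<Sum>k<p. u j k * (\<Sum>l<p. v k l * w l)) = (\<Sum>l<p. (\<Sum>k<p. u j k * v k l) * w l)"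
    unfolding sum_distrib_left sum_distrib_right by (subst sum.swap) (simp add: mult.assoc)
  also have "\<dots> = (\<Sum>l<p. (if j = l then 1 else 0) * w l)" using assms by (intro sum.cong) auto
  also have "\<dots> = w j" using assms(2) by (simp add: mult_delta_left)
  finally show ?thesis .
qed

lemma t_eq: "j < p \<Longrightarrow> b < q \<Longrightarrow> t (j * q + b) = (\<Sum>k<p. F' $$ (j, k) * rvar (off + k * q + b))"
  by (simp add: frame_coord_def)

lemma rvar_eq: "j < p \<Longrightarrow> b < q \<Longrightarrow> rvar (off + j * q + b) = (\<Sum>k<p. F $$ (j, k) * t (k * q + b))"
  using inverse_sum[of "\<lambda>i k. F $$ (i, k)" "\<lambda>i k. F' $$ (i, k)" j "\<lambda>k. rvar (off + k * q + b)"] inv_sums(1)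
  by (simp add: t_eq)

lemma ratfuns_eq: "ratfuns (I \<union> {off..<off + p * q}) = gen_field (ratfuns I \<union> t ` {..<p * q})"
proof (rule antisym)
  let ?G = "gen_field (ratfuns I \<union> t ` {..<p * q})"
  note G = subfield_setD[OF subfield_set_gen_field[of "ratfuns I \<union> t ` {..<p * q}"]]
  have incl: "ratfuns I \<subseteq> ?G" "t ` {..<p * q} \<subseteq> ?G" using gen_field_incl[of "ratfuns I \<union> t ` {..<p * q}"] by auto
  show "ratfuns (I \<union> {off..<off + p * q}) \<subseteq> ?G"
    unfolding ratfuns_gen_field[of "I \<union> {off..<off + p * q}"]
  proof (rule gen_field_minimal)
    have "rvar i \<in> ?G" if "i \<in> {off..<off + p * q}" for i
    proof -
      have "i - off < p * q" using that by auto
      then obtain j b where jb: "i - off = j * q + b" "j < p" "b < q" by (rule index_cases)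
      then have "i = off + j * q + b" using that by auto
      then have "rvar i = (\<Sum>k<p. F $$ (j, k) * t (k * q + b))" using rvar_eq jb by simp
      also have "\<dots> \<in> ?G"
        using FL(1)[OF jb(2)] incl index_bound[OF _ jb(3)]
        by (intro subring_set_sum[OF G(1)] G(6)) auto
      finally show ?thesis .
    qed
    then show "range rconst \<union> rvar ` (I \<union> {off..<off + p * q}) \<subseteq> ?G"
      using incl(1) rvar_in_ratfuns by (auto dest: subsetD)
  qed simp
  show "?G \<subseteq> ratfuns (I \<union> {off..<off + p * q})"
  proof (rule gen_field_minimal)
    note R = subfield_setD[OF subfield_set_ratfuns[of "I \<union> {off..<off + p * q}"]]
    have sub: "ratfuns I \<subseteq> ratfuns (I \<union> {off..<off + p * q})"
      unfolding ratfuns_gen_field by (intro gen_field_mono) auto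
    have "t i \<in> ratfuns (I \<union> {off..<off + p * q})" if i: "i < p * q" for i
    proof -
      from i obtain j b where jb: "i = j * q + b" "j < p" "b < q" by (rule index_cases)
      have "rvar (off + k * q + b) \<in> ratfuns (I \<union> {off..<off + p * q})" if "k < p" for k
        using index_bound[OF that jb(3)] by (intro rvar_in_ratfuns) auto
      then show ?thesis
        unfolding jb(1) t_eq[OF jb(2,3)] using FL(2)[OF jb(2)] sub
        by (intro subring_set_sum[OF R(1)] R(6)) auto
    qed
    then show "ratfuns I \<union> t ` {..<p * q} \<subseteq> ratfuns (I \<union> {off..<off + p * q})" using sub by auto
  qed (rule subfield_set_ratfuns)
qed

text \<open>The old fibre coordinates as linear forms in the coordinates with respect to the frame, the latter
  being the variables of the outer polynomial ring.\<close>

definition fibre_subst :: "(nat, 'c) mpoly \<Rightarrow> (nat, (nat, 'c) mpoly fract) mpoly" where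
  "fibre_subst = meval (\<lambda>c. mconst (rconst c)) (\<lambda>i. if i \<in> {off..<off + p * q}
     then \<Sum>k<p. mconst (F $$ ((i - off) div q, k)) * mvar (k * q + (i - off) mod q) else mconst (rvar i))"

lemma comm_ring_hom_fibre_subst: "comm_ring_hom fibre_subst"
  unfolding fibre_subst_def
  using comm_ring_hom_comp[OF comm_ring_hom_rconst comm_ring_hom_mconst]
  by (intro comm_ring_hom_meval) (simp add: o_def)

lemma fibre_subst_gens:
  "fibre_subst (mconst c) = mconst (rconst c)"
  "i \<notin> {off..<off + p * q} \<Longrightarrow> fibre_subst (mvar i) = mconst (rvar i)"
  "j < p \<Longrightarrow> b < q \<Longrightarrow> fibre_subst (mvar (off + j * q + b)) = (\<Sum>k<p. mconst (F $$ (j, k)) * mvar (k * q + b))"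
proof -
  interpret m: comm_ring_hom "mconst :: (nat, 'c) mpoly fract \<Rightarrow> (nat, (nat, 'c) mpoly fract) mpoly"
    by (rule comm_ring_hom_mconst)
  show "fibre_subst (mconst c) = mconst (rconst c)"
    "i \<notin> {off..<off + p * q} \<Longrightarrow> fibre_subst (mvar i) = mconst (rvar i)"
    unfolding fibre_subst_def by (subst meval_mconst; simp) (subst meval_mvar; auto)
  show "j < p \<Longrightarrow> b < q \<Longrightarrow> fibre_subst (mvar (off + j * q + b)) = (\<Sum>k<p. mconst (F $$ (j, k)) * mvar (k * q + b))"
    unfolding fibre_subst_def using index_bound[of j b]
    by (subst meval_mvar) (simp_all add: add.assoc)
qed

lemma eval_fibre_subst: "meval id t (fibre_subst a) = meval rconst rvar a"
proof -
  note ev = comm_ring_hom_meval[OF comm_ring_hom_id, of t]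
  interpret ev: comm_ring_hom "meval id t" by (rule ev)
  show ?thesis
  proof (rule mpoly_hom_eqI[of "\<lambda>a. meval id t (fibre_subst a)" "meval rconst rvar"])
    show "comm_ring_hom (\<lambda>a. meval id t (fibre_subst a))"
      using comm_ring_hom_comp[OF comm_ring_hom_fibre_subst ev] by (simp add: o_def)
    show "comm_ring_hom (meval rconst rvar)" by (rule comm_ring_hom_meval[OF comm_ring_hom_rconst])
    show "meval id t (fibre_subst (mconst c)) = meval rconst rvar (mconst c)" for c
      by (simp add: fibre_subst_gens)
    show "meval id t (fibre_subst (mvar i)) = meval rconst rvar (mvar i)" for i
    proof (cases "i \<in> {off..<off + p * q}")
      case True
      then have "i - off < p * q" by auto
      then obtain j b where jb: "i - off = j * q + b" "j < p" "b < q" by (rule index_cases)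
      then have i: "i = off + j * q + b" using True by auto
      show ?thesis
        unfolding i fibre_subst_gens(3)[OF jb(2,3)]
        by (simp add: ev.hom_sum ev.hom_mult rvar_eq[OF jb(2,3)])
    qed (simp add: fibre_subst_gens)
  qed
qed

text \<open>The coordinates in the frame become new independent variables over the base.\<close>

definition fibre_map :: "(nat, 'c) mpoly fract \<Rightarrow> (nat, (nat, 'c) mpoly fract) mpoly fract" where
  "fibre_map = fract_ext (\<lambda>a. Fract (fibre_subst a) 1)"

lemma fibre_map:
  shows comm_ring_hom_fibre_map: "comm_ring_hom fibre_map"
    and fibre_map_Fract: "b \<noteq> 0 \<Longrightarrow> fibre_map (Fract a b) = Fract (fibre_subst a) 1 / Fract (fibre_subst b) 1"
proof -
  have hom: "comm_ring_hom (\<lambda>a. Fract (fibre_subst a) 1)"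
    using comm_ring_hom_comp[OF comm_ring_hom_fibre_subst comm_ring_hom_Fract] by (simp add: o_def)
  have inj: "a = 0" if "Fract (fibre_subst a) 1 = 0" for a
  proof -
    have "fibre_subst a = 0" using that by (simp add: Zero_fract_def eq_fract)
    then have "meval rconst rvar a = 0" using eval_fibre_subst[of a] by (simp add: meval_def)
    then show ?thesis by (simp add: meval_rconst_rvar_eq_0_iff)
  qed
  show "comm_ring_hom fibre_map" unfolding fibre_map_def by (rule comm_ring_hom_fract_ext[OF hom inj])
  show "b \<noteq> 0 \<Longrightarrow> fibre_map (Fract a b) = Fract (fibre_subst a) 1 / Fract (fibre_subst b) 1"
    unfolding fibre_map_def by (rule fract_ext_Fract[OF hom inj])
qed

lemma fibre_map_base:
  assumes "x \<in> ratfuns I"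
  shows "fibre_map x = Fract (mconst x) 1"
proof (rule ratfuns_hom_eqI[OF comm_ring_hom_fibre_map _ _ _ assms])
  show "comm_ring_hom (\<lambda>x. Fract (mconst x) 1)"
    using comm_ring_hom_comp[OF comm_ring_hom_mconst comm_ring_hom_Fract] by (simp add: o_def)
  interpret f: comm_ring_hom fibre_subst by (rule comm_ring_hom_fibre_subst)
  show "fibre_map (rconst c) = Fract (mconst (rconst c)) 1" for c
    unfolding rconst_def[of c] by (subst fibre_map_Fract) (simp_all add: fibre_subst_gens rconst_def)
  show "fibre_map (rvar i) = Fract (mconst (rvar i)) 1" if "i \<in> I" for i
  proof -
    have "i \<notin> {off..<off + p * q}" using that disj by blast
    note * = fibre_subst_gens(2)[OF this]
    show ?thesis
      unfolding rvar_def[of i] by (subst fibre_map_Fract) (simp_all add: * rvar_def)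
  qed
qed

lemma fibre_map_t:
  assumes "i < p * q"
  shows "fibre_map (t i) = Fract (mvar i) 1"
proof -
  interpret f: comm_ring_hom fibre_subst by (rule comm_ring_hom_fibre_subst)
  interpret h: comm_ring_hom fibre_map by (rule comm_ring_hom_fibre_map)
  interpret E: comm_ring_hom "\<lambda>a. Fract a 1 :: (nat, (nat, 'c) mpoly fract) mpoly fract" by (rule comm_ring_hom_Fract)
  interpret m: comm_ring_hom "mconst :: (nat, 'c) mpoly fract \<Rightarrow> (nat, (nat, 'c) mpoly fract) mpoly"
    by (rule comm_ring_hom_mconst)
  from assms obtain j b where jb: "i = j * q + b" "j < p" "b < q" by (rule index_cases)
  have "fibre_map (rvar (off + k * q + b)) = Fract (\<Sum>l<p. mconst (F $$ (k, l)) * mvar (l * q + b)) 1" if "k < p" for k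
    unfolding rvar_def by (subst fibre_map_Fract) (simp_all add: fibre_subst_gens(3)[OF that jb(3)])
  then have "fibre_map (t i) =
      Fract (\<Sum>k<p. mconst (F' $$ (j, k)) * (\<Sum>l<p. mconst (F $$ (k, l)) * mvar (l * q + b))) 1"
    unfolding jb(1) t_eq[OF jb(2,3)] using FL(2)[OF jb(2)]
    by (simp add: h.hom_sum h.hom_mult fibre_map_base E.hom_sum E.hom_mult del: mult_fract)
  also have "(\<Sum>k<p. mconst (F' $$ (j, k)) * (\<Sum>l<p. mconst (F $$ (k, l)) * mvar (l * q + b))) =
      (\<Sum>l<p. mconst (\<Sum>k<p. F' $$ (j, k) * F $$ (k, l)) * mvar (l * q + b))"
    unfolding sum_distrib_left m.hom_sum m.hom_mult sum_distrib_right by (subst sum.swap) (simp add: mult.assoc)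
  also have "\<dots> = (\<Sum>l<p. (if j = l then 1 else 0) * mvar (l * q + b))"
    using jb(2) by (intro sum.cong) (auto simp: inv_sums)
  also have "\<dots> = mvar i" using jb by (simp add: mult_delta_left)
  finally show ?thesis .
qed

text \<open>An algebraic relation would be carried by \<open>fibre_map\<close> to a relation among variables.\<close>

lemma alg_indep_t: "alg_indep_family (ratfuns I) {..<p * q} t"
  unfolding alg_indep_family_def
proof (intro ballI impI)
  fix a assume a: "a \<in> mpolys (ratfuns I) {..<p * q}" and 0: "meval id t a = 0"
  interpret h: comm_ring_hom fibre_map by (rule comm_ring_hom_fibre_map)
  have "meval (\<lambda>c. Fract (mconst c) 1) (\<lambda>i. Fract (mvar i) 1) a = fibre_map (meval id t a)"
    unfolding hom_meval[OF comm_ring_hom_fibre_map]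
    using a by (intro meval_cong) (auto simp: mpolys_def fibre_map_base fibre_map_t subset_iff)
  then have "meval rconst rvar a = 0" using 0 by (simp add: rconst_def[abs_def] rvar_def[abs_def])
  then show "a = 0" by (simp add: meval_rconst_rvar_eq_0_iff)
qed

end

section \<open>The orthogonal group and its action\<close>

lemma unit_vec_mult_mat:
  assumes "M \<in> carrier_mat n n" "i < n" "j < n"
  shows "unit_vec n i \<bullet> (M *\<^sub>v unit_vec n j) = (M $$ (i, j) :: 'b::comm_ring_1)"
  using assms by (simp add: scalar_prod_left_unit scalar_prod_right_unit)

lemma polar_form_eq:
  fixes D :: "'b::comm_ring_1 mat"
  assumes D: "D \<in> carrier_mat n n" and v: "v \<in> carrier_vec n" and w: "w \<in> carrier_vec n"
  shows "polar_form D v w = v \<bullet> ((D + D\<^sup>T) *\<^sub>v w)"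
proof -
  have Dv: "D *\<^sub>v v \<in> carrier_vec n" "D *\<^sub>v w \<in> carrier_vec n" "D\<^sup>T *\<^sub>v w \<in> carrier_vec n" using D v w by auto
  have "quad_form D (v + w) = (v + w) \<bullet> (D *\<^sub>v v + D *\<^sub>v w)"
    using D v w by (simp add: quad_form_def mult_add_distrib_mat_vec)
  also have "\<dots> = quad_form D v + v \<bullet> (D *\<^sub>v w) + (w \<bullet> (D *\<^sub>v v) + quad_form D w)"
    using v w Dv
    by (simp add: quad_form_def add_scalar_prod_distrib[of _ n] scalar_prod_add_distrib[of _ n])
  also have "w \<bullet> (D *\<^sub>v v) = v \<bullet> (D\<^sup>T *\<^sub>v w)"
  proof -
    have "(D\<^sup>T *\<^sub>v w) \<bullet> v = w \<bullet> (D *\<^sub>v v)" by (rule transpose_vec_mult_scalar[OF D v w])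
    then show ?thesis using comm_scalar_prod[OF Dv(3) v] by simp
  qed
  finally have "polar_form D v w = v \<bullet> (D *\<^sub>v w) + v \<bullet> (D\<^sup>T *\<^sub>v w)" by (simp add: polar_form_def)
  also have "\<dots> = v \<bullet> (D *\<^sub>v w + D\<^sup>T *\<^sub>v w)"
    using v Dv by (simp add: scalar_prod_add_distrib[of _ n])
  also have "D *\<^sub>v w + D\<^sup>T *\<^sub>v w = (D + D\<^sup>T) *\<^sub>v w"
    using D w by (simp add: add_mult_distrib_mat_vec[of _ n n])
  finally show ?thesis .
qed

lemma gram_entry:
  assumes "A \<in> carrier_mat n n" "B \<in> carrier_mat n n" "i < n" "j < n"
  shows "(A\<^sup>T * B * A) $$ (i, j) = (\<Sum>l<n. (\<Sum>k<n. A $$ (k, i) * B $$ (k, l)) * (A $$ (l, j) :: 'b::comm_ring_1))"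
proof -
  have "(A\<^sup>T * B * A) $$ (i, j) = (\<Sum>l<n. (A\<^sup>T * B) $$ (i, l) * A $$ (l, j))"
    using assms by (intro index_mat_mult_lessThan) auto
  also have "\<dots> = (\<Sum>l<n. (\<Sum>k<n. A\<^sup>T $$ (i, k) * B $$ (k, l)) * A $$ (l, j))"
    using assms by (intro sum.cong arg_cong2[where f = "(*)"] index_mat_mult_lessThan) auto
  finally show ?thesis using assms by simp
qed

lemma scalar_prod_gram:
  fixes A :: "'b::comm_ring_1 mat"
  assumes A: "A \<in> carrier_mat n n" and B: "B \<in> carrier_mat n n" and v: "v \<in> carrier_vec n" and w: "w \<in> carrier_vec n"
  shows "(A *\<^sub>v v) \<bullet> (B *\<^sub>v (A *\<^sub>v w)) = v \<bullet> ((A\<^sup>T * B * A) *\<^sub>v w)"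
proof -
  have "(A\<^sup>T * B * A) *\<^sub>v w = (A\<^sup>T * B) *\<^sub>v (A *\<^sub>v w)"
    using A B w by (intro assoc_mult_mat_vec[of _ n n _ n]) auto
  also have "\<dots> = A\<^sup>T *\<^sub>v (B *\<^sub>v (A *\<^sub>v w))"
    using A B w by (intro assoc_mult_mat_vec[of _ n n _ n]) auto
  finally have 1: "(A\<^sup>T * B * A) *\<^sub>v w = A\<^sup>T *\<^sub>v (B *\<^sub>v (A *\<^sub>v w))" .
  have c: "B *\<^sub>v (A *\<^sub>v w) \<in> carrier_vec n" "A *\<^sub>v v \<in> carrier_vec n" "A\<^sup>T *\<^sub>v (B *\<^sub>v (A *\<^sub>v w)) \<in> carrier_vec n"
    using A B v w by auto
  have "(A\<^sup>T *\<^sub>v (B *\<^sub>v (A *\<^sub>v w))) \<bullet> v = (B *\<^sub>v (A *\<^sub>v w)) \<bullet> (A *\<^sub>v v)"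
    by (rule transpose_vec_mult_scalar[OF A v c(1)])
  then show ?thesis using comm_scalar_prod[OF c(1,2)] comm_scalar_prod[OF c(3) v] 1 by simp
qed

locale quadratic_space =
  fixes n :: nat and B :: "'a::field_char_0 alg_closure mat"
  assumes B: "B \<in> carrier_mat n n" "B\<^sup>T = B" "det B \<noteq> 0"
    and B_base: "\<And>i j. i < n \<Longrightarrow> j < n \<Longrightarrow> B $$ (i, j) \<in> range to_ac"
begin

definition isometries :: "'a alg_closure mat set" where
  "isometries = {A \<in> carrier_mat n n. A\<^sup>T * B * A = B}"

lemma isometriesD: "A \<in> isometries \<Longrightarrow> A \<in> carrier_mat n n" "A \<in> isometries \<Longrightarrow> A\<^sup>T * B * A = B"
  by (auto simp: isometries_def)

lemma isometries_det: "A \<in> isometries \<Longrightarrow> det A * det A = 1"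
proof -
  assume A: "A \<in> isometries"
  have "det (A\<^sup>T * B * A) = det A * det B * det A"
    using isometriesD(1)[OF A] B(1)
    by (simp add: det_mult[of _ n] det_transpose[of _ n] mult_carrier_mat[of _ n n])
  then have "det A * det B * det A = det B" using isometriesD(2)[OF A] by simp
  then have "(det A * det A) * det B = 1 * det B" by (simp add: mult_ac)
  then show ?thesis using B(3) by simp
qed

lemma one_isometry: "1\<^sub>m n \<in> isometries"
  using B(1) by (simp add: isometries_def)

lemma mult_isometry:
  assumes "A \<in> isometries" "A' \<in> isometries"
  shows "A * A' \<in> isometries"
proof -
  note c = isometriesD(1)[OF assms(1)] isometriesD(1)[OF assms(2)]
  have "(A * A')\<^sup>T * B * (A * A') = A'\<^sup>T * A\<^sup>T * B * (A * A')" using c by (simp add: transpose_mult)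
  also have "\<dots> = A'\<^sup>T * (A\<^sup>T * B * A) * A'"
    using c B(1) by (simp add: assoc_mult_mat[of _ n n _ n _ n])
  also have "\<dots> = B" using assms by (simp add: isometriesD)
  finally show ?thesis using c by (auto simp: isometries_def)
qed

lemma inverse_isometry:
  assumes A: "A \<in> isometries"
  obtains A' where "A' \<in> isometries" "A * A' = 1\<^sub>m n" "A' * A = 1\<^sub>m n"
proof -
  note c = isometriesD(1)[OF A]
  have "det A \<noteq> 0" using isometries_det[OF A] by auto
  then obtain A' where A': "A' \<in> carrier_mat n n" "A * A' = 1\<^sub>m n" "A' * A = 1\<^sub>m n"
    using inverse_matrix_over_subfield[OF subfield_set_UNIV c] by auto
  have "A'\<^sup>T * B * A' = A'\<^sup>T * (A\<^sup>T * B * A) * A'" by (simp add: isometriesD(2)[OF A])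
  also have "\<dots> = (A * A')\<^sup>T * B * (A * A')"
    using c A'(1) B(1) by (simp add: transpose_mult[of _ n n _ n] assoc_mult_mat[of _ n n _ n _ n])
  also have "\<dots> = B" using B(1) by (simp add: A'(2))
  finally show ?thesis using that[of A'] A' by (auto simp: isometries_def)
qed

end

lemma galois_hom:
  assumes "\<sigma> \<in> absolute_galois_group"
  shows "comm_ring_hom \<sigma>" "\<sigma> (to_ac c) = to_ac c" "bij \<sigma>"
proof -
  have s: "bij \<sigma>" "\<And>x y. \<sigma> (x + y) = \<sigma> x + \<sigma> y" "\<And>x y. \<sigma> (x * y) = \<sigma> x * \<sigma> y" "\<And>c. \<sigma> (to_ac c) = to_ac c"
    using assms by (auto simp: absolute_galois_group_def)
  show "comm_ring_hom \<sigma>" using s(4)[of 1] s(2,3) by (intro comm_ring_homI) auto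
  show "\<sigma> (to_ac c) = to_ac c" "bij \<sigma>" by (fact s)+
qed

lemma galois_id: "id \<in> absolute_galois_group"
  by (auto simp: absolute_galois_group_def)

lemma galois_comp:
  "\<sigma> \<in> absolute_galois_group \<Longrightarrow> \<tau> \<in> absolute_galois_group \<Longrightarrow> \<sigma> \<circ> \<tau> \<in> absolute_galois_group"
  by (auto simp: absolute_galois_group_def bij_comp)

lemma galois_inv: "\<sigma> \<in> absolute_galois_group \<Longrightarrow> inv_into UNIV \<sigma> \<in> absolute_galois_group"
proof -
  assume s: "\<sigma> \<in> absolute_galois_group"
  note h = galois_hom[OF s]
  interpret comm_ring_hom \<sigma> by (rule h)
  have r: "\<sigma> (inv_into UNIV \<sigma> x) = x" for x using h(3) by (simp add: bij_is_surj surj_f_inv_f)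
  have l: "inv_into UNIV \<sigma> (\<sigma> x) = x" for x using h(3) by (simp add: bij_is_inj)
  have "inv_into UNIV \<sigma> (x + y) = inv_into UNIV \<sigma> x + inv_into UNIV \<sigma> y" "inv_into UNIV \<sigma> (x * y) = inv_into UNIV \<sigma> x * inv_into UNIV \<sigma> y" for x y
    using l[of "inv_into UNIV \<sigma> x + inv_into UNIV \<sigma> y"] l[of "inv_into UNIV \<sigma> x * inv_into UNIV \<sigma> y"] by (simp_all add: hom_add hom_mult r)
  moreover have "inv_into UNIV \<sigma> (to_ac c) = to_ac c" for c using l[of "to_ac c"] h(2) by simp
  ultimately show ?thesis using h(3) by (auto simp: absolute_galois_group_def bij_imp_bij_inv)
qed

context quadratic_space
begin

lemma galois_isometry:
  assumes s: "\<sigma> \<in> absolute_galois_group" and A: "A \<in> isometries"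
  shows "map_mat \<sigma> A \<in> isometries"
proof -
  interpret comm_ring_hom \<sigma> by (rule galois_hom[OF s])
  note c = isometriesD(1)[OF A]
  have "\<sigma> (B $$ (i, j)) = B $$ (i, j)" if ij: "i < n" "j < n" for i j
  proof -
    obtain c where "B $$ (i, j) = to_ac c" using B_base[OF ij] by blast
    then show ?thesis by (simp add: galois_hom(2)[OF s])
  qed
  then have "map_mat \<sigma> B = B" using B(1) by (intro eq_matI) auto
  moreover have "map_mat \<sigma> (A\<^sup>T * B * A) = (map_mat \<sigma> A)\<^sup>T * map_mat \<sigma> B * map_mat \<sigma> A"
    using c B(1) by (simp add: mat_hom_mult[of _ n n _ n] map_mat_transpose mult_carrier_mat[of _ n n _ n])
  ultimately show ?thesis using c isometriesD(2)[OF A] by (auto simp: isometries_def)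
qed

end

text \<open>The polar form of \<open>q\<close> has the matrix \<open>B = C + C\<^sup>T\<close>, and \<open>2 q(v)\<close> is the value of the polar form at
  \<open>(v, v)\<close>, so preserving the one is preserving the other.\<close>

lemma orthogonal_group_isometries:
  fixes C :: "'a::field_char_0 mat"
  assumes C: "C \<in> carrier_mat n n" and nd: "nondegenerate_form n C"
  defines "B \<equiv> map_mat to_ac (C + C\<^sup>T)"
  shows "quadratic_space n B" "orthogonal_group n C = quadratic_space.isometries n B"
proof -
  interpret ac: comm_ring_hom "to_ac :: 'a \<Rightarrow> 'a alg_closure" by (rule comm_ring_hom_to_ac)
  have S: "C + C\<^sup>T \<in> carrier_mat n n" using C by simp
  have Bc: "B \<in> carrier_mat n n" using S by (simp add: B_def)
  have "det (C + C\<^sup>T) \<noteq> 0"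
  proof
    assume "det (C + C\<^sup>T) = 0"
    then obtain v where v: "v \<in> carrier_vec n" "v \<noteq> 0\<^sub>v n" "(C + C\<^sup>T) *\<^sub>v v = 0\<^sub>v n"
      using det_0_iff_vec_prod_zero_field[OF S] by blast
    have "polar_form C v w = 0" if w: "w \<in> carrier_vec n" for w
    proof -
      have "polar_form C v w = polar_form C w v"
        using v(1) w by (simp add: polar_form_def comm_add_vec[of v n w])
      also have "\<dots> = 0" using polar_form_eq[OF C w v(1)] v(3) w by simp
      finally show ?thesis .
    qed
    then show False using nd v(1,2) unfolding nondegenerate_form_def by blast
  qed
  then have "det B \<noteq> 0" by (simp add: B_def ac.hom_det)
  moreover have "B\<^sup>T = B" using C by (intro eq_matI) (auto simp: B_def)
  moreover have "B $$ (i, j) \<in> range to_ac" if "i < n" "j < n" for i j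
    using that C by (simp add: B_def flip: to_ac_add)
  ultimately show qs: "quadratic_space n B" using Bc by unfold_locales
  interpret quadratic_space n B by (rule qs)
  let ?D = "map_mat to_ac C"
  have D: "?D \<in> carrier_mat n n" using C by simp
  have DB: "?D + ?D\<^sup>T = B" using C by (intro eq_matI) (auto simp: B_def)
  have polar: "polar_form ?D v w = v \<bullet> (B *\<^sub>v w)" if "v \<in> carrier_vec n" "w \<in> carrier_vec n" for v w
    using polar_form_eq[OF D that] by (simp add: DB)
  have double: "v \<bullet> (B *\<^sub>v v) = 2 * quad_form ?D v" if v: "v \<in> carrier_vec n" for v
  proof -
    have c: "?D\<^sup>T *\<^sub>v v \<in> carrier_vec n" using D v by simp
    have "B *\<^sub>v v = ?D *\<^sub>v v + ?D\<^sup>T *\<^sub>v v"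
      unfolding DB[symmetric] using D v by (simp add: add_mult_distrib_mat_vec[of _ n n])
    moreover have "v \<bullet> (?D\<^sup>T *\<^sub>v v) = v \<bullet> (?D *\<^sub>v v)"
      using transpose_vec_mult_scalar[OF D v v] comm_scalar_prod[OF c v] by simp
    ultimately show ?thesis using D v by (simp add: quad_form_def scalar_prod_add_distrib[of _ n])
  qed
  show "orthogonal_group n C = isometries"
  proof (rule equalityI; rule subsetI)
    fix A assume "A \<in> orthogonal_group n C"
    then have A: "A \<in> carrier_mat n n" "\<And>v. v \<in> carrier_vec n \<Longrightarrow> quad_form ?D (A *\<^sub>v v) = quad_form ?D v"
      by (auto simp: orthogonal_group_def)
    have "A\<^sup>T * B * A = B"
    proof (rule eq_matI)
      fix i j assume "i < dim_row B" "j < dim_col B"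
      then have ij: "i < n" "j < n" using Bc by auto
      let ?i = "unit_vec n i :: 'a alg_closure vec" and ?j = "unit_vec n j :: 'a alg_closure vec"
      have "(A\<^sup>T * B * A) $$ (i, j) = ?i \<bullet> ((A\<^sup>T * B * A) *\<^sub>v ?j)"
        using A(1) Bc ij by (intro unit_vec_mult_mat[symmetric]) auto
      also have "\<dots> = (A *\<^sub>v ?i) \<bullet> (B *\<^sub>v (A *\<^sub>v ?j))"
        using ij by (intro scalar_prod_gram[OF A(1) Bc, symmetric]) auto
      also have "\<dots> = polar_form ?D (A *\<^sub>v ?i) (A *\<^sub>v ?j)"
        using A(1) by (intro polar[symmetric]) auto
      also have "\<dots> = polar_form ?D ?i ?j"
        using A(2)[of "?i + ?j"] A(2)[of ?i] A(2)[of ?j] A(1)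
        by (simp add: polar_form_def mult_add_distrib_mat_vec[of _ n n])
      also have "\<dots> = B $$ (i, j)"
        using polar[of ?i ?j] unit_vec_mult_mat[OF Bc ij] by simp
      finally show "(A\<^sup>T * B * A) $$ (i, j) = B $$ (i, j)" .
    qed (use A(1) Bc in auto)
    then show "A \<in> isometries" using A(1) by (simp add: isometries_def)
  next
    fix A assume A: "A \<in> isometries"
    note c = isometriesD(1)[OF A]
    obtain A' where "A' \<in> isometries" "A * A' = 1\<^sub>m n" "A' * A = 1\<^sub>m n" by (rule inverse_isometry[OF A])
    then have "invertible_mat A"
      using c isometriesD(1)[of A'] by (auto simp: invertible_mat_def inverts_mat_def)
    moreover have "quad_form ?D (A *\<^sub>v v) = quad_form ?D v" if v: "v \<in> carrier_vec n" for v
    proof -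
      have "2 * quad_form ?D (A *\<^sub>v v) = (A *\<^sub>v v) \<bullet> (B *\<^sub>v (A *\<^sub>v v))"
        using c v by (intro double[symmetric]) auto
      also have "\<dots> = v \<bullet> (B *\<^sub>v v)" using scalar_prod_gram[OF c Bc v v] isometriesD(2)[OF A] by simp
      also have "\<dots> = 2 * quad_form ?D v" by (rule double[OF v])
      finally show ?thesis by simp
    qed
    ultimately show "A \<in> orthogonal_group n C" using c by (simp add: orthogonal_group_def)
  qed
qed

text \<open>The matrix coefficients are polynomials \<open>P i j\<close> over the base field in the entries of an isometry, with
  no denominator because the determinant of an isometry is \<open>1\<close> or \<open>-1\<close>; the points where the
  polynomial \<open>u\<close> does not vanish have trivial stabilizer.\<close>

locale orthogonal_rep = quadratic_space n B for n and B :: "'a::field_char_0 alg_closure mat" +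
  fixes m :: nat and \<rho> :: "'a alg_closure mat \<Rightarrow> 'a alg_closure mat"
    and P :: "nat \<Rightarrow> nat \<Rightarrow> (nat \<times> nat, 'a) mpoly" and u :: "(nat, 'a) mpoly"
  assumes rho: "\<And>A. A \<in> isometries \<Longrightarrow> \<rho> A \<in> carrier_mat m m" "\<rho> (1\<^sub>m n) = 1\<^sub>m m"
      "\<And>A A'. A \<in> isometries \<Longrightarrow> A' \<in> isometries \<Longrightarrow> \<rho> (A * A') = \<rho> A * \<rho> A'"
    and P: "\<And>i j. i < m \<Longrightarrow> j < m \<Longrightarrow> mvars (P i j) \<subseteq> {..<n} \<times> {..<n}"
      "\<And>i j A. i < m \<Longrightarrow> j < m \<Longrightarrow> A \<in> isometries \<Longrightarrow> \<rho> A $$ (i, j) = meval to_ac (\<lambda>ab. A $$ ab) (P i j)"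
    and u: "mvars u \<subseteq> {..<m}" "\<exists>x\<in>carrier_vec m. meval to_ac (\<lambda>i. x $ i) u \<noteq> 0"
      "\<And>x A. x \<in> carrier_vec m \<Longrightarrow> meval to_ac (\<lambda>i. x $ i) u \<noteq> 0 \<Longrightarrow> A \<in> isometries \<Longrightarrow>
        \<rho> A *\<^sub>v x = x \<Longrightarrow> A = 1\<^sub>m n"
begin

lemma rho_galois:
  assumes s: "\<sigma> \<in> absolute_galois_group" and A: "A \<in> isometries"
  shows "\<rho> (map_mat \<sigma> A) = map_mat \<sigma> (\<rho> A)"
proof (rule eq_matI)
  note sA = galois_isometry[OF s A]
  show "dim_row (\<rho> (map_mat \<sigma> A)) = dim_row (map_mat \<sigma> (\<rho> A))"
    "dim_col (\<rho> (map_mat \<sigma> A)) = dim_col (map_mat \<sigma> (\<rho> A))"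
    using rho(1)[OF sA] rho(1)[OF A] by auto
  fix i j assume "i < dim_row (map_mat \<sigma> (\<rho> A))" "j < dim_col (map_mat \<sigma> (\<rho> A))"
  then have ij: "i < m" "j < m" using rho(1)[OF A] by auto
  have "\<sigma> (\<rho> A $$ (i, j)) = meval (\<lambda>c. \<sigma> (to_ac c)) (\<lambda>ab. \<sigma> (A $$ ab)) (P i j)"
    using ij A by (simp add: P hom_meval[OF galois_hom(1)[OF s]])
  also have "\<dots> = meval to_ac (\<lambda>ab. map_mat \<sigma> A $$ ab) (P i j)"
    using P(1)[OF ij] isometriesD(1)[OF A]
    by (intro meval_cong) (auto simp: galois_hom(2)[OF s])
  also have "\<dots> = \<rho> (map_mat \<sigma> A) $$ (i, j)" using ij sA by (simp add: P)
  finally show "\<rho> (map_mat \<sigma> A) $$ (i, j) = map_mat \<sigma> (\<rho> A) $$ (i, j)" using ij rho(1)[OF A] by simp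
qed

text \<open>The isometries together with the Galois group act on the rational functions in the coordinates
  \<open>x\<^sub>0, \<dots>, x\<^sub>m\<^sub>-\<^sub>1\<close> of the given representation and the entries of a square matrix, the coordinate with
  index \<open>m + a * n + b\<close> being the entry in row \<open>a\<close> and column \<open>b\<close>; the isometries multiply the matrix
  from the left.\<close>

definition grp :: "('a alg_closure mat \<times> ('a alg_closure \<Rightarrow> 'a alg_closure)) set" where
  "grp = isometries \<times> absolute_galois_group"

text \<open>An element \<open>(A, \<sigma>)\<close> substitutes \<open>A x\<close> for the vector \<open>x\<close> of coordinates and applies \<open>\<sigma>\<close> to the
  coefficients. The substitution is contravariant, which reverses the order of the matrices.\<close>

definition gmul :: "'a alg_closure mat \<times> ('a alg_closure \<Rightarrow> 'a alg_closure) \<Rightarrow>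
    'a alg_closure mat \<times> ('a alg_closure \<Rightarrow> 'a alg_closure) \<Rightarrow> 'a alg_closure mat \<times> ('a alg_closure \<Rightarrow> 'a alg_closure)" where
  "gmul \<gamma> \<delta> = (map_mat (snd \<gamma>) (fst \<delta>) * fst \<gamma>, snd \<gamma> \<circ> snd \<delta>)"

definition gone :: "'a alg_closure mat \<times> ('a alg_closure \<Rightarrow> 'a alg_closure)" where
  "gone = (1\<^sub>m n, id)"

definition var_image :: "'a alg_closure mat \<Rightarrow> nat \<Rightarrow> (nat, 'a alg_closure) mpoly" where
  "var_image A i = (if i < m then \<Sum>j<m. mconst (\<rho> A $$ (i, j)) * mvar j
     else if i < m + n * n then \<Sum>k<n. mconst (A $$ ((i - m) div n, k)) * mvar (m + k * n + (i - m) mod n)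
     else mvar i)"

definition poly_act :: "'a alg_closure mat \<times> ('a alg_closure \<Rightarrow> 'a alg_closure) \<Rightarrow>
    (nat, 'a alg_closure) mpoly \<Rightarrow> (nat, 'a alg_closure) mpoly" where
  "poly_act \<gamma> = meval (\<lambda>c. mconst (snd \<gamma> c)) (var_image (fst \<gamma>))"

definition act :: "'a alg_closure mat \<times> ('a alg_closure \<Rightarrow> 'a alg_closure) \<Rightarrow>
    (nat, 'a alg_closure) mpoly fract \<Rightarrow> (nat, 'a alg_closure) mpoly fract" where
  "act \<gamma> = fract_ext (\<lambda>p. Fract (poly_act \<gamma> p) 1)"

lemma grpD:
  assumes "\<gamma> \<in> grp"
  shows "fst \<gamma> \<in> isometries" "snd \<gamma> \<in> absolute_galois_group" "fst \<gamma> \<in> carrier_mat n n"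
    "comm_ring_hom (snd \<gamma>)" "snd \<gamma> (to_ac c) = to_ac c" "snd \<gamma> 0 = 0" "snd \<gamma> 1 = 1"
proof -
  show 1: "fst \<gamma> \<in> isometries" "snd \<gamma> \<in> absolute_galois_group" using assms by (auto simp: grp_def)
  then show "fst \<gamma> \<in> carrier_mat n n" by (simp add: isometriesD)
  show "comm_ring_hom (snd \<gamma>)" "snd \<gamma> (to_ac c) = to_ac c"
    using galois_hom[OF 1(2)] by auto
  then interpret comm_ring_hom "snd \<gamma>" by simp
  show "snd \<gamma> 0 = 0" "snd \<gamma> 1 = 1" by simp_all
qed

lemma gone_grp: "gone \<in> grp"
  using one_isometry galois_id by (simp add: gone_def grp_def)

lemma gmul_grp: "\<gamma> \<in> grp \<Longrightarrow> \<delta> \<in> grp \<Longrightarrow> gmul \<gamma> \<delta> \<in> grp"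
  by (auto simp: grp_def gmul_def mult_isometry galois_isometry galois_comp)

lemma matrix_var_index:
  assumes "m \<le> i" "i < m + n * n"
  obtains a b where "i = m + a * n + b" "a < n" "b < n"
proof -
  have "n > 0" using assms by (cases n) auto
  moreover have "i - m < n * n" using assms by auto
  ultimately show ?thesis
    using that[of "(i - m) div n" "(i - m) mod n"] assms by (simp add: less_mult_imp_div_less)
qed

lemma matrix_index_bound: "a < n \<Longrightarrow> b < n \<Longrightarrow> m + a * n + b < m + n * n"
proof -
  assume "a < n" "b < n"
  have "a * n + b < Suc a * n" using \<open>b < n\<close> by simp
  also have "\<dots> \<le> n * n" using \<open>a < n\<close> by (intro mult_le_mono1) simp
  finally show ?thesis by simp
qed

lemma var_image_simps:
  "i < m \<Longrightarrow> var_image A i = (\<Sum>j<m. mconst (\<rho> A $$ (i, j)) * mvar j)"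
  "a < n \<Longrightarrow> b < n \<Longrightarrow> var_image A (m + a * n + b) = (\<Sum>k<n. mconst (A $$ (a, k)) * mvar (m + k * n + b))"
  "m + n * n \<le> i \<Longrightarrow> var_image A i = mvar i"
  using matrix_index_bound[of a b] by (auto simp: var_image_def)

lemma comm_ring_hom_poly_act: "\<gamma> \<in> grp \<Longrightarrow> comm_ring_hom (poly_act \<gamma>)"
  unfolding poly_act_def using comm_ring_hom_comp[OF grpD(4) comm_ring_hom_mconst]
  by (intro comm_ring_hom_meval) (simp add: o_def)

lemma poly_act_gens:
  assumes "\<gamma> \<in> grp"
  shows "poly_act \<gamma> (mconst c) = mconst (snd \<gamma> c)" "poly_act \<gamma> (mvar i) = var_image (fst \<gamma>) i"
proof -
  interpret m: comm_ring_hom "mconst :: 'a alg_closure \<Rightarrow> (nat, 'a alg_closure) mpoly" by (rule comm_ring_hom_mconst)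
  show "poly_act \<gamma> (mconst c) = mconst (snd \<gamma> c)" "poly_act \<gamma> (mvar i) = var_image (fst \<gamma>) i"
    unfolding poly_act_def by (simp_all add: grpD[OF assms])
qed

lemma linear_forms_compose:
  fixes v :: "nat \<Rightarrow> (nat, 'a alg_closure) mpoly"
  assumes A: "A \<in> carrier_mat p p" "A' \<in> carrier_mat p p" and i: "i < p"
  shows "(\<Sum>j<p. mconst (A $$ (i, j)) * (\<Sum>k<p. mconst (A' $$ (j, k)) * v k)) =
    (\<Sum>k<p. mconst ((A * A') $$ (i, k)) * v k)"
proof -
  interpret m: comm_ring_hom "mconst :: 'a alg_closure \<Rightarrow> (nat, 'a alg_closure) mpoly" by (rule comm_ring_hom_mconst)
  have "(\<Sum>j<p. mconst (A $$ (i, j)) * (\<Sum>k<p. mconst (A' $$ (j, k)) * v k)) =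
      (\<Sum>k<p. mconst (\<Sum>j<p. A $$ (i, j) * A' $$ (j, k)) * v k)"
    unfolding sum_distrib_left m.hom_sum m.hom_mult sum_distrib_right by (subst sum.swap) (simp add: mult.assoc)
  also have "\<dots> = (\<Sum>k<p. mconst ((A * A') $$ (i, k)) * v k)"
    by (intro sum.cong refl) (simp add: index_mat_mult_lessThan[OF A i] del: index_mult_mat(1))
  finally show ?thesis .
qed

text \<open>Both sides are ring homomorphisms, so it suffices to compare them on constants and variables; there
  it is the multiplicativity of \<open>\<rho>\<close> and its compatibility with the Galois action.\<close>

lemma poly_act_gmul:
  assumes g: "\<gamma> \<in> grp" and d: "\<delta> \<in> grp"
  shows "poly_act (gmul \<gamma> \<delta>) p = poly_act \<gamma> (poly_act \<delta> p)"
proof (rule mpoly_hom_eqI[of "poly_act (gmul \<gamma> \<delta>)" "\<lambda>p. poly_act \<gamma> (poly_act \<delta> p)"])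
  interpret g: comm_ring_hom "poly_act \<gamma>" by (rule comm_ring_hom_poly_act[OF g])
  note gd = gmul_grp[OF g d]
  show "comm_ring_hom (poly_act (gmul \<gamma> \<delta>))" by (rule comm_ring_hom_poly_act[OF gd])
  show "comm_ring_hom (\<lambda>p. poly_act \<gamma> (poly_act \<delta> p))"
    using comm_ring_hom_comp[OF comm_ring_hom_poly_act[OF d] comm_ring_hom_poly_act[OF g]] by (simp add: o_def)
  show "poly_act (gmul \<gamma> \<delta>) (mconst c) = poly_act \<gamma> (poly_act \<delta> (mconst c))" for c
    by (simp add: poly_act_gens g d gd) (simp add: gmul_def)
  show "poly_act (gmul \<gamma> \<delta>) (mvar i) = poly_act \<gamma> (poly_act \<delta> (mvar i))" for i
  proof -
    let ?A = "fst \<gamma>" and ?D = "map_mat (snd \<gamma>) (fst \<delta>)"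
    have D: "?D \<in> isometries" by (rule galois_isometry[OF grpD(2)[OF g] grpD(1)[OF d]])
    have fst: "fst (gmul \<gamma> \<delta>) = ?D * ?A" by (simp add: gmul_def)
    consider "i < m" | "m \<le> i" "i < m + n * n" | "m + n * n \<le> i" by linarith
    then show ?thesis
    proof cases
      case 1
      have "poly_act \<gamma> (poly_act \<delta> (mvar i)) = (\<Sum>j<m. mconst (snd \<gamma> (\<rho> (fst \<delta>) $$ (i, j))) * (\<Sum>k<m. mconst (\<rho> ?A $$ (j, k)) * mvar k))"
        using 1 by (simp add: poly_act_gens g d var_image_simps g.hom_sum g.hom_mult)
      also have "\<dots> = (\<Sum>j<m. mconst (\<rho> ?D $$ (i, j)) * (\<Sum>k<m. mconst (\<rho> ?A $$ (j, k)) * mvar k))"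
        using 1 rho(1)[OF grpD(1)[OF d]]
        by (intro sum.cong) (auto simp: rho_galois[OF grpD(2)[OF g] grpD(1)[OF d]])
      also have "\<dots> = (\<Sum>k<m. mconst (\<rho> (?D * ?A) $$ (i, k)) * mvar k)"
        using 1 D grpD(1)[OF g] by (simp add: linear_forms_compose rho)
      finally show ?thesis using 1 by (simp add: poly_act_gens gd fst var_image_simps)
    next
      case 2
      then obtain a b where i: "i = m + a * n + b" and ab: "a < n" "b < n" by (rule matrix_var_index)
      have "poly_act \<gamma> (poly_act \<delta> (mvar i)) =
          (\<Sum>j<n. mconst (snd \<gamma> (fst \<delta> $$ (a, j))) * (\<Sum>k<n. mconst (?A $$ (j, k)) * mvar (m + k * n + b)))"
        unfolding i using ab by (simp add: poly_act_gens g d var_image_simps(2) g.hom_sum g.hom_mult)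
      also have "\<dots> = (\<Sum>j<n. mconst (?D $$ (a, j)) * (\<Sum>k<n. mconst (?A $$ (j, k)) * mvar (m + k * n + b)))"
        using ab grpD(3)[OF d] by (intro sum.cong) auto
      also have "\<dots> = (\<Sum>k<n. mconst ((?D * ?A) $$ (a, k)) * mvar (m + k * n + b))"
        using ab isometriesD(1)[OF D] grpD(3)[OF g] by (intro linear_forms_compose)
      finally show ?thesis unfolding i using ab by (simp add: poly_act_gens gd fst var_image_simps(2))
    next
      case 3
      then show ?thesis by (simp add: poly_act_gens g d gd var_image_simps)
    qed
  qed
qed

lemma poly_act_gone: "poly_act gone p = p"
proof (rule mpoly_hom_eqI[of "poly_act gone" "\<lambda>p. p"])
  interpret m: comm_ring_hom "mconst :: 'a alg_closure \<Rightarrow> (nat, 'a alg_closure) mpoly" by (rule comm_ring_hom_mconst)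
  show "comm_ring_hom (poly_act gone)" by (rule comm_ring_hom_poly_act[OF gone_grp])
  show "comm_ring_hom (\<lambda>p :: (nat, 'a alg_closure) mpoly. p)" using comm_ring_hom_id by (simp add: id_def)
  show "poly_act gone (mconst c) = mconst c" for c by (simp add: poly_act_gens gone_grp) (simp add: gone_def)
  show "poly_act gone (mvar i) = mvar i" for i
  proof -
    have one: "(\<Sum>k<p. mconst ((1\<^sub>m p :: 'a alg_closure mat) $$ (j, k)) * v k) = v j"
      if "j < p" for j p and v :: "nat \<Rightarrow> (nat, 'a alg_closure) mpoly"
    proof -
      have "(\<Sum>k<p. mconst ((1\<^sub>m p :: 'a alg_closure mat) $$ (j, k)) * v k) = (\<Sum>k<p. if k = j then v k else 0)"
        using that by (intro sum.cong) auto
      then show ?thesis using that by simp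
    qed
    consider "i < m" | "m \<le> i" "i < m + n * n" | "m + n * n \<le> i" by linarith
    then show ?thesis
    proof cases
      case 2
      then obtain a b where i: "i = m + a * n + b" and ab: "a < n" "b < n" by (rule matrix_var_index)
      then show ?thesis
        using one[of a n "\<lambda>k. mvar (m + k * n + b)"]
        by (simp add: poly_act_gens gone_grp var_image_simps(2)) (simp add: gone_def)
    qed (use one[of i m mvar] in \<open>simp_all add: poly_act_gens gone_grp var_image_simps, simp_all add: gone_def rho\<close>)
  qed
qed

lemma poly_act_inj:
  assumes g: "\<gamma> \<in> grp" and "poly_act \<gamma> p = 0"
  shows "p = 0"
proof -
  obtain A' where A': "A' \<in> isometries" "fst \<gamma> * A' = 1\<^sub>m n" using inverse_isometry[OF grpD(1)[OF g]] by blast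
  define \<delta> where "\<delta> = (map_mat (inv_into UNIV (snd \<gamma>)) A', inv_into UNIV (snd \<gamma>))"
  note s = galois_inv[OF grpD(2)[OF g]]
  interpret s: comm_ring_hom "inv_into UNIV (snd \<gamma>)" by (rule galois_hom(1)[OF s])
  have d: "\<delta> \<in> grp" using A' s by (simp add: \<delta>_def grp_def galois_isometry)
  have "map_mat (inv_into UNIV (snd \<gamma>)) (fst \<gamma>) * map_mat (inv_into UNIV (snd \<gamma>)) A' = map_mat (inv_into UNIV (snd \<gamma>)) (fst \<gamma> * A')"
    using grpD(3)[OF g] isometriesD(1)[OF A'(1)] by (simp add: s.mat_hom_mult[of _ n n _ n])
  also have "\<dots> = 1\<^sub>m n" unfolding A'(2) by (rule s.mat_hom_one)
  finally have "gmul \<delta> \<gamma> = gone"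
    using galois_hom(3)[OF grpD(2)[OF g]] by (simp add: gmul_def gone_def \<delta>_def inj_imp_inv_eq bij_is_inj)
  then have "p = poly_act \<delta> (poly_act \<gamma> p)" using poly_act_gmul[OF d g] poly_act_gone by metis
  also have "\<dots> = 0" using assms(2) by (simp add: poly_act_def meval_def)
  finally show ?thesis .
qed

lemma act:
  assumes g: "\<gamma> \<in> grp"
  shows comm_ring_hom_act: "comm_ring_hom (act \<gamma>)"
    and act_Fract: "b \<noteq> 0 \<Longrightarrow> act \<gamma> (Fract a b) = Fract (poly_act \<gamma> a) (poly_act \<gamma> b)"
proof -
  have hom: "comm_ring_hom (\<lambda>p. Fract (poly_act \<gamma> p) 1)"
    using comm_ring_hom_comp[OF comm_ring_hom_poly_act[OF g] comm_ring_hom_Fract] by (simp add: o_def)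
  have inj: "p = 0" if "Fract (poly_act \<gamma> p) 1 = 0" for p
    using that poly_act_inj[OF g] by (simp add: Zero_fract_def eq_fract)
  show "comm_ring_hom (act \<gamma>)" unfolding act_def by (rule comm_ring_hom_fract_ext[OF hom inj])
  show "b \<noteq> 0 \<Longrightarrow> act \<gamma> (Fract a b) = Fract (poly_act \<gamma> a) (poly_act \<gamma> b)"
    unfolding act_def by (simp add: fract_ext_Fract[OF hom inj])
qed

lemma act_gens:
  assumes g: "\<gamma> \<in> grp"
  shows "act \<gamma> (rconst c) = rconst (snd \<gamma> c)"
    "i < m \<Longrightarrow> act \<gamma> (rvar i) = (\<Sum>j<m. rconst (\<rho> (fst \<gamma>) $$ (i, j)) * rvar j)"
    "a < n \<Longrightarrow> b < n \<Longrightarrow> act \<gamma> (rvar (m + a * n + b)) = (\<Sum>k<n. rconst (fst \<gamma> $$ (a, k)) * rvar (m + k * n + b))"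
proof -
  interpret p: comm_ring_hom "poly_act \<gamma>" by (rule comm_ring_hom_poly_act[OF g])
  interpret E: comm_ring_hom "\<lambda>a. Fract a 1 :: (nat, 'a alg_closure) mpoly fract" by (rule comm_ring_hom_Fract)
  have sum: "Fract (\<Sum>j\<in>J. mconst (f j) * mvar (h j)) 1 = (\<Sum>j\<in>J. rconst (f j) * rvar (h j))"
    for J :: "nat set" and f :: "nat \<Rightarrow> 'a alg_closure" and h :: "nat \<Rightarrow> nat"
    unfolding E.hom_sum E.hom_mult rconst_def rvar_def ..
  have var: "act \<gamma> (rvar i) = Fract (var_image (fst \<gamma>) i) 1" for i
    unfolding rvar_def by (subst act_Fract[OF g]) (simp_all add: poly_act_gens[OF g])
  show "act \<gamma> (rconst c) = rconst (snd \<gamma> c)"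
    unfolding rconst_def by (subst act_Fract[OF g]) (simp_all add: poly_act_gens[OF g])
  show "i < m \<Longrightarrow> act \<gamma> (rvar i) = (\<Sum>j<m. rconst (\<rho> (fst \<gamma>) $$ (i, j)) * rvar j)"
    unfolding var by (simp only: var_image_simps sum)
  show "a < n \<Longrightarrow> b < n \<Longrightarrow> act \<gamma> (rvar (m + a * n + b)) = (\<Sum>k<n. rconst (fst \<gamma> $$ (a, k)) * rvar (m + k * n + b))"
    unfolding var by (simp only: var_image_simps(2) sum)
qed

lemma semilinear:
  assumes L: "subfield_set L" "\<And>\<gamma> x. \<gamma> \<in> grp \<Longrightarrow> x \<in> L \<Longrightarrow> act \<gamma> x \<in> L"
  shows "semilinear_action grp act gmul gone L"
proof (intro semilinear_action.intro)
  interpret E: comm_ring_hom "\<lambda>a. Fract a 1 :: (nat, 'a alg_closure) mpoly fract" by (rule comm_ring_hom_Fract)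
  have F1: "act \<gamma> (Fract p 1) = Fract (poly_act \<gamma> p) 1" if "\<gamma> \<in> grp" for \<gamma> p
  proof -
    interpret p: comm_ring_hom "poly_act \<gamma>" by (rule comm_ring_hom_poly_act[OF that])
    show ?thesis using act_Fract[OF that, of 1 p] by simp
  qed
  show "act gone a = a" for a
    using fract_hom_eqI[OF comm_ring_hom_act[OF gone_grp] comm_ring_hom_id, of a]
    by (simp add: F1[OF gone_grp] poly_act_gone)
  show "act (gmul \<gamma> \<delta>) a = act \<gamma> (act \<delta> a)" if g: "\<gamma> \<in> grp" and d: "\<delta> \<in> grp" for \<gamma> \<delta> a
  proof (rule fract_hom_eqI[OF comm_ring_hom_act[OF gmul_grp[OF g d]]])
    show "comm_ring_hom (\<lambda>a. act \<gamma> (act \<delta> a))"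
      using comm_ring_hom_comp[OF comm_ring_hom_act[OF d] comm_ring_hom_act[OF g]] by (simp add: o_def)
    show "act (gmul \<gamma> \<delta>) (Fract a 1) = act \<gamma> (act \<delta> (Fract a 1))" for a
      unfolding F1[OF g] F1[OF d] F1[OF gmul_grp[OF g d]] poly_act_gmul[OF g d] ..
  qed
qed (fact comm_ring_hom_act gone_grp gmul_grp L)+

lemma ratfuns_stable:
  assumes g: "\<gamma> \<in> grp"
  shows "x \<in> ratfuns {..<m} \<Longrightarrow> act \<gamma> x \<in> ratfuns {..<m}"
    "x \<in> ratfuns {m..<m + n * n} \<Longrightarrow> act \<gamma> x \<in> ratfuns {m..<m + n * n}"
proof -
  note R = subfield_setD[OF subfield_set_ratfuns]
  have 1: "act \<gamma> (rvar i) \<in> ratfuns {..<m}" if "i \<in> {..<m}" for i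
  proof -
    have i: "i < m" using that by simp
    show ?thesis unfolding act_gens(2)[OF g i]
      by (intro subring_set_sum[OF R(1)] R(6) rconst_in_ratfuns rvar_in_ratfuns)
  qed
  have 2: "act \<gamma> (rvar i) \<in> ratfuns {m..<m + n * n}" if "i \<in> {m..<m + n * n}" for i
  proof -
    have "m \<le> i" "i < m + n * n" using that by auto
    then obtain a b where i: "i = m + a * n + b" and ab: "a < n" "b < n" by (rule matrix_var_index)
    have k: "m + k * n + b \<in> {m..<m + n * n}" if "k \<in> {..<n}" for k
      using matrix_index_bound[OF _ ab(2), of k] that by simp
    show ?thesis
      unfolding i act_gens(3)[OF g ab]
      by (intro subring_set_sum[OF R(1)] R(6) rconst_in_ratfuns rvar_in_ratfuns k)
  qed
  have c: "act \<gamma> (rconst c) \<in> ratfuns I" for c I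
    unfolding act_gens(1)[OF g] by (rule rconst_in_ratfuns)
  show "x \<in> ratfuns {..<m} \<Longrightarrow> act \<gamma> x \<in> ratfuns {..<m}"
    by (rule ratfuns_image_subset[OF comm_ring_hom_act[OF g] subfield_set_ratfuns c 1])
  show "x \<in> ratfuns {m..<m + n * n} \<Longrightarrow> act \<gamma> x \<in> ratfuns {m..<m + n * n}"
    by (rule ratfuns_image_subset[OF comm_ring_hom_act[OF g] subfield_set_ratfuns c 2])
qed

end

section \<open>The matrix coefficients are orbit sums\<close>

text \<open>The value is a sum of products of a function of the values of the right variables with a function of
  the values of the left variables.\<close>

lemma meval_split_variables:
  fixes p :: "('x + 'y, 'c::zero) mpoly"
  shows "meval \<phi> (case_sum f g) p = (\<Sum>t\<in>Poly_Mapping.keys p. (\<phi> (Poly_Mapping.lookup p t) *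
      (\<Prod>x\<in>Poly_Mapping.keys t \<inter> range Inr. case_sum (\<lambda>_. 0) g x ^ Poly_Mapping.lookup t x)) *
      (\<Prod>x\<in>Poly_Mapping.keys t \<inter> range Inl. case_sum f (\<lambda>_. 0) x ^ Poly_Mapping.lookup t x))"
  unfolding meval_def
proof (intro sum.cong refl)
  fix t assume "t \<in> Poly_Mapping.keys p"
  let ?K = "Poly_Mapping.keys t"
  have K: "?K = (?K \<inter> range Inr) \<union> (?K \<inter> range Inl)" by (auto intro: sum.exhaust_sel)
  have "(\<Prod>x\<in>?K. case_sum f g x ^ Poly_Mapping.lookup t x) =
      (\<Prod>x\<in>?K \<inter> range Inr. case_sum f g x ^ Poly_Mapping.lookup t x) *
      (\<Prod>x\<in>?K \<inter> range Inl. case_sum f g x ^ Poly_Mapping.lookup t x)"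
    by (subst K, subst prod.union_disjoint) auto
  also have "\<dots> = (\<Prod>x\<in>?K \<inter> range Inr. case_sum (\<lambda>_. 0) g x ^ Poly_Mapping.lookup t x) *
      (\<Prod>x\<in>?K \<inter> range Inl. case_sum f (\<lambda>_. 0) x ^ Poly_Mapping.lookup t x)"
    by (intro arg_cong2[where f = "(*)"] prod.cong) auto
  finally show "\<phi> (Poly_Mapping.lookup p t) * (\<Prod>x\<in>?K. case_sum f g x ^ Poly_Mapping.lookup t x) =
      \<phi> (Poly_Mapping.lookup p t) * (\<Prod>x\<in>?K \<inter> range Inr. case_sum (\<lambda>_. 0) g x ^ Poly_Mapping.lookup t x) *
      (\<Prod>x\<in>?K \<inter> range Inl. case_sum f (\<lambda>_. 0) x ^ Poly_Mapping.lookup t x)"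
    by (simp add: mult.assoc)
qed

context quadratic_space
begin

text \<open>The equations for an isometry whose entries are the variables chosen by \<open>h\<close>.\<close>

definition gram_poly :: "(nat \<times> nat \<Rightarrow> 'v) \<Rightarrow> nat \<times> nat \<Rightarrow> ('v, 'a alg_closure) mpoly" where
  "gram_poly h ij = (\<Sum>l<n. (\<Sum>k<n. mvar (h (k, fst ij)) * mconst (B $$ (k, l))) * mvar (h (l, snd ij)))
     - mconst (B $$ ij)"

lemma meval_gram_poly:
  assumes "comm_ring_hom \<phi>" "A \<in> carrier_mat n n" "i < n" "j < n"
    and f: "\<And>k l. k < n \<Longrightarrow> l < n \<Longrightarrow> f (h (k, l)) = A $$ (k, l)"
  shows "meval \<phi> f (gram_poly h (i, j)) = (A\<^sup>T * map_mat \<phi> B * A) $$ (i, j) - \<phi> (B $$ (i, j))"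
proof -
  interpret \<phi>: comm_ring_hom \<phi> by fact
  interpret ev: comm_ring_hom "meval \<phi> f" by (rule comm_ring_hom_meval[OF assms(1)])
  have B': "map_mat \<phi> B \<in> carrier_mat n n" using B(1) by simp
  show ?thesis
    unfolding gram_entry[OF assms(2) B' assms(3,4)] gram_poly_def using assms(3,4) f B(1)
    by (simp add: ev.hom_sum ev.hom_mult ev.hom_minus)
qed

lemma meval_gram_poly_isometry:
  assumes \<phi>: "comm_ring_hom \<phi>" and A: "A \<in> isometries" and ij: "ij \<in> {..<n} \<times> {..<n}"
    and f: "\<And>k l. k < n \<Longrightarrow> l < n \<Longrightarrow> f (h (k, l)) = \<phi> (A $$ (k, l))"
  shows "meval \<phi> f (gram_poly h ij) = 0"
proof -
  interpret \<phi>: comm_ring_hom \<phi> by fact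
  note c = isometriesD(1)[OF A]
  obtain i j where ij': "ij = (i, j)" "i < n" "j < n" using ij by auto
  have "(map_mat \<phi> A)\<^sup>T * map_mat \<phi> B * map_mat \<phi> A = map_mat \<phi> (A\<^sup>T * B * A)"
    using c B(1) by (simp add: \<phi>.mat_hom_mult[of _ n n _ n] map_mat_transpose mult_carrier_mat[of _ n n _ n])
  then have "(map_mat \<phi> A)\<^sup>T * map_mat \<phi> B * map_mat \<phi> A = map_mat \<phi> B" by (simp add: isometriesD(2)[OF A])
  then show ?thesis
    using meval_gram_poly[OF \<phi> _ ij'(2,3), of "map_mat \<phi> A" f h] c B(1) ij' f by simp
qed

lemma gram_poly_zeros:
  assumes "\<And>i j. i < n \<Longrightarrow> j < n \<Longrightarrow> meval id z (gram_poly h (i, j)) = 0"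
  shows "mat n n (\<lambda>ij. z (h ij)) \<in> isometries"
proof -
  let ?A = "mat n n (\<lambda>ij. z (h ij))"
  have "(?A\<^sup>T * B * ?A) $$ (i, j) = B $$ (i, j)" if "i < n" "j < n" for i j
  proof -
    have "map_mat id B = B" by (intro eq_matI) auto
    then show ?thesis using meval_gram_poly[OF comm_ring_hom_id, of ?A i j z h] assms[OF that] that by simp
  qed
  then show ?thesis using B(1) unfolding isometries_def by (auto intro!: eq_matI)
qed

end

context orthogonal_rep
begin

sublocale V: semilinear_action grp act gmul gone "ratfuns {..<m}"
  by (rule semilinear[OF subfield_set_ratfuns ratfuns_stable(1)])

sublocale W: semilinear_action grp act gmul gone "ratfuns {m..<m + n * n}"
  by (rule semilinear[OF subfield_set_ratfuns ratfuns_stable(2)])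

text \<open>The value of \<open>u\<close> at the generic point of the representation.\<close>

definition den :: "(nat, 'a alg_closure) mpoly fract" where
  "den = meval (\<lambda>c. rconst (to_ac c)) rvar u"

lemma den: "den \<in> ratfuns {..<m}" "den \<noteq> 0"
proof -
  interpret ac: comm_ring_hom "to_ac :: 'a \<Rightarrow> 'a alg_closure" by (rule comm_ring_hom_to_ac)
  show "den \<in> ratfuns {..<m}"
    unfolding den_def using u(1)
    by (intro meval_in_subring subfield_setD(1)[OF subfield_set_ratfuns]) (auto intro: rvar_in_ratfuns)
  have e: "den = meval rconst rvar (Poly_Mapping.map to_ac u)"
    unfolding den_def by (rule meval_map[OF comm_ring_hom_to_ac, symmetric]) simp
  show "den \<noteq> 0"
  proof
    assume "den = 0"
    then have 0: "Poly_Mapping.map to_ac u = 0" unfolding e by (simp only: meval_rconst_rvar_eq_0_iff)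
    obtain x :: "'a alg_closure vec" where x: "meval to_ac (vec_index x) u \<noteq> 0" using u(2) by blast
    have "meval to_ac (vec_index x) u = meval id (vec_index x) (Poly_Mapping.map to_ac u)"
      by (subst meval_map[OF comm_ring_hom_to_ac]) simp_all
    then show False using x unfolding 0 by (simp add: meval_def)
  qed
qed

text \<open>The coordinates of \<open>\<rho>(A) x - \<rho>(A') x\<close>, where \<open>A\<close>, \<open>A'\<close> and \<open>x\<close> have the three kinds of variables as their
  entries, in this order.\<close>

definition point_poly :: "nat \<Rightarrow> (nat \<times> nat + nat \<times> nat + nat, 'a alg_closure) mpoly" where
  "point_poly l = (\<Sum>j<m. (meval (\<lambda>c. mconst (to_ac c)) (\<lambda>ab. mvar (Inl ab)) (P l j)
      - meval (\<lambda>c. mconst (to_ac c)) (\<lambda>ab. mvar (Inr (Inl ab))) (P l j)) * mvar (Inr (Inr j)))"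

lemma meval_point_poly:
  assumes \<phi>: "comm_ring_hom \<phi>" and l: "l < m" and A: "A \<in> isometries" "A' \<in> isometries"
    and f: "\<And>k l. k < n \<Longrightarrow> l < n \<Longrightarrow> f (Inl (k, l)) = \<phi> (A $$ (k, l))"
      "\<And>k l. k < n \<Longrightarrow> l < n \<Longrightarrow> f (Inr (Inl (k, l))) = \<phi> (A' $$ (k, l))"
  shows "meval \<phi> f (point_poly l) = (\<Sum>j<m. \<phi> (\<rho> A $$ (l, j)) * f (Inr (Inr j))) - (\<Sum>j<m. \<phi> (\<rho> A' $$ (l, j)) * f (Inr (Inr j)))"
proof -
  interpret \<phi>: comm_ring_hom \<phi> by fact
  note h = comm_ring_hom_meval[OF \<phi>, of f]
  interpret ev: comm_ring_hom "meval \<phi> f" by (rule h)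
  have 1: "meval (\<lambda>c. \<phi> (to_ac c)) g (P l j) = \<phi> (\<rho> D $$ (l, j))"
    if "j < m" "D \<in> isometries" "\<And>k l. k < n \<Longrightarrow> l < n \<Longrightarrow> g (k, l) = \<phi> (D $$ (k, l))" for g D j
  proof -
    have "\<phi> (\<rho> D $$ (l, j)) = meval (\<lambda>c. \<phi> (to_ac c)) (\<lambda>ab. \<phi> (D $$ ab)) (P l j)"
      using P(2)[OF l that(1,2)] by (simp add: hom_meval[OF \<phi>])
    also have "\<dots> = meval (\<lambda>c. \<phi> (to_ac c)) g (P l j)"
      using P(1)[OF l that(1)] that(3) by (intro meval_cong) auto
    finally show ?thesis ..
  qed
  have 2: "meval (\<lambda>c. \<phi> (to_ac c)) (\<lambda>ab. f (Inl ab)) (P l j) = \<phi> (\<rho> A $$ (l, j))"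
    "meval (\<lambda>c. \<phi> (to_ac c)) (\<lambda>ab. f (Inr (Inl ab))) (P l j) = \<phi> (\<rho> A' $$ (l, j))" if "j < m" for j
    using that by (simp_all add: 1 A f)
  show ?thesis
    unfolding point_poly_def sum_subtractf[symmetric]
    by (simp add: ev.hom_sum ev.hom_mult ev.hom_minus hom_meval[OF h] 2 left_diff_distrib)
qed

text \<open>The value \<open>0\<close> keeps the evaluation of any polynomial inside the function field of the representation.\<close>

definition coord :: "nat \<Rightarrow> (nat, 'a alg_closure) mpoly fract" where
  "coord k = (if k < m then rvar k else 0)"

lemma coord_in_ratfuns: "coord k \<in> ratfuns {..<m}"
  using subfield_setD(2)[OF subfield_set_ratfuns] by (auto simp: coord_def intro: rvar_in_ratfuns)

lemma den_coord: "den = meval (\<lambda>c. rconst (to_ac c)) coord u"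
  unfolding den_def using u(1) by (intro meval_cong) (auto simp: coord_def)

text \<open>If \<open>\<rho>(A) x = \<rho>(A') x\<close> at a point \<open>x\<close> with \<open>u(x) \<noteq> 0\<close>, then \<open>A = A'\<close>. By the Nullstellensatz a power of
  \<open>u(x) (A\<^sub>i\<^sub>j - A'\<^sub>i\<^sub>j)\<close> therefore lies in the ideal of the equations for \<open>A\<close>, \<open>A'\<close> and \<open>\<rho>(A) x = \<rho>(A') x\<close>; at
  the generic point \<open>x\<close> the equations become differences of orbit maps.\<close>

lemma separation_by_orbit_map:
  assumes ij: "i < n" "j < n"
  shows "\<exists>N c. \<forall>\<gamma>'\<in>grp. \<forall>\<gamma>\<in>grp. (den * (rconst (fst \<gamma> $$ (i, j)) - rconst (fst \<gamma>' $$ (i, j)))) ^ N =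
    (\<Sum>l<m. meval rconst (case_sum (\<lambda>ab. rconst (fst \<gamma> $$ ab)) (case_sum (\<lambda>ab. rconst (fst \<gamma>' $$ ab)) coord)) (c l)
       * (act \<gamma> (rvar l) - act \<gamma>' (rvar l)))"
proof -
  let ?mat = "{..<n} \<times> {..<n}"
  define K :: "(nat \<times> nat + nat \<times> nat + nat) set" where "K = ?mat <+> (?mat <+> {..<m})"
  define E :: "nat \<times> nat + nat \<times> nat + nat \<Rightarrow> (nat \<times> nat + nat \<times> nat + nat, 'a alg_closure) mpoly"
    where "E = case_sum (gram_poly Inl) (case_sum (gram_poly (Inr \<circ> Inl)) point_poly)"
  define g :: "(nat \<times> nat + nat \<times> nat + nat, 'a alg_closure) mpoly"
    where "g = meval (\<lambda>c. mconst (to_ac c)) (\<lambda>k. mvar (Inr (Inr k))) u * (mvar (Inl (i, j)) - mvar (Inr (Inl (i, j))))"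
  have fin: "finite K" by (simp add: K_def)
  have "meval id z g = 0" if z: "\<forall>\<kappa>\<in>K. meval id z (E \<kappa>) = 0" for z
  proof -
    let ?A = "mat n n (\<lambda>ij. z (Inl ij))" and ?A' = "mat n n (\<lambda>ij. z ((Inr \<circ> Inl) ij))" and ?x = "vec m (\<lambda>k. z (Inr (Inr k)))"
    have z1: "meval id z (gram_poly Inl (a, b)) = 0" if "a < n" "b < n" for a b
      using bspec[OF z, of "Inl (a, b)"] that by (simp add: K_def E_def InlI)
    have z2: "meval id z (gram_poly (Inr \<circ> Inl) (a, b)) = 0" if "a < n" "b < n" for a b
      using bspec[OF z, of "Inr (Inl (a, b))"] that by (simp add: K_def E_def InlI InrI)
    have z3: "meval id z (point_poly l) = 0" if "l < m" for l
      using bspec[OF z, of "Inr (Inr l)"] that by (simp add: K_def E_def InlI InrI)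
    have A: "?A \<in> isometries" and A': "?A' \<in> isometries"
      by (rule gram_poly_zeros, erule z1, assumption) (rule gram_poly_zeros, erule z2, assumption)
    note ev = comm_ring_hom_meval[OF comm_ring_hom_id, of z]
    interpret ev: comm_ring_hom "meval id z" by (rule ev)
    have g: "meval id z g = meval to_ac (\<lambda>k. ?x $ k) u * (?A $$ (i, j) - ?A' $$ (i, j))"
    proof -
      have "meval to_ac (\<lambda>k. z (Inr (Inr k))) u = meval to_ac (\<lambda>k. ?x $ k) u"
        using u(1) by (intro meval_cong) auto
      then show ?thesis using ij by (simp add: g_def ev.hom_mult ev.hom_minus hom_meval[OF ev])
    qed
    show ?thesis
    proof (cases "meval to_ac (\<lambda>k. ?x $ k) u = 0")
      case False
      have eq: "\<rho> ?A *\<^sub>v ?x = \<rho> ?A' *\<^sub>v ?x"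
      proof (rule eq_vecI)
        show "dim_vec (\<rho> ?A *\<^sub>v ?x) = dim_vec (\<rho> ?A' *\<^sub>v ?x)" using rho(1)[OF A] rho(1)[OF A'] by auto
        fix l assume "l < dim_vec (\<rho> ?A' *\<^sub>v ?x)"
        then have l: "l < m" using rho(1)[OF A'] by auto
        have "0 = meval id z (point_poly l)" using z3[OF l] by simp
        also have "\<dots> = (\<Sum>j<m. \<rho> ?A $$ (l, j) * z (Inr (Inr j))) - (\<Sum>j<m. \<rho> ?A' $$ (l, j) * z (Inr (Inr j)))"
          by (subst meval_point_poly[OF comm_ring_hom_id l A A']) simp_all
        finally show "(\<rho> ?A *\<^sub>v ?x) $ l = (\<rho> ?A' *\<^sub>v ?x) $ l"
          using l rho(1)[OF A] rho(1)[OF A'] by (simp add: scalar_prod_def atLeast0LessThan)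
      qed
      obtain D where D: "D \<in> isometries" "?A' * D = 1\<^sub>m n" "D * ?A' = 1\<^sub>m n" using inverse_isometry[OF A'] by blast
      note c = rho(1)[OF A] rho(1)[OF A'] rho(1)[OF D(1)]
      have "\<rho> (D * ?A) *\<^sub>v ?x = \<rho> D *\<^sub>v (\<rho> ?A *\<^sub>v ?x)"
        unfolding rho(3)[OF D(1) A] using c by (intro assoc_mult_mat_vec[of _ m m _ m]) auto
      also have "\<dots> = \<rho> (D * ?A') *\<^sub>v ?x"
        unfolding rho(3)[OF D(1) A'] eq using c by (intro assoc_mult_mat_vec[symmetric, of _ m m _ m]) auto
      also have "\<dots> = ?x" unfolding D(3) rho(2) by simp
      finally have "D * ?A = 1\<^sub>m n"
        using u(3)[of ?x "D * ?A"] False mult_isometry[OF D(1) A] by simp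
      then have "?A' * D * ?A = ?A'"
        using isometriesD(1)[OF D(1)] by (simp add: assoc_mult_mat[of _ n n _ n _ n])
      then have "?A = ?A'" unfolding D(2) by simp
      then show ?thesis unfolding g by simp
    qed (simp add: g)
  qed
  then have "\<exists>N c. g ^ N = (\<Sum>\<kappa>\<in>K. c \<kappa> * E \<kappa>)" by (rule nullstellensatz[OF fin])
  then obtain N c where Nc: "g ^ N = (\<Sum>\<kappa>\<in>K. c \<kappa> * E \<kappa>)" by (elim exE)
  show ?thesis
  proof (intro exI[of _ N] exI[of _ "\<lambda>l. c (Inr (Inr l))"] ballI)
    fix \<gamma>' \<gamma> assume g': "\<gamma>' \<in> grp" and g: "\<gamma> \<in> grp"
    let ?f = "case_sum (\<lambda>ab. rconst (fst \<gamma> $$ ab)) (case_sum (\<lambda>ab. rconst (fst \<gamma>' $$ ab)) coord)"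
    note ev = comm_ring_hom_meval[OF comm_ring_hom_rconst, of ?f]
    interpret ev: comm_ring_hom "meval rconst ?f" by (rule ev)
    have 1: "meval rconst ?f (gram_poly Inl ab) = 0" if "ab \<in> ?mat" for ab
      by (rule meval_gram_poly_isometry[OF comm_ring_hom_rconst grpD(1)[OF g] that]) simp
    have 2: "meval rconst ?f (gram_poly (Inr \<circ> Inl) ab) = 0" if "ab \<in> ?mat" for ab
      by (rule meval_gram_poly_isometry[OF comm_ring_hom_rconst grpD(1)[OF g'] that]) simp
    have 3: "meval rconst ?f (point_poly l) = act \<gamma> (rvar l) - act \<gamma>' (rvar l)" if "l < m" for l
      by (subst meval_point_poly[OF comm_ring_hom_rconst that grpD(1)[OF g] grpD(1)[OF g']])
        (simp_all add: act_gens(2)[OF g that] act_gens(2)[OF g' that] coord_def)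
    have "(den * (rconst (fst \<gamma> $$ (i, j)) - rconst (fst \<gamma>' $$ (i, j)))) ^ N = meval rconst ?f (g ^ N)"
      by (simp add: ev.hom_power g_def ev.hom_mult ev.hom_minus hom_meval[OF ev] den_coord)
    also have "\<dots> = (\<Sum>\<kappa>\<in>K. meval rconst ?f (c \<kappa>) * meval rconst ?f (E \<kappa>))"
      unfolding Nc by (simp add: ev.hom_sum ev.hom_mult)
    also have "\<dots> = (\<Sum>l<m. meval rconst ?f (c (Inr (Inr l))) * (act \<gamma> (rvar l) - act \<gamma>' (rvar l)))"
      unfolding K_def by (simp add: sum.Plus E_def 1 2 3)
    finally show "(den * (rconst (fst \<gamma> $$ (i, j)) - rconst (fst \<gamma>' $$ (i, j)))) ^ N =
      (\<Sum>l<m. meval rconst ?f (c (Inr (Inr l))) * (act \<gamma> (rvar l) - act \<gamma>' (rvar l)))" .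
  qed
qed

text \<open>Each term of the coefficients in the identity above is a product of a function of one group element
  and a function of the other.\<close>

lemma matrix_coefficient_radicial:
  assumes ij: "i < n" "j < n"
  shows "\<exists>N (S :: nat set) f g w. finite S \<and> (\<forall>s\<in>S. \<forall>\<gamma>\<in>grp. f s \<gamma> \<in> ratfuns {..<m}) \<and>
    (\<forall>s\<in>S. w s \<in> V.orbit_span) \<and> (\<forall>\<gamma>'\<in>grp. \<forall>\<gamma>\<in>grp.
      (rconst (fst \<gamma> $$ (i, j)) - rconst (fst \<gamma>' $$ (i, j))) ^ N = (\<Sum>s\<in>S. f s \<gamma>' * g s \<gamma> * (w s \<gamma> - w s \<gamma>')))"
proof -
  note R = subfield_setD[OF subfield_set_ratfuns[of "{..<m}"]]
  from separation_by_orbit_map[OF ij] obtain N c where *: "\<forall>\<gamma>'\<in>grp. \<forall>\<gamma>\<in>grp.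
    (den * (rconst (fst \<gamma> $$ (i, j)) - rconst (fst \<gamma>' $$ (i, j)))) ^ N =
    (\<Sum>l<m. meval rconst (case_sum (\<lambda>ab. rconst (fst \<gamma> $$ ab)) (case_sum (\<lambda>ab. rconst (fst \<gamma>' $$ ab)) coord)) (c l)
       * (act \<gamma> (rvar l) - act \<gamma>' (rvar l)))" by (elim exE)
  define T where "T = Sigma {..<m} (\<lambda>l. Poly_Mapping.keys (c l))"
  have finT: "finite T" by (simp add: T_def)
  from ex_bij_betw_nat_finite[OF finT] obtain h where h: "bij_betw h {0..<card T} T" ..
  define f where "f s \<gamma>' = rconst (Poly_Mapping.lookup (c (fst s)) (snd s)) *
    (\<Prod>x\<in>Poly_Mapping.keys (snd s) \<inter> range Inr. case_sum (\<lambda>_. 0) (case_sum (\<lambda>ab. rconst (fst \<gamma>' $$ ab)) coord) x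
      ^ Poly_Mapping.lookup (snd s) x)" for s and \<gamma>' :: "'a alg_closure mat \<times> ('a alg_closure \<Rightarrow> 'a alg_closure)"
  define g where "g s \<gamma> = (\<Prod>x\<in>Poly_Mapping.keys (snd s) \<inter> range Inl.
    case_sum (\<lambda>ab. rconst (fst \<gamma> $$ ab)) (\<lambda>_. 0) x ^ Poly_Mapping.lookup (snd s) x)"
    for s :: "nat \<times> (nat \<times> nat + nat \<times> nat + nat \<Rightarrow>\<^sub>0 nat)" and \<gamma> :: "'a alg_closure mat \<times> ('a alg_closure \<Rightarrow> 'a alg_closure)"
  have fL: "f s \<gamma> / den ^ N \<in> ratfuns {..<m}" for s \<gamma>
    unfolding f_def using R(2) coord_in_ratfuns
    by (intro R(6,9) rconst_in_ratfuns subring_set_prod[OF R(1)] subring_set_power[OF R(1)] den(1))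
      (auto split: sum.splits)
  have wL: "(\<lambda>\<gamma>. act \<gamma> (rvar (fst s))) \<in> V.orbit_span" if "s \<in> T" for s
    using that by (intro V.orbit_span_orbit rvar_in_ratfuns) (auto simp: T_def)
  have eq: "(rconst (fst \<gamma> $$ (i, j)) - rconst (fst \<gamma>' $$ (i, j))) ^ N =
      (\<Sum>s\<in>T. f s \<gamma>' / den ^ N * g s \<gamma> * (act \<gamma> (rvar (fst s)) - act \<gamma>' (rvar (fst s))))"
    if "\<gamma>' \<in> grp" "\<gamma> \<in> grp" for \<gamma> \<gamma>'
  proof -
    have "den ^ N * (rconst (fst \<gamma> $$ (i, j)) - rconst (fst \<gamma>' $$ (i, j))) ^ N =
        (\<Sum>l<m. (\<Sum>t\<in>Poly_Mapping.keys (c l). f (l, t) \<gamma>' * g (l, t) \<gamma>) * (act \<gamma> (rvar l) - act \<gamma>' (rvar l)))"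
      unfolding power_mult_distrib[symmetric] bspec[OF bspec[OF * that(1)] that(2)] meval_split_variables f_def g_def fst_conv snd_conv ..
    also have "\<dots> = (\<Sum>s\<in>T. f s \<gamma>' * g s \<gamma> * (act \<gamma> (rvar (fst s)) - act \<gamma>' (rvar (fst s))))"
      unfolding T_def sum_distrib_right by (subst sum.Sigma) (auto simp: split_def)
    finally have "(rconst (fst \<gamma> $$ (i, j)) - rconst (fst \<gamma>' $$ (i, j))) ^ N =
        (\<Sum>s\<in>T. f s \<gamma>' * g s \<gamma> * (act \<gamma> (rvar (fst s)) - act \<gamma>' (rvar (fst s)))) / den ^ N"
      using den(2) by (simp add: eq_divide_eq mult.commute)
    then show ?thesis by (simp add: sum_divide_distrib)
  qed
  have hT: "h s \<in> T" if "s \<in> {0..<card T}" for s using bij_betwE[OF h] that by blast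
  show ?thesis
  proof (rule exI[of _ N], rule exI[of _ "{0..<card T}"], rule exI[of _ "\<lambda>s \<gamma>. f (h s) \<gamma> / den ^ N"],
      rule exI[of _ "\<lambda>s. g (h s)"], rule exI[of _ "\<lambda>s \<gamma>. act \<gamma> (rvar (fst (h s)))"], intro conjI ballI)
    show "finite {0..<card T}" by simp
    show "f (h s) \<gamma> / den ^ N \<in> ratfuns {..<m}" for s \<gamma> by (rule fL)
    show "(\<lambda>\<gamma>. act \<gamma> (rvar (fst (h s)))) \<in> V.orbit_span" if "s \<in> {0..<card T}" for s by (rule wL[OF hT[OF that]])
    fix \<gamma>' \<gamma> assume "\<gamma>' \<in> grp" "\<gamma> \<in> grp"
    from eq[OF this] show "(rconst (fst \<gamma> $$ (i, j)) - rconst (fst \<gamma>' $$ (i, j))) ^ N =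
      (\<Sum>s\<in>{0..<card T}. f (h s) \<gamma>' / den ^ N * g (h s) \<gamma> * (act \<gamma> (rvar (fst (h s))) - act \<gamma>' (rvar (fst (h s)))))"
      unfolding sum.reindex_bij_betw[OF h, of "\<lambda>s. f s \<gamma>' / den ^ N * g s \<gamma> * (act \<gamma> (rvar (fst s)) - act \<gamma>' (rvar (fst s)))"] .
  qed
qed

text \<open>The matrix of \<open>\<gamma>\<close> is the matrix of \<open>\<gamma>\<delta>\<close> times the transform of a fixed matrix by \<open>\<gamma>\<close>, so the span of the
  matrix coefficients is stable under translations.\<close>

lemma matrix_coefficient_V_orbit_span:
  assumes "i < n" "j < n"
  shows "(\<lambda>\<gamma>. rconst (fst \<gamma> $$ (i, j))) \<in> V.orbit_span"
proof -
  let ?I = "{..<n} \<times> {..<n}"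
  have trans: "\<exists>v. (\<forall>i\<in>?I. \<forall>k\<in>?I. v i k \<in> ratfuns {..<m}) \<and> (\<forall>\<gamma>\<in>grp. \<forall>i\<in>?I. rconst (fst \<gamma> $$ i) =
      (\<Sum>k\<in>?I. act \<gamma> (v i k) * rconst (fst (gmul \<gamma> \<delta>) $$ k)))" if d: "\<delta> \<in> grp" for \<delta>
  proof -
    obtain D where D: "D \<in> isometries" "fst \<delta> * D = 1\<^sub>m n" "D * fst \<delta> = 1\<^sub>m n" by (rule inverse_isometry[OF grpD(1)[OF d]])
    note Dc = isometriesD(1)[OF D(1)]
    have R0: "(0 :: (nat, 'a alg_closure) mpoly fract) \<in> ratfuns {..<m}" by (rule subfield_setD(2)[OF subfield_set_ratfuns])
    show ?thesis
    proof (intro exI[of _ "\<lambda>i k. if snd k = snd i then rconst (D $$ (fst i, fst k)) else 0"] conjI ballI)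
      show "(if snd k = snd i then rconst (D $$ (fst i, fst k)) else 0) \<in> ratfuns {..<m}" for i k :: "nat \<times> nat"
        using R0 by simp
      fix \<gamma> i assume g: "\<gamma> \<in> grp" and "i \<in> ?I"
      then obtain a b where i: "i = (a, b)" "a < n" "b < n" by auto
      interpret s: comm_ring_hom "snd \<gamma>" by (rule grpD(4)[OF g])
      have gm: "fst (gmul \<gamma> \<delta>) \<in> carrier_mat n n" by (rule grpD(3)[OF gmul_grp[OF g d]])
      have "map_mat (snd \<gamma>) D * fst (gmul \<gamma> \<delta>) = map_mat (snd \<gamma>) (D * fst \<delta>) * fst \<gamma>"
        using Dc grpD(3)[OF d] grpD(3)[OF g]
        by (simp add: gmul_def s.mat_hom_mult[of _ n n _ n] assoc_mult_mat[of _ n n _ n _ n])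
      also have "\<dots> = fst \<gamma>" unfolding D(3) s.mat_hom_one using grpD(3)[OF g] by simp
      finally have "rconst (fst \<gamma> $$ (a, b)) = (\<Sum>k<n. rconst (snd \<gamma> (D $$ (a, k))) * rconst (fst (gmul \<gamma> \<delta>) $$ (k, b)))"
        using index_mat_mult_lessThan[of "map_mat (snd \<gamma>) D" n n "fst (gmul \<gamma> \<delta>)" n a b] gm Dc i
        by (simp add: rconst_sum)
      also have "\<dots> = (\<Sum>k<n. \<Sum>l<n. if l = b then rconst (snd \<gamma> (D $$ (a, k))) * rconst (fst (gmul \<gamma> \<delta>) $$ (k, l)) else 0)"
        using i by simp
      also have "\<dots> = (\<Sum>k\<in>?I. act \<gamma> (if snd k = snd i then rconst (D $$ (fst i, fst k)) else 0) * rconst (fst (gmul \<gamma> \<delta>) $$ k))"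
        unfolding sum.cartesian_product i(1)
        by (intro sum.cong) (auto simp: act_gens(1)[OF g] V.act_simps[OF g])
      finally show "rconst (fst \<gamma> $$ i) = (\<Sum>k\<in>?I. act \<gamma> (if snd k = snd i then rconst (D $$ (fst i, fst k)) else 0) * rconst (fst (gmul \<gamma> \<delta>) $$ k))"
        unfolding i(1) .
    qed
  qed
  have "(\<lambda>ab \<gamma>. rconst (fst \<gamma> $$ ab)) (i, j) \<in> V.orbit_span"
  proof (rule V.radicial_family_in_orbit_span[where a = "\<lambda>ab \<gamma>. rconst (fst \<gamma> $$ ab)" and I = ?I])
    show "\<exists>N (S :: nat set) f g w. finite S \<and> (\<forall>s\<in>S. \<forall>\<gamma>\<in>grp. f s \<gamma> \<in> ratfuns {..<m}) \<and>
      (\<forall>s\<in>S. w s \<in> V.orbit_span) \<and> (\<forall>\<gamma>'\<in>grp. \<forall>\<gamma>\<in>grp.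
        (rconst (fst \<gamma> $$ k) - rconst (fst \<gamma>' $$ k)) ^ N = (\<Sum>s\<in>S. f s \<gamma>' * g s \<gamma> * (w s \<gamma> - w s \<gamma>')))"
      if "k \<in> ?I" for k
      using matrix_coefficient_radicial[of "fst k" "snd k"] that by (simp only: mem_Times_iff lessThan_iff prod.collapse)
  qed (use assms trans in auto)
  then show ?thesis .
qed

text \<open>The determinant of the matrix of variables does not vanish since its value at the identity is \<open>1\<close>.\<close>

lemma generic_matrix:
  defines "M \<equiv> mat n n (\<lambda>(a, b). rvar (m + a * n + b) :: (nat, 'a alg_closure) mpoly fract)"
  shows "M \<in> carrier_mat n n" "det M \<noteq> 0"
    "\<And>i j. i < n \<Longrightarrow> j < n \<Longrightarrow> M $$ (i, j) \<in> ratfuns {m..<m + n * n}"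
    "\<And>\<gamma>. \<gamma> \<in> grp \<Longrightarrow> map_mat (act \<gamma>) M = map_mat rconst (fst \<gamma>) * M"
proof -
  show M: "M \<in> carrier_mat n n" by (simp add: M_def)
  show "M $$ (i, j) \<in> ratfuns {m..<m + n * n}" if "i < n" "j < n" for i j
    using that matrix_index_bound[OF that] by (auto simp: M_def intro!: rvar_in_ratfuns)
  show "map_mat (act \<gamma>) M = map_mat rconst (fst \<gamma>) * M" if g: "\<gamma> \<in> grp" for \<gamma>
  proof (rule eq_matI)
    fix a b assume "a < dim_row (map_mat rconst (fst \<gamma>) * M)" "b < dim_col (map_mat rconst (fst \<gamma>) * M)"
    then have ab: "a < n" "b < n" using M grpD(3)[OF g] by auto
    have "(map_mat rconst (fst \<gamma>) * M) $$ (a, b) = (\<Sum>k<n. map_mat rconst (fst \<gamma>) $$ (a, k) * M $$ (k, b))"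
      using M grpD(3)[OF g] ab by (intro index_mat_mult_lessThan) auto
    also have "\<dots> = act \<gamma> (M $$ (a, b))" using ab grpD(3)[OF g] by (simp add: M_def act_gens(3)[OF g])
    finally show "map_mat (act \<gamma>) M $$ (a, b) = (map_mat rconst (fst \<gamma>) * M) $$ (a, b)" using ab M by simp
  qed (use M grpD(3)[OF g] in auto)
  interpret ev: comm_ring_hom "meval rconst (rvar :: nat \<Rightarrow> (nat, 'a alg_closure) mpoly fract)"
    by (rule comm_ring_hom_meval[OF comm_ring_hom_rconst])
  define z :: "nat \<Rightarrow> 'a alg_closure" where "z i = (if (i - m) div n = (i - m) mod n then 1 else 0)" for i
  interpret ez: comm_ring_hom "meval id z" by (rule comm_ring_hom_meval[OF comm_ring_hom_id])
  let ?P = "mat n n (\<lambda>(a, b). mvar (m + a * n + b) :: (nat, 'a alg_closure) mpoly)"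
  have "map_mat (meval rconst rvar) ?P = M" by (intro eq_matI) (auto simp: M_def)
  then have d: "det M = meval rconst rvar (det ?P)" by (metis ev.hom_det)
  have "map_mat (meval id z) ?P = 1\<^sub>m n" by (intro eq_matI) (auto simp: z_def)
  then have "meval id z (det ?P) = 1" by (metis ez.hom_det det_one)
  then have "det ?P \<noteq> 0" by auto
  then show "det M \<noteq> 0" unfolding d by (simp only: meval_rconst_rvar_eq_0_iff not_False_eq_True)
qed

text \<open>For the generic matrix \<open>M\<close> and \<open>\<gamma> = (A, \<sigma>)\<close> one has \<open>\<gamma>(M) = A M\<close>, hence \<open>A = \<gamma>(M) M\<^sup>-\<^sup>1\<close>.\<close>

lemma matrix_coefficient_W_orbit_span:
  assumes "i < n" "j < n"
  shows "(\<lambda>\<gamma>. rconst (fst \<gamma> $$ (i, j))) \<in> W.orbit_span"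
proof -
  define M where "M = mat n n (\<lambda>(a, b). rvar (m + a * n + b) :: (nat, 'a alg_closure) mpoly fract)"
  note M = generic_matrix[folded M_def]
  obtain M' where M': "M' \<in> carrier_mat n n" "M * M' = 1\<^sub>m n" "\<forall>i<n. \<forall>j<n. M' $$ (i, j) \<in> ratfuns {m..<m + n * n}"
    using inverse_matrix_over_subfield[OF subfield_set_ratfuns M(1,3,2)] by auto
  have "rconst (fst \<gamma> $$ (i, j)) = (\<Sum>k<n. act \<gamma> (M $$ (i, k)) * M' $$ (k, j))" if g: "\<gamma> \<in> grp" for \<gamma>
  proof -
    have "map_mat rconst (fst \<gamma>) = map_mat (act \<gamma>) M * M'"
      unfolding M(4)[OF g] using M(1) M'(1,2) grpD(3)[OF g] by (simp add: assoc_mult_mat[of _ n n _ n _ n])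
    then have "map_mat rconst (fst \<gamma>) $$ (i, j) = (\<Sum>k<n. map_mat (act \<gamma>) M $$ (i, k) * M' $$ (k, j))"
      using index_mat_mult_lessThan[of "map_mat (act \<gamma>) M" n n M' n i j] M(1) M'(1) assms by simp
    then show ?thesis using assms grpD(3)[OF g] M(1) by simp
  qed
  then show ?thesis
    using assms M(3) M'(3) by (intro W.orbit_spanI[of "{..<n}"]) auto
qed

end

section \<open>Invariant frames\<close>

context orthogonal_rep
begin

text \<open>A representation whose matrix entries are orbit sums splits over the function field, so its
  coordinates become invariant in a suitable frame.\<close>

lemma invariant_frame:
  fixes \<tau> :: "'a alg_closure mat \<Rightarrow> 'a alg_closure mat"
  assumes act: "semilinear_action grp act gmul gone L"
    and \<tau>: "\<And>A. A \<in> isometries \<Longrightarrow> \<tau> A \<in> carrier_mat p p" "\<tau> (1\<^sub>m n) = 1\<^sub>m p"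
      "\<And>A A'. A \<in> isometries \<Longrightarrow> A' \<in> isometries \<Longrightarrow> \<tau> (A * A') = \<tau> A * \<tau> A'"
      "\<And>\<sigma> A. \<sigma> \<in> absolute_galois_group \<Longrightarrow> A \<in> isometries \<Longrightarrow> \<tau> (map_mat \<sigma> A) = map_mat \<sigma> (\<tau> A)"
    and entries: "\<And>i j. i < p \<Longrightarrow> j < p \<Longrightarrow>
      (\<lambda>\<gamma>. rconst (\<tau> (fst \<gamma>) $$ (i, j))) \<in> semilinear_action.orbit_span grp act L"
    and vars: "\<And>\<gamma> j b. \<gamma> \<in> grp \<Longrightarrow> j < p \<Longrightarrow> b < q \<Longrightarrow>
      act \<gamma> (rvar (off + j * q + b)) = (\<Sum>k<p. rconst (\<tau> (fst \<gamma>) $$ (j, k)) * rvar (off + k * q + b))"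
  shows "\<exists>F\<in>carrier_mat p p. \<exists>F'\<in>carrier_mat p p. F * F' = 1\<^sub>m p \<and> F' * F = 1\<^sub>m p \<and>
    (\<forall>i<p. \<forall>j<p. F $$ (i, j) \<in> L) \<and> (\<forall>i<p. \<forall>j<p. F' $$ (i, j) \<in> L) \<and>
    (\<forall>\<gamma>\<in>grp. \<forall>i<p * q. act \<gamma> (frame_coord F' p q off i) = frame_coord F' p q off i)"
proof -
  interpret S: semilinear_action grp act gmul gone L by (rule act)
  interpret r: comm_ring_hom "rconst :: 'a alg_closure \<Rightarrow> (nat, 'a alg_closure) mpoly fract" by (rule comm_ring_hom_rconst)
  define c where "c \<gamma> = map_mat rconst (\<tau> (fst \<gamma>))" for \<gamma> :: "'a alg_closure mat \<times> ('a alg_closure \<Rightarrow> 'a alg_closure)"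
  have c: "c \<gamma> \<in> carrier_mat p p" if "\<gamma> \<in> grp" for \<gamma> using \<tau>(1)[OF grpD(1)[OF that]] by (simp add: c_def)
  have "\<exists>F\<in>carrier_mat p p. (\<forall>i<p. \<forall>j<p. F $$ (i, j) \<in> L) \<and> det F \<noteq> 0 \<and> (\<forall>\<gamma>\<in>grp. map_mat (act \<gamma>) F = c \<gamma> * F)"
  proof (rule S.cocycle_splits[OF c])
    show "c gone = 1\<^sub>m p" by (simp add: c_def gone_def \<tau>(2) r.mat_hom_one)
    show "c (gmul \<gamma> \<delta>) = map_mat (act \<gamma>) (c \<delta>) * c \<gamma>" if g: "\<gamma> \<in> grp" and d: "\<delta> \<in> grp" for \<gamma> \<delta>
    proof -
      note gd = galois_isometry[OF grpD(2)[OF g] grpD(1)[OF d]]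
      have "c (gmul \<gamma> \<delta>) = map_mat rconst (map_mat (snd \<gamma>) (\<tau> (fst \<delta>))) * c \<gamma>"
        unfolding c_def gmul_def fst_conv \<tau>(3)[OF gd grpD(1)[OF g]] \<tau>(4)[OF grpD(2)[OF g] grpD(1)[OF d]]
        using \<tau>(1)[OF grpD(1)[OF g]] \<tau>(1)[OF grpD(1)[OF d]] by (simp add: r.mat_hom_mult[of _ p p _ p])
      also have "map_mat rconst (map_mat (snd \<gamma>) (\<tau> (fst \<delta>))) = map_mat (act \<gamma>) (c \<delta>)"
        by (intro eq_matI) (auto simp: c_def act_gens(1)[OF g])
      finally show ?thesis .
    qed
    show "(\<lambda>\<gamma>. c \<gamma> $$ (i, j)) \<in> S.orbit_span" if "i < p" "j < p" for i j
      using \<tau>(1) grpD(1) that by (intro S.orbit_span_cong[OF entries[OF that]]) (fastforce simp: c_def)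
  qed
  then obtain F where F: "F \<in> carrier_mat p p" "\<forall>i<p. \<forall>j<p. F $$ (i, j) \<in> L" "det F \<noteq> 0"
    "\<forall>\<gamma>\<in>grp. map_mat (act \<gamma>) F = c \<gamma> * F" by (elim bexE conjE)
  have "\<exists>F'\<in>carrier_mat p p. F * F' = 1\<^sub>m p \<and> F' * F = 1\<^sub>m p \<and> (\<forall>i<p. \<forall>j<p. F' $$ (i, j) \<in> L)"
    using F(1,2,3) by (intro inverse_matrix_over_subfield[OF S.L]) auto
  then obtain F' where F': "F' \<in> carrier_mat p p" "F * F' = 1\<^sub>m p" "F' * F = 1\<^sub>m p" "\<forall>i<p. \<forall>j<p. F' $$ (i, j) \<in> L"
    by (elim bexE conjE)
  have "act \<gamma> (frame_coord F' p q off i) = frame_coord F' p q off i" if g: "\<gamma> \<in> grp" and i: "i < p * q" for \<gamma> i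
  proof -
    interpret h: comm_ring_hom "act \<gamma>" by (rule comm_ring_hom_act[OF g])
    define j b where "j = i div q" and "b = i mod q"
    have q: "q > 0" using i by (cases q) auto
    have jb: "j < p" "b < q" using i q by (auto simp: j_def b_def less_mult_imp_div_less)
    let ?D = "map_mat (act \<gamma>) F'"
    have D: "?D \<in> carrier_mat p p" using F' by simp
    note cg = c[OF g]
    have "?D * c \<gamma> * F = ?D * (c \<gamma> * F)" using D cg F(1) by (intro assoc_mult_mat) auto
    also have "\<dots> = map_mat (act \<gamma>) (F' * F)"
      unfolding bspec[OF F(4) g, symmetric] using F(1) F'(1) by (simp add: h.mat_hom_mult[of _ p p _ p])
    also have "\<dots> = 1\<^sub>m p" unfolding F'(3) by (rule h.mat_hom_one)
    finally have 1: "?D * c \<gamma> * F = 1\<^sub>m p" .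
    have "?D * c \<gamma> = ?D * c \<gamma> * (F * F')" unfolding F'(2) using D cg by simp
    also have "\<dots> = ?D * c \<gamma> * F * F'"
      using F(1) F'(1) D cg by (intro assoc_mult_mat[symmetric, of _ p p _ p _ p]) auto
    finally have Dc: "?D * c \<gamma> = F'" unfolding 1 using F'(1) by simp
    have v: "act \<gamma> (rvar (off + k * q + b)) = (\<Sum>l<p. c \<gamma> $$ (k, l) * rvar (off + l * q + b))" if "k < p" for k
      using vars[OF g that jb(2)] that \<tau>(1)[OF grpD(1)[OF g]] by (simp add: c_def)
    have "act \<gamma> (frame_coord F' p q off i) = (\<Sum>k<p. ?D $$ (j, k) * (\<Sum>l<p. c \<gamma> $$ (k, l) * rvar (off + l * q + b)))"
      unfolding frame_coord_def j_def[symmetric] b_def[symmetric] h.hom_sum h.hom_mult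
      using F'(1) jb v by (intro sum.cong) auto
    also have "\<dots> = (\<Sum>l<p. (?D * c \<gamma>) $$ (j, l) * rvar (off + l * q + b))"
      unfolding sum_distrib_left using index_mat_mult_lessThan[OF D cg jb(1)]
      by (subst sum.swap) (simp add: sum_distrib_right mult.assoc del: index_mult_mat(1))
    also have "\<dots> = frame_coord F' p q off i" unfolding Dc frame_coord_def j_def b_def ..
    finally show ?thesis .
  qed
  then show ?thesis using F F' by blast
qed

lemma V_frame:
  "\<exists>F F'. frame F F' n n m {..<m} \<and> (\<forall>\<gamma>\<in>grp. \<forall>i<n * n. act \<gamma> (frame_coord F' n n m i) = frame_coord F' n n m i)"
proof -
  have "\<exists>F\<in>carrier_mat n n. \<exists>F'\<in>carrier_mat n n. F * F' = 1\<^sub>m n \<and> F' * F = 1\<^sub>m n \<and>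
    (\<forall>i<n. \<forall>j<n. F $$ (i, j) \<in> ratfuns {..<m}) \<and> (\<forall>i<n. \<forall>j<n. F' $$ (i, j) \<in> ratfuns {..<m}) \<and>
    (\<forall>\<gamma>\<in>grp. \<forall>i<n * n. act \<gamma> (frame_coord F' n n m i) = frame_coord F' n n m i)"
    using isometriesD(1) matrix_coefficient_V_orbit_span act_gens(3)
    by (intro invariant_frame[OF V.semilinear_action_axioms, where \<tau> = "\<lambda>A. A"]) auto
  then show ?thesis
    by (elim bexE conjE) (intro exI conjI, unfold_locales, auto)
qed

lemma W_frame:
  "\<exists>F F'. frame F F' m 1 0 {m..<m + n * n} \<and> (\<forall>\<gamma>\<in>grp. \<forall>i<m. act \<gamma> (frame_coord F' m 1 0 i) = frame_coord F' m 1 0 i)"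
proof -
  have entries: "(\<lambda>\<gamma>. rconst (\<rho> (fst \<gamma>) $$ (i, j))) \<in> W.orbit_span" if ij: "i < m" "j < m" for i j
  proof (rule W.orbit_span_cong)
    show "(\<lambda>\<gamma>. meval (\<lambda>c. rconst (to_ac c)) (\<lambda>ab. rconst (fst \<gamma> $$ ab)) (P i j)) \<in> W.orbit_span"
      using P(1)[OF ij] matrix_coefficient_W_orbit_span
      by (intro W.orbit_span_meval[where f = "\<lambda>ab \<gamma>. rconst (fst \<gamma> $$ ab)"]) auto
    show "rconst (\<rho> (fst \<gamma>) $$ (i, j)) = meval (\<lambda>c. rconst (to_ac c)) (\<lambda>ab. rconst (fst \<gamma> $$ ab)) (P i j)"
      if "\<gamma> \<in> grp" for \<gamma>
      using P(2)[OF ij grpD(1)[OF that]] by (simp add: hom_meval[OF comm_ring_hom_rconst])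
  qed
  have "\<exists>F\<in>carrier_mat m m. \<exists>F'\<in>carrier_mat m m. F * F' = 1\<^sub>m m \<and> F' * F = 1\<^sub>m m \<and>
    (\<forall>i<m. \<forall>j<m. F $$ (i, j) \<in> ratfuns {m..<m + n * n}) \<and> (\<forall>i<m. \<forall>j<m. F' $$ (i, j) \<in> ratfuns {m..<m + n * n}) \<and>
    (\<forall>\<gamma>\<in>grp. \<forall>i<m * 1. act \<gamma> (frame_coord F' m 1 0 i) = frame_coord F' m 1 0 i)"
    by (intro invariant_frame[OF W.semilinear_action_axioms, where \<tau> = \<rho>])
      (auto simp: rho rho_galois entries act_gens(2) simp del: One_nat_def)
  then show ?thesis
    by (elim bexE conjE) (intro exI conjI, unfold_locales, auto)
qed

end

section \<open>The generic symmetric matrix\<close>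

text \<open>Split off an index \<open>i\<close> with \<open>S i i \<noteq> 0\<close>, using a square root, and subtract a matrix of rank one. If all
  diagonal entries vanish but \<open>S i j \<noteq> 0\<close>, replacing the basis vector \<open>i\<close> by the sum of the basis vectors
  \<open>i\<close> and \<open>j\<close> produces a nonzero diagonal entry.\<close>

lemma symmetric_eq_gram_family:
  fixes S :: "nat \<Rightarrow> nat \<Rightarrow> 'f::{alg_closed_field, field_char_0}"
  assumes "finite J" "\<And>i j. S i j = S j i"
  shows "\<exists>q. \<forall>i\<in>J. \<forall>j\<in>J. S i j = (\<Sum>k\<in>J. q k i * q k j)"
  using assms
proof (induction "card J" arbitrary: J S)
  case 0
  then show ?case by auto
next
  case (Suc N)
  note fin = \<open>finite J\<close> and sym = \<open>\<And>i j. S i j = S j i\<close>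
  have diag: "\<exists>q. \<forall>i\<in>J. \<forall>j\<in>J. S i j = (\<Sum>k\<in>J. q k i * q k j)"
    if i: "i \<in> J" "S i i \<noteq> 0" and sym: "\<And>i j. S i j = S j i" for S :: "nat \<Rightarrow> nat \<Rightarrow> 'f" and i
  proof -
    obtain d where d: "d ^ 2 = S i i" using nth_root_exists[of 2 "S i i"] by auto
    then have d0: "d \<noteq> 0" using i(2) by auto
    have "\<exists>q. \<forall>a\<in>J - {i}. \<forall>b\<in>J - {i}. S a b - S i a * S i b / S i i = (\<Sum>k\<in>J - {i}. q k a * q k b)"
      using Suc.hyps(2) fin i sym by (intro Suc.hyps(1)) (auto simp: mult.commute)
    then obtain q where q: "\<And>a b. a \<in> J - {i} \<Longrightarrow> b \<in> J - {i} \<Longrightarrow>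
      S a b - S i a * S i b / S i i = (\<Sum>k\<in>J - {i}. q k a * q k b)" by blast
    define q' where "q' k a = (if k = i then S i a / d else if a = i then 0 else q k a)" for k a
    have "S a b = (\<Sum>k\<in>J. q' k a * q' k b)" if ab: "a \<in> J" "b \<in> J" for a b
    proof -
      have "(\<Sum>k\<in>J. q' k a * q' k b) = S i a * S i b / S i i + (\<Sum>k\<in>J - {i}. q' k a * q' k b)"
        using fin i by (subst sum.remove[of _ i]) (auto simp: q'_def d[symmetric] power2_eq_square)
      also have "(\<Sum>k\<in>J - {i}. q' k a * q' k b) = S a b - S i a * S i b / S i i"
      proof (cases "a = i \<or> b = i")
        case True
        then have "(\<Sum>k\<in>J - {i}. q' k a * q' k b) = 0" by (intro sum.neutral) (auto simp: q'_def)
        then show ?thesis using True i(2) sym[of i a] by auto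
      next
        case False
        then have "(\<Sum>k\<in>J - {i}. q' k a * q' k b) = (\<Sum>k\<in>J - {i}. q k a * q k b)"
          by (intro sum.cong) (auto simp: q'_def)
        then show ?thesis using q[of a b] False ab by simp
      qed
      finally show ?thesis by simp
    qed
    then show ?thesis by blast
  qed
  consider i where "i \<in> J" "S i i \<noteq> 0" | i j where "i \<in> J" "j \<in> J" "S i j \<noteq> 0" "\<forall>i\<in>J. S i i = 0"
    | "\<forall>i\<in>J. \<forall>j\<in>J. S i j = 0" by blast
  then show ?case
  proof cases
    case 1
    then show ?thesis by (rule diag) (rule sym)
  next
    case 2
    then have ij: "i \<noteq> j" by auto
    define S' where "S' a b = S a b + (if a = i then S j b else 0) + (if b = i then S a j else 0)" for a b
    have "\<exists>q. \<forall>a\<in>J. \<forall>b\<in>J. S' a b = (\<Sum>k\<in>J. q k a * q k b)"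
    proof (rule diag[OF 2(1)])
      show "S' i i \<noteq> 0" using 2 sym[of j i] by (simp add: S'_def)
      show "S' a b = S' b a" for a b using sym[of a b] sym[of j b] sym[of j a] by (simp add: S'_def)
    qed
    then obtain q where q: "\<And>a b. a \<in> J \<Longrightarrow> b \<in> J \<Longrightarrow> S' a b = (\<Sum>k\<in>J. q k a * q k b)" by blast
    define q' where "q' k a = q k a - (if a = i then q k j else 0)" for k a
    have "S a b = (\<Sum>k\<in>J. q' k a * q' k b)" if ab: "a \<in> J" "b \<in> J" for a b
    proof -
      have "(\<Sum>k\<in>J. q' k a * q' k b) = S' a b - (if a = i then S' j b else 0) - (if b = i then S' a j else 0)
          + (if a = i \<and> b = i then S' j j else 0)"
        using ab 2 by (simp add: q q'_def algebra_simps sum.distrib sum_subtractf)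
      also have "\<dots> = S a b" using ij 2(2,4) by (auto simp: S'_def)
      finally show ?thesis by simp
    qed
    then show ?thesis by blast
  qed (auto intro: exI[of _ "\<lambda>_ _. 0"])
qed

lemma symmetric_eq_gram:
  fixes S :: "'f::{alg_closed_field, field_char_0} mat"
  assumes S: "S \<in> carrier_mat n n" "S\<^sup>T = S"
  shows "\<exists>Q\<in>carrier_mat n n. Q\<^sup>T * Q = S"
proof -
  have sym: "S $$ (i, j) = S $$ (j, i)" if "i < n" "j < n" for i j
    using index_transpose_mat(1)[of i S j] S that by auto
  define s where "s i j = (if i < n \<and> j < n then S $$ (i, j) else 0)" for i j
  have "s i j = s j i" for i j using sym[of i j] by (auto simp: s_def)
  then have "\<exists>q. \<forall>i\<in>{..<n}. \<forall>j\<in>{..<n}. s i j = (\<Sum>k\<in>{..<n}. q k i * q k j)"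
    by (intro symmetric_eq_gram_family) auto
  then obtain q where q: "\<And>i j. i < n \<Longrightarrow> j < n \<Longrightarrow> S $$ (i, j) = (\<Sum>k<n. q k i * q k j)" by (auto simp: s_def)
  have "(mat n n (\<lambda>(k, i). q k i))\<^sup>T * mat n n (\<lambda>(k, i). q k i) = S"
  proof (rule eq_matI)
    fix i j assume "i < dim_row S" "j < dim_col S"
    then have ij: "i < n" "j < n" using S by auto
    show "((mat n n (\<lambda>(k, i). q k i))\<^sup>T * mat n n (\<lambda>(k, i). q k i)) $$ (i, j) = S $$ (i, j)"
      using ij q[OF ij] index_mat_mult_lessThan[of "(mat n n (\<lambda>(k, i). q k i))\<^sup>T" n n "mat n n (\<lambda>(k, i). q k i)" n i j]
      by simp
  qed (use S in auto)
  then show ?thesis by (intro bexI[of _ "mat n n (\<lambda>(k, i). q k i)"]) auto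
qed

lemma symmetric_eq_gram_of_form:
  fixes S :: "'f::{alg_closed_field, field_char_0} mat"
  assumes B: "B \<in> carrier_mat n n" "B\<^sup>T = B" "det B \<noteq> 0" and S: "S \<in> carrier_mat n n" "S\<^sup>T = S"
  shows "\<exists>Y\<in>carrier_mat n n. Y\<^sup>T * B * Y = S"
proof -
  obtain D where D: "D \<in> carrier_mat n n" "D\<^sup>T * D = B" using symmetric_eq_gram[OF B(1,2)] by blast
  obtain Q where Q: "Q \<in> carrier_mat n n" "Q\<^sup>T * Q = S" using symmetric_eq_gram[OF S] by blast
  have "det B = det (D\<^sup>T) * det D" unfolding D(2)[symmetric] using D(1) by (intro det_mult[of _ n]) auto
  then have "det D \<noteq> 0" using B(3) by auto
  then obtain D' where D': "D' \<in> carrier_mat n n" "D * D' = 1\<^sub>m n"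
    using inverse_matrix_over_subfield[OF subfield_set_UNIV D(1)] by auto
  have "(D' * Q)\<^sup>T * B * (D' * Q) = (D * D' * Q)\<^sup>T * (D * D' * Q)"
    unfolding D(2)[symmetric] using D(1) D'(1) Q(1)
    by (simp add: transpose_mult[of _ n n _ n] assoc_mult_mat[of _ n n _ n _ n])
  also have "\<dots> = S" using Q by (simp add: D'(2))
  finally show ?thesis using D'(1) Q(1) by (intro bexI[of _ "D' * Q"]) auto
qed

text \<open>A linear retraction of a field extension onto the base field carries a linear relation with
  coefficients in the large field to one with coefficients in the base.\<close>

lemma linear_retraction:
  "\<exists>r :: 'c::field alg_closure \<Rightarrow> 'c. r 1 = 1 \<and> (\<forall>x y. r (x + y) = r x + r y) \<and> (\<forall>c x. r (to_ac c * x) = c * r x)"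
proof -
  interpret v: vector_space_pair "\<lambda>(c :: 'c) (x :: 'c alg_closure). to_ac c * x" "(*) :: 'c \<Rightarrow> 'c \<Rightarrow> 'c"
    by unfold_locales (auto simp: algebra_simps)
  have "v.vs1.independent {1}" by (simp add: v.vs1.dependent_single)
  from v.linear_independent_extend[OF this, of "\<lambda>_. 1"] obtain r where
    "Vector_Spaces.linear (\<lambda>(c :: 'c) (x :: 'c alg_closure). to_ac c * x) (*) r" "r 1 = 1" by auto
  then show ?thesis
    by (intro exI[of _ r]) (auto simp: Vector_Spaces.linear_iff)
qed

lemma map_mult_base:
  fixes r :: "'c::field alg_closure \<Rightarrow> 'c" and p :: "('x, 'c alg_closure) mpoly"
  assumes r: "\<And>x y. r (x + y) = r x + r y" "\<And>c x. r (to_ac c * x) = c * r x"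
  shows "Poly_Mapping.map r (p * Poly_Mapping.map to_ac q) = Poly_Mapping.map r p * q"
proof -
  have r0: "r 0 = 0" using r(2)[of 0 0] by simp
  have add: "Poly_Mapping.map r (f + g) = Poly_Mapping.map r f + Poly_Mapping.map r g"
    for f g :: "('x, 'c alg_closure) mpoly"
    by (rule poly_mapping_eqI) (simp add: lookup_map[of r] r0 r lookup_add)
  have addc: "Poly_Mapping.map to_ac (f + g) = Poly_Mapping.map to_ac f + Poly_Mapping.map to_ac g"
    for f g :: "('x, 'c) mpoly"
    by (rule poly_mapping_eqI) (simp add: lookup_map lookup_add)
  have single: "Poly_Mapping.map s (Poly_Mapping.single t c) = Poly_Mapping.single t (s c)" if "s 0 = 0"
    for s :: "'u::zero \<Rightarrow> 'w::zero" and t :: "'x \<Rightarrow>\<^sub>0 nat" and c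
    by (rule poly_mapping_eqI) (simp add: lookup_map that lookup_single when_def)
  show ?thesis
  proof (induction q rule: mpoly_induct_single)
    case (single t c)
    note sg = single
    show ?case
    proof (induction p rule: mpoly_induct_single)
      case (single s d)
      have "r (d * to_ac c) = r d * c" using r(2)[of c d] by (simp add: mult.commute)
      then show ?case by (simp add: \<open>\<And>s t c. s 0 = 0 \<Longrightarrow> Poly_Mapping.map s (Poly_Mapping.single t c) = Poly_Mapping.single t (s c)\<close> r0 mult_single)
    qed (simp add: add distrib_right)
  qed (simp add: addc add distrib_left)
qed

lemma map_mat_entry: "A \<in> carrier_mat p q \<Longrightarrow> i < p \<Longrightarrow> j < q \<Longrightarrow> map_mat f A $$ (i, j) = f (A $$ (i, j))"
  by simp

context orthogonal_rep
begin

text \<open>The isometries are extended to the algebraic closure of the field of rational functions in the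
  entries of a generic symmetric matrix.\<close>

definition coef :: "'a alg_closure \<Rightarrow> (nat, 'a alg_closure) mpoly fract alg_closure" where
  "coef c = to_ac (rconst c)"

lemma comm_ring_hom_coef: "comm_ring_hom coef"
  using comm_ring_hom_comp[OF comm_ring_hom_rconst comm_ring_hom_to_ac] by (simp add: coef_def[abs_def] o_def)

sublocale coef: comm_ring_hom coef by (rule comm_ring_hom_coef)

definition var_mat :: "(nat, 'b::idom) mpoly mat" where
  "var_mat = mat n n (\<lambda>(a, b). mvar (m + a * n + b))"

definition gram_mat :: "(nat, 'a alg_closure) mpoly mat" where
  "gram_mat = var_mat\<^sup>T * map_mat mconst B * var_mat"

text \<open>The positions on and above the diagonal, row by row.\<close>

definition sym_index :: "nat set" where
  "sym_index = {k \<in> {..<n * n}. k div n \<le> k mod n}"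

text \<open>The image of each variable under the substitution of the Gram matrix for the generic symmetric
  matrix. The variables that do not occur in the generic symmetric matrix are sent to variables beyond
  those of the representation and of the matrix, so that the substitution is injective.\<close>

definition gram_var :: "nat \<Rightarrow> (nat, 'a alg_closure) mpoly" where
  "gram_var k = (if k \<in> sym_index then gram_mat $$ (k div n, k mod n) else mvar (m + n * n + k))"

definition sym_mat :: "(nat, 'a alg_closure) mpoly fract mat" where
  "sym_mat = mat n n (\<lambda>(i, j). rvar (min i j * n + max i j))"

text \<open>The matrices whose columns have generic inner products.\<close>

definition gram_sym :: "(nat, 'a alg_closure) mpoly fract alg_closure mat \<Rightarrow> bool" where
  "gram_sym Y \<longleftrightarrow> Y \<in> carrier_mat n n \<and> Y\<^sup>T * map_mat coef B * Y = map_mat to_ac sym_mat"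

text \<open>The point whose matrix entries are those of \<open>Y\<close>, the remaining variables being sent to those for which
  they stand in \<open>gram_var\<close>. The variables of the representation do not occur in the polynomials
  evaluated here; their value is arbitrary.\<close>

definition pt :: "(nat, 'a alg_closure) mpoly fract alg_closure mat \<Rightarrow> nat \<Rightarrow> (nat, 'a alg_closure) mpoly fract alg_closure" where
  "pt Y i = (if i < m then 0 else if i < m + n * n then Y $$ ((i - m) div n, (i - m) mod n)
    else to_ac (rvar (i - (m + n * n))))"

lemma pt_simps:
  "a < n \<Longrightarrow> b < n \<Longrightarrow> pt Y (m + a * n + b) = Y $$ (a, b)" "pt Y (m + n * n + k) = to_ac (rvar k)"
  using matrix_index_bound[of a b] by (auto simp: pt_def)

lemma comm_ring_hom_pt: "comm_ring_hom (meval coef (pt Y))"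
  by (rule comm_ring_hom_meval[OF comm_ring_hom_coef])

lemma carriers: "(var_mat :: (nat, 'b::idom) mpoly mat) \<in> carrier_mat n n" "gram_mat \<in> carrier_mat n n" "sym_mat \<in> carrier_mat n n"
  "map_mat coef B \<in> carrier_mat n n"
  using B(1) by (auto simp: var_mat_def gram_mat_def sym_mat_def)

lemma sym_mat_entry: "i < n \<Longrightarrow> j < n \<Longrightarrow> sym_mat $$ (i, j) = rvar (min i j * n + max i j)"
  by (simp add: sym_mat_def)

lemma sym_index_entry:
  assumes "i < n" "j < n"
  shows "min i j * n + max i j \<in> sym_index" "(min i j * n + max i j) div n = min i j" "(min i j * n + max i j) mod n = max i j"
proof -
  show 1: "(min i j * n + max i j) div n = min i j" "(min i j * n + max i j) mod n = max i j" using assms by auto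
  have "min i j * n + max i j < n * n" using matrix_index_bound[of "min i j" "max i j"] assms by auto
  then show "min i j * n + max i j \<in> sym_index" unfolding sym_index_def using 1 by simp
qed

lemma sym_indexD:
  assumes "k \<in> sym_index"
  shows "k div n < n" "k mod n < n" "min (k div n) (k mod n) * n + max (k div n) (k mod n) = k"
proof -
  have k: "k < n * n" "k div n \<le> k mod n" using assms by (auto simp: sym_index_def)
  have n: "n > 0" using k(1) by (cases n) auto
  show "k div n < n" "k mod n < n" using k n by (auto simp: less_mult_imp_div_less)
  show "min (k div n) (k mod n) * n + max (k div n) (k mod n) = k" using k(2) by (simp add: min_def max_def)
qed

lemma eval_gram_mat:
  assumes "comm_ring_hom \<phi>" and Y: "Y \<in> carrier_mat n n" and f: "\<And>a b. a < n \<Longrightarrow> b < n \<Longrightarrow> f (m + a * n + b) = Y $$ (a, b)"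
    and ij: "i < n" "j < n"
  shows "meval \<phi> f (gram_mat $$ (i, j)) = (Y\<^sup>T * map_mat \<phi> B * Y) $$ (i, j)"
proof -
  interpret \<phi>: comm_ring_hom \<phi> by fact
  interpret ev: comm_ring_hom "meval \<phi> f" by (rule comm_ring_hom_meval[OF assms(1)])
  have V: "(var_mat :: (nat, 'a alg_closure) mpoly mat) \<in> carrier_mat n n" by (rule carriers)
  have 1: "map_mat (meval \<phi> f) var_mat = Y" using Y f by (intro eq_matI) (auto simp: var_mat_def)
  have 2: "map_mat (meval \<phi> f) (map_mat mconst B) = map_mat \<phi> B" by (intro eq_matI) auto
  have "map_mat (meval \<phi> f) gram_mat = Y\<^sup>T * map_mat \<phi> B * Y"
    unfolding gram_mat_def 1[symmetric] 2[symmetric] using V B(1)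
    by (simp add: ev.mat_hom_mult[of _ n n _ n] map_mat_transpose mult_carrier_mat[of _ n n _ n])
  then show ?thesis unfolding map_mat_entry[OF carriers(2) ij, symmetric] by (rule arg_cong)
qed

lemma gram_mat_sym: "i < n \<Longrightarrow> j < n \<Longrightarrow> gram_mat $$ (i, j) = gram_mat $$ (j, i)"
proof -
  assume "i < n" "j < n"
  have v: "(var_mat :: (nat, 'a alg_closure) mpoly mat) \<in> carrier_mat n n" by (rule carriers)
  have B': "(map_mat mconst B :: (nat, 'a alg_closure) mpoly mat) \<in> carrier_mat n n"
    "(map_mat mconst B)\<^sup>T = (map_mat mconst B :: (nat, 'a alg_closure) mpoly mat)"
    using B(1,2) by (simp_all add: map_mat_transpose)
  have "gram_mat\<^sup>T = gram_mat"
    unfolding gram_mat_def using v B'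
    by (simp add: transpose_mult[of _ n n _ n] assoc_mult_mat[of _ n n _ n _ n] mult_carrier_mat[of _ n n _ n])
  then show ?thesis using index_transpose_mat(1)[of i gram_mat j] carriers(2) \<open>i < n\<close> \<open>j < n\<close> by simp
qed

lemma gram_var_entry: "i < n \<Longrightarrow> j < n \<Longrightarrow> gram_var (min i j * n + max i j) = gram_mat $$ (i, j)"
  using sym_index_entry[of i j] gram_mat_sym[of i j] by (simp add: gram_var_def min_def max_def split: if_splits)

lemma eval_gram_var:
  assumes "gram_sym Y"
  shows "meval coef (pt Y) (gram_var k) = to_ac (rvar k)"
proof (cases "k \<in> sym_index")
  case True
  note k = sym_indexD[OF True]
  have Y: "Y \<in> carrier_mat n n" "Y\<^sup>T * map_mat coef B * Y = map_mat to_ac sym_mat" using assms by (auto simp: gram_sym_def)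
  have "meval coef (pt Y) (gram_mat $$ (k div n, k mod n)) = to_ac (sym_mat $$ (k div n, k mod n))"
    using eval_gram_mat[OF comm_ring_hom_coef Y(1) _ k(1,2), of "pt Y"] carriers(3) k(1,2) by (simp add: pt_simps Y(2))
  then show ?thesis using True k by (simp add: gram_var_def sym_mat_entry)
qed (simp add: gram_var_def pt_simps)

lemma eval_gram_vars:
  assumes "gram_sym Y"
  shows "meval coef (pt Y) (meval mconst gram_var q) = to_ac (meval rconst rvar q)"
  by (simp add: hom_meval[OF comm_ring_hom_pt] hom_meval[OF comm_ring_hom_to_ac] eval_gram_var[OF assms] coef_def)

lemma gram_sym_exists: "\<exists>Y. gram_sym Y"
proof -
  have "(map_mat coef B)\<^sup>T = map_mat coef B" using B(2) by (simp add: map_mat_transpose)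
  moreover have "det (map_mat coef B) \<noteq> 0"
    using B(3) by (simp add: coef.hom_det) (simp add: coef_def)
  moreover have "(map_mat to_ac sym_mat)\<^sup>T = map_mat to_ac sym_mat"
    by (intro eq_matI) (auto simp: sym_mat_def min.commute max.commute)
  ultimately show ?thesis
    using symmetric_eq_gram_of_form[OF carriers(4), of "map_mat to_ac sym_mat"] carriers(3) by (auto simp: gram_sym_def)
qed

text \<open>A matrix \<open>Y\<close> with generic Gram matrix specialises a relation among the images to a relation among
  variables.\<close>

lemma gram_vars_independent: "meval mconst gram_var q = 0 \<Longrightarrow> q = 0"
proof -
  assume 0: "meval mconst gram_var q = 0"
  obtain Y where "gram_sym Y" using gram_sym_exists ..
  from eval_gram_vars[OF this, of q] have "meval rconst rvar q = 0"
    unfolding 0 by (simp add: meval_def)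
  then show "q = 0" by (simp only: meval_rconst_rvar_eq_0_iff)
qed

definition gram_hom :: "(nat, 'a alg_closure) mpoly fract \<Rightarrow> (nat, 'a alg_closure) mpoly fract" where
  "gram_hom = fract_ext (\<lambda>q. Fract (meval mconst gram_var q) 1)"

lemma gram_hom:
  shows comm_ring_hom_gram_hom: "comm_ring_hom gram_hom"
    and gram_hom_gens: "gram_hom (rconst c) = rconst c" "gram_hom (rvar k) = Fract (gram_var k) 1"
proof -
  interpret c: comm_ring_hom "mconst :: 'a alg_closure \<Rightarrow> (nat, 'a alg_closure) mpoly" by (rule comm_ring_hom_mconst)
  interpret ev: comm_ring_hom "meval mconst gram_var" by (rule comm_ring_hom_meval[OF comm_ring_hom_mconst])
  have hom: "comm_ring_hom (\<lambda>q. Fract (meval mconst gram_var q) 1)"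
    using comm_ring_hom_comp[OF ev.comm_ring_hom_axioms comm_ring_hom_Fract] by (simp add: o_def)
  have inj: "q = 0" if "Fract (meval mconst gram_var q) 1 = 0" for q
    using that gram_vars_independent[of q] by (simp add: Zero_fract_def eq_fract)
  show "comm_ring_hom gram_hom" unfolding gram_hom_def by (rule comm_ring_hom_fract_ext[OF hom inj])
  show "gram_hom (rconst c) = rconst c"
    unfolding rconst_def gram_hom_def by (subst fract_ext_Fract[OF hom inj]) simp_all
  show "gram_hom (rvar k) = Fract (gram_var k) 1"
    unfolding rvar_def gram_hom_def by (subst fract_ext_Fract[OF hom inj]) simp_all
qed

lemma gram_hom_sym_mat: "i < n \<Longrightarrow> j < n \<Longrightarrow> gram_hom (sym_mat $$ (i, j)) = Fract (gram_mat $$ (i, j)) 1"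
  by (simp add: sym_mat_entry gram_hom_gens gram_var_entry)

lemma matrix_var_decompose:
  assumes "i \<in> {m..<m + n * n}"
  shows "(i - m) div n < n" "(i - m) mod n < n" "m + (i - m) div n * n + (i - m) mod n = i"
proof -
  have n: "n > 0" using assms by (cases n) auto
  show "(i - m) div n < n" "(i - m) mod n < n" using assms n by (auto simp: less_mult_imp_div_less)
  have "(i - m) div n * n + (i - m) mod n = i - m" by simp
  then show "m + (i - m) div n * n + (i - m) mod n = i" using assms by simp
qed

text \<open>A polynomial vanishing at all matrices whose Gram matrix is the generic symmetric matrix is zero:
  otherwise the Gram equations and the invertibility of the polynomial have no common solution, and
  the resulting identity, retracted to the coefficients of the generic symmetric matrix, is
  contradictory after substitution of the Gram matrix of the variable matrix.\<close>

lemma vanishing_on_gram_fibre: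
  assumes van: "\<And>Y. gram_sym Y \<Longrightarrow> meval coef (pt Y) p = 0"
    and vars: "mvars p \<subseteq> {m..<m + n * n} \<union> (+) (m + n * n) ` (- sym_index)"
  shows "p = 0"
proof (rule ccontr)
  assume p: "p \<noteq> 0"
  let ?sq = "{..<n} \<times> {..<n}"
  define p' :: "(nat, (nat, 'a alg_closure) mpoly fract) mpoly" where
    "p' = meval (\<lambda>c. mconst (rconst c)) (\<lambda>i. if i < m + n * n then mvar i else mconst (rvar (i - (m + n * n)))) p"
  \<comment> \<open>the variable with index \<open>m + n * n\<close> is the inverse of the value of the polynomial\<close>
  define E :: "(nat \<times> nat) option \<Rightarrow> (nat, (nat, 'a alg_closure) mpoly fract) mpoly" where
    "E = case_option (mvar (m + n * n) * p' - 1)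
      (\<lambda>ij. (var_mat\<^sup>T * map_mat (\<lambda>c. mconst (rconst c)) B * var_mat) $$ ij - mconst (sym_mat $$ ij))"
  define K where "K = insert None (Some ` ?sq)"
  have evG: "meval \<phi> f (E (Some (i, j))) = (Y\<^sup>T * map_mat (\<lambda>c. \<phi> (rconst c)) B * Y) $$ (i, j) - \<phi> (sym_mat $$ (i, j))"
    if \<phi>: "comm_ring_hom \<phi>" and Y: "Y \<in> carrier_mat n n" and ij: "i < n" "j < n"
      and f: "\<And>a b. a < n \<Longrightarrow> b < n \<Longrightarrow> f (m + a * n + b) = Y $$ (a, b)"
    for \<phi> :: "(nat, 'a alg_closure) mpoly fract \<Rightarrow> 'd::comm_ring_1" and f Y i j
  proof -
    interpret \<phi>: comm_ring_hom \<phi> by fact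
    interpret ev: comm_ring_hom "meval \<phi> f" by (rule comm_ring_hom_meval[OF \<phi>])
    let ?V = "var_mat :: (nat, (nat, 'a alg_closure) mpoly fract) mpoly mat"
    have 1: "map_mat (meval \<phi> f) ?V = Y" using Y f by (intro eq_matI) (auto simp: var_mat_def)
    have 2: "map_mat (meval \<phi> f) (map_mat (\<lambda>c. mconst (rconst c)) B) = map_mat (\<lambda>c. \<phi> (rconst c)) B" by (intro eq_matI) auto
    let ?G = "?V\<^sup>T * map_mat (\<lambda>c. mconst (rconst c)) B * ?V"
    have V: "?V \<in> carrier_mat n n" by (rule carriers)
    have G: "?G \<in> carrier_mat n n" using V B(1) by (simp add: mult_carrier_mat[of _ n n _ n])
    have "map_mat (meval \<phi> f) ?G = Y\<^sup>T * map_mat (\<lambda>c. \<phi> (rconst c)) B * Y"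
      unfolding 1[symmetric] 2[symmetric] using V B(1)
      by (simp add: ev.mat_hom_mult[of _ n n _ n] map_mat_transpose mult_carrier_mat[of _ n n _ n])
    then have "meval \<phi> f (?G $$ (i, j)) = (Y\<^sup>T * map_mat (\<lambda>c. \<phi> (rconst c)) B * Y) $$ (i, j)"
      unfolding map_mat_entry[OF G ij, symmetric] by (rule arg_cong)
    moreover have "meval \<phi> f (mconst (sym_mat $$ (i, j))) = \<phi> (sym_mat $$ (i, j))" by simp
    ultimately show ?thesis unfolding E_def option.case ev.hom_minus by (simp only:)
  qed
  have evN: "meval \<phi> f (E None) = f (m + n * n) *
      meval (\<lambda>c. \<phi> (rconst c)) (\<lambda>i. if i < m + n * n then f i else \<phi> (rvar (i - (m + n * n)))) p - 1"
    if \<phi>: "comm_ring_hom \<phi>" for \<phi> :: "(nat, 'a alg_closure) mpoly fract \<Rightarrow> 'd::comm_ring_1" and f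
  proof -
    interpret \<phi>: comm_ring_hom \<phi> by fact
    note ev = comm_ring_hom_meval[OF \<phi>, of f]
    interpret ev: comm_ring_hom "meval \<phi> f" by (rule ev)
    have "meval \<phi> f p' = meval (\<lambda>c. \<phi> (rconst c)) (\<lambda>i. if i < m + n * n then f i else \<phi> (rvar (i - (m + n * n)))) p"
      unfolding p'_def hom_meval[OF ev] by (rule meval_cong) simp_all
    then show ?thesis by (simp add: E_def ev.hom_minus ev.hom_mult)
  qed
  have "meval id z 1 = 0" if z: "\<forall>\<kappa>\<in>K. meval id z (Poly_Mapping.map to_ac (E \<kappa>)) = 0"
    for z :: "nat \<Rightarrow> (nat, 'a alg_closure) mpoly fract alg_closure"
  proof -
    let ?Y = "mat n n (\<lambda>(a, b). z (m + a * n + b))"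
    have z': "meval to_ac z (E \<kappa>) = 0" if "\<kappa> \<in> K" for \<kappa>
      using bspec[OF z that] by (simp add: meval_map[OF comm_ring_hom_to_ac])
    have "(?Y\<^sup>T * map_mat coef B * ?Y) $$ (i, j) = to_ac (sym_mat $$ (i, j))" if ij: "i < n" "j < n" for i j
      using evG[OF comm_ring_hom_to_ac _ ij, of ?Y z] z'[of "Some (i, j)"] ij by (simp add: K_def coef_def[abs_def])
    then have Y: "gram_sym ?Y"
      unfolding gram_sym_def using carriers(3) by (auto intro!: eq_matI)
    have "0 = meval coef (pt ?Y) p" by (simp add: van[OF Y])
    also have "\<dots> = meval (\<lambda>c. to_ac (rconst c)) (\<lambda>i. if i < m + n * n then z i else to_ac (rvar (i - (m + n * n)))) p"
    proof (rule meval_cong)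
      fix i assume "i \<in> mvars p"
      then consider "i \<in> {m..<m + n * n}" | "i \<ge> m + n * n" using vars by auto
      then show "pt ?Y i = (if i < m + n * n then z i else to_ac (rvar (i - (m + n * n))))"
      proof cases
        case 1
        from matrix_var_decompose[OF 1] show ?thesis using 1 by (auto simp: pt_def)
      qed (auto simp: pt_def)
    qed (simp add: coef_def)
    finally have "meval to_ac z (E None) = - 1" by (simp add: evN[OF comm_ring_hom_to_ac])
    moreover have "meval to_ac z (E None) = 0" by (rule z') (simp add: K_def)
    ultimately show ?thesis by simp
  qed
  moreover have "finite K" by (simp add: K_def)
  ultimately have "\<exists>N c. 1 ^ N = (\<Sum>\<kappa>\<in>K. c \<kappa> * Poly_Mapping.map to_ac (E \<kappa>))" by (intro nullstellensatz) auto
  then obtain c where c: "1 = (\<Sum>\<kappa>\<in>K. c \<kappa> * Poly_Mapping.map to_ac (E \<kappa>))" by auto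
  obtain r :: "(nat, 'a alg_closure) mpoly fract alg_closure \<Rightarrow> (nat, 'a alg_closure) mpoly fract"
    where r: "r 1 = 1" "\<And>x y. r (x + y) = r x + r y" "\<And>c x. r (to_ac c * x) = c * r x"
    using linear_retraction by blast
  have r0: "r 0 = 0" using r(3)[of 0 0] by simp
  have "Poly_Mapping.map r 1 = Poly_Mapping.map r (\<Sum>\<kappa>\<in>K. c \<kappa> * Poly_Mapping.map to_ac (E \<kappa>))" unfolding c[symmetric] ..
  also have "\<dots> = (\<Sum>\<kappa>\<in>K. Poly_Mapping.map r (c \<kappa> * Poly_Mapping.map to_ac (E \<kappa>)))"
  proof -
    have "additive (Poly_Mapping.map r :: (nat, (nat, 'a alg_closure) mpoly fract alg_closure) mpoly \<Rightarrow> _)"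
      by unfold_locales (rule poly_mapping_eqI, simp add: lookup_map r0 r lookup_add)
    then show ?thesis by (rule additive.sum)
  qed
  also have "\<dots> = (\<Sum>\<kappa>\<in>K. Poly_Mapping.map r (c \<kappa>) * E \<kappa>)" by (simp add: map_mult_base[OF r(2,3)])
  finally have eq: "Poly_Mapping.map r 1 = (\<Sum>\<kappa>\<in>K. Poly_Mapping.map r (c \<kappa>) * E \<kappa>)" .
  have one: "Poly_Mapping.map r (1 :: (nat, (nat, 'a alg_closure) mpoly fract alg_closure) mpoly) = 1"
    by (rule poly_mapping_eqI) (simp add: lookup_map r0 lookup_one when_def r)
  \<comment> \<open>the generic point, with the generic symmetric matrix specialised to the Gram matrix of the variables\<close>
  define f where "f i = (if i = m + n * n then inverse (Fract p 1) else rvar i)" for i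
  interpret ev: comm_ring_hom "meval gram_hom f" by (rule comm_ring_hom_meval[OF comm_ring_hom_gram_hom])
  have "meval gram_hom f (E \<kappa>) = 0" if "\<kappa> \<in> K" for \<kappa>
  proof (cases \<kappa>)
    case None
    have "meval (\<lambda>c. gram_hom (rconst c)) (\<lambda>i. if i < m + n * n then f i else gram_hom (rvar (i - (m + n * n)))) p = meval rconst rvar p"
    proof (rule meval_cong)
      fix i assume "i \<in> mvars p"
      then consider "i \<in> {m..<m + n * n}" | k where "i = m + n * n + k" "k \<notin> sym_index" using vars by auto
      then show "(if i < m + n * n then f i else gram_hom (rvar (i - (m + n * n)))) = rvar i"
        by cases (auto simp: f_def gram_hom_gens gram_var_def rvar_def[symmetric])
    qed (simp add: gram_hom_gens)
    moreover have "Fract p 1 \<noteq> 0" using p by (simp add: Zero_fract_def eq_fract)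
    ultimately show ?thesis
      unfolding None evN[OF comm_ring_hom_gram_hom] by (simp add: f_def meval_rconst_rvar del: inverse_fract)
  next
    case (Some ij)
    moreover have "\<kappa> \<in> K" by (rule that)
    ultimately obtain i j where ij: "\<kappa> = Some (i, j)" "i < n" "j < n" by (auto simp: K_def)
    let ?M = "mat n n (\<lambda>(a, b). rvar (m + a * n + b) :: (nat, 'a alg_closure) mpoly fract)"
    have "f (m + a * n + b) = ?M $$ (a, b)" if ab: "a < n" "b < n" for a b
      using matrix_index_bound[OF ab] ab by (simp add: f_def)
    then have "meval gram_hom f (E \<kappa>) = (?M\<^sup>T * map_mat (\<lambda>c. gram_hom (rconst c)) B * ?M) $$ (i, j) - gram_hom (sym_mat $$ (i, j))"
      unfolding ij(1) by (intro evG[OF comm_ring_hom_gram_hom _ ij(2,3)]) auto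
    also have "(?M\<^sup>T * map_mat (\<lambda>c. gram_hom (rconst c)) B * ?M) $$ (i, j) = meval rconst rvar (gram_mat $$ (i, j))"
      unfolding gram_hom_gens by (rule eval_gram_mat[OF comm_ring_hom_rconst _ _ ij(2,3), symmetric]) auto
    finally show ?thesis by (simp add: gram_hom_sym_mat[OF ij(2,3)] meval_rconst_rvar)
  qed
  then have "meval gram_hom f (\<Sum>\<kappa>\<in>K. Poly_Mapping.map r (c \<kappa>) * E \<kappa>) = 0" by (simp add: ev.hom_sum ev.hom_mult)
  then show False unfolding eq[symmetric] one by simp
qed

end

section \<open>Invariants of a square matrix\<close>

context orthogonal_rep
begin

text \<open>The polynomial \<open>a\<close> at the product of a matrix of new variables with the matrix of variables.\<close>

definition translate_poly :: "(nat, 'a alg_closure) mpoly \<Rightarrow> (nat \<times> nat + nat, 'a alg_closure) mpoly" where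
  "translate_poly = meval mconst (\<lambda>i. \<Sum>k<n. mvar (Inl ((i - m) div n, k)) * mvar (Inr (m + k * n + (i - m) mod n)))"

lemma meval_translate_poly:
  assumes "comm_ring_hom \<phi>"
  shows "meval \<phi> f (translate_poly a) = meval \<phi> (\<lambda>i. \<Sum>k<n. f (Inl ((i - m) div n, k)) * f (Inr (m + k * n + (i - m) mod n))) a"
proof -
  interpret \<phi>: comm_ring_hom \<phi> by fact
  note ev = comm_ring_hom_meval[OF assms, of f]
  interpret ev: comm_ring_hom "meval \<phi> f" by (rule ev)
  show ?thesis unfolding translate_poly_def hom_meval[OF ev] by (simp add: ev.hom_sum ev.hom_mult)
qed

lemma var_image_matrix:
  assumes "i \<in> {m..<m + n * n}"
  shows "var_image A i = (\<Sum>k<n. mconst (A $$ ((i - m) div n, k)) * mvar (m + k * n + (i - m) mod n))"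
  using assms by (simp add: var_image_def)

text \<open>The isometries over the algebraic closure are dense in the isometries over any extension field,
  so an identity expressing invariance persists.\<close>

lemma invariance_extends:
  assumes vars: "mvars a \<subseteq> {m..<m + n * n}" "mvars b \<subseteq> {m..<m + n * n}"
    and inv: "\<And>A. A \<in> isometries \<Longrightarrow> poly_act (A, id) a * b = a * poly_act (A, id) b"
    and A: "A \<in> carrier_mat n n" "A\<^sup>T * map_mat coef B * A = map_mat coef B" and Y: "Y \<in> carrier_mat n n"
  shows "meval coef (pt (A * Y)) a * meval coef (pt Y) b = meval coef (pt Y) a * meval coef (pt (A * Y)) b"
proof -
  define emb :: "(nat, 'a alg_closure) mpoly \<Rightarrow> (nat \<times> nat + nat, 'a alg_closure) mpoly"
    where "emb = meval mconst (\<lambda>i. mvar (Inr i))"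
  have ev_emb: "meval \<phi> f (emb c) = meval \<phi> (\<lambda>i. f (Inr i)) c" if \<phi>: "comm_ring_hom \<phi>"
    for \<phi> :: "'a alg_closure \<Rightarrow> 'd::comm_ring_1" and f c
  proof -
    interpret \<phi>: comm_ring_hom \<phi> by fact
    show ?thesis unfolding emb_def hom_meval[OF comm_ring_hom_meval[OF \<phi>]] by simp
  qed
  define T where "T = translate_poly a * emb b - emb a * translate_poly b"
  let ?K = "{..<n} \<times> {..<n}"
  have "meval id z T = 0" if z: "\<forall>ij\<in>?K. meval id z (gram_poly Inl ij) = 0" for z
  proof -
    let ?A = "mat n n (\<lambda>ij. z (Inl ij))"
    have A: "?A \<in> isometries" by (rule gram_poly_zeros) (use z in auto)
    note ev = comm_ring_hom_meval[OF comm_ring_hom_id, of z]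
    interpret ev: comm_ring_hom "meval id z" by (rule ev)
    note er = comm_ring_hom_meval[OF comm_ring_hom_id, of "\<lambda>i. z (Inr i)"]
    interpret er: comm_ring_hom "meval id (\<lambda>i. z (Inr i))" by (rule er)
    have tr: "meval id z (translate_poly c) = meval id (\<lambda>i. z (Inr i)) (poly_act (?A, id) c)" if "mvars c \<subseteq> {m..<m + n * n}" for c
      unfolding meval_translate_poly[OF comm_ring_hom_id] poly_act_def hom_meval[OF er]
    proof (rule meval_cong)
      fix i assume "i \<in> mvars c"
      then have i: "i \<in> {m..<m + n * n}" using that by blast
      show "(\<Sum>k<n. z (Inl ((i - m) div n, k)) * z (Inr (m + k * n + (i - m) mod n))) =
          meval id (\<lambda>i. z (Inr i)) (var_image (fst (?A, id)) i)"
        using matrix_var_decompose[OF i] by (simp add: var_image_matrix[OF i] er.hom_sum er.hom_mult)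
    qed simp
    have "meval id z T = meval id (\<lambda>i. z (Inr i)) (poly_act (?A, id) a * b - a * poly_act (?A, id) b)"
      unfolding T_def ev.hom_minus ev.hom_mult er.hom_minus er.hom_mult tr[OF vars(1)] tr[OF vars(2)] ev_emb[OF comm_ring_hom_id] ..
    then show ?thesis by (simp add: inv[OF A] er.hom_zero)
  qed
  then have "\<exists>N c. T ^ N = (\<Sum>ij\<in>?K. c ij * gram_poly Inl ij)" by (intro nullstellensatz) auto
  then obtain N c where Nc: "T ^ N = (\<Sum>ij\<in>?K. c ij * gram_poly Inl ij)" by (elim exE)
  define f where "f = case_sum (\<lambda>ab. A $$ ab) (pt Y)"
  interpret ev: comm_ring_hom "meval coef f" by (rule comm_ring_hom_meval[OF comm_ring_hom_coef])
  have tr: "meval coef f (translate_poly c) = meval coef (pt (A * Y)) c" if "mvars c \<subseteq> {m..<m + n * n}" for c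
    unfolding meval_translate_poly[OF comm_ring_hom_coef]
  proof (rule meval_cong)
    fix i assume "i \<in> mvars c"
    then have i: "i \<in> {m..<m + n * n}" using that by blast
    note d = matrix_var_decompose[OF i]
    have "pt (A * Y) i = (A * Y) $$ ((i - m) div n, (i - m) mod n)"
      using pt_simps(1)[OF d(1,2)] unfolding d(3) .
    then show "(\<Sum>k<n. f (Inl ((i - m) div n, k)) * f (Inr (m + k * n + (i - m) mod n))) = pt (A * Y) i"
      using index_mat_mult_lessThan[OF A(1) Y d(1,2)] d(2) by (simp add: f_def pt_simps del: index_mult_mat(1))
  qed simp
  have "meval coef f (gram_poly Inl ij) = 0" if "ij \<in> ?K" for ij
    using that meval_gram_poly[OF comm_ring_hom_coef A(1), of "fst ij" "snd ij" f Inl] A(2) B(1) by (auto simp: f_def)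
  then have "meval coef f (T ^ N) = 0" unfolding Nc by (simp add: ev.hom_sum ev.hom_mult)
  then have "meval coef f T = 0" by (simp add: ev.hom_power)
  then show ?thesis
    by (simp add: T_def ev.hom_minus ev.hom_mult tr vars ev_emb[OF comm_ring_hom_coef]) (simp add: f_def)
qed

lemma det_sym_mat: "det sym_mat \<noteq> 0"
proof -
  let ?M = "mat n n (\<lambda>(a, b). rvar (m + a * n + b) :: (nat, 'a alg_closure) mpoly fract)"
  interpret g: comm_ring_hom gram_hom by (rule comm_ring_hom_gram_hom)
  interpret r: comm_ring_hom "rconst :: 'a alg_closure \<Rightarrow> (nat, 'a alg_closure) mpoly fract" by (rule comm_ring_hom_rconst)
  have "map_mat gram_hom sym_mat = ?M\<^sup>T * map_mat rconst B * ?M"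
  proof (rule eq_matI)
    fix i j assume "i < dim_row (?M\<^sup>T * map_mat rconst B * ?M)" "j < dim_col (?M\<^sup>T * map_mat rconst B * ?M)"
    then have ij: "i < n" "j < n" by auto
    have "(?M\<^sup>T * map_mat rconst B * ?M) $$ (i, j) = meval rconst rvar (gram_mat $$ (i, j))"
      by (rule eval_gram_mat[OF comm_ring_hom_rconst _ _ ij, symmetric]) auto
    then show "map_mat gram_hom sym_mat $$ (i, j) = (?M\<^sup>T * map_mat rconst B * ?M) $$ (i, j)"
      using ij carriers(3) by (simp add: gram_hom_sym_mat meval_rconst_rvar)
  qed (use carriers(3) in auto)
  then have "gram_hom (det sym_mat) = det (?M\<^sup>T * map_mat rconst B * ?M)" by (metis g.hom_det)
  also have "\<dots> = det ?M * rconst (det B) * det ?M"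
    using B(1) generic_matrix(1)
    by (simp add: det_mult[of _ n] det_transpose[of _ n] mult_carrier_mat[of _ n n] r.hom_det)
  also have "\<dots> \<noteq> 0" using generic_matrix(2) B(3) by simp
  finally show ?thesis by auto
qed

text \<open>The generic Gram matrix is invertible, so \<open>A = Y' Y\<^sup>-\<^sup>1\<close> makes sense.\<close>

lemma gram_sym_isometry:
  assumes "gram_sym Y" "gram_sym Y'"
  shows "\<exists>A\<in>carrier_mat n n. A\<^sup>T * map_mat coef B * A = map_mat coef B \<and> Y' = A * Y"
proof -
  let ?B = "map_mat coef B" and ?S = "map_mat to_ac sym_mat"
  interpret ac: comm_ring_hom "to_ac :: (nat, 'a alg_closure) mpoly fract \<Rightarrow> _" by (rule comm_ring_hom_to_ac)
  have Y: "Y \<in> carrier_mat n n" "Y\<^sup>T * ?B * Y = ?S" and Y': "Y' \<in> carrier_mat n n" "Y'\<^sup>T * ?B * Y' = ?S"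
    using assms by (auto simp: gram_sym_def)
  have "det ?S = det (Y\<^sup>T * ?B) * det Y"
    unfolding Y(2)[symmetric] using Y(1) carriers(4) by (intro det_mult[of _ n]) auto
  moreover have "det ?S \<noteq> 0" using det_sym_mat by (simp add: ac.hom_det)
  ultimately have "det Y \<noteq> 0" by auto
  then obtain Z where Z: "Z \<in> carrier_mat n n" "Y * Z = 1\<^sub>m n" "Z * Y = 1\<^sub>m n"
    using inverse_matrix_over_subfield[OF subfield_set_UNIV Y(1)] by auto
  have "(Y' * Z)\<^sup>T * ?B * (Y' * Z) = Z\<^sup>T * (Y'\<^sup>T * ?B * Y') * Z"
    using Y'(1) Z(1) carriers(4) by (simp add: transpose_mult[of _ n n _ n] assoc_mult_mat[of _ n n _ n _ n] mult_carrier_mat[of _ n n _ n])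
  also have "\<dots> = Z\<^sup>T * (Y\<^sup>T * ?B * Y) * Z" unfolding Y(2) Y'(2) ..
  also have "\<dots> = (Y * Z)\<^sup>T * ?B * (Y * Z)"
    using Y(1) Z(1) carriers(4) by (simp add: transpose_mult[of _ n n _ n] assoc_mult_mat[of _ n n _ n _ n] mult_carrier_mat[of _ n n _ n])
  also have "\<dots> = ?B" unfolding Z(2) using carriers(4) by simp
  finally have "(Y' * Z)\<^sup>T * ?B * (Y' * Z) = ?B" .
  moreover have "Y' * Z * Y = Y'" using Y'(1) Z Y(1) by (simp add: assoc_mult_mat[of _ n n _ n _ n])
  ultimately show ?thesis using Y'(1) Z(1) by (intro bexI[of _ "Y' * Z"]) auto
qed

lemma galois_gram_sym:
  assumes s: "\<sigma> \<in> absolute_galois_group" and Y: "gram_sym Y"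
  shows "gram_sym (map_mat \<sigma> Y)"
    "mvars a \<subseteq> {m..<m + n * n} \<Longrightarrow> \<sigma> (meval coef (pt Y) a) = meval coef (pt (map_mat \<sigma> Y)) a"
proof -
  interpret s: comm_ring_hom \<sigma> by (rule galois_hom[OF s])
  have sc: "\<sigma> (coef c) = coef c" for c by (simp add: coef_def galois_hom(2)[OF s])
  have Yc: "Y \<in> carrier_mat n n" "Y\<^sup>T * map_mat coef B * Y = map_mat to_ac sym_mat" using Y by (auto simp: gram_sym_def)
  have "map_mat \<sigma> (Y\<^sup>T * map_mat coef B * Y) = (map_mat \<sigma> Y)\<^sup>T * map_mat \<sigma> (map_mat coef B) * map_mat \<sigma> Y"
    using Yc(1) carriers(4) by (simp add: s.mat_hom_mult[of _ n n _ n] map_mat_transpose mult_carrier_mat[of _ n n _ n])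
  moreover have "map_mat \<sigma> (map_mat coef B) = map_mat coef B" "map_mat \<sigma> (map_mat to_ac sym_mat) = map_mat to_ac sym_mat"
    by (auto intro!: eq_matI simp: sc galois_hom(2)[OF s])
  ultimately show "gram_sym (map_mat \<sigma> Y)" using Yc by (simp add: gram_sym_def)
  show "\<sigma> (meval coef (pt Y) a) = meval coef (pt (map_mat \<sigma> Y)) a" if "mvars a \<subseteq> {m..<m + n * n}"
    unfolding hom_meval[OF galois_hom(1)[OF s]] sc
  proof (rule meval_cong)
    fix i assume "i \<in> mvars a"
    then have "i \<in> {m..<m + n * n}" using that by blast
    then show "\<sigma> (pt Y i) = pt (map_mat \<sigma> Y) i"
      using matrix_var_decompose[of i] Yc(1) by (simp add: pt_def)
  qed simp
qed

definition gram_fun :: "nat \<Rightarrow> (nat, 'a alg_closure) mpoly fract" where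
  "gram_fun k = Fract (gram_var k) 1"

lemma gram_var_in_mpolys:
  "k \<in> sym_index \<Longrightarrow> gram_var k \<in> mpolys UNIV {m..<m + n * n}"
  "k \<notin> sym_index \<Longrightarrow> gram_var k = mvar (m + n * n + k)"
proof -
  note M = subring_setD[OF subring_set_mpolys[OF subring_set_UNIV, of "{m..<m + n * n}"]]
  have v: "var_mat $$ (a, b) \<in> mpolys UNIV {m..<m + n * n}" if "a < n" "b < n" for a b
    using that matrix_index_bound[OF that] by (simp add: var_mat_def)
  have V: "(var_mat :: (nat, 'a alg_closure) mpoly mat) \<in> carrier_mat n n"
    and B': "(map_mat mconst B :: (nat, 'a alg_closure) mpoly mat) \<in> carrier_mat n n" using carriers(1) B(1) by auto
  assume k: "k \<in> sym_index"
  show "gram_var k \<in> mpolys UNIV {m..<m + n * n}"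
    unfolding gram_var_def if_P[OF k] gram_mat_def gram_entry[OF V B' sym_indexD(1,2)[OF k]] using sym_indexD(1,2)[OF k] B(1)
    by (intro subring_set_sum[OF subring_set_mpolys[OF subring_set_UNIV]] M(5)) (auto intro!: v)
qed (simp add: gram_var_def)

text \<open>At a matrix \<open>Y\<close> with generic Gram matrix an invariant rational function has a value that does
  not depend on \<open>Y\<close>, hence is fixed by the Galois group and rational in the Gram matrix.\<close>

theorem invariants_of_matrix:
  assumes x: "x \<in> ratfuns {m..<m + n * n}" and fix': "\<And>A. A \<in> isometries \<Longrightarrow> act (A, id) x = x"
  shows "x \<in> gen_field (range rconst \<union> gram_fun ` sym_index)"
proof -
  obtain a b where ab: "x = Fract a b" "b \<noteq> 0" "mvars a \<subseteq> {m..<m + n * n}" "mvars b \<subseteq> {m..<m + n * n}"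
    using x unfolding ratfuns_def by blast
  have inv: "poly_act (A, id) a * b = a * poly_act (A, id) b" if A: "A \<in> isometries" for A
  proof -
    have g: "(A, id) \<in> grp" using A galois_id by (simp add: grp_def)
    have "poly_act (A, id) b \<noteq> 0" using poly_act_inj[OF g] ab(2) by blast
    then show ?thesis using fix'[OF A] unfolding ab(1) act_Fract[OF g ab(2)] by (simp add: eq_fract ab(2))
  qed
  let ?ev = "\<lambda>Y. meval coef (pt Y)"
  obtain Y where Y: "gram_sym Y" "?ev Y b \<noteq> 0"
    using vanishing_on_gram_fibre[of b] ab(2,4) by blast
  define r where "r = ?ev Y a / ?ev Y b"
  have val: "?ev Y' a = r * ?ev Y' b" if Y': "gram_sym Y'" for Y'
  proof -
    obtain A where A: "A \<in> carrier_mat n n" "A\<^sup>T * map_mat coef B * A = map_mat coef B" "Y' = A * Y"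
      using gram_sym_isometry[OF Y(1) Y'] by blast
    have "Y \<in> carrier_mat n n" using Y(1) by (simp add: gram_sym_def)
    from invariance_extends[OF ab(3,4) inv A(1,2) this] show ?thesis
      unfolding A(3) r_def using Y(2) by (simp add: field_simps)
  qed
  have "\<sigma> r = r" if s: "\<sigma> \<in> absolute_galois_group" for \<sigma>
  proof -
    interpret s: comm_ring_hom \<sigma> by (rule galois_hom[OF s])
    have "?ev (map_mat \<sigma> Y) b \<noteq> 0"
      using Y(2) hom_eq_0_iff[OF galois_hom(1)[OF s]] by (simp add: galois_gram_sym(2)[OF s Y(1) ab(4), symmetric])
    moreover have "\<sigma> r = ?ev (map_mat \<sigma> Y) a / ?ev (map_mat \<sigma> Y) b"
      unfolding r_def hom_divide[OF galois_hom(1)[OF s]] galois_gram_sym(2)[OF s Y(1) ab(3)] galois_gram_sym(2)[OF s Y(1) ab(4)] ..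
    ultimately show ?thesis using val[OF galois_gram_sym(1)[OF s Y(1)]] by simp
  qed
  then have "r \<in> range to_ac" by (rule galois_fixed_field)
  then obtain r0 where "r = to_ac r0" by blast
  moreover obtain P0 Q where r0: "r0 = Fract P0 Q" "Q \<noteq> 0" by (cases r0) auto
  ultimately have r: "r = to_ac (meval rconst rvar P0) / to_ac (meval rconst rvar Q)" "to_ac (meval rconst rvar Q) \<noteq> 0"
    by (simp_all add: Fract_eq_meval meval_rconst_rvar_eq_0_iff)
  let ?G = "meval mconst gram_var"
  let ?V = "{m..<m + n * n} \<union> (+) (m + n * n) ` (- sym_index)"
  note sub = subring_set_mpolys[OF subring_set_UNIV, of ?V]
  note M = subring_setD[OF sub]
  have gv: "gram_var k \<in> mpolys UNIV ?V" for k
    using gram_var_in_mpolys[of k] by (cases "k \<in> sym_index") (auto simp: mpolys_def)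
  have gv': "?G q \<in> mpolys UNIV ?V" for q by (intro meval_in_subring[OF sub]) (auto intro: gv)
  have "a * ?G Q - b * ?G P0 = 0"
  proof (rule vanishing_on_gram_fibre)
    have "a \<in> mpolys UNIV ?V" "b \<in> mpolys UNIV ?V" using ab(3,4) by (auto simp: mpolys_def)
    then have "a * ?G Q - b * ?G P0 \<in> mpolys UNIV ?V" using gv' by (intro M(5,6))
    then show "mvars (a * ?G Q - b * ?G P0) \<subseteq> ?V" by (simp add: mpolys_def)
    fix Y' assume Y': "gram_sym Y'"
    interpret ev: comm_ring_hom "?ev Y'" by (rule comm_ring_hom_pt)
    show "?ev Y' (a * ?G Q - b * ?G P0) = 0"
      using r by (simp add: ev.hom_minus ev.hom_mult eval_gram_vars[OF Y'] val[OF Y'])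
  qed
  then have eq: "a * ?G Q = b * ?G P0" by simp
  \<comment> \<open>the variables that do not belong to the generic symmetric matrix are specialised to constants, at a
    point where the denominator survives\<close>
  obtain z where z: "meval id z Q \<noteq> 0" using mpoly_nonvanishing_point[OF r0(2)] .
  let ?sub = "\<lambda>i. if i \<in> sym_index then mvar i else mconst (z i)"
  define \<eta> :: "(nat, 'a alg_closure) mpoly \<Rightarrow> (nat, 'a alg_closure) mpoly"
    where "\<eta> = meval mconst (\<lambda>i. if i < m + n * n then mvar i else mconst (z (i - (m + n * n))))"
  interpret c: comm_ring_hom "mconst :: 'a alg_closure \<Rightarrow> (nat, 'a alg_closure) mpoly" by (rule comm_ring_hom_mconst)
  have eh: "comm_ring_hom \<eta>" unfolding \<eta>_def by (rule comm_ring_hom_meval[OF comm_ring_hom_mconst])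
  interpret \<eta>: comm_ring_hom \<eta> by (rule eh)
  have block: "\<eta> q = q" if "mvars q \<subseteq> {m..<m + n * n}" for q
  proof -
    have "\<eta> q = meval mconst mvar q" unfolding \<eta>_def using that by (intro meval_cong) auto
    then show ?thesis by simp
  qed
  have ev: "comm_ring_hom (?G :: (nat, 'a alg_closure) mpoly \<Rightarrow> _)" by (rule comm_ring_hom_meval[OF comm_ring_hom_mconst])
  have \<eta>G: "\<eta> (?G q) = ?G (meval mconst ?sub q)" for q
    unfolding hom_meval[OF eh] hom_meval[OF ev]
  proof (rule meval_cong)
    show "\<eta> (gram_var k) = ?G (?sub k)" for k
      using gram_var_in_mpolys[of k] block[of "gram_var k"]
      by (cases "k \<in> sym_index") (auto simp: mpolys_def \<eta>_def)
  qed (simp add: \<eta>_def)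
  have "meval mconst ?sub Q \<noteq> 0"
  proof
    assume 0: "meval mconst ?sub Q = 0"
    have "meval id z Q = meval id z (meval mconst ?sub Q)"
      unfolding hom_meval[OF comm_ring_hom_meval[OF comm_ring_hom_id, of z]] by (intro meval_cong) auto
    then show False using z unfolding 0 by (simp add: meval_def)
  qed
  then have nz: "?G (meval mconst ?sub Q) \<noteq> 0" using gram_vars_independent by blast
  have "a * ?G (meval mconst ?sub Q) = b * ?G (meval mconst ?sub P0)"
    using arg_cong[OF eq, of \<eta>] unfolding \<eta>.hom_mult \<eta>G block[OF ab(3)] block[OF ab(4)] .
  then have x: "x = Fract (?G (meval mconst ?sub P0)) 1 / Fract (?G (meval mconst ?sub Q)) 1"
    unfolding ab(1) using ab(2) nz by (simp add: eq_fract mult.commute)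
  have mem: "Fract (?G (meval mconst ?sub q)) 1 \<in> gen_field (range rconst \<union> gram_fun ` sym_index)" for q
  proof -
    let ?L = "gen_field (range rconst \<union> gram_fun ` sym_index)"
    note L = subfield_setD(1)[OF subfield_set_gen_field[of "range rconst \<union> gram_fun ` sym_index"]]
    have incl: "rconst c \<in> ?L" "k \<in> sym_index \<Longrightarrow> gram_fun k \<in> ?L" for c k
      using gen_field_incl[of "range rconst \<union> gram_fun ` sym_index"] by auto
    have "Fract (?G (meval mconst ?sub q)) 1 = meval rconst (\<lambda>i. if i \<in> sym_index then gram_fun i else rconst (z i)) q"
      unfolding hom_meval[OF ev] hom_meval[OF comm_ring_hom_Fract] rconst_def[symmetric]
      by (intro meval_cong) (auto simp: gram_fun_def[symmetric] rconst_def[symmetric])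
    also have "\<dots> \<in> ?L" by (intro meval_in_subring[OF L]) (auto intro: incl)
    finally show ?thesis .
  qed
  show ?thesis unfolding x by (rule subfield_setD(9)[OF subfield_set_gen_field mem mem])
qed

text \<open>A relation among the images under an injective substitution comes from one among the variables.\<close>

lemma gram_fun_independent: "alg_indep_family (range rconst) sym_index gram_fun"
  unfolding alg_indep_family_def
proof (intro ballI impI)
  fix q assume q: "q \<in> mpolys (range (rconst :: 'a alg_closure \<Rightarrow> _)) sym_index" and 0: "meval id gram_fun q = 0"
  define q0 where "q0 = Poly_Mapping.map (inv_into UNIV rconst) q"
  have "inj (rconst :: 'a alg_closure \<Rightarrow> (nat, 'a alg_closure) mpoly fract)" by (rule injI) (simp add: rconst_inject)
  then have inv0: "inv_into UNIV (rconst :: 'a alg_closure \<Rightarrow> (nat, 'a alg_closure) mpoly fract) 0 = 0"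
    by (metis inv_f_f rconst_simps(1))
  have "Poly_Mapping.map rconst q0 = q"
    using q by (intro poly_mapping_eqI) (auto simp: q0_def lookup_map inv0 mpolys_def f_inv_into_f)
  then have "0 = meval id gram_fun (Poly_Mapping.map rconst q0)" using 0 by simp
  also have "\<dots> = meval rconst gram_fun q0" by (simp add: meval_map[OF comm_ring_hom_rconst])
  also have "\<dots> = Fract (meval mconst gram_var q0) 1"
    unfolding hom_meval[OF comm_ring_hom_Fract] by (simp add: gram_fun_def[abs_def] rconst_def[abs_def])
  finally have "q0 = 0" using gram_vars_independent by (simp add: Zero_fract_def eq_fract)
  then show "q = 0" using \<open>Poly_Mapping.map rconst q0 = q\<close> by (auto intro: poly_mapping_eqI simp: lookup_map)
qed

lemma act_gram_fun:
  assumes g: "\<gamma> \<in> grp" and k: "k \<in> sym_index"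
  shows "act \<gamma> (gram_fun k) = gram_fun k"
proof -
  let ?M = "mat n n (\<lambda>(a, b). rvar (m + a * n + b) :: (nat, 'a alg_closure) mpoly fract)"
  let ?B = "map_mat rconst B" and ?A = "map_mat rconst (fst \<gamma>)"
  interpret h: comm_ring_hom "act \<gamma>" by (rule comm_ring_hom_act[OF g])
  interpret r: comm_ring_hom "rconst :: 'a alg_closure \<Rightarrow> (nat, 'a alg_closure) mpoly fract" by (rule comm_ring_hom_rconst)
  note i = sym_indexD(1,2)[OF k]
  have c: "?M \<in> carrier_mat n n" "?B \<in> carrier_mat n n" "?A \<in> carrier_mat n n" using B(1) grpD(3)[OF g] by auto
  have gf: "gram_fun k = (?M\<^sup>T * ?B * ?M) $$ (k div n, k mod n)"
    unfolding gram_fun_def gram_var_def if_P[OF k] meval_rconst_rvar[symmetric]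
    by (rule eval_gram_mat[OF comm_ring_hom_rconst _ _ i]) auto
  have "map_mat (act \<gamma>) ?B = ?B"
  proof (rule eq_matI)
    fix a b assume "a < dim_row ?B" "b < dim_col ?B"
    then have ab: "a < n" "b < n" using B(1) by auto
    obtain d where "B $$ (a, b) = to_ac d" using B_base[OF ab] by blast
    then show "map_mat (act \<gamma>) ?B $$ (a, b) = ?B $$ (a, b)"
      using ab B(1) by (simp add: act_gens(1)[OF g] grpD(5)[OF g])
  qed auto
  then have "map_mat (act \<gamma>) (?M\<^sup>T * ?B * ?M) = (?A * ?M)\<^sup>T * ?B * (?A * ?M)"
    unfolding generic_matrix(4)[OF g, symmetric] using c
    by (simp add: h.mat_hom_mult[of _ n n _ n] map_mat_transpose mult_carrier_mat[of _ n n _ n])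
  also have "\<dots> = ?M\<^sup>T * (?A\<^sup>T * ?B * ?A) * ?M"
    using c by (simp add: transpose_mult[of _ n n _ n] assoc_mult_mat[of _ n n _ n _ n] mult_carrier_mat[of _ n n _ n])
  also have "?A\<^sup>T * ?B * ?A = map_mat rconst ((fst \<gamma>)\<^sup>T * B * fst \<gamma>)"
    using grpD(3)[OF g] B(1) by (simp add: r.mat_hom_mult[of _ n n _ n] map_mat_transpose mult_carrier_mat[of _ n n _ n])
  also have "\<dots> = ?B" unfolding isometriesD(2)[OF grpD(1)[OF g]] ..
  finally have "map_mat (act \<gamma>) (?M\<^sup>T * ?B * ?M) = ?M\<^sup>T * ?B * ?M" .
  moreover have "?M\<^sup>T * ?B * ?M \<in> carrier_mat n n" using c by (simp add: mult_carrier_mat[of _ n n _ n])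
  ultimately show ?thesis unfolding gf using map_mat_entry[OF _ i, of "?M\<^sup>T * ?B * ?M" "act \<gamma>"] by simp
qed

lemma subfield_set_range_rconst: "subfield_set (range (rconst :: 'a alg_closure \<Rightarrow> (nat, 'a alg_closure) mpoly fract))"
  by (rule subfield_set_image[OF comm_ring_hom_rconst subfield_set_UNIV])

sublocale C: semilinear_action grp act gmul gone "range rconst"
  by (rule semilinear[OF subfield_set_range_rconst]) (auto simp: act_gens(1))

text \<open>On constants the isometries act trivially, so only the Galois group matters.\<close>

lemma fixed_constants: "C.fixed = base_field"
proof
  show "C.fixed \<subseteq> base_field"
  proof
    fix x assume "x \<in> C.fixed"
    then obtain c where c: "x = rconst c" and "\<forall>\<gamma>\<in>grp. act \<gamma> x = x" by (auto simp: C.fixed_def)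
    then have "\<sigma> c = c" if "\<sigma> \<in> absolute_galois_group" for \<sigma>
      using that act_gens(1)[of "(1\<^sub>m n, \<sigma>)" c] one_isometry by (auto simp: grp_def rconst_inject)
    then have "c \<in> range to_ac" by (rule galois_fixed_field)
    then show "x \<in> base_field" unfolding c base_field_def rconst_def by blast
  qed
  have "act \<gamma> (rconst (to_ac c)) = rconst (to_ac c)" if "\<gamma> \<in> grp" for c \<gamma>
    unfolding act_gens(1)[OF that] grpD(5)[OF that] ..
  then show "base_field \<subseteq> C.fixed"
    unfolding base_field_def C.fixed_def rconst_def[symmetric] by blast
qed

theorem fixed_field_of_matrix: "W.fixed \<subseteq> gen_field (base_field \<union> gram_fun ` sym_index)"
proof
  fix x assume x: "x \<in> W.fixed"
  then have x': "x \<in> ratfuns {m..<m + n * n}" "\<And>\<gamma>. \<gamma> \<in> grp \<Longrightarrow> act \<gamma> x = x" by (auto simp: W.fixed_def)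
  have "x \<in> gen_field (range rconst \<union> gram_fun ` sym_index)"
    by (rule invariants_of_matrix[OF x'(1)]) (rule x'(2), simp add: grp_def galois_id)
  from C.fixed_field_adjoin[OF act_gram_fun gram_fun_independent this x'(2)]
  show "x \<in> gen_field (base_field \<union> gram_fun ` sym_index)" unfolding fixed_constants by simp
qed

end

section \<open>Stable purity\<close>

text \<open>A polynomial in both groups of variables is a polynomial in the second group whose coefficients are
  polynomials in the first.\<close>

lemma alg_indep_family_tower:
  fixes s1 :: "'x \<Rightarrow> 'f::field" and s2 :: "'y \<Rightarrow> 'f"
  assumes K: "subring_set K" and L: "subring_set L" and KL: "K \<subseteq> L" "s1 ` J1 \<subseteq> L"
    and ind: "alg_indep_family K J1 s1" "alg_indep_family L J2 s2"
  shows "alg_indep_family K (J1 <+> J2) (case_sum s1 s2)"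
  unfolding alg_indep_family_def
proof (intro ballI impI)
  fix p assume p: "p \<in> mpolys K (J1 <+> J2)" and 0: "meval id (case_sum s1 s2) p = 0"
  define \<psi> :: "('x + 'y, 'f) mpoly \<Rightarrow> ('y, ('x, 'f) mpoly) mpoly"
    where "\<psi> = meval (\<lambda>c. mconst (mconst c)) (case_sum (\<lambda>x. mconst (mvar x)) mvar)"
  define \<chi> :: "('y, ('x, 'f) mpoly) mpoly \<Rightarrow> ('x + 'y, 'f) mpoly"
    where "\<chi> = meval (meval mconst (\<lambda>x. mvar (Inl x))) (\<lambda>y. mvar (Inr y))"
  interpret c: comm_ring_hom "mconst :: 'f \<Rightarrow> ('x, 'f) mpoly" by (rule comm_ring_hom_mconst)
  interpret c': comm_ring_hom "mconst :: ('x, 'f) mpoly \<Rightarrow> ('y, ('x, 'f) mpoly) mpoly" by (rule comm_ring_hom_mconst)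
  interpret c'': comm_ring_hom "mconst :: 'f \<Rightarrow> ('x + 'y, 'f) mpoly" by (rule comm_ring_hom_mconst)
  note m1 = comm_ring_hom_meval[OF comm_ring_hom_mconst, of "\<lambda>x. mvar (Inl x) :: ('x + 'y, 'f) mpoly"]
  interpret m1: comm_ring_hom "meval mconst (\<lambda>x. mvar (Inl x) :: ('x + 'y, 'f) mpoly)" by (rule m1)
  have \<chi>: "comm_ring_hom \<chi>" unfolding \<chi>_def by (rule comm_ring_hom_meval[OF m1])
  have "\<chi> (\<psi> p) = meval mconst mvar p"
    unfolding \<psi>_def hom_meval[OF \<chi>] by (intro meval_cong) (auto simp: \<chi>_def split: sum.split)
  then have inv: "\<chi> (\<psi> p) = p" by simp
  note MK = subring_set_mpolys[OF K, of J1]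
  note MM = subring_set_mpolys[OF MK, of J2]
  have K0: "0 \<in> K" "1 \<in> K" by (rule subring_setD[OF K])+
  have M0: "(0 :: ('x, 'f) mpoly) \<in> mpolys K J1" "(1 :: ('x, 'f) mpoly) \<in> mpolys K J1" by (rule subring_setD[OF MK])+
  have \<psi>: "\<psi> p \<in> mpolys (mpolys K J1) J2"
    unfolding \<psi>_def
  proof (rule meval_in_subring[OF MM])
    show "mconst (mconst (Poly_Mapping.lookup p t)) \<in> mpolys (mpolys K J1) J2" for t
      using p K0 M0 by (intro mconst_in_mpolys) (auto simp: mpolys_def)
    fix x assume "x \<in> mvars p"
    then have "x \<in> J1 <+> J2" using p by (auto simp: mpolys_def)
    then show "case_sum (\<lambda>x. mconst (mvar x)) mvar x \<in> mpolys (mpolys K J1) J2"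
      using K0 M0 by (auto intro!: mconst_in_mpolys mvar_in_mpolys)
  qed
  note e = comm_ring_hom_meval[OF comm_ring_hom_id, of s1]
  interpret e: comm_ring_hom "meval id s1" by (rule e)
  define q where "q = Poly_Mapping.map (meval id s1) (\<psi> p)"
  have look: "Poly_Mapping.lookup q t = meval id s1 (Poly_Mapping.lookup (\<psi> p) t)" for t
    by (simp add: q_def lookup_map)
  have "q \<in> mpolys L J2"
  proof -
    have "meval id s1 r \<in> L" if "r \<in> mpolys K J1" for r
      using that KL by (intro meval_in_subring[OF L]) (auto simp: mpolys_def)
    moreover have "mvars q \<subseteq> mvars (\<psi> p)" unfolding q_def by (rule mvars_map)
    ultimately show ?thesis using \<psi> unfolding mpolys_def[of L] mem_Collect_eq look by (auto simp: mpolys_def[of "mpolys K J1"])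
  qed
  moreover have "meval id s2 q = 0"
  proof -
    have h: "comm_ring_hom (meval (meval id s1) s2)" by (rule comm_ring_hom_meval[OF e])
    have "meval id s2 q = meval (meval id s1) s2 (\<psi> p)" unfolding q_def by (subst meval_map[OF e]) simp_all
    also have "\<dots> = meval id (case_sum s1 s2) p"
      unfolding \<psi>_def hom_meval[OF h] by (intro meval_cong) (auto split: sum.split)
    finally show ?thesis using 0 by simp
  qed
  ultimately have "q = 0" using ind(2) unfolding alg_indep_family_def by blast
  then have z: "meval id s1 (Poly_Mapping.lookup (\<psi> p) t) = 0" for t using look[of t] by simp
  have "Poly_Mapping.lookup (\<psi> p) t = 0" for t
  proof -
    have "Poly_Mapping.lookup (\<psi> p) t \<in> mpolys K J1" using \<psi> by (simp add: mpolys_def[of "mpolys K J1"])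
    then show ?thesis using ind(1) z[of t] unfolding alg_indep_family_def by blast
  qed
  then have "\<psi> p = 0" by (intro poly_mapping_eqI) simp
  interpret \<chi>: comm_ring_hom \<chi> by (rule \<chi>)
  show "p = 0" using inv unfolding \<open>\<psi> p = 0\<close> \<chi>.hom_zero by simp
qed

lemma alg_indep_family_image:
  fixes h :: "'c::field \<Rightarrow> 'd::field"
  assumes h: "comm_ring_hom h" and K: "0 \<in> K" and ind: "alg_indep_family K J s"
  shows "alg_indep_family (h ` K) J (\<lambda>j. h (s j))"
  unfolding alg_indep_family_def
proof (intro ballI impI)
  interpret h: field_hom h by (rule field_hom_comm_ring_hom[OF h])
  fix q assume q: "q \<in> mpolys (h ` K) J" and 0: "meval id (\<lambda>j. h (s j)) q = 0"
  define q0 where "q0 = Poly_Mapping.map (inv_into K h) q"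
  have "inj_on h K" by (rule inj_onI) simp
  then have inv0: "inv_into K h 0 = 0" using K by (metis inv_into_f_f h.hom_zero)
  have hq: "Poly_Mapping.map h q0 = q"
    using q by (intro poly_mapping_eqI) (auto simp: q0_def lookup_map inv0 mpolys_def f_inv_into_f)
  have "q0 \<in> mpolys K J"
    using q mvars_map[of "inv_into K h" q] by (auto simp: q0_def mpolys_def lookup_map inv0 inv_into_into)
  moreover have "h (meval id s q0) = 0"
    using 0 unfolding hq[symmetric] by (simp add: meval_map[OF h] hom_meval[OF h])
  then have "meval id s q0 = 0" by simp
  ultimately have "q0 = 0" using ind unfolding alg_indep_family_def by blast
  then show "q = 0" unfolding hq[symmetric] by (intro poly_mapping_eqI) (simp add: lookup_map)
qed

text \<open>A polynomial whose variables are the elements themselves is renamed to one in the indices.\<close>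

lemma alg_independent_of_family:
  fixes k :: "'f::field set"
  assumes k: "subring_set k" and ind: "alg_indep_family k J s"
  shows "alg_independent k (s ` J)"
  unfolding alg_independent_def
proof (intro allI impI, elim conjE)
  fix p :: "('f, 'f) mpoly" assume p: "mvars p \<subseteq> s ` J" "Poly_Mapping.range p \<subseteq> k" "meval id id p = 0"
  note k0 = subring_setD(1,2)[OF k]
  have inv: "s (inv_into J s x) = x" "inv_into J s x \<in> J" if "x \<in> mvars p" for x
    using p(1) that by (auto intro: f_inv_into_f inv_into_into)
  interpret c: comm_ring_hom "mconst :: 'f \<Rightarrow> ('b, 'f) mpoly" by (rule comm_ring_hom_mconst)
  define q where "q = meval mconst (\<lambda>x. mvar (inv_into J s x)) p"
  have "q \<in> mpolys k J"
    unfolding q_def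
  proof (rule meval_in_subring[OF subring_set_mpolys[OF k]])
    fix t assume "t \<in> Poly_Mapping.keys p"
    then have "Poly_Mapping.lookup p t \<in> k" using p(2) by (auto simp: Poly_Mapping.range.rep_eq in_keys_iff)
    then show "mconst (Poly_Mapping.lookup p t) \<in> mpolys k J" using k0(1) by simp
  qed (use k0 inv in auto)
  moreover have "meval id s q = meval id id p"
    unfolding q_def hom_meval[OF comm_ring_hom_meval[OF comm_ring_hom_id, of s]] by (intro meval_cong) (auto simp: inv)
  then have "meval id s q = 0" using p(3) by simp
  ultimately have "q = 0" using ind unfolding alg_indep_family_def by blast
  interpret c: comm_ring_hom "mconst :: 'f \<Rightarrow> ('f, 'f) mpoly" by (rule comm_ring_hom_mconst)
  note h = comm_ring_hom_meval[OF comm_ring_hom_mconst, of "\<lambda>j. mvar (s j) :: ('f, 'f) mpoly"]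
  interpret h: comm_ring_hom "meval mconst (\<lambda>j. mvar (s j) :: ('f, 'f) mpoly)" by (rule h)
  have "meval mconst mvar p = meval mconst (\<lambda>j. mvar (s j)) q"
    unfolding q_def hom_meval[OF h] by (intro meval_cong) (auto simp: inv)
  then show "p = 0" by (simp add: \<open>q = 0\<close> h.hom_zero)
qed

context orthogonal_rep
begin

text \<open>On the function field of the representation, the two kinds of group elements act by the two
  substitutions in the definition of the invariant field.\<close>

lemma act_fract_map:
  assumes "x \<in> ratfuns {..<m}"
  shows "A \<in> isometries \<Longrightarrow> act (A, id) x = fract_map (lin_subst m (\<rho> A)) x"
    "\<sigma> \<in> absolute_galois_group \<Longrightarrow> act (1\<^sub>m n, \<sigma>) x = fract_map (Poly_Mapping.map \<sigma>) x"
proof -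
  obtain a b where ab: "x = Fract a b" "b \<noteq> 0" "mvars a \<subseteq> {..<m}" "mvars b \<subseteq> {..<m}"
    using assms unfolding ratfuns_def by blast
  interpret c: comm_ring_hom "mconst :: 'a alg_closure \<Rightarrow> (nat, 'a alg_closure) mpoly" by (rule comm_ring_hom_mconst)
  show "act (A, id) x = fract_map (lin_subst m (\<rho> A)) x" if A: "A \<in> isometries"
  proof -
    have g: "(A, id) \<in> grp" using A galois_id by (simp add: grp_def)
    have hom: "comm_ring_hom (lin_subst m (\<rho> D))" for D
      unfolding lin_subst_def by (rule comm_ring_hom_meval[OF comm_ring_hom_mconst])
    obtain D where D: "D \<in> isometries" "A * D = 1\<^sub>m n" using inverse_isometry[OF A] by blast
    interpret l: comm_ring_hom "lin_subst m (\<rho> A)" by (rule hom)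
    interpret l': comm_ring_hom "lin_subst m (\<rho> D)" by (rule hom)
    have gens: "lin_subst m (\<rho> D) (mconst c) = mconst c"
      "lin_subst m (\<rho> D) (mvar i) = (if i < m then \<Sum>j<m. mconst (\<rho> D $$ (i, j)) * mvar j else mvar i)" for D c i
      by (simp_all add: lin_subst_def)
    have "lin_subst m (\<rho> D) (lin_subst m (\<rho> A) p) = p" for p
    proof (rule mpoly_hom_eqI[of "\<lambda>p. lin_subst m (\<rho> D) (lin_subst m (\<rho> A) p)" "\<lambda>p. p"])
      show "comm_ring_hom (\<lambda>p. lin_subst m (\<rho> D) (lin_subst m (\<rho> A) p))"
        using comm_ring_hom_comp[OF hom[of A] hom[of D]] by (simp add: o_def)
      show "comm_ring_hom (\<lambda>p :: (nat, 'a alg_closure) mpoly. p)" using comm_ring_hom_id by (simp add: id_def)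
      show "lin_subst m (\<rho> D) (lin_subst m (\<rho> A) (mvar i)) = mvar i" for i
      proof (cases "i < m")
        case True
        have "lin_subst m (\<rho> D) (lin_subst m (\<rho> A) (mvar i)) =
            (\<Sum>j<m. mconst (\<rho> A $$ (i, j)) * (\<Sum>k<m. mconst (\<rho> D $$ (j, k)) * mvar k))"
          using True by (simp add: gens l'.hom_sum l'.hom_mult)
        also have "\<dots> = (\<Sum>k<m. mconst ((\<rho> A * \<rho> D) $$ (i, k)) * mvar k)"
          by (rule linear_forms_compose[OF rho(1)[OF A] rho(1)[OF D(1)] True])
        also have "\<dots> = (\<Sum>k<m. if k = i then mvar k else 0)"
          unfolding rho(3)[OF A D(1), symmetric] D(2) rho(2) using True by (intro sum.cong) auto
        finally show ?thesis using True by simp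
      qed (simp add: gens)
    qed (simp add: gens)
    then have nz: "lin_subst m (\<rho> A) p = 0 \<longleftrightarrow> p = 0" for p by (metis l.hom_zero l'.hom_zero)
    have eq: "poly_act (A, id) p = lin_subst m (\<rho> A) p" if "mvars p \<subseteq> {..<m}" for p
      unfolding poly_act_def lin_subst_def using that by (intro meval_cong) (auto simp: var_image_simps)
    show ?thesis
      unfolding ab(1) act_Fract[OF g ab(2)] eq[OF ab(3)] eq[OF ab(4)]
      by (rule fract_map_Fract[OF l.hom_mult nz ab(2), symmetric])
  qed
  show "act (1\<^sub>m n, \<sigma>) x = fract_map (Poly_Mapping.map \<sigma>) x" if s: "\<sigma> \<in> absolute_galois_group"
  proof -
    have g: "(1\<^sub>m n, \<sigma>) \<in> grp" using s one_isometry by (simp add: grp_def)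
    have "var_image (1\<^sub>m n) = mvar"
      using poly_act_gone[of "mvar _"] unfolding poly_act_gens(2)[OF gone_grp] by (intro ext) (simp add: gone_def)
    then have eq: "poly_act (1\<^sub>m n, \<sigma>) = Poly_Mapping.map \<sigma>"
      unfolding poly_act_def by (intro ext) (simp add: map_eq_meval[OF galois_hom(1)[OF s]])
    interpret p: comm_ring_hom "poly_act (1\<^sub>m n, \<sigma>)" by (rule comm_ring_hom_poly_act[OF g])
    have "poly_act (1\<^sub>m n, \<sigma>) p = 0 \<longleftrightarrow> p = 0" for p using poly_act_inj[OF g] p.hom_zero by blast
    from fract_map_Fract[OF p.hom_mult this ab(2), of a] show ?thesis
      unfolding ab(1) act_Fract[OF g ab(2)] eq ..
  qed
qed

lemma V_fixed_eq: "V.fixed = invariant_field isometries m \<rho>"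
proof -
  have "act \<gamma> x = act (fst \<gamma>, id) (act (1\<^sub>m n, snd \<gamma>) x)" if g: "\<gamma> \<in> grp" for \<gamma> x
  proof -
    have grps: "(fst \<gamma>, id) \<in> grp" "(1\<^sub>m n, snd \<gamma>) \<in> grp"
      using g one_isometry galois_id by (auto simp: grp_def)
    have "map_mat id (1\<^sub>m n) = (1\<^sub>m n :: 'a alg_closure mat)" by (intro eq_matI) auto
    then have "gmul (fst \<gamma>, id) (1\<^sub>m n, snd \<gamma>) = \<gamma>"
      using grpD(3)[OF g] by (cases \<gamma>) (simp add: gmul_def)
    then show ?thesis using V.mul(2)[OF grps, of x] by simp
  qed
  then have "(\<forall>\<gamma>\<in>grp. act \<gamma> x = x) \<longleftrightarrow>
      (\<forall>A\<in>isometries. act (A, id) x = x) \<and> (\<forall>\<sigma>\<in>absolute_galois_group. act (1\<^sub>m n, \<sigma>) x = x)" for x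
    using one_isometry galois_id grpD(1,2) unfolding grp_def by (metis SigmaI)
  then show ?thesis
    unfolding V.fixed_def invariant_field_def function_field_eq_ratfuns
    by (intro Collect_cong conj_cong refl) (simp add: act_fract_map)
qed

text \<open>The field of invariants of the representation and the matrix together is described twice: as generated
  over the invariants of the representation by the \<open>n * n\<close> coordinates in an invariant frame, and as
  generated over the base field by the entries of the Gram matrix and the \<open>m\<close> coordinates in an invariant
  frame. The former coordinates become new variables under \<open>fibre_map\<close>, and the latter generators are
  algebraically independent.\<close>

theorem invariant_field_stably_pure: "stably_pure base_field (invariant_field isometries m \<rho>)"
proof -
  from V_frame obtain F1 F1' where "frame F1 F1' n n m {..<m}"
    and t1: "\<forall>\<gamma>\<in>grp. \<forall>i<n * n. act \<gamma> (frame_coord F1' n n m i) = frame_coord F1' n n m i" by (elim exE conjE)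
  then interpret f1: frame F1 F1' n n m "{..<m}" by simp
  from W_frame obtain F2 F2' where "frame F2 F2' m 1 0 {m..<m + n * n}"
    and t2: "\<forall>\<gamma>\<in>grp. \<forall>i<m. act \<gamma> (frame_coord F2' m 1 0 i) = frame_coord F2' m 1 0 i" by (elim exE conjE)
  then interpret f2: frame F2 F2' m 1 0 "{m..<m + n * n}" by simp
  let ?R = "ratfuns {..<m + n * n} :: (nat, 'a alg_closure) mpoly fract set"
  have sets: "{..<m} \<union> {m..<m + n * n} = {..<m + n * n}" "{m..<m + n * n} \<union> {0..<0 + m * 1} = {..<m + n * n}" by auto
  note R1 = f1.ratfuns_eq[unfolded sets] and R2 = f2.ratfuns_eq[unfolded sets]
  define s where "s = case_sum gram_fun f2.t"
  define J where "J = sym_index <+> {..<m * 1}"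
  let ?K1 = "gen_field (V.fixed \<union> f1.t ` {..<n * n})" and ?K2 = "gen_field (base_field \<union> s ` J)"
  interpret R: semilinear_action grp act gmul gone ?R
  proof (rule semilinear[OF subfield_set_ratfuns])
    fix \<gamma> x assume g: "\<gamma> \<in> grp" and x: "x \<in> ?R"
    have sub: "(ratfuns I :: (nat, 'a alg_closure) mpoly fract set) \<subseteq> ?R" if "I \<subseteq> {..<m + n * n}" for I
      unfolding ratfuns_gen_field using that by (intro gen_field_mono) auto
    show "act \<gamma> x \<in> ?R"
    proof (rule ratfuns_image_subset[OF comm_ring_hom_act[OF g] subfield_set_ratfuns _ _ x])
      fix i assume "i \<in> {..<m + n * n}"
      then consider "i \<in> {..<m}" | "i \<in> {m..<m + n * n}" by force
      then show "act \<gamma> (rvar i) \<in> ?R"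
      proof cases
        case 1
        have "ratfuns {..<m} \<subseteq> ?R" by (rule sub) auto
        then show ?thesis using ratfuns_stable(1)[OF g rvar_in_ratfuns[OF 1]] by blast
      next
        case 2
        have "ratfuns {m..<m + n * n} \<subseteq> ?R" by (rule sub) auto
        then show ?thesis using ratfuns_stable(2)[OF g rvar_in_ratfuns[OF 2]] by blast
      qed
    qed (simp add: act_gens(1)[OF g])
  qed
  have base: "(base_field :: (nat, 'a alg_closure) mpoly fract set) \<subseteq> ratfuns I" for I
    by (auto simp: base_field_def rconst_def[symmetric])
  have base_fixed: "act \<gamma> x = x" if "\<gamma> \<in> grp" "x \<in> base_field" for \<gamma> x
    using that unfolding fixed_constants[symmetric] by (simp add: C.fixed_def)
  have gram_W: "gram_fun k \<in> ratfuns {m..<m + n * n}" if "k \<in> sym_index" for k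
    unfolding gram_fun_def ratfuns_def mem_Collect_eq using gram_var_in_mpolys(1)[OF that]
    by (intro exI[of _ "gram_var k"] exI[of _ 1]) (simp add: mpolys_def)
  have incl: "base_field \<subseteq> R.fixed" "V.fixed \<subseteq> R.fixed" "f1.t ` {..<n * n} \<subseteq> R.fixed" "s ` J \<subseteq> R.fixed"
  proof -
    show "base_field \<subseteq> R.fixed" using base base_fixed by (auto simp: R.fixed_def)
    have "ratfuns {..<m} \<subseteq> ?R" "f1.t ` {..<n * n} \<subseteq> ?R"
      unfolding R1 using gen_field_incl[of "ratfuns {..<m} \<union> f1.t ` {..<n * n}"] by auto
    then show "V.fixed \<subseteq> R.fixed" "f1.t ` {..<n * n} \<subseteq> R.fixed"
      using t1 by (auto simp: R.fixed_def V.fixed_def)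
    have "ratfuns {m..<m + n * n} \<subseteq> ?R" "f2.t ` {..<m * 1} \<subseteq> ?R"
      unfolding R2 using gen_field_incl[of "ratfuns {m..<m + n * n} \<union> f2.t ` {..<m * 1}"] by auto
    then show "s ` J \<subseteq> R.fixed"
      using t2 gram_W act_gram_fun by (auto simp: R.fixed_def s_def J_def)
  qed
  have K1: "R.fixed \<subseteq> ?K1"
  proof
    fix x assume "x \<in> R.fixed"
    then have x: "x \<in> ?R" "\<And>\<gamma>. \<gamma> \<in> grp \<Longrightarrow> act \<gamma> x = x" by (auto simp: R.fixed_def)
    show "x \<in> ?K1"
      by (rule V.fixed_field_adjoin[OF _ f1.alg_indep_t]) (use t1 x R1 in auto)
  qed
  have K2: "R.fixed \<subseteq> ?K2"
  proof
    fix x assume "x \<in> R.fixed"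
    then have x: "x \<in> ?R" "\<And>\<gamma>. \<gamma> \<in> grp \<Longrightarrow> act \<gamma> x = x" by (auto simp: R.fixed_def)
    have "x \<in> gen_field (W.fixed \<union> f2.t ` {..<m * 1})"
      by (rule W.fixed_field_adjoin[OF _ f2.alg_indep_t]) (use t2 x R2 in auto)
    also have "\<dots> \<subseteq> gen_field (gen_field (base_field \<union> gram_fun ` sym_index) \<union> f2.t ` {..<m * 1})"
      using fixed_field_of_matrix by (intro gen_field_mono) auto
    also have "\<dots> = gen_field (base_field \<union> gram_fun ` sym_index \<union> f2.t ` {..<m * 1})" by (rule gen_field_Un_gen_field)
    also have "base_field \<union> gram_fun ` sym_index \<union> f2.t ` {..<m * 1} = base_field \<union> s ` J"
      unfolding s_def J_def Plus_def image_Un image_image sum.case Un_assoc ..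
    finally show "x \<in> ?K2" .
  qed
  have "?K1 \<subseteq> R.fixed" by (intro gen_field_minimal R.subfield_set_fixed Un_least incl)
  moreover have "?K2 \<subseteq> R.fixed" by (intro gen_field_minimal R.subfield_set_fixed Un_least incl)
  ultimately have eq: "?K1 = ?K2" using K1 K2 by blast
  have bsub: "subfield_set (base_field :: (nat, 'a alg_closure) mpoly fract set)" unfolding fixed_constants[symmetric] by (rule C.subfield_set_fixed)
  have "alg_indep_family base_field sym_index gram_fun"
  proof -
    have "(base_field :: (nat, 'a alg_closure) mpoly fract set) \<subseteq> range rconst" by (auto simp: base_field_def rconst_def)
    then show ?thesis using gram_fun_independent unfolding alg_indep_family_def mpolys_def by blast
  qed
  then have ind: "alg_indep_family base_field J s"
    unfolding J_def s_def using gram_W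
    by (intro alg_indep_family_tower[OF subfield_setD(1)[OF bsub] subfield_setD(1)[OF subfield_set_ratfuns] base _ _ f2.alg_indep_t]) auto
  let ?\<iota> = "\<lambda>c. Fract (mconst c) 1 :: (nat, (nat, 'a alg_closure) mpoly fract) mpoly fract"
  let ?x = "\<lambda>i. Fract (mvar i) 1 :: (nat, (nat, 'a alg_closure) mpoly fract) mpoly fract"
  let ?h = "f1.fibre_map"
  note h = f1.comm_ring_hom_fibre_map
  have hb: "?h ` base_field = ?\<iota> ` base_field" using base f1.fibre_map_base by (intro image_cong refl) blast
  have hV: "?h ` V.fixed = ?\<iota> ` V.fixed" by (intro image_cong refl f1.fibre_map_base) (simp add: V.fixed_def)
  have ht: "?h ` f1.t ` {..<n * n} = ?x ` {..<n * n}"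
    unfolding image_image by (intro image_cong refl) (simp add: f1.fibre_map_t)
  have "gen_field (?\<iota> ` V.fixed \<union> ?x ` {..<n * n}) = ?h ` ?K1"
    unfolding image_gen_field[OF h] image_Un hV ht ..
  also have "\<dots> = gen_field (?\<iota> ` base_field \<union> (\<lambda>j. ?h (s j)) ` J)"
    unfolding eq image_gen_field[OF h] image_Un hb image_image ..
  finally have field: "gen_field (?\<iota> ` V.fixed \<union> ?x ` {..<n * n}) = gen_field (?\<iota> ` base_field \<union> (\<lambda>j. ?h (s j)) ` J)" .
  have "alg_indep_family (?h ` base_field) J (\<lambda>j. ?h (s j))"
    by (rule alg_indep_family_image[OF h subfield_setD(2)[OF bsub] ind])
  then have "alg_independent (?\<iota> ` base_field) ((\<lambda>j. ?h (s j)) ` J)"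
    unfolding hb[symmetric] by (intro alg_independent_of_family subfield_setD(1) subfield_set_image[OF h bsub])
  then show ?thesis
    unfolding stably_pure_def Let_def purely_transcendental_def V_fixed_eq[symmetric] using field by blast
qed

end

text \<open>Since the square of the determinant of an isometry is \<open>1\<close>, the denominator can be moved to the numerator.\<close>

lemma regular_fun_on_isometries:
  fixes B :: "'a::field_char_0 alg_closure mat"
  assumes "quadratic_space n B" and f: "regular_fun n (quadratic_space.isometries n B) f"
  shows "\<exists>p :: (nat \<times> nat, 'a) mpoly. mvars p \<subseteq> {..<n} \<times> {..<n} \<and>
    (\<forall>A\<in>quadratic_space.isometries n B. f A = meval to_ac (\<lambda>ab. A $$ ab) p)"
proof -
  interpret quadratic_space n B by fact
  from f obtain p :: "(nat \<times> nat, 'a) mpoly" and N where p: "mvars p \<subseteq> {..<n} \<times> {..<n}"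
    "\<forall>A\<in>isometries. det A ^ N * f A = meval to_ac (\<lambda>ab. A $$ ab) p" unfolding regular_fun_def by blast
  let ?X = "mat n n mvar :: (nat \<times> nat, 'a) mpoly mat"
  let ?M = "mpolys UNIV ({..<n} \<times> {..<n}) :: (nat \<times> nat, 'a) mpoly set"
  have sub: "subring_set ?M" by (rule subring_set_mpolys) simp
  have "det ?X \<in> ?M" by (rule det_in_subring[OF sub]) auto
  moreover have "p \<in> ?M" using p(1) by (simp add: mpolys_def)
  ultimately have "det ?X ^ N * p \<in> ?M" by (intro subring_setD(5)[OF sub] subring_set_power[OF sub])
  moreover have "f A = meval to_ac (\<lambda>ab. A $$ ab) (det ?X ^ N * p)" if A: "A \<in> isometries" for A
  proof -
    interpret ev: comm_ring_hom "meval to_ac (\<lambda>ab. A $$ ab)" by (rule comm_ring_hom_meval[OF comm_ring_hom_to_ac])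
    have "map_mat (meval to_ac (\<lambda>ab. A $$ ab)) ?X = A" using isometriesD(1)[OF A] by (intro eq_matI) auto
    then have "meval to_ac (\<lambda>ab. A $$ ab) (det ?X) = det A" by (metis ev.hom_det)
    then have "meval to_ac (\<lambda>ab. A $$ ab) (det ?X ^ N * p) = (det A * det A) ^ N * f A"
      using bspec[OF p(2) A] by (simp add: ev.hom_mult ev.hom_power power_mult_distrib mult.assoc)
    then show ?thesis by (simp add: isometries_det[OF A])
  qed
  ultimately show ?thesis by (intro exI[of _ "det ?X ^ N * p"]) (simp add: mpolys_def)
qed

theorem proposition4p10:
  fixes C :: "'a::field_char_0 mat" and n m :: nat
    and \<rho> :: "'a alg_closure mat \<Rightarrow> 'a alg_closure mat"
  assumes "n \<ge> 2"
    and "C \<in> carrier_mat n n"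
    and "nondegenerate_form n C"
    and "linear_action n (orthogonal_group n C) m \<rho>"
    and "almost_free n (orthogonal_group n C) m \<rho>"
  shows "stably_pure base_field (invariant_field (orthogonal_group n C) m \<rho>)"
proof -
  define B :: "'a alg_closure mat" where "B = map_mat to_ac (C + C\<^sup>T)"
  note og = orthogonal_group_isometries[OF assms(2,3), folded B_def]
  interpret quadratic_space n B by (rule og(1))
  note act = assms(4)[unfolded og(2) linear_action_def]
  have "\<forall>ij\<in>{..<m} \<times> {..<m}. \<exists>p :: (nat \<times> nat, 'a) mpoly. mvars p \<subseteq> {..<n} \<times> {..<n} \<and>
      (\<forall>A\<in>isometries. \<rho> A $$ ij = meval to_ac (\<lambda>ab. A $$ ab) p)"
    using act by (auto intro!: regular_fun_on_isometries[OF og(1)])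
  from bchoice[OF this] obtain P :: "nat \<times> nat \<Rightarrow> (nat \<times> nat, 'a) mpoly" where
    P: "\<forall>ij\<in>{..<m} \<times> {..<m}. mvars (P ij) \<subseteq> {..<n} \<times> {..<n} \<and>
      (\<forall>A\<in>isometries. \<rho> A $$ ij = meval to_ac (\<lambda>ab. A $$ ab) (P ij))" ..
  obtain U where U: "open_over_base m U" "U \<noteq> {}" "\<And>x. x \<in> U \<Longrightarrow> {A \<in> isometries. \<rho> A *\<^sub>v x = x} = {1\<^sub>m n}"
    using assms(5) unfolding og(2) almost_free_def by blast
  from U(1) obtain Q :: "(nat, 'a) mpoly set" where Q: "\<forall>p\<in>Q. mvars p \<subseteq> {..<m}"
    "U = {x \<in> carrier_vec m. \<exists>p\<in>Q. meval to_ac (\<lambda>i. x $ i) p \<noteq> 0}" unfolding open_over_base_def by blast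
  from U(2) obtain x where "x \<in> U" by blast
  then obtain u where u: "u \<in> Q" "x \<in> carrier_vec m" "meval to_ac (\<lambda>i. x $ i) u \<noteq> 0" unfolding Q(2) by blast
  have free: "A = 1\<^sub>m n" if "y \<in> carrier_vec m" "meval to_ac (vec_index y) u \<noteq> 0" "A \<in> isometries" "\<rho> A *\<^sub>v y = y" for y A
  proof -
    have "y \<in> U" using that(1,2) u(1) unfolding Q(2) by blast
    from U(3)[OF this] that(3,4) show ?thesis by blast
  qed
  interpret orthogonal_rep n B m \<rho> "\<lambda>i j. P (i, j)" u
  proof unfold_locales
    show "\<exists>x\<in>carrier_vec m. meval to_ac (\<lambda>i. x $ i) u \<noteq> 0" using u(2,3) by blast
  qed (use act P Q(1) u(1) free in auto)
  show ?thesis unfolding og(2) by (rule invariant_field_stably_pure)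
qed

end
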